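(* For every even integer $l=2k\ge 4$ there exists a subset $S'=S'(l)\subseteq S$ such that: (a) $S'$ has relative asymptotic density $1$ within $S$, i.e. $|S'\cap[1,X]|/|S\cap[1,X]|\to1$ as $X\to\infty$; (b) the set of accumulation points of the sequence of numbers $\{\widehat{\nu_n}(4)\}_{n\in S'}$ is the whole of $[-1,1]$; (c) along $n\in S'$ (as $n\to\infty$) we have $N_n\to\infty$ and $$|\mathcal{M}_l(n)|=O\left(N_n^{k}\right).$$
   Context: $S=\{a^2+b^2: a,b\in\mathbb{Z}\}$ is the set of (positive) integers expressible as a sum of two squares. For $n\in S$, $\mathcal{E}_n=\{\mu=(\mu_1,\mu_2)\in\mathbb{Z}^2:\mu_1^2+\mu_2^2=n\}$ and $N_n=|\mathcal{E}_n|$. The probability measure $\nu_n=\frac1{N_n}\sum_{\mu\in\mathcal{E}_n}\delta_{\mu/\sqrt n}$ lives on the unit circle, and $\widehat{\nu_n}(4)=\int z^{-4}\,d\nu_n(z)=\frac1{N_n}\sum_{\mu\in\mathcal{E}_n}\left(\frac{\mu_1+i\mu_2}{\sqrt n}\right)^4$ (a real number). For $l=2k$ the length-$l$ semi-correlation set is $$\mathcal{M}_l(n)=\left\{(\mu^1,\ldots,\mu^l)\in\mathcal{E}_n^l:\ \sum_{j=1}^l\mu^j_1=0\right\},$$ the set of $l$-tuples of lattice points in $\mathcal{E}_n$ whose first coordinates sum to $0$. The constant in the $O$-notation may depend on $l$. *)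

theory Defs
  imports "HOL-Analysis.Analysis" "HOL-Library.Landau_Symbols"
begin

definition sums_of_two_squares :: "nat set" where
  "sums_of_two_squares = {n. n > 0 \<and> (\<exists>a b :: int. int n = a\<^sup>2 + b\<^sup>2)}"

definition lattice_points :: "nat \<Rightarrow> (int \<times> int) set" where
  "lattice_points n = {(a, b). a\<^sup>2 + b\<^sup>2 = int n}"

definition num_lattice_points :: "nat \<Rightarrow> nat" where
  "num_lattice_points n = card (lattice_points n)"

definition circle_point :: "nat \<Rightarrow> int \<times> int \<Rightarrow> complex" where
  "circle_point n \<mu> =
     Complex (real_of_int (fst \<mu>)) (real_of_int (snd \<mu>)) / complex_of_real (sqrt (real n))"

text \<open>
  The average of the Dirac masses at the points \<open>\<mu> / sqrt n\<close> is the push-forward of the uniform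
  distribution on the lattice points, as a Borel measure on the complex plane.
\<close>
definition circle_measure :: "nat \<Rightarrow> complex measure" where
  "circle_measure n =
     distr (uniform_count_measure (lattice_points n)) borel (circle_point n)"

definition fourier_coeff :: "complex measure \<Rightarrow> int \<Rightarrow> complex" where
  "fourier_coeff \<nu> m = (LINT z|\<nu>. z powi (- m))"

text \<open>An \<open>l\<close>-tuple is an extensional function on \<open>{1..l}\<close>.\<close>
definition semi_correlations :: "nat \<Rightarrow> nat \<Rightarrow> (nat \<Rightarrow> int \<times> int) set" where
  "semi_correlations l n =
     {\<mu> \<in> {1..l} \<rightarrow>\<^sub>E lattice_points n. (\<Sum>j = 1..l. fst (\<mu> j)) = 0}"

definition relative_density_one :: "nat set \<Rightarrow> nat set \<Rightarrow> bool" where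
  "relative_density_one B A \<longleftrightarrow>
     (\<lambda>X. real (card (B \<inter> {1..X})) / real (card (A \<inter> {1..X}))) \<longlonglongrightarrow> 1"

text \<open>
  Accumulation points of the sequence \<open>f n\<close>, \<open>n \<in> A\<close>: a value is counted with the multiplicity
  with which the indices attain it.
\<close>
definition accumulation_points :: "(nat \<Rightarrow> 'a::topological_space) \<Rightarrow> nat set \<Rightarrow> 'a set" where
  "accumulation_points f A = {x. \<forall>U. open U \<and> x \<in> U \<longrightarrow> infinite {n \<in> A. f n \<in> U}}"

text \<open>The filter of \<open>n\<close> tending to infinity inside \<open>A\<close>.\<close>
definition at_top_along :: "nat set \<Rightarrow> nat filter" where
  "at_top_along A = inf at_top (principal A)"

lemma finite_lattice_points: "finite (lattice_points n)"
proof -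
  have le: "\<bar>a\<bar> \<le> int n" if "a\<^sup>2 + b\<^sup>2 = int n" for a b :: int
  proof -
    have "\<bar>a\<bar> \<le> \<bar>a\<bar>\<^sup>2" using self_le_power[of "\<bar>a\<bar>" 2] by (cases "a = 0") auto
    also have "\<dots> \<le> int n" using that zero_le_power2[of b] by (simp only: power2_abs)
    finally show ?thesis .
  qed
  have "lattice_points n \<subseteq> {- int n..int n} \<times> {- int n..int n}"
  proof (rule subrelI)
    fix a b assume "(a, b) \<in> lattice_points n"
    then have "a\<^sup>2 + b\<^sup>2 = int n" by (simp add: lattice_points_def)
    then show "(a, b) \<in> {- int n..int n} \<times> {- int n..int n}"
      using le[of a b] le[of b a] by (simp add: add.commute abs_le_iff)
  qed
  then show ?thesis by (rule finite_subset) simp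
qed

lemma fourier_coeff_circle_measure:
  "fourier_coeff (circle_measure n) m =
     (\<Sum>\<mu>\<in>lattice_points n. circle_point n \<mu> powi (- m)) / of_nat (num_lattice_points n)"
proof -
  have meas: "(\<lambda>z::complex. z powi (- m)) \<in> borel_measurable borel"
    unfolding power_int_def by measurable
  have "fourier_coeff (circle_measure n) m =
      (LINT \<mu>|uniform_count_measure (lattice_points n). circle_point n \<mu> powi (- m))"
    unfolding fourier_coeff_def circle_measure_def
    by (rule integral_distr[OF _ meas]) (simp add: measurable_def space_uniform_count_measure sets_uniform_count_measure)
  also have "\<dots> = (\<Sum>\<mu>\<in>lattice_points n. circle_point n \<mu> powi (- m)) / of_nat (num_lattice_points n)"
    unfolding uniform_count_measure_def
    by (subst lebesgue_integral_point_measure_finite)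
       (auto simp: finite_lattice_points num_lattice_points_def scaleR_conv_of_real sum_divide_distrib)
  finally show ?thesis .
qed

lemma fourier_coeff_4:
  assumes "n > 0"
  shows "fourier_coeff (circle_measure n) 4 =
     (\<Sum>\<mu>\<in>lattice_points n. circle_point n \<mu> ^ 4) / of_nat (num_lattice_points n)"
proof -
  have inv: "circle_point n \<mu> powi (- 4) = circle_point n (fst \<mu>, - snd \<mu>) ^ 4"
    if "\<mu> \<in> lattice_points n" for \<mu>
  proof -
    obtain a b where \<mu>: "\<mu> = (a, b)" by force
    have "a\<^sup>2 + b\<^sup>2 = int n" using that by (simp add: \<mu> lattice_points_def)
    then have eq: "(real_of_int a)\<^sup>2 + (real_of_int b)\<^sup>2 = real n"
      by (metis of_int_add of_int_of_nat_eq of_int_power)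
    have "Complex a b * Complex a (- b) = of_real (real n)"
      using eq by (simp add: complex_eq_iff power2_eq_square)
    moreover have "complex_of_real (sqrt n) * complex_of_real (sqrt n) = of_real (real n)"
      by (metis of_real_mult of_nat_0_le_iff real_sqrt_mult_self abs_of_nonneg)
    ultimately have "circle_point n (a, b) * circle_point n (a, - b) = 1"
      using assms by (simp add: circle_point_def)
    then have "inverse (circle_point n (a, b)) = circle_point n (a, - b)"
      by (rule inverse_unique)
    then show ?thesis using power_inverse[of "circle_point n (a, b)" 4] by (simp add: \<mu> power_int_minus)
  qed
  have "(\<Sum>\<mu>\<in>lattice_points n. circle_point n \<mu> powi (- 4)) =
        (\<Sum>\<mu>\<in>lattice_points n. circle_point n (fst \<mu>, - snd \<mu>) ^ 4)"
    by (rule sum.cong) (auto simp: inv)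
  also have "\<dots> = (\<Sum>\<mu>\<in>lattice_points n. circle_point n \<mu> ^ 4)"
    by (rule sum.reindex_bij_witness[where i = "\<lambda>\<mu>. (fst \<mu>, - snd \<mu>)" and j = "\<lambda>\<mu>. (fst \<mu>, - snd \<mu>)"])
       (auto simp: lattice_points_def)
  finally show ?thesis by (simp add: fourier_coeff_circle_measure)
qed

end

theory Submission
  imports Defs "HOL-Number_Theory.Number_Theory"
begin

text \<open>
  Let \<open>p \<equiv> 1 (mod 4)\<close> be a prime not dividing \<open>m\<close>, and let \<open>w\<close> be a Gaussian prime above \<open>p\<close>. The
  lattice points of norm \<open>p * m\<close> are the disjoint union of \<open>w\<close> times and of \<open>cnj w\<close> times the
  lattice points of norm \<open>m\<close>. A vanishing sum of points of norm \<open>p * m\<close> therefore reads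
  \<open>w * a + cnj w * b = 0\<close>, where \<open>a\<close> and \<open>b\<close> are sums of points of norm \<open>m\<close>. If \<open>a \<noteq> 0\<close>, then this
  equation prescribes \<open>w / cnj w\<close> and with it the prime \<open>p\<close>. So all but finitely many \<open>p\<close>, the bad
  primes for \<open>m\<close>, force \<open>a = b = 0\<close>: every vanishing sum splits into two vanishing sums of norm \<open>m\<close>,
  and the numbers \<open>corr\<close> of vanishing sums obey a binomial recursion (\<open>corr_extends\<close>). The first
  coordinate of a lattice point being its real part, a semi-correlation over \<open>p * m\<close> is an equation
  \<open>w * s + cnj (w * s) = 0\<close>, and in the same way it comes from a vanishing sum of norm \<open>m\<close>
  (\<open>semi_correlations_extends\<close>).

  Divide the number of vanishing sums of \<open>2 * k\<close> points by its Gaussian prediction, a constant times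
  the \<open>k\<close>-th power of the number of points. In this normalisation the recursion has the constant
  solution 1, and every solution tends to it because the entries for \<open>k \<le> 1\<close> are 1 throughout
  (\<open>majorant_tendsto\<close>). Hence a number that arises from a bounded number by sufficiently many
  extensions with primes that are not bad, a long chain, satisfies the estimate for
  semi-correlations with a constant that depends on \<open>k\<close> only (\<open>semi_correlations_chain\<close>).

  Almost every sum of two squares is such a chain (\<open>exceptional_null\<close>). Order the prime factors of
  \<open>n\<close> by size and collect those up to some \<open>z\<close> in the initial number. The exceptions are divisible
  by the square of a large prime, or by a high power of a small prime, or have few prime factors
  \<open>1 (mod 4)\<close>, or are divisible by \<open>m * p\<close> with \<open>p > z\<close> bad for \<open>m\<close> and exceeding all prime factors
  of \<open>m\<close>. All but the third kind are handled by a union bound, because the number \<open>S X\<close> of sums of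
  two squares up to \<open>X\<close> satisfies \<open>S (X / d) \<le> C * (1 + ln d) / d * S X\<close> (\<open>S2_count_regular\<close>); the
  third kind by a sieve. Both rest on comparing \<open>S X * ln X\<close> with \<open>X\<close> times the sum of the
  reciprocals of the sums of two squares up to \<open>X\<close>, for which Chebyshev type bounds for primes
  suffice. As at most \<open>(N + 1) ^ (2 * l)\<close> primes are bad for a number with \<open>N\<close> lattice points, the
  sum of \<open>1 / (m * p)\<close> over the pairs that remain after excluding the first two kinds converges
  (\<open>bad_pairs_sum_le\<close>).

  An extension by \<open>p\<close> multiplies the fourth Fourier coefficient by \<open>cos (4 \<theta>)\<close>, where \<open>\<theta>\<close> is the
  angle of \<open>w\<close>. These cosines are dense in \<open>[-1, 1]\<close> (\<open>infinitely_many_primes_near_angle\<close>). A chain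
  whose cosines are all close to 1 except for the last one therefore realises any target
  approximately, and a sequence of such chains is added to the set of typical \<open>n\<close>. Density of the
  cosines follows from the boundedness of the sums of \<open>ln p / p * cos (4 * k * \<theta>)\<close> for each \<open>k \<ge> 1\<close>,
  that is, from the non-vanishing at 1 of the Hecke \<open>L\<close>-series of the characters
  \<open>z \<mapsto> (z / \<bar>z\<bar>) ^ (4 * k)\<close> (\<open>Lam_sum_bounded\<close>). This is proved by elementary means in the manner of
  Mertens: the \<open>L\<close>-series converges at 1 because its coefficients cancel (\<open>sum_hecke_le\<close>), and if it
  vanished there, then the inequality \<open>3 + 4 cos x + cos (2 x) \<ge> 0\<close> would be violated on average.
\<close>

section \<open>Gaussian integers of given norm\<close>

definition gauss_ints :: "complex set" where
  "gauss_ints = {z. Re z \<in> \<int> \<and> Im z \<in> \<int>}"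

text \<open>
  Lattice points are treated as complex numbers, so that Gaussian primes act on them by
  multiplication; the first coordinate becomes the real part.
\<close>
definition gauss_pts :: "nat \<Rightarrow> complex set" where
  "gauss_pts n = {z \<in> gauss_ints. (cmod z)\<^sup>2 = real n}"

lemma gauss_ints_closed [simp, intro]:
  "0 \<in> gauss_ints" "1 \<in> gauss_ints" "\<i> \<in> gauss_ints" "of_nat n \<in> gauss_ints" "of_int i \<in> gauss_ints"
  "z \<in> gauss_ints \<Longrightarrow> w \<in> gauss_ints \<Longrightarrow> z + w \<in> gauss_ints"
  "z \<in> gauss_ints \<Longrightarrow> w \<in> gauss_ints \<Longrightarrow> z - w \<in> gauss_ints"
  "z \<in> gauss_ints \<Longrightarrow> w \<in> gauss_ints \<Longrightarrow> z * w \<in> gauss_ints"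
  "z \<in> gauss_ints \<Longrightarrow> - z \<in> gauss_ints"
  "z \<in> gauss_ints \<Longrightarrow> cnj z \<in> gauss_ints"
  by (auto simp: gauss_ints_def)

lemma gauss_ints_E:
  assumes "z \<in> gauss_ints"
  obtains a b :: int where "z = Complex (of_int a) (of_int b)"
  using assms by (auto simp: gauss_ints_def elim!: Ints_cases) (metis complex.collapse)

lemma Complex_gauss_ints [simp]: "Complex (of_int a) (of_int b) \<in> gauss_ints"
  by (auto simp: gauss_ints_def)

lemma Complex_gauss_pts_iff:
  "Complex (of_int a) (of_int b) \<in> gauss_pts n \<longleftrightarrow> a\<^sup>2 + b\<^sup>2 = int n"
proof -
  have "(real_of_int a)\<^sup>2 + (real_of_int b)\<^sup>2 = real n \<longleftrightarrow> a\<^sup>2 + b\<^sup>2 = int n"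
    by (metis (mono_tags, lifting) of_int_add of_int_eq_iff of_int_of_nat_eq of_int_power)
  then show ?thesis by (simp add: gauss_pts_def cmod_power2)
qed

lemma gauss_pts_E:
  assumes "z \<in> gauss_pts n"
  obtains a b :: int where "z = Complex (of_int a) (of_int b)" "a\<^sup>2 + b\<^sup>2 = int n"
proof -
  from assms have "z \<in> gauss_ints" by (simp add: gauss_pts_def)
  then obtain a b where z: "z = Complex (of_int a) (of_int b)" by (rule gauss_ints_E)
  with assms have "a\<^sup>2 + b\<^sup>2 = int n" by (simp add: Complex_gauss_pts_iff)
  with z show thesis by (rule that)
qed

lemma gauss_pts_eq_image: "gauss_pts n = (\<lambda>(a, b). Complex (of_int a) (of_int b)) ` lattice_points n"
  by (auto simp: lattice_points_def Complex_gauss_pts_iff elim!: gauss_pts_E)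

lemma inj_lattice_embed: "inj_on (\<lambda>(a, b). Complex (of_int a) (of_int b)) A"
  by (auto simp: inj_on_def)

lemma card_gauss_pts: "card (gauss_pts n) = num_lattice_points n"
  unfolding gauss_pts_eq_image num_lattice_points_def by (rule card_image[OF inj_lattice_embed])

lemma finite_gauss_pts [simp]: "finite (gauss_pts n)"
  unfolding gauss_pts_eq_image by (intro finite_imageI finite_lattice_points)

lemma sums_of_two_squares_iff: "n \<in> sums_of_two_squares \<longleftrightarrow> n > 0 \<and> gauss_pts n \<noteq> {}"
proof -
  have "gauss_pts n \<noteq> {} \<longleftrightarrow> (\<exists>a b :: int. int n = a\<^sup>2 + b\<^sup>2)"
    unfolding gauss_pts_eq_image by (auto simp: lattice_points_def eq_commute[of "int n"])
  then show ?thesis by (simp add: sums_of_two_squares_def)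
qed

lemma gauss_pts_mult: "z \<in> gauss_pts m \<Longrightarrow> w \<in> gauss_pts n \<Longrightarrow> z * w \<in> gauss_pts (m * n)"
  by (auto simp: gauss_pts_def norm_mult power_mult_distrib)

lemma gauss_pts_cnj [simp]: "cnj z \<in> gauss_pts n \<longleftrightarrow> z \<in> gauss_pts n"
proof -
  have "cnj z \<in> gauss_ints \<longleftrightarrow> z \<in> gauss_ints" using gauss_ints_closed(10)[of z] gauss_ints_closed(10)[of "cnj z"] by auto
  then show ?thesis by (simp add: gauss_pts_def)
qed

lemma gauss_pts_nonzero: "z \<in> gauss_pts n \<Longrightarrow> n > 0 \<Longrightarrow> z \<noteq> 0"
  by (auto simp: gauss_pts_def)

lemma gauss_pts_mult_cnj: "z \<in> gauss_pts n \<Longrightarrow> z * cnj z = of_nat n"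
  by (auto simp: gauss_pts_def complex_mult_cnj cmod_power2 complex_eq_iff)

lemma gauss_pts_divide:
  assumes "z \<in> gauss_pts (m * n)" "w \<in> gauss_pts m" "m > 0" "z / w \<in> gauss_ints"
  shows "z / w \<in> gauss_pts n"
  using assms by (auto simp: gauss_pts_def norm_divide power_divide)

text \<open>
  Here \<open>z / w = z * cnj w / p\<close>. If \<open>p\<close> divides the real part \<open>u\<close> of \<open>z * cnj w\<close>, then it divides the
  imaginary part as well, since the two squares add up to \<open>p\<^sup>2 * n\<close>.
\<close>
lemma gauss_ints_quotient:
  assumes w: "w \<in> gauss_pts p" and z: "z \<in> gauss_pts (p * n)" and p: "prime p"
    and d: "int p dvd u" and eq: "Re (z * cnj w) = of_int u"
  shows "z / w \<in> gauss_ints"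
proof -
  have p0: "p > 0" using p by (simp add: prime_gt_0_nat)
  have zw: "z * cnj w \<in> gauss_ints" using w z by (auto simp: gauss_pts_def)
  then obtain a b where ab: "z * cnj w = Complex (of_int a) (of_int b)" by (rule gauss_ints_E)
  have "z * cnj w \<in> gauss_pts ((p * n) * p)" using w z by (intro gauss_pts_mult) auto
  then have "a\<^sup>2 + b\<^sup>2 = int ((p * n) * p)" unfolding ab Complex_gauss_pts_iff .
  moreover have au: "a = u" using eq ab by simp
  ultimately have "b\<^sup>2 = int p * (int n * int p) - u\<^sup>2" by (simp add: algebra_simps)
  moreover have "int p dvd u\<^sup>2" using d by (simp add: power2_eq_square)
  ultimately have "int p dvd b\<^sup>2" by simp
  then have "int p dvd b" using p by (simp add: prime_dvd_power_iff)
  then obtain b' where b': "b = int p * b'" by auto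
  from d obtain u' where u': "u = int p * u'" by auto
  have "z / w = z * cnj w / (w * cnj w)" using gauss_pts_nonzero[OF w p0] by simp
  also have "\<dots> = z * cnj w / of_nat p" using gauss_pts_mult_cnj[OF w] by simp
  also have "\<dots> = Complex (of_int u') (of_int b')"
    using p0 by (auto simp: ab au u' b' complex_eq_iff)
  finally show ?thesis by simp
qed

text \<open>
  With \<open>w = a + b i\<close> and \<open>z = x + y i\<close> the prime \<open>p\<close> divides
  \<open>(a x + b y) (a x - b y) = a\<^sup>2 (x\<^sup>2 + y\<^sup>2) - y\<^sup>2 (a\<^sup>2 + b\<^sup>2)\<close>, hence one of the two factors, which
  are the real parts of \<open>z * cnj w\<close> and of \<open>z * w\<close>.
\<close>
lemma gaussian_prime_divides:
  assumes p: "prime p" and w: "w \<in> gauss_pts p" and z: "z \<in> gauss_pts (p * n)"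
  shows "z / w \<in> gauss_ints \<or> z / cnj w \<in> gauss_ints"
proof -
  from w obtain a b where ab: "w = Complex (of_int a) (of_int b)" "a\<^sup>2 + b\<^sup>2 = int p" by (rule gauss_pts_E)
  from z obtain x y where xy: "z = Complex (of_int x) (of_int y)" "x\<^sup>2 + y\<^sup>2 = int (p * n)" by (rule gauss_pts_E)
  have "(a * x + b * y) * (a * x - b * y) = a\<^sup>2 * (x\<^sup>2 + y\<^sup>2) - y\<^sup>2 * (a\<^sup>2 + b\<^sup>2)"
    by (simp add: algebra_simps power2_eq_square)
  also have "\<dots> = int p * (a\<^sup>2 * int n - y\<^sup>2)" unfolding xy(2) ab(2) by (simp add: algebra_simps)
  finally have "int p dvd (a * x + b * y) * (a * x - b * y)" by simp
  then have "int p dvd a * x + b * y \<or> int p dvd a * x - b * y"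
    using p by (simp add: prime_dvd_mult_iff)
  then show ?thesis
  proof
    assume "int p dvd a * x + b * y"
    then have "z / w \<in> gauss_ints" by (rule gauss_ints_quotient[OF w z p]) (simp add: ab xy)
    then show ?thesis ..
  next
    assume "int p dvd a * x - b * y"
    then have "z / cnj w \<in> gauss_ints"
      by (rule gauss_ints_quotient[OF _ z p, rotated]) (use w in \<open>simp_all add: ab xy\<close>)
    then show ?thesis ..
  qed
qed

lemma gauss_pts_prime_mult:
  assumes p: "prime p" and w: "w \<in> gauss_pts p"
  shows "gauss_pts (p * n) = (*) w ` gauss_pts n \<union> (*) (cnj w) ` gauss_pts n"
proof (intro equalityI subsetI)
  fix z assume z: "z \<in> gauss_pts (p * n)"
  have p0: "p > 0" using p by (simp add: prime_gt_0_nat)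
  have w0: "w \<noteq> 0" using gauss_pts_nonzero[OF w p0] .
  from gaussian_prime_divides[OF p w z] show "z \<in> (*) w ` gauss_pts n \<union> (*) (cnj w) ` gauss_pts n"
  proof
    assume "z / w \<in> gauss_ints"
    then have "z / w \<in> gauss_pts n" by (rule gauss_pts_divide[OF z w p0])
    moreover have "z = w * (z / w)" using w0 by simp
    ultimately show ?thesis by blast
  next
    assume "z / cnj w \<in> gauss_ints"
    then have "z / cnj w \<in> gauss_pts n" using gauss_pts_divide[OF z _ p0, of "cnj w"] w by simp
    moreover have "z = cnj w * (z / cnj w)" using w0 by simp
    ultimately show ?thesis by blast
  qed
qed (use w in \<open>auto intro: gauss_pts_mult\<close>)

text \<open>
  Thue's argument: if \<open>y\<^sup>2 \<equiv> -1 (mod p)\<close>, then two of the more than \<open>p\<close> values \<open>a - y * b\<close> with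
  \<open>a, b \<le> sqrt p\<close> are congruent, and their difference gives a norm that is a multiple of \<open>p\<close> below
  \<open>2 * p\<close>.
\<close>
lemma prime_1_mod_4_gauss_pts:
  assumes p: "prime p" and p4: "p mod 4 = 1"
  shows "\<exists>w. w \<in> gauss_pts p"
proof -
  have p2: "2 < p" using prime_ge_2_nat[OF p] p4 by (cases "p = 2") auto
  have "[Legendre (-1) (int p) = (-1) ^ ((p - 1) div 2)] (mod int p)"
    using euler_criterion[OF p p2, of "-1"] by simp
  moreover have "even ((p - 1) div 2)" using p4 by presburger
  ultimately have "[Legendre (-1) (int p) = 1] (mod int p)" by simp
  moreover have "\<not> [0 = 1] (mod int p)" "\<not> [-1 = 1] (mod int p)"
    using p2 by (auto simp: cong_def zmod_minus1)
  ultimately have "QuadRes (int p) (-1)" by (auto simp: Legendre_def split: if_splits)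
  then obtain y where y: "[y\<^sup>2 = -1] (mod int p)" by (auto simp: QuadRes_def)
  define r where "r = nat \<lfloor>sqrt p\<rfloor>"
  have r1: "real r \<le> sqrt p" "sqrt p < real r + 1" 
  proof -
    have "real r = of_int \<lfloor>sqrt p\<rfloor>" unfolding r_def by simp
    then show "real r \<le> sqrt p" "sqrt p < real r + 1" by linarith+
  qed
  have rp: "r\<^sup>2 \<le> p"
  proof -
    have "(real r)\<^sup>2 \<le> (sqrt p)\<^sup>2" using r1 by (intro power_mono) auto
    then show ?thesis by (simp flip: of_nat_power)
  qed
  have pr: "p < (r + 1)\<^sup>2"
  proof -
    have "(sqrt p)\<^sup>2 < (real r + 1)\<^sup>2" using r1 by (intro power_strict_mono) auto
    then have "real p < real ((r + 1)\<^sup>2)" by (simp add: add.commute)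
    then show ?thesis by (simp only: of_nat_less_iff)
  qed
  have rp': "r\<^sup>2 < p"
  proof (rule ccontr)
    assume "\<not> r\<^sup>2 < p"
    with rp have "p = r\<^sup>2" by simp
    with p show False by (metis prime_power_iff numeral_eq_one_iff semiring_norm(85))
  qed
  \<comment> \<open>Thue: more pairs than residues.\<close>
  define f where "f = (\<lambda>(a::nat, b::nat). (int a - y * int b) mod int p)"
  have "\<not> inj_on f ({0..r} \<times> {0..r})"
  proof
    assume "inj_on f ({0..r} \<times> {0..r})"
    then have "card ({0..r} \<times> {0..r}) = card (f ` ({0..r} \<times> {0..r}))" by (simp add: card_image)
    also have "f ` ({0..r} \<times> {0..r}) \<subseteq> {0..<int p}" using p2 by (auto simp: f_def)
    then have "card (f ` ({0..r} \<times> {0..r})) \<le> card {0..<int p}" by (intro card_mono) auto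
    finally show False using pr by (simp add: power2_eq_square)
  qed
  then obtain a b c d where abcd: "a \<le> r" "b \<le> r" "c \<le> r" "d \<le> r" "(a, b) \<noteq> (c, d)"
    "f (a, b) = f (c, d)" by (auto simp: inj_on_def)
  define u where "u = int a - int c"
  define v where "v = int b - int d"
  have "[int a - y * int b = int c - y * int d] (mod int p)"
    using abcd by (simp add: f_def cong_def)
  then have "int p dvd u - y * v" by (simp add: cong_iff_dvd_diff u_def v_def algebra_simps)
  moreover have "int p dvd y\<^sup>2 + 1" using y by (simp add: cong_iff_dvd_diff)
  moreover have "u\<^sup>2 + v\<^sup>2 = (u - y * v) * (u + y * v) + (y\<^sup>2 + 1) * v\<^sup>2"
    by (simp add: algebra_simps power2_eq_square)
  ultimately have dv: "int p dvd u\<^sup>2 + v\<^sup>2" by simp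
  have uv0: "u\<^sup>2 + v\<^sup>2 > 0" using abcd by (auto simp: u_def v_def sum_power2_gt_zero_iff)
  have "\<bar>u\<bar> \<le> int r" "\<bar>v\<bar> \<le> int r" using abcd by (auto simp: u_def v_def)
  then have "\<bar>u\<bar>\<^sup>2 \<le> (int r)\<^sup>2" "\<bar>v\<bar>\<^sup>2 \<le> (int r)\<^sup>2" by (intro power_mono; simp)+
  then have "u\<^sup>2 \<le> (int r)\<^sup>2" "v\<^sup>2 \<le> (int r)\<^sup>2" by simp_all
  moreover have "(int r)\<^sup>2 < int p" using rp' by (simp flip: of_nat_power)
  ultimately have lt: "u\<^sup>2 + v\<^sup>2 < 2 * int p" by linarith
  from dv obtain k where k: "u\<^sup>2 + v\<^sup>2 = int p * k" by auto
  with uv0 have "k > 0" using p2 by (simp add: zero_less_mult_iff)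
  moreover from lt k p2 have "k < 2" by (simp add: mult.commute)
  ultimately have "k = 1" by simp
  with k have "Complex (of_int u) (of_int v) \<in> gauss_pts p" by (simp add: Complex_gauss_pts_iff)
  then show ?thesis by blast
qed

text \<open>
  Otherwise \<open>-1\<close> would be a quadratic residue modulo \<open>p\<close>, contrary to Euler's criterion.
\<close>
lemma inert_prime_dvd:
  fixes x y :: int
  assumes p: "prime p" and p4: "p mod 4 = 3" and d: "int p dvd x\<^sup>2 + y\<^sup>2"
  shows "int p dvd x \<and> int p dvd y"
proof -
  have p2: "2 < p" using prime_ge_2_nat[OF p] p4 by (cases "p = 2") auto
  have main: "int p dvd v" if d: "int p dvd u\<^sup>2 + v\<^sup>2" for u v :: int
  proof (rule ccontr)
    assume nv: "\<not> int p dvd v"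
    then have "coprime v (int p)"
      using p by (metis coprime_commute prime_imp_coprime prime_nat_int_transfer)
    then obtain t where t: "[v * t = 1] (mod int p)" using cong_solve_coprime_int by blast
    have "[(u * t)\<^sup>2 + (v * t)\<^sup>2 = 0] (mod int p)"
      using d by (simp add: cong_0_iff power_mult_distrib flip: distrib_right)
    moreover have "[(v * t)\<^sup>2 = 1\<^sup>2] (mod int p)" using t by (rule cong_pow)
    ultimately have "[(u * t)\<^sup>2 + 1 = 0] (mod int p)"
      by (smt (verit, best) cong_add_lcancel cong_sym cong_trans power_one)
    then have "[(u * t)\<^sup>2 = -1] (mod int p)" by (simp add: cong_iff_dvd_diff)
    then have "QuadRes (int p) (-1)" by (auto simp: QuadRes_def)
    moreover have "\<not> [-1 = 0] (mod int p)" using p2 by (auto simp: cong_0_iff)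
    ultimately have "Legendre (-1) (int p) = 1" by (simp add: Legendre_def)
    moreover have "[Legendre (-1) (int p) = (-1) ^ ((p - 1) div 2)] (mod int p)"
      using euler_criterion[OF p p2, of "-1"] by simp
    moreover have "odd ((p - 1) div 2)" using p4 by presburger
    ultimately have "[1 = -1] (mod int p)" by simp
    then have "int p dvd 2" by (simp add: cong_iff_dvd_diff)
    then show False using p2 zdvd_imp_le by fastforce
  qed
  from main[OF d] main[of y x] d show ?thesis by (simp add: add.commute)
qed

lemma gauss_pts_inert_mult:
  assumes p: "prime p" and p4: "p mod 4 = 3"
  shows "gauss_pts (p * n) = (if p dvd n then (*) (of_nat p) ` gauss_pts (n div p) else {})"
proof -
  have p0: "p > 0" using p by (simp add: prime_gt_0_nat)
  have *: "p dvd n \<and> z \<in> (*) (of_nat p) ` gauss_pts (n div p)" if z: "z \<in> gauss_pts (p * n)" for z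
  proof -
    from z obtain x y where xy: "z = Complex (of_int x) (of_int y)" "x\<^sup>2 + y\<^sup>2 = int (p * n)" by (rule gauss_pts_E)
    have "int p dvd x \<and> int p dvd y" by (rule inert_prime_dvd[OF p p4]) (simp add: xy)
    then obtain x' y' where x': "x = int p * x'" and y': "y = int p * y'" by (auto elim!: dvdE)
    have "int p * (int p * (x'\<^sup>2 + y'\<^sup>2)) = int p * int n"
      using xy(2) unfolding x' y' by (simp add: algebra_simps power2_eq_square)
    then have e: "int p * (x'\<^sup>2 + y'\<^sup>2) = int n" using p0 by simp
    then have dn: "p dvd n" by (metis dvd_triv_left int_dvd_int_iff)
    then have "int n = int p * int (n div p)" by (simp flip: of_nat_mult)
    with e p0 have "x'\<^sup>2 + y'\<^sup>2 = int (n div p)" by simp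
    then have "Complex (of_int x') (of_int y') \<in> gauss_pts (n div p)" by (simp add: Complex_gauss_pts_iff)
    moreover have "z = of_nat p * Complex (of_int x') (of_int y')"
      by (simp add: xy x' y' complex_eq_iff)
    ultimately show ?thesis using dn by blast
  qed
  have "(*) (of_nat p) ` gauss_pts (n div p) \<subseteq> gauss_pts (p * n)" if dn: "p dvd n"
  proof
    fix z assume "z \<in> (*) (of_nat p) ` gauss_pts (n div p)"
    moreover have "of_nat p \<in> gauss_pts (p * p)" by (auto simp: gauss_pts_def power2_eq_square)
    ultimately have "z \<in> gauss_pts (p * p * (n div p))" by (auto intro: gauss_pts_mult)
    also have "p * p * (n div p) = p * n" using dn by simp
    finally show "z \<in> gauss_pts (p * n)" .
  qed
  with * show ?thesis by auto
qed

lemma gauss_pts_2_mult: "gauss_pts (2 * n) = (*) (1 + \<i>) ` gauss_pts n"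
proof -
  have w: "1 + \<i> \<in> gauss_pts 2" by (auto simp: gauss_pts_def cmod_power2)
  have "(*) (cnj (1 + \<i>)) ` gauss_pts n \<subseteq> (*) (1 + \<i>) ` gauss_pts n"
  proof
    fix z assume "z \<in> (*) (cnj (1 + \<i>)) ` gauss_pts n"
    then obtain v where v: "v \<in> gauss_pts n" "z = cnj (1 + \<i>) * v" by auto
    have "- \<i> \<in> gauss_pts 1" by (auto simp: gauss_pts_def)
    from gauss_pts_mult[OF this v(1)] have "- \<i> * v \<in> gauss_pts n" by simp
    moreover have "z = (1 + \<i>) * (- \<i> * v)" by (simp add: v(2) complex_eq_iff)
    ultimately show "z \<in> (*) (1 + \<i>) ` gauss_pts n" by blast
  qed
  then show ?thesis using gauss_pts_prime_mult[OF two_is_prime_nat w, of n] by auto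
qed

text \<open>
  The Gaussian integers \<open>w\<close> and \<open>cnj w\<close> are coprime because \<open>p = w * cnj w\<close> and \<open>w + cnj w\<close> are
  coprime integers. So the two halves of the circle of norm \<open>p * n\<close> meet only in multiples of \<open>p\<close>.
\<close>
lemma gauss_pts_halves_inter:
  assumes p: "prime p" and p4: "p mod 4 = 1" and w: "w \<in> gauss_pts p" and n: "n > 0"
  shows "(*) w ` gauss_pts n \<inter> (*) (cnj w) ` gauss_pts n =
         (if p dvd n then (*) (of_nat p) ` gauss_pts (n div p) else {})"
proof -
  have p0: "p > 0" using p by (simp add: prime_gt_0_nat)
  have w0: "w \<noteq> 0" using gauss_pts_nonzero[OF w p0] .
  have wc: "w * cnj w = of_nat p" by (rule gauss_pts_mult_cnj[OF w])
  from w obtain a b where ab: "w = Complex (of_int a) (of_int b)" "a\<^sup>2 + b\<^sup>2 = int p" by (rule gauss_pts_E)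
  have na: "\<not> int p dvd 2 * a"
  proof
    assume "int p dvd 2 * a"
    then have "int p dvd 2 \<or> int p dvd a" using p by (simp add: prime_dvd_mult_iff)
    moreover have "\<not> int p dvd 2"
    proof
      assume "int p dvd 2"
      then have "p dvd 2" by (metis int_dvd_int_iff of_nat_numeral)
      then have "p = 2" using p two_is_prime_nat primes_dvd_imp_eq by blast
      then show False using p4 by simp
    qed
    ultimately have da: "int p dvd a" by blast
    then have "int p dvd b\<^sup>2" using ab(2)
      by (metis dvd_add_right_iff dvd_mult dvd_refl power2_eq_square)
    then have db: "int p dvd b" using p by (simp add: prime_dvd_power_iff)
    from da db have "int p * int p dvd a\<^sup>2 + b\<^sup>2"
      by (auto simp: power2_eq_square intro!: dvd_add mult_dvd_mono)
    then have "int p * int p dvd int p * 1" unfolding ab(2) by simp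
    then have "int p dvd 1" using p0 by (subst (asm) dvd_mult_cancel_left) auto
    then show False using p by auto
  qed
  moreover have "prime (int p)" using p by simp
  ultimately have "coprime (int p) (2 * a)" by (intro prime_imp_coprime)
  then obtain s t where st: "s * int p + t * (2 * a) = 1"
    by (metis bezout_int coprime_imp_gcd_eq_1)
  have wcn: "w + cnj w = of_int (2 * a)" by (simp add: ab(1) complex_eq_iff)
  \<comment> \<open>Bezout: \<open>w\<close> and \<open>cnj w\<close> generate the unit ideal.\<close>
  have one: "of_int s * (w * cnj w) + of_int t * (w + cnj w) = 1"
  proof -
    have "of_int s * (w * cnj w) + of_int t * (w + cnj w) = of_int (s * int p + t * (2 * a))"
      unfolding wc wcn by simp
    then show ?thesis unfolding st by simp
  qed
  have sub: "p dvd n \<and> z \<in> (*) (of_nat p) ` gauss_pts (n div p)"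
    if "z \<in> (*) w ` gauss_pts n" "z \<in> (*) (cnj w) ` gauss_pts n" for z
  proof -
    from that(1) obtain u where u: "u \<in> gauss_pts n" "z = w * u" by auto
    from that(2) obtain v where v: "v \<in> gauss_pts n" "z = cnj w * v" by auto
    define g where "g = of_int s * w * u + of_int t * v + of_int t * u"
    have gg: "g \<in> gauss_ints" unfolding g_def using u v w by (auto simp: gauss_pts_def)
    have "u = (of_int s * (w * cnj w) + of_int t * (w + cnj w)) * u" unfolding one by simp
    also have "\<dots> = of_int s * w * cnj w * u + of_int t * (w * u) + of_int t * cnj w * u"
      by (simp add: algebra_simps)
    also have "w * u = cnj w * v" using u v by simp
    finally have ug: "u = cnj w * g" by (simp add: g_def algebra_simps)
    from gg obtain c d where cd: "g = Complex (of_int c) (of_int d)" by (rule gauss_ints_E)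
    have "real n = (cmod u)\<^sup>2" using u by (simp add: gauss_pts_def)
    also have "\<dots> = (cmod w)\<^sup>2 * (cmod g)\<^sup>2" unfolding ug by (simp add: norm_mult power_mult_distrib)
    also have "\<dots> = real p * (cmod g)\<^sup>2" using w by (simp add: gauss_pts_def)
    also have "(cmod g)\<^sup>2 = of_int (c\<^sup>2 + d\<^sup>2)" by (simp add: cd cmod_power2)
    finally have "real_of_int (int n) = real_of_int (int p * (c\<^sup>2 + d\<^sup>2))" by simp
    then have e: "int n = int p * (c\<^sup>2 + d\<^sup>2)" by (simp only: of_int_eq_iff)
    then have dn: "p dvd n" by (metis dvd_triv_left int_dvd_int_iff)
    then have "int n = int p * int (n div p)" by (simp flip: of_nat_mult)
    with e p0 have "c\<^sup>2 + d\<^sup>2 = int (n div p)" by simp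
    then have "g \<in> gauss_pts (n div p)" by (simp add: cd Complex_gauss_pts_iff)
    moreover have "z = of_nat p * g" by (simp add: u(2) ug flip: wc)
    ultimately show ?thesis using dn by blast
  qed
  have "z \<in> (*) w ` gauss_pts n \<inter> (*) (cnj w) ` gauss_pts n"
    if dn: "p dvd n" and z: "z \<in> (*) (of_nat p) ` gauss_pts (n div p)" for z
  proof -
    from z obtain g where g: "g \<in> gauss_pts (n div p)" "z = of_nat p * g" by auto
    have "w * g \<in> gauss_pts (p * (n div p))" "cnj w * g \<in> gauss_pts (p * (n div p))"
      using g w by (auto intro: gauss_pts_mult)
    then have "w * g \<in> gauss_pts n" "cnj w * g \<in> gauss_pts n" using dn by simp_all
    moreover have "z = cnj w * (w * g)" "z = w * (cnj w * g)" by (simp_all add: g flip: wc)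
    ultimately show ?thesis by blast
  qed
  with sub show ?thesis by (auto split: if_splits)
qed

section \<open>Coefficients of Hecke series\<close>

text \<open>
  The coefficients of the Hecke \<open>L\<close>-series of the character \<open>z \<mapsto> (z / \<bar>z\<bar>) ^ (4 * k)\<close> of the
  Gaussian integers. The exponent makes the character trivial on units, and the division by 4 counts
  one point from each orbit of units, so that the first coefficient is 1.
\<close>
definition hecke :: "nat \<Rightarrow> nat \<Rightarrow> real" where
  "hecke k n = (\<Sum>z\<in>gauss_pts n. Re (sgn z ^ (4 * k))) / 4"

lemma hecke_0: "hecke 0 n = real (num_lattice_points n) / 4"
  by (simp add: hecke_def card_gauss_pts)

lemma hecke_0_nonneg: "hecke 0 n \<ge> 0" by (simp add: hecke_0)

lemma sum_sgn_gauss_pts: "(\<Sum>z\<in>gauss_pts n. sgn z ^ (4 * k)) = of_real (4 * hecke k n)"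
proof -
  have "(\<Sum>z\<in>gauss_pts n. sgn z ^ (4 * k)) = (\<Sum>z\<in>gauss_pts n. sgn (cnj z) ^ (4 * k))"
    by (rule sum.reindex_bij_witness[where i = cnj and j = cnj]) auto
  also have "\<dots> = cnj (\<Sum>z\<in>gauss_pts n. sgn z ^ (4 * k))" by (simp add: sgn_div_norm)
  finally have "Im (\<Sum>z\<in>gauss_pts n. sgn z ^ (4 * k)) = 0"
    by (metis Reals_cnj_iff complex_is_Real_iff)
  then show ?thesis by (simp add: complex_eq_iff hecke_def)
qed

lemma Re_sgn_power_le: "\<bar>Re (sgn z ^ m)\<bar> \<le> 1"
proof -
  have "\<bar>Re (sgn z ^ m)\<bar> \<le> cmod (sgn z ^ m)" by (rule abs_Re_le_cmod)
  also have "\<dots> \<le> 1" by (simp add: norm_power norm_sgn power_le_one)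
  finally show ?thesis .
qed

lemma abs_hecke_le: "\<bar>hecke k n\<bar> \<le> hecke 0 n"
proof -
  have "\<bar>\<Sum>z\<in>gauss_pts n. Re (sgn z ^ (4 * k))\<bar> \<le> (\<Sum>z\<in>gauss_pts n. 1)"
    by (rule order.trans[OF sum_abs]) (intro sum_mono Re_sgn_power_le)
  then show ?thesis by (simp add: hecke_def)
qed

lemma gauss_pts_1: "gauss_pts 1 = {1, -1, \<i>, -\<i>}"
proof
  show "gauss_pts 1 \<subseteq> {1, -1, \<i>, -\<i>}"
  proof
    fix z assume "z \<in> gauss_pts 1"
    then obtain a b where ab: "z = Complex (of_int a) (of_int b)" "a\<^sup>2 + b\<^sup>2 = int 1" by (rule gauss_pts_E)
    have "a\<^sup>2 \<le> 1" "b\<^sup>2 \<le> 1" using ab(2) zero_le_power2[of a] zero_le_power2[of b] by linarith+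
    then have "a \<in> {-1, 0, 1}" "b \<in> {-1, 0, 1}"
      using abs_square_le_1[of a] abs_square_le_1[of b] by auto
    then show "z \<in> {1, -1, \<i>, -\<i>}" using ab by (auto simp: complex_eq_iff)
  qed
qed (auto simp: gauss_pts_def)

lemma hecke_1: "hecke k 1 = 1"
proof -
  have i4: "\<i> ^ 4 = 1" by (simp add: power4_eq_xxxx)
  show ?thesis
    unfolding hecke_def gauss_pts_1
    by (simp add: sgn_div_norm complex_eq_iff power_mult i4)
qed

text \<open>
  Inclusion and exclusion over the two halves of the circle of norm \<open>p * n\<close>; the character takes
  conjugate values at \<open>w\<close> and \<open>cnj w\<close> and the value 1 at \<open>p\<close>.
\<close>
lemma hecke_prime_1_mod_4:
  assumes p: "prime p" and p4: "p mod 4 = 1" and w: "w \<in> gauss_pts p" and n: "n > 0"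
  shows "hecke k (p * n) = 2 * Re (sgn w ^ (4 * k)) * hecke k n - (if p dvd n then hecke k (n div p) else 0)"
proof -
  have p0: "p > 0" using p by (simp add: prime_gt_0_nat)
  have w0: "w \<noteq> 0" using gauss_pts_nonzero[OF w p0] .
  define F where "F = (\<lambda>z::complex. sgn z ^ (4 * k))"
  have F: "F (x * y) = F x * F y" for x y by (simp add: F_def sgn_mult power_mult_distrib)
  have scale: "sum F ((*) c ` A) = F c * sum F A" if "c \<noteq> 0" for c A
    using that by (subst sum.reindex) (auto simp: inj_on_def F sum_distrib_left)
  have Fp: "F (of_nat p) = 1" using p0 by (simp add: F_def sgn_div_norm scaleR_conv_of_real)
  have "sum F (gauss_pts (p * n)) + sum F ((*) w ` gauss_pts n \<inter> (*) (cnj w) ` gauss_pts n) =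
        sum F ((*) w ` gauss_pts n) + sum F ((*) (cnj w) ` gauss_pts n)"
    unfolding gauss_pts_prime_mult[OF p w] by (rule sum.union_inter) auto
  also have "\<dots> = (F w + F (cnj w)) * sum F (gauss_pts n)"
    using w0 by (simp add: scale distrib_right)
  also have "F (cnj w) = cnj (F w)" by (simp add: F_def sgn_eq)
  also have "F w + cnj (F w) = of_real (2 * Re (F w))" by (rule complex_add_cnj)
  finally have e: "sum F (gauss_pts (p * n)) = of_real (2 * Re (F w)) * sum F (gauss_pts n)
       - sum F ((*) w ` gauss_pts n \<inter> (*) (cnj w) ` gauss_pts n)" by (simp add: algebra_simps)
  have "sum F ((*) w ` gauss_pts n \<inter> (*) (cnj w) ` gauss_pts n) =
        (if p dvd n then sum F (gauss_pts (n div p)) else 0)"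
    unfolding gauss_pts_halves_inter[OF p p4 w n] using p0 by (simp add: scale Fp)
  with e have "sum F (gauss_pts (p * n)) = of_real (2 * Re (F w)) * sum F (gauss_pts n)
       - (if p dvd n then sum F (gauss_pts (n div p)) else 0)" by simp
  then have "complex_of_real (4 * hecke k (p * n)) = of_real (2 * Re (F w) * (4 * hecke k n)
       - (if p dvd n then 4 * hecke k (n div p) else 0))"
    unfolding F_def sum_sgn_gauss_pts by simp
  then have "4 * hecke k (p * n) = 2 * Re (F w) * (4 * hecke k n)
       - (if p dvd n then 4 * hecke k (n div p) else 0)" by (simp only: of_real_eq_iff)
  then show ?thesis by (auto simp: F_def split: if_splits)
qed

lemma hecke_inert:
  assumes p: "prime p" and p4: "p mod 4 = 3"
  shows "hecke k (p * n) = (if p dvd n then hecke k (n div p) else 0)"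
proof -
  have p0: "p > 0" using p by (simp add: prime_gt_0_nat)
  then have "inj_on ((*) (complex_of_nat p)) A" for A by (auto simp: inj_on_def)
  then show ?thesis
    using p0 by (simp add: hecke_def gauss_pts_inert_mult[OF assms] sum.reindex sgn_mult)
       (simp add: sgn_div_norm scaleR_conv_of_real)
qed

lemma sgn_1_ii_power4: "sgn (1 + \<i>) ^ 4 = -1"
proof -
  have "cmod (1 + \<i>) ^ 4 = ((cmod (1 + \<i>))\<^sup>2)\<^sup>2" by (simp flip: power_mult)
  also have "\<dots> = 4" by (simp add: cmod_power2)
  finally have c: "cmod (1 + \<i>) ^ 4 = 4" .
  have "(1 + \<i>) ^ 4 = -4" by (simp add: power4_eq_xxxx algebra_simps)
  then show ?thesis
    using c by (simp add: sgn_eq power_divide flip: of_real_power)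
qed

lemma hecke_2: "hecke k (2 * n) = (- 1) ^ k * hecke k n"
proof -
  have nz: "1 + \<i> \<noteq> 0" by (simp add: complex_eq_iff)
  have "inj_on ((*) (1 + \<i>)) A" for A using nz by (auto simp: inj_on_def)
  moreover have "Re (sgn ((1 + \<i>) * z) ^ (4 * k)) = (-1) ^ k * Re (sgn z ^ (4 * k))" for z
  proof -
    have "sgn ((1 + \<i>) * z) ^ (4 * k) = (sgn (1 + \<i>) ^ 4) ^ k * sgn z ^ (4 * k)"
      by (simp add: sgn_mult power_mult_distrib power_mult)
    also have "\<dots> = of_real ((-1) ^ k) * sgn z ^ (4 * k)" by (simp add: sgn_1_ii_power4)
    finally have "Re (sgn ((1 + \<i>) * z) ^ (4 * k)) = Re (of_real ((-1) ^ k) * sgn z ^ (4 * k))" by simp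
    also have "Re (of_real c * x) = c * Re x" for c x by simp
    finally show ?thesis .
  qed
  ultimately show ?thesis
    by (simp add: hecke_def gauss_pts_2_mult sum.reindex sum_distrib_left)
qed

section \<open>The twisted von Mangoldt function\<close>

text \<open>
  The possible choices differ by units and conjugation. This leaves the real parts of the powers
  with exponent divisible by 4 unchanged.
\<close>
definition gprime :: "nat \<Rightarrow> complex" where "gprime p = (SOME w. w \<in> gauss_pts p)"

lemma gprime: "prime p \<Longrightarrow> p mod 4 = 1 \<Longrightarrow> gprime p \<in> gauss_pts p"
  unfolding gprime_def by (rule someI_ex) (rule prime_1_mod_4_gauss_pts)

text \<open>
  The sum of the \<open>j\<close>-th powers of the reciprocal roots of the Euler factor at \<open>p\<close>: one root
  \<open>(-1) ^ k\<close> at 2, the two conjugate character values at the Gaussian primes above \<open>p \<equiv> 1 (mod 4)\<close>,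
  and the roots 1 and \<open>-1\<close> at an inert prime.
\<close>
definition tau :: "nat \<Rightarrow> nat \<Rightarrow> nat \<Rightarrow> real" where
  "tau k p j = (if p = 2 then (-1) ^ (k * j)
     else if p mod 4 = 1 then 2 * Re (sgn (gprime p) ^ (4 * k * j))
     else if even j then 2 else 0)"

lemma prime_mod_4_cases:
  assumes "prime (p::nat)"
  obtains "p = 2" | "p mod 4 = 1" | "p mod 4 = 3"
proof -
  have "p = 2 \<or> odd p" using assms prime_odd_nat[of p] prime_ge_2_nat[of p] by force
  then have "p = 2 \<or> p mod 4 = 1 \<or> p mod 4 = 3" by presburger
  then show thesis using that by blast
qed

text \<open>
  Newton's identity between the complete symmetric functions \<open>U\<close> and the power sums \<open>T\<close> of two
  numbers with sum \<open>t\<close> and product \<open>d\<close>.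
\<close>
lemma newton_two_roots:
  fixes U T :: "nat \<Rightarrow> real"
  assumes U1: "U 1 = t * U 0" and U2: "\<And>a. U (a + 2) = t * U (a + 1) - d * U a"
    and T1: "T 1 = t" and T2: "T 2 = t\<^sup>2 - 2 * d" and T: "\<And>j. j \<ge> 1 \<Longrightarrow> T (j + 2) = t * T (j + 1) - d * T j"
  shows "real a * U a = (\<Sum>j=1..a. T j * U (a - j))"
proof -
  define V where "V = (\<lambda>a. \<Sum>j=1..a. T j * U (a - j))"
  \<comment> \<open>The power sums in terms of the complete symmetric functions.\<close>
  have aux: "t * U (a + 1) - 2 * d * U a = T (a + 2) * U 0" for a
  proof (induction a rule: induct_nat_012)
    case 0
    have "t * U (0 + 1) - 2 * d * U 0 = (t\<^sup>2 - 2 * d) * U 0" using U1 by (simp add: power2_eq_square algebra_simps)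
    also have "t\<^sup>2 - 2 * d = T (0 + 2)" unfolding add_0 using T2 ..
    finally show ?case .
  next
    case 1
    have T3: "T (1 + 2) = t * (t\<^sup>2 - 2 * d) - d * t" 
      by (simp only: T[of 1, unfolded one_add_one, OF order.refl] T1 T2)
    have U2': "U (1 + 1) = t * (t * U 0) - d * U 0" using U2[of 0] U1 by (simp add: numeral_2_eq_2)
    have "t * U (1 + 1) - 2 * d * U 1 = T (1 + 2) * U 0"
      unfolding T3 U2' U1 by (simp add: power2_eq_square algebra_simps)
    then show ?case by simp
  next
    case (ge2 n)
    have "t * U (Suc (Suc n) + 1) - 2 * d * U (Suc (Suc n)) =
       t * (t * U (Suc n + 1) - 2 * d * U (Suc n)) - d * (t * U (n + 1) - 2 * d * U n)"
    proof -
      have a: "U (Suc (Suc (Suc n))) = t * U (Suc (Suc n)) - d * U (Suc n)" using U2[of "Suc n"] by simp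
      have b: "U (Suc (Suc n)) = t * U (Suc n) - d * U n" using U2[of n] by simp
      show ?thesis by (simp add: a b) (simp add: algebra_simps)
    qed
    also have "\<dots> = (t * T (Suc n + 2) - d * T (n + 2)) * U 0"
      unfolding ge2 by (simp add: algebra_simps)
    also have "t * T (Suc n + 2) - d * T (n + 2) = T (Suc (Suc n) + 2)"
      using T[of "n + 2"] by simp
    finally show ?case .
  qed
  have V2: "V (a + 2) = t * V (a + 1) - d * V a + T (a + 2) * U 0" for a
  proof -
    have "V (a + 2) = (\<Sum>j=1..a. T j * U (a + 2 - j)) + T (a + 1) * U 1 + T (a + 2) * U 0"
      by (simp add: V_def)
    also have "(\<Sum>j=1..a. T j * U (a + 2 - j)) = (\<Sum>j=1..a. t * (T j * U (a + 1 - j)) - d * (T j * U (a - j)))"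
    proof (rule sum.cong)
      fix j assume "j \<in> {1..a}"
      then have "a + 2 - j = (a - j) + 2" "a + 1 - j = (a - j) + 1" by auto
      then show "T j * U (a + 2 - j) = t * (T j * U (a + 1 - j)) - d * (T j * U (a - j))"
        by (simp only: U2) (simp add: algebra_simps)
    qed simp
    also have "\<dots> = t * (\<Sum>j=1..a. T j * U (a + 1 - j)) - d * V a"
      by (simp add: sum_subtractf sum_distrib_left V_def)
    also have "(\<Sum>j=1..a. T j * U (a + 1 - j)) = V (a + 1) - T (a + 1) * U 0"
      by (simp add: V_def)
    finally show ?thesis using U1 by (simp add: algebra_simps)
  qed
  have "real a * U a = V a"
  proof (induction a rule: induct_nat_012)
    case 1
    show ?case using U1 T1 by (simp add: V_def)
  next
    case (ge2 n)
    have "real (n + 2) * U (n + 2) = t * (real (n + 1) * U (n + 1)) - d * (real n * U n) + (t * U (n + 1) - 2 * d * U n)"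
      unfolding U2 by (simp add: algebra_simps)
    also have "\<dots> = t * V (n + 1) - d * V n + T (n + 2) * U 0"
      using ge2 aux by simp
    also have "\<dots> = V (n + 2)" by (rule V2[symmetric])
    finally show ?case by simp
  qed (simp add: V_def)
  then show ?thesis by (simp add: V_def)
qed

lemma prime_power_decompose:
  fixes n :: nat assumes "prime p" "n > 0"
  obtains m where "n = p ^ multiplicity p n * m" "\<not> p dvd m" "m > 0"
proof -
  have "p \<noteq> 1" using assms by auto
  with assms obtain m where "n = p ^ multiplicity p n * m" "\<not> p dvd m"
    using multiplicity_decompose'[of n p] by (metis neq0_conv not_prime_unit)
  moreover have "m > 0" using calculation assms by (cases "m = 0") auto
  ultimately show thesis by (rule that)
qed

text \<open>
  On the progression \<open>p ^ a * m\<close> with \<open>m\<close> prime to \<open>p\<close>, the recursion for \<open>F\<close> is the one of the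
  complete symmetric functions, so that Newton's identity applies with \<open>a\<close> the multiplicity of \<open>p\<close>.
\<close>
lemma local_newton:
  fixes F T :: "nat \<Rightarrow> real"
  assumes p: "prime p" and n: "n > 0"
    and F: "\<And>m. m > 0 \<Longrightarrow> F (p * m) = t * F m - d * (if p dvd m then F (m div p) else 0)"
    and T: "T 1 = t" "T 2 = t\<^sup>2 - 2 * d" "\<And>j. j \<ge> 1 \<Longrightarrow> T (j + 2) = t * T (j + 1) - d * T j"
  shows "real (multiplicity p n) * F n = (\<Sum>j=1..multiplicity p n. T j * F (n div p ^ j))"
proof -
  have p0: "p > 0" using p by (simp add: prime_gt_0_nat)
  obtain m where m: "n = p ^ multiplicity p n * m" "\<not> p dvd m" "m > 0"
    using prime_power_decompose[OF p n] .
  define U where "U = (\<lambda>a. F (p ^ a * m))"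
  have "real (multiplicity p n) * U (multiplicity p n) = (\<Sum>j=1..multiplicity p n. T j * U (multiplicity p n - j))"
  proof (rule newton_two_roots[OF _ _ T])
    show "U 1 = t * U 0" using F[of m] m by (simp add: U_def)
    show "U (a + 2) = t * U (a + 1) - d * U a" for a
      using F[of "p ^ (a + 1) * m"] m p0 by (simp add: U_def mult.assoc)
  qed
  also have "\<dots> = (\<Sum>j=1..multiplicity p n. T j * F (n div p ^ j))"
  proof (intro sum.cong refl arg_cong2[where f = "(*)"])
    fix j assume j: "j \<in> {1..multiplicity p n}"
    then have "p ^ multiplicity p n = p ^ j * p ^ (multiplicity p n - j)" by (simp flip: power_add)
    then have "n = p ^ j * (p ^ (multiplicity p n - j) * m)" using m(1) by (simp add: mult.assoc)
    then have "n div p ^ j = p ^ (multiplicity p n - j) * m"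
      using p0 by (metis nonzero_mult_div_cancel_left power_not_zero less_numeral_extra(3))
    then show "U (multiplicity p n - j) = F (n div p ^ j)" by (simp add: U_def)
  qed
  also have "U (multiplicity p n) = F n" using m(1) by (simp add: U_def)
  finally show ?thesis .
qed

text \<open>
  One form for the three types of primes: \<open>t\<close> and \<open>d\<close> are the sum and the product of the two
  reciprocal roots, one of which is 0 at the prime 2.
\<close>
lemma tau_recurrence:
  assumes p: "prime p"
  obtains t d where
    "\<And>m. m > 0 \<Longrightarrow> hecke k (p * m) = t * hecke k m - d * (if p dvd m then hecke k (m div p) else 0)"
    "tau k p 1 = t" "tau k p 2 = t\<^sup>2 - 2 * d" "\<And>j. j \<ge> 1 \<Longrightarrow> tau k p (j + 2) = t * tau k p (j + 1) - d * tau k p j"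
    "p = 2 \<Longrightarrow> t = (-1) ^ k \<and> d = 0" "p mod 4 = 3 \<Longrightarrow> t = 0 \<and> d = -1"
  using p
proof (cases rule: prime_mod_4_cases)
  case 1
  show ?thesis
    by (rule that[of "(-1) ^ k" 0]) (use 1 in \<open>auto simp: hecke_2 tau_def power_mult power_add power2_eq_square distrib_left\<close>)
next
  case 2
  note w = gprime[OF p 2]
  have p0: "p > 0" using p by (simp add: prime_gt_0_nat)
  define z where "z = sgn (gprime p) ^ (4 * k)"
  have "cmod z = 1" using gauss_pts_nonzero[OF w p0] by (simp add: z_def norm_power norm_sgn)
  then have zc: "z * cnj z = 1" by (simp add: complex_mult_cnj cmod_def)
  have p2: "p \<noteq> 2" using 2 by auto
  have tau: "tau k p j = 2 * Re (z ^ j)" for j using 2 p2 by (simp add: tau_def z_def power_mult)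
  have re_scale: "Re (x * of_real c) = c * Re x" for x :: complex and c by simp
  have rec: "Re (z ^ (j + 2)) = 2 * Re z * Re (z ^ (j + 1)) - Re (z ^ j)" for j
  proof -
    have "z ^ (j + 2) + z ^ j = z ^ (j + 2) + z ^ j * (z * cnj z)" by (simp add: zc)
    also have "\<dots> = z ^ (j + 1) * (z + cnj z)" by (simp add: algebra_simps)
    also have "z + cnj z = of_real (2 * Re z)" by (simp add: complex_eq_iff)
    finally have "Re (z ^ (j + 2) + z ^ j) = Re (z ^ (j + 1) * of_real (2 * Re z))" by simp
    then show ?thesis unfolding re_scale by simp
  qed
  show ?thesis
  proof (rule that[of "2 * Re z" 1])
    show "tau k p 2 = (2 * Re z)\<^sup>2 - 2 * 1" using rec[of 0] by (simp add: tau power2_eq_square numeral_2_eq_2)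
    show "tau k p (j + 2) = 2 * Re z * tau k p (j + 1) - 1 * tau k p j" for j
      unfolding tau rec by (simp add: algebra_simps)
  qed (use 2 in \<open>auto simp: hecke_prime_1_mod_4[OF p 2 w] z_def tau\<close>)
next
  case 3
  then have "p \<noteq> 2" by auto
  show ?thesis
    by (rule that[of 0 "-1"]) (use 3 \<open>p \<noteq> 2\<close> in \<open>auto simp: hecke_inert[OF p 3] tau_def\<close>)
qed

lemma multiplicity_hecke:
  assumes "prime p" "n > 0"
  shows "real (multiplicity p n) * hecke k n = (\<Sum>j=1..multiplicity p n. tau k p j * hecke k (n div p ^ j))"
  using assms(1)
proof (rule tau_recurrence[of p k])
  fix t d :: real
  assume "\<And>m. m > 0 \<Longrightarrow> hecke k (p * m) = t * hecke k m - d * (if p dvd m then hecke k (m div p) else 0)"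
    "tau k p 1 = t" "tau k p 2 = t\<^sup>2 - 2 * d" "\<And>j. j \<ge> 1 \<Longrightarrow> tau k p (j + 2) = t * tau k p (j + 1) - d * tau k p j"
  then show ?thesis by (rule local_newton[OF assms])
qed

text \<open>
  Minus the logarithmic derivative of the Hecke series has these coefficients.
\<close>
definition Lam :: "nat \<Rightarrow> nat \<Rightarrow> real" where
  "Lam k d = mangoldt d * tau k (aprimedivisor d) (multiplicity (aprimedivisor d) d)"

lemma Lam_prime_power: "prime p \<Longrightarrow> j > 0 \<Longrightarrow> Lam k (p ^ j) = ln p * tau k p j"
  by (simp add: Lam_def aprimedivisor_prime_power)

lemma Lam_eq_0: "\<not> primepow d \<Longrightarrow> Lam k d = 0"
  by (simp add: Lam_def mangoldt_def)

lemma sum_divisors_Lam: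
  fixes F :: "nat \<Rightarrow> real"
  assumes n: "n > 0"
  shows "(\<Sum>d | d dvd n. Lam k d * F (n div d)) =
    (\<Sum>p\<in>prime_factors n. ln p * (\<Sum>j=1..multiplicity p n. tau k p j * F (n div p ^ j)))"
proof -
  let ?A = "SIGMA p:prime_factors n. {0<..multiplicity p n}"
  have "(\<Sum>d | d dvd n. Lam k d * F (n div d)) = (\<Sum>d\<in>primepow_factors n. Lam k d * F (n div d))"
    using n by (intro sum.mono_neutral_right) (auto simp: primepow_factors_def intro: ccontr[of "primepow _"] Lam_eq_0)
  also have "primepow_factors n = (\<lambda>(p,k). p ^ k) ` ?A"
    using n by (subst primepow_factors_altdef) fast+
  also have "(\<Sum>d\<in>\<dots>. Lam k d * F (n div d)) = (\<Sum>(p,j)\<in>?A. Lam k (p ^ j) * F (n div p ^ j))"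
    by (subst sum.reindex)
       (auto simp: inj_on_def prime_power_inj'' prime_factors_multiplicity case_prod_unfold)
  also have "\<dots> = (\<Sum>p\<in>prime_factors n. \<Sum>j\<in>{0<..multiplicity p n}. Lam k (p ^ j) * F (n div p ^ j))"
    by (rule sum.Sigma [symmetric]) auto
  also have "\<dots> = (\<Sum>p\<in>prime_factors n. ln p * (\<Sum>j=1..multiplicity p n. tau k p j * F (n div p ^ j)))"
  proof (rule sum.cong)
    fix p assume "p \<in> prime_factors n"
    then have p: "prime p" by auto
    have "(\<Sum>j\<in>{0<..multiplicity p n}. Lam k (p ^ j) * F (n div p ^ j)) =
          (\<Sum>j=1..multiplicity p n. Lam k (p ^ j) * F (n div p ^ j))"
      by (intro sum.cong) auto
    also have "\<dots> = (\<Sum>j=1..multiplicity p n. ln p * (tau k p j * F (n div p ^ j)))"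
      using p by (intro sum.cong) (simp_all add: Lam_prime_power)
    finally show "(\<Sum>j\<in>{0<..multiplicity p n}. Lam k (p ^ j) * F (n div p ^ j)) =
      ln p * (\<Sum>j=1..multiplicity p n. tau k p j * F (n div p ^ j))" by (simp only: sum_distrib_left)
  qed simp
  finally show ?thesis .
qed

lemma ln_eq_sum_multiplicity:
  fixes n :: nat
  assumes "n > 0"
  shows "ln (real n) = (\<Sum>p\<in>prime_factors n. ln (real p) * real (multiplicity p n))"
proof -
  have "real n = (\<Prod>p\<in>prime_factors n. real p ^ multiplicity p n)"
    using prime_factorization_nat[of n] assms by (metis (no_types, lifting) of_nat_power of_nat_prod prod.cong)
  also have "ln \<dots> = (\<Sum>p\<in>prime_factors n. ln (real p ^ multiplicity p n))"
    by (intro ln_prod) (auto simp: prime_gt_0_nat dest!: in_prime_factors_imp_prime)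
  also have "\<dots> = (\<Sum>p\<in>prime_factors n. ln p * real (multiplicity p n))"
    by (intro sum.cong refl) (auto simp: ln_realpow prime_gt_0_nat dest!: in_prime_factors_imp_prime)
  finally show ?thesis .
qed

text \<open>
  The logarithm is additive over prime powers, and at each prime Newton's identity turns the
  multiplicity into a convolution with the power sums.
\<close>
lemma hecke_ln_eq_conv:
  assumes n: "n > 0"
  shows "hecke k n * ln n = (\<Sum>d | d dvd n. Lam k d * hecke k (n div d))"
proof -
  have "hecke k n * ln n = (\<Sum>p\<in>prime_factors n. ln p * (real (multiplicity p n) * hecke k n))"
    unfolding ln_eq_sum_multiplicity[OF n] sum_distrib_left by (intro sum.cong refl) simp
  also have "\<dots> = (\<Sum>p\<in>prime_factors n. ln p * (\<Sum>j=1..multiplicity p n. tau k p j * hecke k (n div p ^ j)))"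
    using n by (intro sum.cong refl arg_cong2[where f = "(*)"] multiplicity_hecke) auto
  finally show ?thesis using sum_divisors_Lam[OF n] by simp
qed

lemma tau_0: "tau 0 p j = (if p = 2 then 1 else if p mod 4 = 1 then 2 else if even j then 2 else 0)"
  by (simp add: tau_def)

lemma abs_tau_le: "\<bar>tau k p j\<bar> \<le> tau 0 p j"
  using Re_sgn_power_le[of "gprime p" "4 * k * j"] by (auto simp: tau_def power_abs)

lemma Lam_0_nonneg: "Lam 0 d \<ge> 0"
  by (simp add: Lam_def mangoldt_nonneg tau_0)

lemma abs_Lam_le: "\<bar>Lam k d\<bar> \<le> Lam 0 d"
  by (auto simp: Lam_def abs_mult mangoldt_nonneg intro!: mult_left_mono abs_tau_le)

lemma Lam_0_le: "Lam 0 d \<le> 2 * mangoldt d"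
proof -
  have "tau 0 p j \<le> 2" for p j by (simp add: tau_0)
  then have "Lam 0 d \<le> mangoldt d * 2" unfolding Lam_def
    by (intro mult_left_mono mangoldt_nonneg)
  then show ?thesis by simp
qed

text \<open>
  The inequality \<open>3 + 4 cos x + cos (2 x) = 2 (1 + cos x)\<^sup>2 \<ge> 0\<close>, prime power by prime power.
\<close>
lemma Lam_3_4_1: "3 * Lam 0 d + 4 * Lam k d + Lam (2 * k) d \<ge> 0"
proof -
  have *: "3 * tau 0 p j + 4 * tau k p j + tau (2 * k) p j \<ge> 0" if p: "p > 0" "p mod 4 = 1 \<Longrightarrow> prime p" for p j
  proof (cases "p \<noteq> 2 \<and> p mod 4 = 1")
    case True
    define z where "z = sgn (gprime p) ^ (4 * k * j)"
    have "gprime p \<in> gauss_pts p" using True that gprime by blast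
    then have "gprime p \<noteq> 0" using p gauss_pts_nonzero by blast
    then have "cmod z = 1" by (simp add: z_def norm_power norm_sgn)
    then have "(Re z)\<^sup>2 + (Im z)\<^sup>2 = 1" by (simp add: cmod_def)
    then have "Re (z\<^sup>2) = 2 * (Re z)\<^sup>2 - 1" by (simp add: power2_eq_square)
    moreover have "sgn (gprime p) ^ (4 * (2 * k) * j) = z\<^sup>2"
      unfolding z_def by (simp only: power_mult[symmetric] mult_ac)
    ultimately have "3 * tau 0 p j + 4 * tau k p j + tau (2 * k) p j = 4 * (1 + Re z)\<^sup>2"
      using True by (simp add: tau_def z_def power2_eq_square algebra_simps)
    then show ?thesis by simp
  next
    case False
    have "(-1::real) ^ (k * j) \<ge> -1" by (cases "even (k * j)") auto
    with False show ?thesis by (auto simp: tau_def mult.assoc)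
  qed
  show ?thesis
  proof (cases "primepow d")
    case True
    then have "prime (aprimedivisor d)"
      by (intro prime_aprimedivisor') (auto simp: primepow_def prime_gt_0_nat)
    then have "mangoldt d * (3 * tau 0 (aprimedivisor d) (multiplicity (aprimedivisor d) d) +
         4 * tau k (aprimedivisor d) (multiplicity (aprimedivisor d) d) +
         tau (2 * k) (aprimedivisor d) (multiplicity (aprimedivisor d) d)) \<ge> (0::real)"
      by (intro mult_nonneg_nonneg mangoldt_nonneg *) (auto simp: prime_gt_0_nat)
    then show ?thesis by (simp add: Lam_def algebra_simps)
  qed (simp add: Lam_eq_0)
qed

section \<open>Summation by parts and Chebyshev's bound\<close>

lemma sum_dirichlet_conv:
  fixes a b :: "nat \<Rightarrow> real"
  shows "(\<Sum>n=1..x. \<Sum>d | d dvd n. a d * b (n div d)) = (\<Sum>d=1..x. a d * (\<Sum>m=1..x div d. b m))"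
proof -
  have fin: "finite {d. d dvd n}" if "n \<in> {1..x}" for n :: nat using that by simp
  have "(\<Sum>n=1..x. \<Sum>d | d dvd n. a d * b (n div d)) = (\<Sum>(n,d)\<in>(SIGMA n:{1..x}. {d. d dvd n}). a d * b (n div d))"
    by (rule sum.Sigma) (use fin in auto)
  also have "\<dots> = (\<Sum>(d,m)\<in>(SIGMA d:{1..x}. {1..x div d}). a d * b m)"
  proof (rule sum.reindex_bij_witness[where j = "\<lambda>(n,d). (d, n div d)" and i = "\<lambda>(d,m). (d * m, d)"])
    fix q assume q: "q \<in> (SIGMA n:{1..x}. {d. d dvd n})"
    then obtain n d where nd: "q = (n, d)" "1 \<le> n" "n \<le> x" "d dvd n" by auto
    then have "d \<le> n" by (simp add: dvd_imp_le)
    moreover have "d > 0" using nd by (cases "d = 0") auto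
    moreover have "n div d > 0" using nd \<open>d \<le> n\<close> \<open>d > 0\<close> by (simp add: div_greater_zero_iff)
    ultimately show "(case q of (n, d) \<Rightarrow> (d, n div d)) \<in> (SIGMA d:{1..x}. {1..x div d})"
      using nd by (auto intro: div_le_mono)
  next
    fix q assume "q \<in> (SIGMA d:{1..x}. {1..x div d})"
    then obtain d m where dm: "q = (d, m)" "1 \<le> d" "d \<le> x" "1 \<le> m" "m \<le> x div d" by auto
    then have "m * d \<le> x" by (simp add: less_eq_div_iff_mult_less_eq)
    then show "(case q of (d, m) \<Rightarrow> (d * m, d)) \<in> (SIGMA n:{1..x}. {d. d dvd n})"
      using dm by (auto simp: mult.commute)
  qed auto
  also have "\<dots> = (\<Sum>d=1..x. \<Sum>m=1..x div d. a d * b m)"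
    by (rule sum.Sigma[symmetric]) auto
  finally show ?thesis by (simp add: sum_distrib_left)
qed

lemma abel_summation:
  fixes a w :: "nat \<Rightarrow> real"
  shows "(\<Sum>n=1..x. a n * w n) =
    (\<Sum>n=1..x. a n) * w (Suc x) + (\<Sum>n=1..x. (\<Sum>m=1..n. a m) * (w n - w (Suc n)))"
  by (induction x) (auto simp: algebra_simps)

text \<open>
  For decreasing weights, partial sums bounded by \<open>C * n\<close> may be replaced by those of the constant
  sequence \<open>C\<close>.
\<close>
lemma sum_weighted_le:
  fixes a w :: "nat \<Rightarrow> real"
  assumes A: "\<And>n. (\<Sum>m=1..n. a m) \<le> C * n" and w: "\<And>n. n \<ge> 1 \<Longrightarrow> w (Suc n) \<le> w n" "\<And>n. n \<ge> 1 \<Longrightarrow> w n \<ge> 0"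
  shows "(\<Sum>n=1..x. a n * w n) \<le> C * (\<Sum>n=1..x. w n)"
proof -
  have "(\<Sum>n=1..x. a n * w n) \<le> (C * x) * w (Suc x) + (\<Sum>n=1..x. (C * n) * (w n - w (Suc n)))"
    unfolding abel_summation[of a w]
    by (intro add_mono sum_mono mult_right_mono A w) (use w in auto)
  also have "\<dots> = C * ((\<Sum>n=1..x. 1) * w (Suc x) + (\<Sum>n=1..x. (\<Sum>m=1..n. 1) * (w n - w (Suc n))))"
    by (simp add: sum_distrib_left algebra_simps)
  also have "\<dots> = C * (\<Sum>n=1..x. w n)" using abel_summation[of "\<lambda>_. 1" w x] by simp
  finally show ?thesis .
qed

lemma inverse_sqrt_diff:
  assumes "n \<ge> (1::nat)"
  shows "1 / (sqrt n * (n + 1)) \<le> 2 * (1 / sqrt n - 1 / sqrt (n + 1))"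
proof -
  define s where "s = sqrt n"
  define t where "t = sqrt (real n + 1)"
  have st: "s > 0" "s < t" using assms by (auto simp: s_def t_def)
  have sq: "t * t = real n + 1" "s * s = real n" by (auto simp: s_def t_def)
  have "t * t - s * s = 1" using sq by simp
  then have e: "(t - s) * (t + s) = 1" by (simp add: algebra_simps)
  have "1 = (t - s) * (t + s)" using e by simp
  also have "\<dots> \<le> (t - s) * (2 * t)" using st by (intro mult_left_mono) auto
  finally have "1 / (s * (t * t)) \<le> ((t - s) * (2 * t)) / (s * (t * t))"
    using st by (intro divide_right_mono) auto
  also have "\<dots> = 2 * (1 / s - 1 / t)" using st by (simp add: field_simps)
  finally show ?thesis unfolding sq by (simp add: s_def t_def add.commute)
qed

lemma sum_inverse_sqrt_le: "(\<Sum>n=1..x. 1 / sqrt (real n)) \<le> 2 * sqrt x"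
proof (induction x)
  case (Suc x)
  define s where "s = sqrt x"
  define t where "t = sqrt (real (Suc x))"
  have st: "s \<ge> 0" "s < t" by (auto simp: s_def t_def)
  have "t * t - s * s = 1" by (auto simp: s_def t_def)
  then have e: "(t - s) * (t + s) = 1" by (simp add: algebra_simps)
  have "1 = (t - s) * (t + s)" using e by simp
  also have "\<dots> \<le> (t - s) * (2 * t)" using st by (intro mult_left_mono) auto
  finally have "1 / t \<le> ((t - s) * (2 * t)) / t" using st by (intro divide_right_mono) auto
  then have "1 / t \<le> 2 * t - 2 * s" using st by simp
  then show ?case using Suc by (simp add: s_def t_def)
qed simp

text \<open>
  Each term is at most \<open>4 * (n powr (1/4) - (n - 1) powr (1/4))\<close>.
\<close>
lemma sum_powr_34_le: "(\<Sum>n=1..x. real n powr (- 3 / 4)) \<le> 4 * real x powr (1 / 4)"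
proof (induction x)
  case (Suc x)
  define s where "s = real x powr (1/4)"
  define t where "t = real (Suc x) powr (1/4)"
  have st: "s \<ge> 0" "s \<le> t" by (auto simp: s_def t_def intro: powr_mono2)
  have t0: "t > 0" by (simp add: t_def)
  have t4: "t ^ 4 = real (Suc x)" by (simp add: t_def powr_powr flip: powr_realpow)
  have s4: "s ^ 4 = real x" by (cases "x = 0") (simp_all add: s_def powr_powr flip: powr_realpow)
  have "t ^ 4 - s ^ 4 = (t - s) * (t ^ 3 + t ^ 2 * s + t * s ^ 2 + s ^ 3)"
    by (simp add: algebra_simps power4_eq_xxxx power3_eq_cube power2_eq_square)
  then have "1 = (t - s) * (t ^ 3 + t ^ 2 * s + t * s ^ 2 + s ^ 3)" by (simp add: t4 s4)
  also have "\<dots> \<le> (t - s) * (t ^ 3 + t ^ 2 * t + t * t ^ 2 + t ^ 3)"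
    using st t0 by (intro mult_left_mono add_mono power_mono) auto
  also have "\<dots> = (t - s) * (4 * t ^ 3)" by (simp add: algebra_simps power3_eq_cube power2_eq_square)
  finally have "1 / t ^ 3 \<le> 4 * t - 4 * s" using t0 by (simp add: field_simps)
  moreover have "real (Suc x) powr (-3/4) = 1 / t ^ 3"
    by (simp add: t_def powr_powr powr_minus_divide flip: powr_realpow)
  ultimately show ?case using Suc by (simp add: s_def t_def)
qed simp

lemma sum_inverse_n_sqrt_le: "(\<Sum>n=1..x. 1 / (real n * sqrt (real n))) \<le> 4"
proof -
  have "(\<Sum>n=1..x. 1 / (real n * sqrt (real n))) \<le> 4 - 4 / sqrt (real (Suc x))"
  proof (induction x)
    case (Suc x)
    define a where "a = real (Suc x)"
    have a: "a \<ge> 1" "sqrt a > 0" by (auto simp: a_def)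
    have "sqrt a * (a + 1) \<le> sqrt a * (2 * a)" using a by (intro mult_left_mono) auto
    then have "2 / (sqrt a * (2 * a)) \<le> 2 / (sqrt a * (a + 1))" using a by (intro divide_left_mono) auto
    moreover have "2 / (sqrt a * (2 * a)) = 1 / (a * sqrt a)" using a by (simp add: field_simps)
    ultimately have "1 / (a * sqrt a) \<le> 2 * (1 / (sqrt a * (a + 1)))" by simp
    then have "1 / (real (Suc x) * sqrt (real (Suc x))) \<le> 2 * (1 / (sqrt (Suc x) * (Suc x + 1)))"
      by (simp add: a_def)
    also have "\<dots> \<le> 2 * (2 * (1 / sqrt (Suc x) - 1 / sqrt (Suc x + 1)))"
      by (intro mult_left_mono inverse_sqrt_diff) auto
    finally show ?case using Suc by (simp add: add.commute)
  qed simp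
  also have "\<dots> \<le> 4" by simp
  finally show ?thesis .
qed

lemma real_div_bounds:
  assumes "d \<ge> 1" "d \<le> (x::nat)"
  shows "real (x div d) \<le> real x / real d" "real x / real d - 1 < real (x div d)"
    "real x / (2 * real d) \<le> real (x div d)" "x div d \<ge> 1"
proof -
  have e: "real x / real d = real (x div d) + real (x mod d) / real d"
  proof -
    have "real x = real (d * (x div d) + x mod d)" by simp
    also have "\<dots> = real d * real (x div d) + real (x mod d)" by (simp only: of_nat_add of_nat_mult)
    finally show ?thesis using assms by (simp add: field_simps)
  qed
  show "real (x div d) \<le> real x / real d" unfolding e by simp
  have "x mod d < d" using assms by simp
  then show l: "real x / real d - 1 < real (x div d)"
    unfolding e using assms by simp
  show g: "x div d \<ge> 1" using assms by (simp add: Suc_le_eq div_greater_zero_iff)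
  show "real x / (2 * real d) \<le> real (x div d)" using l g by (simp add: field_simps)
qed

lemma sum_mangoldt_floor:
  "(\<Sum>d=1..x. mangoldt d * real (x div d)) = ln (fact x)"
proof -
  have "(\<Sum>d=1..x. mangoldt d * real (x div d)) = (\<Sum>d=1..x. mangoldt d * (\<Sum>m=1..x div d. 1))" by simp
  also have "\<dots> = (\<Sum>n=1..x. \<Sum>d | d dvd n. mangoldt d * 1)"
    by (rule sum_dirichlet_conv[symmetric])
  also have "\<dots> = (\<Sum>n=1..x. ln (real n))"
    by (intro sum.cong) (simp_all add: mangoldt_sum)
  also have "\<dots> = ln (fact x)"
  proof (induction x)
    case (Suc x)
    have "ln (fact (Suc x)) = ln (real (Suc x)) + ln (fact x)" by (simp add: ln_mult del: of_nat_Suc)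
    with Suc show ?case by simp
  qed simp
  finally show ?thesis .
qed

text \<open>
  Compare the prime factorisations of \<open>(2 * n)!\<close> and \<open>(n!)\<^sup>2\<close>: every prime power in \<open>(n, 2 * n]\<close>
  contributes to \<open>2 * n choose n\<close>, which is at most \<open>4 ^ n\<close>.
\<close>
lemma chebyshev_doubling:
  "(\<Sum>d=1..2*n. mangoldt d) \<le> (\<Sum>d=1..n. mangoldt d) + 2 * real n * ln 2"
proof -
  have div: "real (2 * n div d) - 2 * real (n div d) \<ge> (if d > n then 1 else 0)" if "d \<in> {1..2*n}" for d
  proof (cases "d > n")
    case True
    then have "n div d = 0" "2 * n div d \<ge> 1" using that by (auto simp: Suc_le_eq div_greater_zero_iff)
    with True show ?thesis by simp
  next
    case False
    have "2 * (n div d) * d \<le> 2 * n" by simp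
    then have "2 * (n div d) \<le> 2 * n div d" using that by (simp add: less_eq_div_iff_mult_less_eq)
    then have "real (2 * (n div d)) \<le> real (2 * n div d)" by (simp only: of_nat_le_iff)
    with False show ?thesis by simp
  qed
  have split: "{1..2*n} = {1..n} \<union> {n+1..2*n}" by auto
  have "(\<Sum>d=1..2*n. mangoldt d) - (\<Sum>d=1..n. mangoldt d) = (\<Sum>d=n+1..2*n. mangoldt d :: real)"
    unfolding split by (subst sum.union_disjoint) auto
  also have "\<dots> = (\<Sum>d=n+1..2*n. mangoldt d * (if d > n then 1 else 0))" by (intro sum.cong) auto
  also have "\<dots> \<le> (\<Sum>d=1..2*n. mangoldt d * (if d > n then 1 else 0))"
    by (intro sum_mono2) (auto simp: mangoldt_nonneg)
  also have "\<dots> \<le> (\<Sum>d=1..2*n. mangoldt d * (real (2 * n div d) - 2 * real (n div d)))"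
    by (intro sum_mono mult_left_mono mangoldt_nonneg div)
  also have "\<dots> = (\<Sum>d=1..2*n. mangoldt d * real (2 * n div d)) - 2 * (\<Sum>d=1..2*n. mangoldt d * real (n div d))"
    by (simp add: sum_subtractf sum_distrib_left algebra_simps)
  also have "(\<Sum>d=1..2*n. mangoldt d * real (n div d)) = (\<Sum>d=1..n. mangoldt d * real (n div d))"
    by (rule sum.mono_neutral_right) auto
  also have "(\<Sum>d=1..2*n. mangoldt d * real (2 * n div d)) - 2 * (\<Sum>d=1..n. mangoldt d * real (n div d)) =
      ln (fact (2 * n)) - 2 * ln (fact n)" by (simp only: sum_mangoldt_floor)
  also have "\<dots> = ln (fact (2 * n) / (fact n * fact n))" by (simp add: ln_div ln_mult)
  also have "fact (2 * n) / (fact n * fact n) = real (2 * n choose n)"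
    by (simp add: binomial_fact flip: mult_2)
  also have "ln (real (2 * n choose n)) \<le> ln (2 ^ (2 * n))"
  proof -
    have "2 * n choose n \<le> 2 ^ (2 * n)" by (rule binomial_le_pow2)
    then have "real (2 * n choose n) \<le> 2 ^ (2 * n)" by (metis of_nat_le_iff of_nat_numeral of_nat_power)
    then show ?thesis by (subst ln_le_cancel_iff) auto
  qed
  also have "\<dots> = 2 * real n * ln 2" by (simp add: ln_realpow)
  finally show ?thesis by simp
qed

text \<open>
  Sum the doubling inequality over \<open>x, x / 2, x / 4\<close> and so on.
\<close>
lemma chebyshev_upper: "(\<Sum>d=1..x. mangoldt d) \<le> 4 * real x"
proof (induction x rule: less_induct)
  case (less x)
  have ln2: "ln (2::real) \<le> 1" using ln_le_minus_one[of "2::real"] by simp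
  have even: "(\<Sum>d=1..2*n. mangoldt d) \<le> 6 * real n" if "2 * n \<le> x" "n \<ge> 1" for n
  proof -
    have "(\<Sum>d=1..2*n. mangoldt d) \<le> 4 * real n + 2 * real n * ln 2"
      using chebyshev_doubling[of n] less[of n] that by simp
    also have "\<dots> \<le> 4 * real n + 2 * real n * 1" using ln2 by (intro add_left_mono mult_left_mono) auto
    finally show ?thesis by simp
  qed
  consider "x = 0" | "x = 1" | n where "n \<ge> 1" "x = 2 * n" | n where "n \<ge> 1" "x = 2 * n + 1"
    by (metis One_nat_def Suc_eq_plus1 evenE gr0_conv_Suc not_gr_zero oddE le_add1 plus_1_eq_Suc mult_0_right)
  then show ?case
  proof cases
    case 3
    with even[of n] show ?thesis by simp
  next
    case 4
    have "mangoldt x \<le> ln x" using 4 by (intro mangoldt_le) auto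
    also have "\<dots> \<le> 2 * real n" using ln_le_minus_one[of "real x"] 4 by simp
    finally show ?thesis using even[of n] 4 by simp
  qed auto
qed

lemma sum_Lam_0_le: "(\<Sum>d=1..x. Lam 0 d) \<le> 8 * real x"
proof -
  have "(\<Sum>d=1..x. Lam 0 d) \<le> (\<Sum>d=1..x. 2 * mangoldt d)" by (intro sum_mono Lam_0_le)
  also have "\<dots> = 2 * (\<Sum>d=1..x. mangoldt d)" by (simp add: sum_distrib_left)
  also have "\<dots> \<le> 2 * (4 * real x)" by (intro mult_left_mono chebyshev_upper) auto
  finally show ?thesis by simp
qed

section \<open>Lattice points in discs\<close>

definition gauss_disc :: "real \<Rightarrow> complex set" where "gauss_disc r = {z \<in> gauss_ints. cmod z \<le> r}"

lemma gauss_disc_eq_UN: "gauss_disc (sqrt (real x)) = (\<Union>n\<in>{0..x}. gauss_pts n)"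
proof (intro equalityI subsetI)
  fix z assume z: "z \<in> gauss_disc (sqrt (real x))"
  then have zi: "z \<in> gauss_ints" and le: "cmod z \<le> sqrt (real x)" by (auto simp: gauss_disc_def)
  from zi obtain a b where ab: "z = Complex (of_int a) (of_int b)" by (rule gauss_ints_E)
  define n where "n = nat (a\<^sup>2 + b\<^sup>2)"
  have n: "a\<^sup>2 + b\<^sup>2 = int n" by (simp add: n_def)
  then have zn: "z \<in> gauss_pts n" by (simp add: ab Complex_gauss_pts_iff)
  have "real n = (cmod z)\<^sup>2" using zn by (simp add: gauss_pts_def)
  also have "\<dots> \<le> (sqrt (real x))\<^sup>2" using le by (intro power_mono) auto
  finally have "n \<le> x" by simp
  with zn show "z \<in> (\<Union>n\<in>{0..x}. gauss_pts n)" by auto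
next
  fix z assume "z \<in> (\<Union>n\<in>{0..x}. gauss_pts n)"
  then obtain n where "n \<le> x" "z \<in> gauss_pts n" by auto
  then show "z \<in> gauss_disc (sqrt (real x))"
    by (auto simp: gauss_pts_def gauss_disc_def intro: real_le_rsqrt)
qed

lemma finite_gauss_disc [simp]: "finite (gauss_disc r)"
proof -
  have "gauss_disc r \<subseteq> gauss_disc (sqrt (real (nat \<lceil>r\<^sup>2\<rceil>)))"
  proof
    fix z assume "z \<in> gauss_disc r"
    then have z: "z \<in> gauss_ints" "cmod z \<le> r" by (auto simp: gauss_disc_def)
    have "r\<^sup>2 \<le> real (nat \<lceil>r\<^sup>2\<rceil>)" by (rule real_nat_ceiling_ge)
    then have "r \<le> sqrt (real (nat \<lceil>r\<^sup>2\<rceil>))" by (rule real_le_rsqrt)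
    with z show "z \<in> gauss_disc (sqrt (real (nat \<lceil>r\<^sup>2\<rceil>)))" by (auto simp: gauss_disc_def)
  qed
  then show ?thesis unfolding gauss_disc_eq_UN by (rule finite_subset) auto
qed

lemma gauss_pts_disjoint: "m \<noteq> n \<Longrightarrow> gauss_pts m \<inter> gauss_pts n = {}"
  by (auto simp: gauss_pts_def)

lemma sum_gauss_disc: "(\<Sum>z\<in>gauss_disc (sqrt (real x)). f z) = f 0 + (\<Sum>n=1..x. \<Sum>z\<in>gauss_pts n. f z)"
proof -
  have g0: "gauss_pts 0 = {0}" by (auto simp: gauss_pts_def)
  have "(\<Sum>z\<in>gauss_disc (sqrt (real x)). f z) = (\<Sum>n\<in>{0..x}. \<Sum>z\<in>gauss_pts n. f z)"
    unfolding gauss_disc_eq_UN by (rule sum.UNION_disjoint) (auto simp: gauss_pts_disjoint)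
  also have "\<dots> = (\<Sum>z\<in>gauss_pts 0. f z) + (\<Sum>n\<in>{1..x}. \<Sum>z\<in>gauss_pts n. f z)"
    by (simp add: sum.atLeast_Suc_atMost)
  finally show ?thesis by (simp add: g0)
qed

lemma content_complex_cbox: "measure lborel (cbox (Complex a b) (Complex (a + 1) (b + 1))) = 1"
  "measure lborel (box (Complex a b) (Complex (a + 1) (b + 1))) = 1"
  by (simp_all add: measure_lborel_cbox_eq measure_lborel_box_eq Basis_complex_def inner_complex_def)

text \<open>
  Unit squares centred at the lattice points of the disc: the open squares are disjoint and lie in
  the disc of radius \<open>r + 1\<close>, and the closed ones cover the disc of radius \<open>r - 1\<close>.
\<close>
lemma card_gauss_disc_bounds:
  assumes r: "r \<ge> 1"
  shows "pi * (r - 1)\<^sup>2 \<le> real (card (gauss_disc r))" "real (card (gauss_disc r)) \<le> pi * (r + 1)\<^sup>2"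
proof -
  define h :: real where "h = 1 / 2"
  define Q where "Q = (\<lambda>z. box (Complex (Re z - h) (Im z - h)) (Complex (Re z - h + 1) (Im z - h + 1)))"
  define Q' where "Q' = (\<lambda>z. cbox (Complex (Re z - h) (Im z - h)) (Complex (Re z - h + 1) (Im z - h + 1)))"
  have sQ: "Q z \<in> lmeasurable" "Q' z \<in> lmeasurable" for z by (auto simp: Q_def Q'_def)
  have mQ: "measure lborel (Q z) = 1" "measure lborel (Q' z) = 1" for z
    unfolding Q_def Q'_def by (rule content_complex_cbox)+
  have mQ': "measure lebesgue (Q z) = 1" "measure lebesgue (Q' z) = 1" for z
    using mQ by (simp_all add: Q_def Q'_def measure_completion)
  have near: "cmod (w - z) \<le> 1" if "\<bar>Re w - Re z\<bar> \<le> h" "\<bar>Im w - Im z\<bar> \<le> h" for w z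
    using cmod_le[of "w - z"] that by (simp add: h_def)
  have vol: "measure lebesgue (cball (0::complex) s) = pi * s\<^sup>2" if "s \<ge> 0" for s
    using content_cball[OF that, of "0::complex"] by (simp add: measure_completion unit_ball_vol_2)
  have disj: "disjoint_family_on Q (gauss_disc r)"
    unfolding disjoint_family_on_def
  proof (intro ballI impI)
    fix z w assume zw: "z \<in> gauss_disc r" "w \<in> gauss_disc r" "z \<noteq> w"
    then obtain a b c d where ab: "z = Complex (of_int a) (of_int b)" "w = Complex (of_int c) (of_int d)"
      by (auto simp: gauss_disc_def elim!: gauss_ints_E)
    show "Q z \<inter> Q w = {}"
    proof (rule ccontr)
      assume "Q z \<inter> Q w \<noteq> {}"
      then obtain v where "v \<in> Q z" "v \<in> Q w" by auto
      then have "\<bar>real_of_int a - real_of_int c\<bar> < 1" "\<bar>real_of_int b - real_of_int d\<bar> < 1"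
        by (auto simp: Q_def in_box_complex_iff ab h_def)
      then have "a = c" "b = d" by linarith+
      with zw(3) ab show False by simp
    qed
  qed
  have "real (card (gauss_disc r)) = (\<Sum>z\<in>gauss_disc r. measure lebesgue (Q z))" by (simp add: mQ')
  also have "\<dots> = measure lebesgue (\<Union>z\<in>gauss_disc r. Q z)"
  proof (rule measure_finite_Union[symmetric, OF finite_gauss_disc _ disj])
    show "Q ` gauss_disc r \<subseteq> sets lebesgue" using fmeasurableD[OF sQ(1)] by blast
    show "emeasure lebesgue (Q z) \<noteq> \<infinity>" for z
      unfolding infinity_ennreal_def by (rule fmeasurableD2[OF sQ(1)])
  qed
  also have "\<dots> \<le> measure lebesgue (cball (0::complex) (r + 1))"
  proof (rule measure_mono_fmeasurable)
    show "(\<Union>z\<in>gauss_disc r. Q z) \<subseteq> cball 0 (r + 1)"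
    proof
      fix v assume "v \<in> (\<Union>z\<in>gauss_disc r. Q z)"
      then obtain z where z: "z \<in> gauss_disc r" "v \<in> Q z" by auto
      then have "cmod (v - z) \<le> 1" by (intro near; unfold abs_le_iff) (auto simp: Q_def in_box_complex_iff h_def)
      moreover have "cmod z \<le> r" using z by (simp add: gauss_disc_def)
      moreover have "cmod v \<le> cmod (v - z) + cmod z" using norm_triangle_ineq[of "v - z" z] by simp
      ultimately show "v \<in> cball 0 (r + 1)" by simp
    qed
  qed (use sQ in auto)
  also have "\<dots> = pi * (r + 1)\<^sup>2" using r by (intro vol) auto
  finally show "real (card (gauss_disc r)) \<le> pi * (r + 1)\<^sup>2" .
  have "pi * (r - 1)\<^sup>2 = measure lebesgue (cball (0::complex) (r - 1))" using r by (intro vol[symmetric]) auto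
  also have "\<dots> \<le> measure lebesgue (\<Union>z\<in>gauss_disc r. Q' z)"
  proof (rule measure_mono_fmeasurable)
    show "cball 0 (r - 1) \<subseteq> (\<Union>z\<in>gauss_disc r. Q' z)"
    proof
      fix v :: complex assume v: "v \<in> cball 0 (r - 1)"
      define z where "z = Complex (of_int (round (Re v))) (of_int (round (Im v)))"
      have d: "\<bar>Re z - Re v\<bar> \<le> h" "\<bar>Im z - Im v\<bar> \<le> h"
        using of_int_round_abs_le[of "Re v"] of_int_round_abs_le[of "Im v"] by (auto simp: z_def h_def)
      then have "cmod (z - v) \<le> 1" by (rule near)
      moreover have "cmod z \<le> cmod (z - v) + cmod v" using norm_triangle_ineq[of "z - v" v] by simp
      ultimately have "z \<in> gauss_disc r" using v by (auto simp: gauss_disc_def z_def)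
      moreover have "v \<in> Q' z" 
        unfolding Q'_def in_cbox_complex_iff complex.sel atLeastAtMost_iff using d h_def by (intro conjI; linarith)
      ultimately show "v \<in> (\<Union>z\<in>gauss_disc r. Q' z)" by blast
    qed
  qed (use sQ in auto)
  also have "\<dots> \<le> (\<Sum>z\<in>gauss_disc r. measure lebesgue (Q' z))"
    by (rule measure_UNION_le) (use sQ in \<open>auto simp: fmeasurableD\<close>)
  also have "\<dots> = real (card (gauss_disc r))" by (simp add: mQ')
  finally show "pi * (r - 1)\<^sup>2 \<le> real (card (gauss_disc r))" .
qed

lemma card_gauss_disc_sqrt: "real (card (gauss_disc (sqrt (real x)))) = 1 + 4 * (\<Sum>n=1..x. hecke 0 n)"
  using sum_gauss_disc[of "\<lambda>_. 1 :: real" x] by (simp add: hecke_0 card_gauss_pts sum_distrib_left)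

lemma sum_hecke_0_asymp:
  assumes "x \<ge> 1"
  shows "\<bar>(\<Sum>n=1..x. hecke 0 n) - pi / 4 * real x\<bar> \<le> 4 * sqrt (real x)"
proof -
  define r where "r = sqrt (real x)"
  have r: "r \<ge> 1" "r\<^sup>2 = real x" using assms by (auto simp: r_def)
  define T where "T = (\<Sum>n=1..x. hecke 0 n)"
  have c: "real (card (gauss_disc r)) = 1 + 4 * T" unfolding r_def T_def by (rule card_gauss_disc_sqrt)
  have "pi * (r - 1)\<^sup>2 \<le> 1 + 4 * T" "1 + 4 * T \<le> pi * (r + 1)\<^sup>2"
    using card_gauss_disc_bounds[OF r(1)] by (simp_all only: c)
  then have b: "pi * r\<^sup>2 - 2 * (pi * r) + pi \<le> 1 + 4 * T" "1 + 4 * T \<le> pi * r\<^sup>2 + 2 * (pi * r) + pi"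
    by (simp_all add: power2_eq_square algebra_simps)
  have "pi * r \<le> 4 * r" using r pi_less_4 by (intro mult_right_mono) auto
  moreover have "pi < 4" "pi > 1" using pi_less_4 pi_gt3 by auto
  ultimately have "\<bar>4 * T - pi * r\<^sup>2\<bar> \<le> 16 * r" using b r by linarith
  then show ?thesis unfolding T_def r(2)[symmetric] by (simp add: r_def)
qed

lemma sum_hecke_0_le: "(\<Sum>n=1..x. hecke 0 n) \<le> 5 * real x"
proof (cases "x \<ge> 1")
  case True
  have "sqrt (real x) \<le> real x" using True by (simp add: real_le_lsqrt power2_eq_square)
  moreover have "pi / 4 * real x \<le> 1 * real x" using pi_less_4 by (intro mult_right_mono) auto
  ultimately show ?thesis using sum_hecke_0_asymp[OF True] by linarith
qed simp

section \<open>Cancellation in angular sums\<close>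

text \<open>
  The direction varies slowly far from the origin.
\<close>
lemma norm_sgn_diff_le:
  fixes x y :: complex
  assumes "y \<noteq> 0"
  shows "cmod (sgn x - sgn y) \<le> 2 * cmod (x - y) / cmod y"
proof (cases "x = 0")
  case False
  have "sgn x - sgn y = (x - y) / of_real (cmod y) + x * of_real (1 / cmod x - 1 / cmod y)"
    using assms False by (simp add: sgn_eq field_simps)
  then have "cmod (sgn x - sgn y) \<le> cmod ((x - y) / of_real (cmod y)) + cmod (x * of_real (1 / cmod x - 1 / cmod y))"
    by (metis norm_triangle_ineq)
  also have "cmod ((x - y) / of_real (cmod y)) = cmod (x - y) / cmod y" by (simp add: norm_divide)
  also have "cmod (x * of_real (1 / cmod x - 1 / cmod y)) = \<bar>cmod y - cmod x\<bar> / cmod y"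
  proof -
    have e: "1 / cmod x - 1 / cmod y = (cmod y - cmod x) / (cmod x * cmod y)"
      using assms False by (simp add: field_simps)
    show ?thesis unfolding e norm_mult norm_of_real using assms False by (simp add: abs_mult abs_divide)
  qed
  also have "\<dots> \<le> cmod (x - y) / cmod y"
    by (intro divide_right_mono) (auto simp: norm_triangle_ineq3 norm_minus_commute abs_minus_commute)
  finally show ?thesis by simp
qed (use assms in \<open>simp add: norm_sgn\<close>)

lemma norm_sgn_power_diff_le:
  fixes x y :: complex
  assumes "y \<noteq> 0"
  shows "cmod (sgn x ^ m - sgn y ^ m) \<le> real m * (2 * cmod (x - y) / cmod y)"
proof -
  have "cmod (sgn x ^ m - sgn y ^ m) \<le> real m * cmod (sgn x - sgn y)"
    by (rule norm_power_diff) (auto simp: norm_sgn)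
  also have "\<dots> \<le> real m * (2 * cmod (x - y) / cmod y)"
    by (intro mult_left_mono norm_sgn_diff_le assms) auto
  finally show ?thesis .
qed

lemma sum_gauss_disc_inverse_norm_le:
  "(\<Sum>u\<in>gauss_disc (sqrt (real x)). 1 / cmod u) \<le> 40 * sqrt (real x)"
proof -
  have "(\<Sum>u\<in>gauss_disc (sqrt (real x)). 1 / cmod u) = (\<Sum>n=1..x. \<Sum>z\<in>gauss_pts n. 1 / cmod z)"
    unfolding sum_gauss_disc by simp
  also have "\<dots> = (\<Sum>n=1..x. (4 * hecke 0 n) * (1 / sqrt (real n)))"
  proof (intro sum.cong refl)
    fix n
    have "(\<Sum>z\<in>gauss_pts n. 1 / cmod z) = (\<Sum>z\<in>gauss_pts n. 1 / sqrt (real n))"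
    proof (intro sum.cong refl)
      fix z assume "z \<in> gauss_pts n"
      then have "cmod z = sqrt (real n)" by (metis (mono_tags, lifting) gauss_pts_def mem_Collect_eq norm_ge_zero real_sqrt_unique)
      then show "1 / cmod z = 1 / sqrt (real n)" by simp
    qed
    then show "(\<Sum>z\<in>gauss_pts n. 1 / cmod z) = (4 * hecke 0 n) * (1 / sqrt (real n))" by (simp add: hecke_0 card_gauss_pts)
  qed
  also have "\<dots> \<le> 20 * (\<Sum>n=1..x. 1 / sqrt (real n))"
  proof (rule sum_weighted_le)
    show "(\<Sum>m=1..n. 4 * hecke 0 m) \<le> 20 * real n" for n
      using sum_hecke_0_le[of n] by (simp flip: sum_distrib_left)
  qed (auto intro!: divide_left_mono)
  also have "\<dots> \<le> 20 * (2 * sqrt x)" by (intro mult_left_mono sum_inverse_sqrt_le) auto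
  finally show ?thesis by simp
qed

lemma card_annulus_le:
  assumes "s \<ge> 5"
  shows "real (card (gauss_disc (s + 4) - gauss_disc (s - 4))) \<le> 80 * s"
proof -
  have sub: "gauss_disc (s - 4) \<subseteq> gauss_disc (s + 4)" by (auto simp: gauss_disc_def)
  have "card (gauss_disc (s - 4)) \<le> card (gauss_disc (s + 4))" by (rule card_mono[OF finite_gauss_disc sub])
  then have "real (card (gauss_disc (s + 4) - gauss_disc (s - 4))) = real (card (gauss_disc (s + 4))) - real (card (gauss_disc (s - 4)))"
    using sub by (simp add: card_Diff_subset of_nat_diff)
  also have "\<dots> \<le> pi * (s + 4 + 1)\<^sup>2 - pi * (s - 4 - 1)\<^sup>2"
    using assms by (intro diff_mono card_gauss_disc_bounds) auto
  also have "\<dots> = pi * (20 * s)" by (simp add: power2_eq_square algebra_simps)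
  also have "\<dots> \<le> 4 * (20 * s)" using pi_less_4 assms by (intro mult_right_mono) auto
  finally show ?thesis by simp
qed

text \<open>
  A function that varies slowly away from the origin has nearly the same sum over a set of lattice
  points in a disc and over a translate of that set. The points common to both sums contribute
  \<open>O (\<Sum> 1 / \<bar>u\<bar>)\<close>, and the others lie in an annulus of bounded width.
\<close>
lemma sum_shift_close:
  fixes f :: "complex \<Rightarrow> complex"
  assumes A: "A \<subseteq> gauss_ints" and c: "c \<in> gauss_ints" "cmod c \<le> 4"
    and f1: "\<And>z. cmod (f z) \<le> 1" and K: "K \<ge> 0"
    and fK: "\<And>u. u \<noteq> 0 \<Longrightarrow> cmod (f (u + c) - f u) \<le> K / cmod u"
    and s: "s = sqrt (real x)" "s \<ge> 5"
  shows "cmod ((\<Sum>z\<in>{z \<in> gauss_disc s. z - c \<in> A}. f z) - (\<Sum>u\<in>gauss_disc s \<inter> A. f u)) \<le> (40 * K + 82) * s"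
proof -
  define U where "U = {u \<in> A. cmod (u + c) \<le> s}"
  define V where "V = gauss_disc s \<inter> A"
  have UD: "U \<subseteq> gauss_disc (s + 4)"
  proof
    fix u assume u: "u \<in> U"
    have "cmod u \<le> cmod (u + c) + cmod c" using norm_triangle_ineq4[of "u + c" c] by simp
    then show "u \<in> gauss_disc (s + 4)" using u c A by (auto simp: U_def gauss_disc_def)
  qed
  have fin: "finite U" "finite V" by (auto simp: V_def intro: finite_subset[OF UD])
  have "(\<Sum>z\<in>{z \<in> gauss_disc s. z - c \<in> A}. f z) = (\<Sum>u\<in>U. f (u + c))"
    by (rule sum.reindex_bij_witness[where i = "\<lambda>u. u + c" and j = "\<lambda>z. z - c"])
       (use A c in \<open>auto simp: U_def gauss_disc_def\<close>)
  also have "\<dots> = (\<Sum>u\<in>U \<inter> V. f (u + c)) + (\<Sum>u\<in>U - V. f (u + c))"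
    using fin by (metis sum.Int_Diff)
  finally have e1: "(\<Sum>z\<in>{z \<in> gauss_disc s. z - c \<in> A}. f z) = (\<Sum>u\<in>U \<inter> V. f (u + c)) + (\<Sum>u\<in>U - V. f (u + c))" .
  have "(\<Sum>u\<in>V. f u) = (\<Sum>u\<in>U \<inter> V. f u) + (\<Sum>u\<in>V - U. f u)"
    using fin by (metis sum.Int_Diff Int_commute)
  with e1 have e2: "(\<Sum>z\<in>{z \<in> gauss_disc s. z - c \<in> A}. f z) - (\<Sum>u\<in>V. f u) =
     (\<Sum>u\<in>U \<inter> V. f (u + c) - f u) + ((\<Sum>u\<in>U - V. f (u + c)) - (\<Sum>u\<in>V - U. f u))"
    by (simp add: sum_subtractf)
  \<comment> \<open>Points in both sets: \<open>f\<close> changes little. The summand 2 is for the origin.\<close>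
  have b1: "cmod (\<Sum>u\<in>U \<inter> V. f (u + c) - f u) \<le> K * (40 * s) + 2"
  proof -
    have "cmod (\<Sum>u\<in>U \<inter> V. f (u + c) - f u) \<le> (\<Sum>u\<in>U \<inter> V. cmod (f (u + c) - f u))" by (rule norm_sum)
    also have "\<dots> \<le> (\<Sum>u\<in>gauss_disc s. cmod (f (u + c) - f u))"
      by (intro sum_mono2) (auto simp: V_def)
    also have "\<dots> \<le> (\<Sum>u\<in>gauss_disc s. K * (1 / cmod u) + (if u = 0 then 2 else 0))"
    proof (intro sum_mono)
      fix u
      show "cmod (f (u + c) - f u) \<le> K * (1 / cmod u) + (if u = 0 then 2 else 0)"
      proof (cases "u = 0")
        case True
        then show ?thesis using norm_triangle_ineq4[of "f (u + c)" "f u"] f1[of "u + c"] f1[of u] by simp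
      qed (use fK in auto)
    qed
    also have "\<dots> = K * (\<Sum>u\<in>gauss_disc s. 1 / cmod u) + (\<Sum>u\<in>gauss_disc s. if u = 0 then 2 else 0)"
      by (simp add: sum.distrib sum_distrib_left)
    also have "\<dots> \<le> K * (40 * s) + 2"
      unfolding s(1) by (intro add_mono mult_left_mono sum_gauss_disc_inverse_norm_le K) auto
    finally show ?thesis .
  qed
  \<comment> \<open>Points in only one of the sets: they lie in an annulus of width 8, and \<open>f\<close> is bounded by 1.\<close>
  have b2: "cmod ((\<Sum>u\<in>U - V. f (u + c)) - (\<Sum>u\<in>V - U. f u)) \<le> 80 * s"
  proof -
    have "cmod ((\<Sum>u\<in>U - V. f (u + c)) - (\<Sum>u\<in>V - U. f u)) \<le>
        cmod (\<Sum>u\<in>U - V. f (u + c)) + cmod (\<Sum>u\<in>V - U. f u)" by (rule norm_triangle_ineq4)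
    also have "\<dots> \<le> (\<Sum>u\<in>U - V. 1) + (\<Sum>u\<in>V - U. 1)"
      by (intro add_mono order.trans[OF norm_sum] sum_mono f1)
    also have "\<dots> = real (card (U - V) + card (V - U))" by simp
    also have "card (U - V) + card (V - U) = card ((U - V) \<union> (V - U))"
      using fin by (intro card_Un_disjoint[symmetric]) auto
    also have "real \<dots> \<le> real (card (gauss_disc (s + 4) - gauss_disc (s - 4)))"
    proof (intro of_nat_mono card_mono subsetI)
      fix u assume "u \<in> (U - V) \<union> (V - U)"
      then show "u \<in> gauss_disc (s + 4) - gauss_disc (s - 4)"
      proof
        assume u: "u \<in> U - V"
        then have "u \<in> gauss_disc (s + 4)" using UD by auto
        moreover have "\<not> cmod u \<le> s" using u A by (auto simp: U_def V_def gauss_disc_def)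
        ultimately show ?thesis by (auto simp: gauss_disc_def)
      next
        assume u: "u \<in> V - U"
        then have "\<not> cmod (u + c) \<le> s" "cmod u \<le> s" by (auto simp: U_def V_def gauss_disc_def)
        moreover have "cmod (u + c) \<le> cmod u + cmod c" by (rule norm_triangle_ineq)
        ultimately show ?thesis using u c by (auto simp: V_def gauss_disc_def)
      qed
    qed auto
    also have "\<dots> \<le> 80 * s" by (rule card_annulus_le[OF s(2)])
    finally show ?thesis .
  qed
  have "cmod ((\<Sum>z\<in>{z \<in> gauss_disc s. z - c \<in> A}. f z) - (\<Sum>u\<in>V. f u)) \<le> (K * (40 * s) + 2) + 80 * s"
    unfolding e2 by (rule order.trans[OF norm_triangle_ineq]) (intro add_mono b1 b2)
  also have "\<dots> \<le> (40 * K + 82) * s" using s(2) by (simp add: algebra_simps)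
  finally show ?thesis by (simp add: V_def)
qed

text \<open>
  Modulo \<open>2 + \<i>\<close> the imaginary unit is congruent to \<open>-2\<close>.
\<close>
lemma two_plus_i_multiples:
  assumes "z = Complex (of_int a) (of_int b)"
  shows "z - of_nat r \<in> (*) (2 + \<i>) ` gauss_ints \<longleftrightarrow> 5 dvd a - 2 * b - int r"
proof
  assume "z - of_nat r \<in> (*) (2 + \<i>) ` gauss_ints"
  then obtain c d where cd: "z - of_nat r = (2 + \<i>) * Complex (of_int c) (of_int d)"
    by (auto elim!: gauss_ints_E)
  then have "real_of_int (a - int r) = real_of_int (2 * c - d)" "real_of_int b = real_of_int (c + 2 * d)"
    by (simp_all add: assms complex_eq_iff)
  then have "a - int r = 2 * c - d" "b = c + 2 * d" by (simp_all only: of_int_eq_iff)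
  then have "a - 2 * b - int r = 5 * (- d)" by simp
  then show "5 dvd a - 2 * b - int r" by (rule dvdI)
next
  assume "5 dvd a - 2 * b - int r"
  then obtain m where m: "a - 2 * b - int r = 5 * m" by (rule dvdE)
  then have "real_of_int (a - 2 * b - int r) = real_of_int (5 * m)" by simp
  then have m': "real_of_int a = 2 * real_of_int b + real r + 5 * real_of_int m" by simp
  have "z - of_nat r = (2 + \<i>) * Complex (of_int (2 * m + b)) (of_int (- m))"
    using m' by (simp add: assms complex_eq_iff)
  then show "z - of_nat r \<in> (*) (2 + \<i>) ` gauss_ints" by (rule image_eqI) (rule Complex_gauss_ints)
qed

lemma gauss_disc_residues:
  "gauss_disc s = (\<Union>r\<in>{0..<5}. {z \<in> gauss_disc s. z - of_nat r \<in> (*) (2 + \<i>) ` gauss_ints})"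
  "r \<in> {0..<5} \<Longrightarrow> r' \<in> {0..<5} \<Longrightarrow> r \<noteq> r' \<Longrightarrow>
     {z \<in> gauss_disc s. z - of_nat r \<in> (*) (2 + \<i>) ` gauss_ints} \<inter> {z \<in> gauss_disc s. z - of_nat r' \<in> (*) (2 + \<i>) ` gauss_ints} = {}"
proof -
  show "gauss_disc s = (\<Union>r\<in>{0..<5}. {z \<in> gauss_disc s. z - of_nat r \<in> (*) (2 + \<i>) ` gauss_ints})"
  proof (intro equalityI subsetI)
    fix z assume z: "z \<in> gauss_disc s"
    then obtain a b where ab: "z = Complex (of_int a) (of_int b)" by (auto simp: gauss_disc_def elim!: gauss_ints_E)
    define r where "r = nat ((a - 2 * b) mod 5)"
    have "int r = (a - 2 * b) mod 5" by (simp add: r_def)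
    then have "a - 2 * b - int r = 5 * ((a - 2 * b) div 5)" by (simp add: minus_mod_eq_mult_div)
    then have "5 dvd a - 2 * b - int r" by (rule dvdI)
    moreover have "r \<in> {0..<5}" by (simp add: r_def nat_less_iff)
    ultimately show "z \<in> (\<Union>r\<in>{0..<5}. {z \<in> gauss_disc s. z - of_nat r \<in> (*) (2 + \<i>) ` gauss_ints})"
      using two_plus_i_multiples[OF ab, of r] z by blast
  qed (auto simp: gauss_disc_def)
  assume r: "r \<in> {0..<5}" "r' \<in> {0..<5}" "r \<noteq> r'"
  show "{z \<in> gauss_disc s. z - of_nat r \<in> (*) (2 + \<i>) ` gauss_ints} \<inter> {z \<in> gauss_disc s. z - of_nat r' \<in> (*) (2 + \<i>) ` gauss_ints} = {}"
  proof (rule ccontr)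
    assume "\<not> ?thesis"
    then obtain z where z: "z \<in> gauss_disc s" "z - of_nat r \<in> (*) (2 + \<i>) ` gauss_ints" "z - of_nat r' \<in> (*) (2 + \<i>) ` gauss_ints"
      by blast
    from z(1) obtain a b where ab: "z = Complex (of_int a) (of_int b)" by (auto simp: gauss_disc_def elim!: gauss_ints_E)
    have "5 dvd a - 2 * b - int r" "5 dvd a - 2 * b - int r'"
      using z two_plus_i_multiples[OF ab] by blast+
    then have "5 dvd (a - 2 * b - int r) - (a - 2 * b - int r')" by (rule dvd_diff)
    then have "5 dvd int r' - int r" by simp
    moreover have "\<bar>int r' - int r\<bar> < 5" "int r' - int r \<noteq> 0" using r by auto
    ultimately show False using dvd_imp_le_int[of "int r' - int r" 5] by simp
  qed
qed

lemma two_plus_i_power: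
  assumes "m \<ge> 1"
  shows "\<exists>a b :: int. (2 + \<i>) ^ m = Complex (of_int a) (of_int b) \<and> 5 dvd a - 2 * b \<and> \<not> 5 dvd b"
  using assms
proof (induction m rule: nat_induct_at_least)
  case base
  show ?case by (rule exI[of _ 2], rule exI[of _ 1]) (simp add: complex_eq_iff)
next
  case (Suc m)
  then obtain a b :: int where ab: "(2 + \<i>) ^ m = Complex (of_int a) (of_int b)" "5 dvd a - 2 * b" "\<not> 5 dvd b"
    by blast
  have "(2 + \<i>) ^ Suc m = Complex (of_int (2 * a - b)) (of_int (a + 2 * b))"
    by (simp add: ab complex_eq_iff)
  moreover have "5 dvd (2 * a - b) - 2 * (a + 2 * b)" by simp
  moreover have "\<not> 5 dvd a + 2 * b"
  proof
    assume "5 dvd a + 2 * b"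
    with ab(2) have "5 dvd (a + 2 * b) - (a - 2 * b)" by (rule dvd_diff[rotated])
    then have "5 dvd 4 * b" by simp
    with ab(3) show False by presburger
  qed
  ultimately show ?case by blast
qed

text \<open>
  The powers of \<open>2 + \<i>\<close> are never real, since their imaginary parts are prime to 5.
\<close>
lemma Im_sgn_two_plus_i_power:
  assumes "m \<ge> 1"
  shows "Im (sgn (2 + \<i>) ^ m) \<noteq> 0"
proof -
  obtain a b :: int where ab: "(2 + \<i>) ^ m = Complex (of_int a) (of_int b)" "\<not> 5 dvd b"
    using two_plus_i_power[OF assms] by blast
  then have "b \<noteq> 0" by auto
  have "sgn (2 + \<i>) ^ m = (2 + \<i>) ^ m / of_real (cmod (2 + \<i>) ^ m)"
    by (simp add: sgn_eq power_divide)
  also have "Im \<dots> = of_int b / cmod (2 + \<i>) ^ m" by (simp only: ab Im_divide_of_real complex.sel)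
  also have "\<dots> \<noteq> 0" using \<open>b \<noteq> 0\<close> by (simp add: complex_eq_iff)
  finally show ?thesis .
qed

text \<open>
  Multiplication by \<open>\<alpha> = 2 + \<i>\<close> maps the lattice points of a disc onto those points of a disc of
  five times the area that are divisible by \<open>\<alpha>\<close>, and each of the five residue classes modulo \<open>\<alpha>\<close>
  carries almost the same sum. So the sum \<open>\<Phi> x\<close> of \<open>sgn z ^ (4 * k)\<close> over the disc of radius
  \<open>sqrt x\<close> satisfies \<open>\<Phi> (5 x) = 5 sgn \<alpha> ^ (4 * k) \<Phi> x + O (sqrt x)\<close>. As \<open>\<Phi>\<close> is real and
  \<open>sgn \<alpha> ^ (4 * k)\<close> is not, taking imaginary parts yields \<open>\<Phi> x = O (sqrt x)\<close>.
\<close>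
lemma sum_hecke_le:
  assumes k: "k \<ge> 1"
  obtains C where "C \<ge> 0" "\<And>x. \<bar>\<Sum>n=1..x. hecke k n\<bar> \<le> C * sqrt (real x)"
proof -
  define f where "f = (\<lambda>z::complex. sgn z ^ (4 * k))"
  define \<alpha> :: complex where "\<alpha> = 2 + \<i>"
  define A where "A = (*) \<alpha> ` gauss_ints"
  \<comment> \<open>A shift by at most 4 changes the direction by at most \<open>8 / cmod u\<close>.\<close>
  define K where "K = real (4 * k) * 8"
  have a0: "\<alpha> \<noteq> 0" "cmod \<alpha> = sqrt 5" by (auto simp: \<alpha>_def complex_eq_iff cmod_def)
  have ag: "\<alpha> \<in> gauss_ints" using gauss_ints_closed(6)[OF gauss_ints_closed(4)[of 2] gauss_ints_closed(3)] by (simp add: \<alpha>_def)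
  have Phi: "(\<Sum>z\<in>gauss_disc (sqrt (real y)). f z) = of_real (4 * (\<Sum>n=1..y. hecke k n))" for y
    unfolding sum_gauss_disc using k by (simp add: f_def sum_sgn_gauss_pts sum_distrib_left)
  have main: "\<bar>Im (f \<alpha>)\<bar> * \<bar>\<Sum>n=1..y. hecke k n\<bar> \<le> (40 * K + 82) * sqrt 5 * sqrt (real y)" if y: "y \<ge> 5" for y
  proof -
    define s where "s = sqrt (real (5 * y))"
    have "sqrt 25 \<le> s" unfolding s_def using y by (intro real_sqrt_le_mono) auto
    then have s5: "s \<ge> 5" by simp
    have "gauss_disc s \<inter> A = (*) \<alpha> ` gauss_disc (sqrt (real y))"
    proof (intro equalityI subsetI)
      fix u assume "u \<in> gauss_disc s \<inter> A"
      then obtain v where v: "v \<in> gauss_ints" "u = \<alpha> * v" "cmod u \<le> s" by (auto simp: A_def gauss_disc_def)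
      then have "sqrt 5 * cmod v \<le> sqrt 5 * sqrt (real y)" by (simp add: norm_mult a0 s_def real_sqrt_mult)
      then have "cmod v \<le> sqrt (real y)" by simp
      then show "u \<in> (*) \<alpha> ` gauss_disc (sqrt (real y))" using v by (auto simp: gauss_disc_def)
    next
      fix u assume "u \<in> (*) \<alpha> ` gauss_disc (sqrt (real y))"
      then show "u \<in> gauss_disc s \<inter> A"
        using ag by (auto simp: gauss_disc_def A_def norm_mult a0 s_def real_sqrt_mult)
    qed
    then have "(\<Sum>u\<in>gauss_disc s \<inter> A. f u) = (\<Sum>v\<in>gauss_disc (sqrt (real y)). f (\<alpha> * v))"
      using a0 by (simp add: sum.reindex inj_on_def)
    also have "\<dots> = f \<alpha> * (\<Sum>v\<in>gauss_disc (sqrt (real y)). f v)"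
      by (simp add: f_def sgn_mult power_mult_distrib sum_distrib_left)
    finally have sumA: "(\<Sum>u\<in>gauss_disc s \<inter> A. f u) = f \<alpha> * of_real (4 * (\<Sum>n=1..y. hecke k n))" unfolding Phi .
    have close: "cmod ((\<Sum>z\<in>{z \<in> gauss_disc s. z - of_nat r \<in> A}. f z) - (\<Sum>u\<in>gauss_disc s \<inter> A. f u)) \<le> (40 * K + 82) * s"
      if r: "r \<in> {0..<5}" for r
    proof (rule sum_shift_close)
      show "cmod (f (u + of_nat r) - f u) \<le> K / cmod u" if "u \<noteq> 0" for u
      proof -
        have "cmod (f (u + of_nat r) - f u) \<le> real (4 * k) * (2 * cmod ((u + of_nat r) - u) / cmod u)"
          unfolding f_def by (rule norm_sgn_power_diff_le[OF that])
        also have "\<dots> \<le> real (4 * k) * (8 / cmod u)"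
          using r by (intro mult_left_mono divide_right_mono) auto
        finally show ?thesis by (simp add: K_def)
      qed
      show "cmod (f z) \<le> 1" for z by (simp add: f_def norm_power norm_sgn power_le_one)
      show "A \<subseteq> gauss_ints" using ag by (auto simp: A_def)
      show "s = sqrt (real (5 * y))" by (rule s_def)
    qed (use r s5 in \<open>auto simp: K_def\<close>)
    have "of_real (4 * (\<Sum>n=1..5*y. hecke k n)) = (\<Sum>z\<in>gauss_disc s. f z)" unfolding Phi s_def ..
    also have "\<dots> = (\<Sum>r\<in>{0..<5}. \<Sum>z\<in>{z \<in> gauss_disc s. z - of_nat r \<in> A}. f z)"
      unfolding A_def \<alpha>_def
      by (subst gauss_disc_residues(1), rule sum.UNION_disjoint) (use gauss_disc_residues(2) in auto)
    finally have "of_real (4 * (\<Sum>n=1..5*y. hecke k n)) - 5 * (\<Sum>u\<in>gauss_disc s \<inter> A. f u) =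
      (\<Sum>r\<in>{0..<5::nat}. (\<Sum>z\<in>{z \<in> gauss_disc s. z - of_nat r \<in> A}. f z) - (\<Sum>u\<in>gauss_disc s \<inter> A. f u))"
      by (simp add: sum_subtractf)
    then have "cmod (of_real (4 * (\<Sum>n=1..5*y. hecke k n)) - 5 * (\<Sum>u\<in>gauss_disc s \<inter> A. f u)) \<le>
      (\<Sum>r\<in>{0..<5::nat}. (40 * K + 82) * s)"
      by (simp only:) (intro order.trans[OF norm_sum] sum_mono close)
    also have "\<dots> = 5 * ((40 * K + 82) * s)" by simp
    finally have le: "cmod (of_real (4 * (\<Sum>n=1..5*y. hecke k n)) - 5 * (\<Sum>u\<in>gauss_disc s \<inter> A. f u)) \<le> 5 * ((40 * K + 82) * s)" .
    have "\<bar>Im (of_real (4 * (\<Sum>n=1..5*y. hecke k n)) - 5 * (\<Sum>u\<in>gauss_disc s \<inter> A. f u))\<bar> \<le> 5 * ((40 * K + 82) * s)"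
      by (rule order.trans[OF abs_Im_le_cmod le])
    also have "Im (of_real (4 * (\<Sum>n=1..5*y. hecke k n)) - 5 * (\<Sum>u\<in>gauss_disc s \<inter> A. f u)) =
        - (20 * (Im (f \<alpha>) * (\<Sum>n=1..y. hecke k n)))" unfolding sumA by simp
    finally have "20 * (\<bar>Im (f \<alpha>)\<bar> * \<bar>\<Sum>n=1..y. hecke k n\<bar>) \<le> 5 * ((40 * K + 82) * s)"
      by (simp add: abs_mult)
    moreover have "(40 * K + 82) * s \<ge> 0" using s5 by (simp add: K_def)
    ultimately have "\<bar>Im (f \<alpha>)\<bar> * \<bar>\<Sum>n=1..y. hecke k n\<bar> \<le> (40 * K + 82) * s" by linarith
    then show ?thesis by (simp add: s_def real_sqrt_mult)
  qed
  define I where "I = \<bar>Im (f \<alpha>)\<bar>"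
  have I: "I > 0" using Im_sgn_two_plus_i_power[of "4 * k"] k by (simp add: I_def f_def \<alpha>_def)
  \<comment> \<open>The summand 25 covers \<open>x < 5\<close>, where the trivial bound is used.\<close>
  define C where "C = (40 * K + 82) * sqrt 5 / I + 25"
  have K0: "K \<ge> 0" by (simp add: K_def)
  have "\<bar>\<Sum>n=1..x. hecke k n\<bar> \<le> C * sqrt (real x)" for x
  proof (cases "x \<ge> 5")
    case True
    have "\<bar>\<Sum>n=1..x. hecke k n\<bar> \<le> (40 * K + 82) * sqrt 5 / I * sqrt (real x)"
      using main[OF True] I by (simp add: I_def[symmetric] field_simps)
    also have "\<dots> \<le> C * sqrt (real x)" by (intro mult_right_mono) (auto simp: C_def)
    finally show ?thesis .
  next
    case False
    show ?thesis
    proof (cases "x = 0")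
      case False
      have "\<bar>\<Sum>n=1..x. hecke k n\<bar> \<le> (\<Sum>n=1..x. hecke 0 n)"
        by (intro order.trans[OF sum_abs] sum_mono abs_hecke_le)
      also have "\<dots> \<le> 5 * real x" by (rule sum_hecke_0_le)
      also have "\<dots> \<le> 25 * 1" using \<open>\<not> x \<ge> 5\<close> by simp
      also have "\<dots> \<le> C * sqrt (real x)"
        using False I K0 by (intro mult_mono) (auto simp: C_def)
      finally show ?thesis .
    qed simp
  qed
  moreover have "C \<ge> 0" using I K0 by (simp add: C_def)
  ultimately show thesis by (rule that[rotated])
qed

section \<open>Convergence at 1\<close>

definition hecke_sum :: "nat \<Rightarrow> nat \<Rightarrow> real" where
  "hecke_sum k x = (\<Sum>n=1..x. hecke k n / real n)"

lemma cauchy_rate_limit: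
  fixes S e :: "nat \<Rightarrow> real"
  assumes S: "\<And>x y. 1 \<le> x \<Longrightarrow> x \<le> y \<Longrightarrow> \<bar>S y - S x\<bar> \<le> e x" and e: "e \<longlonglongrightarrow> 0"
  obtains L where "\<And>x. x \<ge> 1 \<Longrightarrow> \<bar>S x - L\<bar> \<le> e x"
proof -
  have "Cauchy S"
  proof (rule metric_CauchyI)
    fix r :: real assume r: "r > 0"
    with e have "eventually (\<lambda>x. e x < r / 2) sequentially" by (intro order_tendstoD) auto
    then obtain N where N: "\<And>x. x \<ge> N \<Longrightarrow> e x < r / 2" by (auto simp: eventually_sequentially)
    define M where "M = max N 1"
    have close: "\<bar>S y - S M\<bar> < r / 2" if "y \<ge> M" for y
      using S[of M y] N[of M] that by (simp add: M_def)
    have "dist (S m) (S n) < r" if "m \<ge> M" "n \<ge> M" for m n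
      using close[OF that(1)] close[OF that(2)] unfolding dist_real_def by linarith
    then show "\<exists>M. \<forall>m\<ge>M. \<forall>n\<ge>M. dist (S m) (S n) < r" by blast
  qed
  then obtain L where L: "S \<longlonglongrightarrow> L" using real_Cauchy_convergent convergent_def by blast
  have "\<bar>S x - L\<bar> \<le> e x" if x: "x \<ge> 1" for x
  proof -
    have "(\<lambda>y. \<bar>S y - S x\<bar>) \<longlonglongrightarrow> \<bar>L - S x\<bar>" by (intro tendsto_intros L)
    moreover have "\<forall>y\<ge>x. \<bar>S y - S x\<bar> \<le> e x" using S[OF x] by blast
    ultimately have "\<bar>L - S x\<bar> \<le> e x" by (intro LIMSEQ_le_const2) blast+
    then show ?thesis by (simp add: abs_minus_commute)
  qed
  then show thesis by (rule that)
qed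

text \<open>
  Summation by parts from the bound \<open>O (sqrt x)\<close> for the sums of the coefficients. The limit is the
  value of the Hecke series at 1.
\<close>
lemma hecke_sum_limit:
  assumes k: "k \<ge> 1"
  obtains L C where "C \<ge> 0" "\<And>x. x \<ge> 1 \<Longrightarrow> \<bar>hecke_sum k x - L\<bar> \<le> C / sqrt (real x)"
proof -
  obtain C where C: "C \<ge> 0" "\<And>x. \<bar>\<Sum>n=1..x. hecke k n\<bar> \<le> C * sqrt (real x)"
    using sum_hecke_le[OF k] by blast
  define A where "A = (\<lambda>x. \<Sum>n=1..x. hecke k n)"
  define D where "D = (\<lambda>n. A n * (1 / real n - 1 / real (Suc n)))"
  have gs: "hecke_sum k x = A x * (1 / real (Suc x)) + (\<Sum>n=1..x. D n)" for x
    using abel_summation[of "hecke k" "\<lambda>n. 1 / real n" x] by (simp add: hecke_sum_def A_def D_def)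
  have A1: "\<bar>A x * (1 / real (Suc x))\<bar> \<le> C * (1 / sqrt (real x))" if "x \<ge> 1" for x
  proof -
    have "\<bar>A x * (1 / real (Suc x))\<bar> = \<bar>A x\<bar> * (1 / real (Suc x))" by (simp add: abs_mult)
    also have "\<dots> \<le> (C * sqrt (real x)) * (1 / real x)"
      unfolding A_def using that by (intro mult_mono C(2)) (auto simp: frac_le C(1))
    also have "\<dots> = C * (1 / sqrt (real x))" using that by (simp add: real_div_sqrt field_simps)
    finally show ?thesis .
  qed
  have D1: "\<bar>D n\<bar> \<le> 2 * C * (1 / sqrt (real n) - 1 / sqrt (real (Suc n)))" if n: "n \<ge> 1" for n
  proof -
    have "1 / real n - 1 / real (Suc n) = 1 / (real n * real (Suc n))" using n by (simp add: field_simps)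
    then have "\<bar>D n\<bar> = \<bar>A n\<bar> * (1 / (real n * real (Suc n)))" by (simp add: D_def abs_mult)
    also have "\<dots> \<le> (C * sqrt (real n)) * (1 / (real n * real (Suc n)))"
      unfolding A_def by (intro mult_right_mono C(2)) auto
    also have "\<dots> = C * (1 / (sqrt n * (real n + 1)))"
    proof -
      have "real n = sqrt n * sqrt n" by simp
      then have "(C * sqrt n) * (1 / (real n * real (Suc n))) = (C * sqrt n) * (1 / ((sqrt n * sqrt n) * (real n + 1)))" by simp
      also have "\<dots> = C * (1 / (sqrt n * (real n + 1)))" using n by (simp add: divide_simps)
      finally show ?thesis .
    qed
    also have "\<dots> \<le> C * (2 * (1 / sqrt n - 1 / sqrt (n + 1)))"
      using inverse_sqrt_diff[OF n] C(1) by (intro mult_left_mono) (auto simp: add.commute)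
    finally show ?thesis by (simp add: algebra_simps)
  qed
  have tail: "\<bar>\<Sum>n=Suc x..y. D n\<bar> \<le> 2 * C * (1 / sqrt (real x))" if "1 \<le> x" "x \<le> y" for x y
  proof -
    have "\<bar>\<Sum>n=Suc x..y. D n\<bar> \<le> (\<Sum>n=Suc x..y. 2 * C * (1 / sqrt (real n) - 1 / sqrt (real (Suc n))))"
      by (rule order.trans[OF sum_abs], intro sum_mono D1) (use that in auto)
    also have "\<dots> = 2 * C * (\<Sum>n=Suc x..y. 1 / sqrt (real n) - 1 / sqrt (real (Suc n)))"
      by (simp add: sum_distrib_left)
    also have "(\<Sum>n=Suc x..y. 1 / sqrt (real n) - 1 / sqrt (real (Suc n))) = 1 / sqrt (real (Suc x)) - 1 / sqrt (real (Suc y))"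
      using that(2) by (induction y rule: dec_induct) (auto simp: sum.cl_ivl_Suc)
    also have "2 * C * \<dots> \<le> 2 * C * (1 / sqrt (real x))"
    proof (intro mult_left_mono)
      have "1 / sqrt (real (Suc x)) \<le> 1 / sqrt (real x)" using that by (intro divide_left_mono) auto
      then show "1 / sqrt (real (Suc x)) - 1 / sqrt (real (Suc y)) \<le> 1 / sqrt (real x)"
        using real_sqrt_ge_zero[of "real (Suc y)"] by (smt (verit) divide_nonneg_nonneg of_nat_0_le_iff)
    qed (use C in auto)
    finally show ?thesis .
  qed
  have "\<bar>hecke_sum k y - hecke_sum k x\<bar> \<le> 4 * C / sqrt (real x)" if xy: "1 \<le> x" "x \<le> y" for x y
  proof -
    have "(\<Sum>n=1..y. D n) = (\<Sum>n=1..x. D n) + (\<Sum>n=Suc x..y. D n)"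
      using xy by (metis Suc_eq_plus1 le_add2 le_SucI sum.ub_add_nat add.commute le_Suc_ex)
    then have "hecke_sum k y - hecke_sum k x = A y * (1 / real (Suc y)) - A x * (1 / real (Suc x)) + (\<Sum>n=Suc x..y. D n)"
      by (simp add: gs)
    moreover have "C * (1 / sqrt (real y)) \<le> C * (1 / sqrt (real x))"
      using xy C(1) by (intro mult_left_mono divide_left_mono) auto
    moreover have "\<bar>A y * (1 / real (Suc y))\<bar> \<le> C * (1 / sqrt (real y))" "\<bar>A x * (1 / real (Suc x))\<bar> \<le> C * (1 / sqrt (real x))"
      using xy by (intro A1; simp)+
    moreover have "4 * C / sqrt (real x) = C * (1 / sqrt (real x)) + C * (1 / sqrt (real x)) + 2 * C * (1 / sqrt (real x))"
      by (simp add: field_simps)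
    ultimately show ?thesis using tail[OF xy] by linarith
  qed
  moreover have "(\<lambda>x. 4 * C / sqrt (real x)) \<longlonglongrightarrow> 0" by real_asymp
  ultimately obtain L where "\<And>x. x \<ge> 1 \<Longrightarrow> \<bar>hecke_sum k x - L\<bar> \<le> 4 * C / sqrt (real x)"
    using cauchy_rate_limit[of "hecke_sum k" "\<lambda>x. 4 * C / sqrt (real x)"] by blast
  with C(1) that[of "4 * C" L] show thesis by simp
qed

section \<open>Mertens' theorem for Gaussian integers\<close>

lemma ln_le_2_sqrt: "x > 0 \<Longrightarrow> ln x \<le> 2 * sqrt x" for x :: real
proof -
  assume x: "x > 0"
  have "ln x = 2 * ln (sqrt x)" using x by (simp add: ln_sqrt)
  also have "\<dots> \<le> 2 * (sqrt x - 1)" using x by (intro mult_left_mono ln_le_minus_one) auto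
  finally show ?thesis by simp
qed

text \<open>
  Partial sums at 1 of minus the logarithmic derivative of the Hecke series.
\<close>
definition Lam_sum :: "nat \<Rightarrow> nat \<Rightarrow> real" where
  "Lam_sum k x = (\<Sum>d=1..x. Lam k d / real d)"

lemma sum_Lam_0_sqrt_le: "(\<Sum>d=1..x. Lam 0 d * (1 / sqrt (real d))) \<le> 16 * sqrt (real x)"
proof -
  have "(\<Sum>d=1..x. Lam 0 d * (1 / sqrt (real d))) \<le> 8 * (\<Sum>d=1..x. 1 / sqrt (real d))"
    by (rule sum_weighted_le[OF sum_Lam_0_le]) (auto intro!: divide_left_mono)
  also have "\<dots> \<le> 8 * (2 * sqrt x)" by (intro mult_left_mono sum_inverse_sqrt_le) auto
  finally show ?thesis by simp
qed

lemma sum_hecke_0_sqrt_le: "(\<Sum>n=1..x. hecke 0 n * (1 / sqrt (real n))) \<le> 10 * sqrt (real x)"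
proof -
  have "(\<Sum>n=1..x. hecke 0 n * (1 / sqrt (real n))) \<le> 5 * (\<Sum>d=1..x. 1 / sqrt (real d))"
    by (rule sum_weighted_le[OF sum_hecke_0_le]) (auto intro!: divide_left_mono)
  also have "\<dots> \<le> 5 * (2 * sqrt x)" by (intro mult_left_mono sum_inverse_sqrt_le) auto
  finally show ?thesis by simp
qed

text \<open>
  Mertens' theorem for the Gaussian integers. The sum of \<open>hecke 0 n * ln n\<close> is evaluated in two
  ways, as \<open>ln x\<close> times the number of lattice points, and as the convolution of \<open>Lam 0\<close> with the
  lattice point count \<open>c * x + O (sqrt x)\<close>, which gives \<open>c * x * Lam_sum 0 x + O x\<close>.
\<close>
lemma Lam_sum_0:
  obtains C where "C \<ge> 0" "\<And>x. x \<ge> 1 \<Longrightarrow> \<bar>Lam_sum 0 x - ln (real x)\<bar> \<le> C"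
proof -
  define c where "c = pi / 4"
  have c: "c > 0" "c \<le> 1" using pi_less_4 by (auto simp: c_def)
  define R where "R = (\<lambda>x. \<Sum>n=1..x. hecke 0 n)"
  have R: "\<bar>R y - c * real y\<bar> \<le> 4 * sqrt (real y)" if "y \<ge> 1" for y
    unfolding R_def c_def by (rule sum_hecke_0_asymp[OF that])
  have main: "\<bar>c * real x * Lam_sum 0 x - c * real x * ln (real x)\<bar> \<le> 108 * real x" if x: "x \<ge> 1" for x
  proof -
    have "(\<Sum>n=1..x. hecke 0 n * ln (real n)) = (\<Sum>n=1..x. \<Sum>d | d dvd n. Lam 0 d * hecke 0 (n div d))"
      by (intro sum.cong refl hecke_ln_eq_conv) auto
    also have "\<dots> = (\<Sum>d=1..x. Lam 0 d * R (x div d))" unfolding R_def by (rule sum_dirichlet_conv)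
    \<comment> \<open>The convolution form of the sum, to be compared with its main term \<open>c * x * Lam_sum 0 x\<close>.\<close>
    finally have T: "(\<Sum>n=1..x. hecke 0 n * ln (real n)) = (\<Sum>d=1..x. Lam 0 d * R (x div d))" .
    have "\<bar>(\<Sum>d=1..x. Lam 0 d * R (x div d)) - c * real x * Lam_sum 0 x\<bar> =
          \<bar>\<Sum>d=1..x. Lam 0 d * (R (x div d) - c * (real x / real d))\<bar>"
      by (simp add: Lam_sum_def sum_distrib_left sum_subtractf algebra_simps)
    also have "\<dots> \<le> (\<Sum>d=1..x. Lam 0 d * (5 * sqrt (real x) * (1 / sqrt (real d))))"
    proof (rule order.trans[OF sum_abs], intro sum_mono)
      fix d assume "d \<in> {1..x}"
      then have d: "d \<ge> 1" "d \<le> x" by auto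
      note b = real_div_bounds[OF d]
      have s1: "1 \<le> sqrt (real x / real d)" using d by simp
      have "\<bar>R (x div d) - c * real (x div d)\<bar> \<le> 4 * sqrt (real (x div d))" by (rule R[OF b(4)])
      moreover have "sqrt (real (x div d)) \<le> sqrt (real x / real d)" using b(1) by simp
      moreover have "\<bar>c * real (x div d) - c * (real x / real d)\<bar> \<le> 1"
      proof -
        have "\<bar>c * real (x div d) - c * (real x / real d)\<bar> = c * \<bar>real (x div d) - real x / real d\<bar>"
          unfolding right_diff_distrib[symmetric] abs_mult using c by simp
        also have "\<dots> \<le> 1 * 1" using c b by (intro mult_mono) auto
        finally show ?thesis by simp
      qed
      ultimately have "\<bar>R (x div d) - c * (real x / real d)\<bar> \<le> 5 * sqrt (real x / real d)"
        using s1 by linarith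
      then have "\<bar>R (x div d) - c * (real x / real d)\<bar> \<le> 5 * sqrt (real x) * (1 / sqrt (real d))"
        by (simp add: real_sqrt_divide)
      then show "\<bar>Lam 0 d * (R (x div d) - c * (real x / real d))\<bar> \<le> Lam 0 d * (5 * sqrt (real x) * (1 / sqrt (real d)))"
        unfolding abs_mult abs_of_nonneg[OF Lam_0_nonneg] by (rule mult_left_mono[OF _ Lam_0_nonneg])
    qed
    also have "\<dots> = 5 * sqrt (real x) * (\<Sum>d=1..x. Lam 0 d * (1 / sqrt (real d)))"
      by (simp add: sum_distrib_left mult_ac)
    also have "\<dots> \<le> 5 * sqrt (real x) * (16 * sqrt (real x))"
      by (intro mult_left_mono sum_Lam_0_sqrt_le) auto
    also have "\<dots> = 80 * real x" by simp
    finally have e1: "\<bar>(\<Sum>n=1..x. hecke 0 n * ln (real n)) - c * real x * Lam_sum 0 x\<bar> \<le> 80 * real x" unfolding T .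
    \<comment> \<open>Replacing \<open>ln n\<close> by \<open>ln x\<close>.\<close>
    have e2: "\<bar>ln (real x) * R x - (\<Sum>n=1..x. hecke 0 n * ln (real n))\<bar> \<le> 20 * real x"
    proof -
      have "ln (real x) * R x - (\<Sum>n=1..x. hecke 0 n * ln (real n)) = (\<Sum>n=1..x. hecke 0 n * ln (real x / real n))"
        using x by (simp add: R_def sum_distrib_left ln_div algebra_simps flip: sum_subtractf)
      also have "\<bar>\<dots>\<bar> \<le> (\<Sum>n=1..x. hecke 0 n * (2 * sqrt (real x) * (1 / sqrt (real n))))"
      proof (rule order.trans[OF sum_abs], intro sum_mono)
        fix n assume n: "n \<in> {1..x}"
        have "ln (real x / real n) \<le> 2 * sqrt (real x / real n)" using n by (intro ln_le_2_sqrt) auto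
        moreover have "ln (real x / real n) \<ge> 0" using n by (intro ln_ge_zero) auto
        ultimately have "\<bar>ln (real x / real n)\<bar> \<le> 2 * sqrt (real x) * (1 / sqrt (real n))"
          by (simp add: real_sqrt_divide)
        then show "\<bar>hecke 0 n * ln (real x / real n)\<bar> \<le> hecke 0 n * (2 * sqrt (real x) * (1 / sqrt (real n)))"
          unfolding abs_mult abs_of_nonneg[OF hecke_0_nonneg] by (rule mult_left_mono[OF _ hecke_0_nonneg])
      qed
      also have "\<dots> = 2 * sqrt (real x) * (\<Sum>n=1..x. hecke 0 n * (1 / sqrt (real n)))"
        by (simp add: sum_distrib_left mult_ac)
      also have "\<dots> \<le> 2 * sqrt (real x) * (10 * sqrt (real x))"
        by (intro mult_left_mono sum_hecke_0_sqrt_le) auto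
      finally show ?thesis by simp
    qed
    have e3: "\<bar>ln (real x) * R x - c * real x * ln (real x)\<bar> \<le> 8 * real x"
    proof -
      have "\<bar>ln (real x) * R x - c * real x * ln (real x)\<bar> = ln (real x) * \<bar>R x - c * real x\<bar>"
      proof -
        have "ln (real x) * R x - c * real x * ln (real x) = ln (real x) * (R x - c * real x)"
          by (simp add: algebra_simps)
        then show ?thesis using x by (simp add: abs_mult)
      qed
      also have "\<dots> \<le> (2 * sqrt (real x)) * (4 * sqrt (real x))"
        using x by (intro mult_mono R ln_le_2_sqrt) auto
      finally show ?thesis by simp
    qed
    from e1 e2 e3 show ?thesis by linarith
  qed
  have "\<bar>Lam_sum 0 x - ln (real x)\<bar> \<le> 108 / c" if x: "x \<ge> 1" for x
  proof -
    have "c * real x * \<bar>Lam_sum 0 x - ln (real x)\<bar> = \<bar>c * real x * Lam_sum 0 x - c * real x * ln (real x)\<bar>"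
      using c by (simp add: abs_mult flip: right_diff_distrib)
    also have "\<dots> \<le> 108 * real x" by (rule main[OF x])
    finally show ?thesis using c x by (simp add: field_simps)
  qed
  with c show thesis by (intro that[of "108 / c"]) auto
qed

lemma sum_hecke_ln_conv:
  "(\<Sum>n=1..x. hecke k n / real n * ln (real n)) = (\<Sum>d=1..x. Lam k d / real d * hecke_sum k (x div d))"
proof -
  have "(\<Sum>n=1..x. hecke k n / real n * ln (real n)) =
        (\<Sum>n=1..x. \<Sum>d | d dvd n. (Lam k d / real d) * (hecke k (n div d) / real (n div d)))"
  proof (intro sum.cong refl)
    fix n assume n: "n \<in> {1..x}"
    have "hecke k n / real n * ln (real n) = (hecke k n * ln (real n)) / real n" by simp
    also have "hecke k n * ln (real n) = (\<Sum>d | d dvd n. Lam k d * hecke k (n div d))"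
      using n by (intro hecke_ln_eq_conv) auto
    also have "\<dots> / real n = (\<Sum>d | d dvd n. (Lam k d / real d) * (hecke k (n div d) / real (n div d)))"
      unfolding sum_divide_distrib
    proof (intro sum.cong refl)
      fix d assume "d \<in> {d. d dvd n}"
      then have "real n = real d * real (n div d)" by (simp flip: of_nat_mult)
      then show "Lam k d * hecke k (n div d) / real n = (Lam k d / real d) * (hecke k (n div d) / real (n div d))" by simp
    qed
    finally show "hecke k n / real n * ln (real n) = (\<Sum>d | d dvd n. (Lam k d / real d) * (hecke k (n div d) / real (n div d)))" .
  qed
  also have "\<dots> = (\<Sum>d=1..x. Lam k d / real d * hecke_sum k (x div d))"
    unfolding hecke_sum_def by (rule sum_dirichlet_conv)
  finally show ?thesis .
qed

lemma inverse_sqrt_div_le: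
  assumes "d \<ge> 1" "d \<le> x"
  shows "1 / sqrt (real (x div d)) \<le> 2 * sqrt (real d) / sqrt (real x)"
proof -
  note b = real_div_bounds[OF assms]
  have p: "0 < real x / (2 * real d)" using assms by simp
  have "1 / sqrt (real (x div d)) \<le> 1 / sqrt (real x / (2 * real d))"
    using b p by (intro divide_left_mono) auto
  also have "\<dots> = sqrt 2 * sqrt (real d) / sqrt (real x)" by (simp add: real_sqrt_divide real_sqrt_mult)
  also have "\<dots> \<le> 2 * sqrt (real d) / sqrt (real x)"
    using sqrt2_less_2 by (intro divide_right_mono mult_right_mono) auto
  finally show ?thesis .
qed

text \<open>
  The sum of \<open>hecke k n * ln n / n\<close> is the convolution of \<open>Lam k d / d\<close> with the sums
  \<open>hecke_sum k (x div d)\<close>, all of which are close to \<open>L\<close>, hence it is \<open>L * Lam_sum k x + O 1\<close>. On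
  the other hand it is bounded, by summation by parts.
\<close>
lemma Lam_sum_bounded_if_nonzero:
  assumes L: "L \<noteq> 0" and C: "C \<ge> 0" and S: "\<And>x. x \<ge> 1 \<Longrightarrow> \<bar>hecke_sum k x - L\<bar> \<le> C / sqrt (real x)"
  obtains C' where "\<And>x. x \<ge> 1 \<Longrightarrow> \<bar>Lam_sum k x\<bar> \<le> C'"
proof -
  have "\<bar>Lam_sum k x\<bar> \<le> (42 * C) / \<bar>L\<bar>" if x: "x \<ge> 1" for x
  proof -
    have "(\<Sum>d=1..x. Lam k d / real d * hecke_sum k (x div d)) - L * Lam_sum k x =
          (\<Sum>d=1..x. Lam k d / real d * (hecke_sum k (x div d) - L))"
      by (simp add: Lam_sum_def sum_distrib_left sum_subtractf algebra_simps)
    also have "\<bar>\<dots>\<bar> \<le> (\<Sum>d=1..x. 2 * C / sqrt (real x) * (Lam 0 d * (1 / sqrt (real d))))"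
    proof (rule order.trans[OF sum_abs], intro sum_mono)
      fix d assume "d \<in> {1..x}"
      then have d: "d \<ge> 1" "d \<le> x" by auto
      have "\<bar>Lam k d / real d * (hecke_sum k (x div d) - L)\<bar> \<le> Lam 0 d / real d * (C * (1 / sqrt (real (x div d))))"
        unfolding abs_mult abs_divide using S[OF real_div_bounds(4)[OF d]] d
        by (intro mult_mono) (auto simp: abs_Lam_le Lam_0_nonneg divide_right_mono)
      also have "\<dots> \<le> Lam 0 d / real d * (C * (2 * sqrt (real d) / sqrt (real x)))"
        using C by (intro mult_left_mono inverse_sqrt_div_le d) (auto simp: Lam_0_nonneg)
      also have "\<dots> = 2 * C / sqrt (real x) * (Lam 0 d * (sqrt (real d) / real d))" by (simp add: mult_ac)
      also have "sqrt (real d) / real d = 1 / sqrt (real d)" using d by (simp add: field_simps)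
      finally show "\<bar>Lam k d / real d * (hecke_sum k (x div d) - L)\<bar> \<le> 2 * C / sqrt (real x) * (Lam 0 d * (1 / sqrt (real d)))" .
    qed
    also have "\<dots> = 2 * C / sqrt (real x) * (\<Sum>d=1..x. Lam 0 d * (1 / sqrt (real d)))"
      by (simp only: sum_distrib_left)
    also have "\<dots> \<le> 2 * C / sqrt (real x) * (16 * sqrt (real x))"
      using C by (intro mult_left_mono sum_Lam_0_sqrt_le) auto
    also have "\<dots> = 32 * C" using x by simp
    finally have e1: "\<bar>(\<Sum>d=1..x. Lam k d / real d * hecke_sum k (x div d)) - L * Lam_sum k x\<bar> \<le> 32 * C" .
    \<comment> \<open>Summation by parts; the contributions of the constant \<open>L\<close> cancel.\<close>
    have "(\<Sum>n=1..x. hecke k n / real n * ln (real n)) =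
      hecke_sum k x * ln (real (Suc x)) + (\<Sum>n=1..x. hecke_sum k n * (ln (real n) - ln (real (Suc n))))"
      unfolding hecke_sum_def by (rule abel_summation)
    also have "\<dots> = (hecke_sum k x - L) * ln (real (Suc x)) + (\<Sum>n=1..x. (hecke_sum k n - L) * (ln (real n) - ln (real (Suc n))))
       + L * (ln (real (Suc x)) + (\<Sum>n=1..x. ln (real n) - ln (real (Suc n))))"
      by (simp add: sum_subtractf sum.distrib sum_distrib_left algebra_simps)
    also have "(\<Sum>n=1..x. ln (real n) - ln (real (Suc n))) = - ln (real (Suc x))"
      by (induction x) auto
    finally have e2: "(\<Sum>n=1..x. hecke k n / real n * ln (real n)) =
      (hecke_sum k x - L) * ln (real (Suc x)) + (\<Sum>n=1..x. (hecke_sum k n - L) * (ln (real n) - ln (real (Suc n))))" by simp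
    have e3: "\<bar>(hecke_sum k x - L) * ln (real (Suc x))\<bar> \<le> 6 * C"
    proof -
      have "ln (real (Suc x)) \<le> 2 * sqrt (real (Suc x))" by (intro ln_le_2_sqrt) auto
      also have "\<dots> \<le> 2 * sqrt (4 * real x)" using x by (intro mult_left_mono) auto
      also have "\<dots> = 4 * sqrt (real x)" by (simp add: real_sqrt_mult)
      finally have "ln (real (Suc x)) \<le> 4 * sqrt (real x)" .
      then have "\<bar>(hecke_sum k x - L) * ln (real (Suc x))\<bar> \<le> (C / sqrt (real x)) * (4 * sqrt (real x))"
        unfolding abs_mult using S[OF x] C by (intro mult_mono) auto
      also have "\<dots> = 4 * C" using x by simp
      finally show ?thesis using C by simp
    qed
    have e4: "\<bar>\<Sum>n=1..x. (hecke_sum k n - L) * (ln (real n) - ln (real (Suc n)))\<bar> \<le> 4 * C"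
    proof -
      have "\<bar>\<Sum>n=1..x. (hecke_sum k n - L) * (ln (real n) - ln (real (Suc n)))\<bar> \<le> (\<Sum>n=1..x. C * (1 / (real n * sqrt (real n))))"
      proof (rule order.trans[OF sum_abs], intro sum_mono)
        fix n assume n: "n \<in> {1..x}"
        have "ln (real (Suc n)) - ln (real n) = ln (1 + 1 / real n)"
        proof -
          have "real (Suc n) = real n * (1 + 1 / real n)" using n by (simp add: field_simps)
          then have "ln (real (Suc n)) = ln (real n * (1 + 1 / real n))" by simp
          also have "\<dots> = ln (real n) + ln (1 + 1 / real n)" using n by (intro ln_mult_pos) (auto simp: add_pos_nonneg)
          finally show ?thesis by simp
        qed
        also have "\<dots> \<le> 1 / real n" using n by (intro ln_add_one_self_le_self) auto
        finally have "\<bar>ln (real n) - ln (real (Suc n))\<bar> \<le> 1 / real n" using n by auto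
        moreover have "\<bar>hecke_sum k n - L\<bar> \<le> C / sqrt (real n)" using n by (intro S) auto
        ultimately have "\<bar>(hecke_sum k n - L) * (ln (real n) - ln (real (Suc n)))\<bar> \<le> C / sqrt (real n) * (1 / real n)"
          unfolding abs_mult using C by (intro mult_mono) auto
        then show "\<bar>(hecke_sum k n - L) * (ln (real n) - ln (real (Suc n)))\<bar> \<le> C * (1 / (real n * sqrt (real n)))" 
          by (simp add: mult.commute)
      qed
      also have "\<dots> = C * (\<Sum>n=1..x. 1 / (real n * sqrt (real n)))" by (simp only: sum_distrib_left)
      also have "\<dots> \<le> C * 4" using C by (intro mult_left_mono sum_inverse_n_sqrt_le)
      finally show ?thesis by simp
    qed
    have "\<bar>L * Lam_sum k x\<bar> \<le> 42 * C" using e1 e2 e3 e4 sum_hecke_ln_conv[of k x] by linarith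
    then show ?thesis using L by (simp add: abs_mult field_simps)
  qed
  then show thesis by (rule that)
qed

section \<open>The Dirichlet inverse\<close>

definition dconv :: "(nat \<Rightarrow> real) \<Rightarrow> (nat \<Rightarrow> real) \<Rightarrow> nat \<Rightarrow> real" where
  "dconv f g n = (\<Sum>d | d dvd n. f d * g (n div d))"

lemma dconv_pairs:
  assumes "n > 0"
  shows "dconv f g n = (\<Sum>(a,b)\<in>{(a,b). a * b = n}. f a * g b)"
  unfolding dconv_def
  by (rule sum.reindex_bij_witness[where j = "\<lambda>d. (d, n div d)" and i = fst]) (use assms in auto)

lemma dconv_commute: "n > 0 \<Longrightarrow> dconv f g n = dconv g f n"
  unfolding dconv_pairs
  by (rule sum.reindex_bij_witness[where j = prod.swap and i = prod.swap]) (auto simp: mult.commute)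

lemma finite_mult_eq: "n > 0 \<Longrightarrow> finite {(a, b). a * b = (n::nat)}"
  by (rule finite_subset[of _ "{0..n} \<times> {0..n}"]) (auto simp: Suc_le_eq)

lemma dconv_assoc:
  assumes n: "n > 0"
  shows "dconv (dconv f g) h n = dconv f (dconv g h) n"
proof -
  have "dconv (dconv f g) h n = (\<Sum>(a,b)\<in>{(a,b). a * b = n}. \<Sum>(c,d)\<in>{(c,d). c * d = a}. f c * g d * h b)"
    unfolding dconv_pairs[OF n]
  proof (intro sum.cong refl)
    fix q assume "q \<in> {(a, b). a * b = n}"
    then obtain a b where ab: "q = (a, b)" "a * b = n" by auto
    then have "a > 0" using n by (cases "a = 0") auto
    then show "(case q of (a, b) \<Rightarrow> dconv f g a * h b) =
        (case q of (a, b) \<Rightarrow> \<Sum>(c, d)\<in>{(c, d). c * d = a}. f c * g d * h b)"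
      by (simp add: ab dconv_pairs sum_distrib_right case_prod_unfold)
  qed
  also have "\<dots> = (\<Sum>((a,b),(c,d))\<in>(SIGMA q:{(a,b). a * b = n}. {(c,d). c * d = fst q}). f c * g d * h b)"
    by (subst sum.Sigma[symmetric])
       (use n in \<open>auto simp: finite_mult_eq case_prod_unfold intro!: finite_mult_eq[unfolded case_prod_unfold] gr0I\<close>)
  also have "\<dots> = (\<Sum>((a,b),(c,d))\<in>(SIGMA q:{(a,b). a * b = n}. {(c,d). c * d = snd q}). f a * g c * h d)"
    by (rule sum.reindex_bij_witness[where j = "\<lambda>((a,b),(c,d)). ((c, d * b), (d, b))"
          and i = "\<lambda>((a,b),(c,d)). ((a * c, d), (a, c))"]) (auto simp: mult.assoc)
  also have "\<dots> = (\<Sum>(a,b)\<in>{(a,b). a * b = n}. \<Sum>(c,d)\<in>{(c,d). c * d = b}. f a * g c * h d)"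
    by (subst sum.Sigma[symmetric])
       (use n in \<open>auto simp: finite_mult_eq case_prod_unfold intro!: finite_mult_eq[unfolded case_prod_unfold] gr0I\<close>)
  also have "\<dots> = dconv f (dconv g h) n"
    unfolding dconv_pairs[OF n]
  proof (intro sum.cong refl)
    fix q assume "q \<in> {(a, b). a * b = n}"
    then obtain a b where ab: "q = (a, b)" "a * b = n" by auto
    then have "b > 0" using n by (cases "b = 0") auto
    then show "(case q of (a, b) \<Rightarrow> \<Sum>(c, d)\<in>{(c, d). c * d = b}. f a * g c * h d) =
       (case q of (a, b) \<Rightarrow> f a * dconv g h b)"
      by (simp add: ab dconv_pairs sum_distrib_left case_prod_unfold mult.assoc)
  qed
  finally show ?thesis .
qed

function dinv :: "(nat \<Rightarrow> real) \<Rightarrow> nat \<Rightarrow> real" where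
  "dinv g n = (if n = 1 then 1 else - (\<Sum>d\<in>{d. d dvd n \<and> d < n}. dinv g d * g (n div d)))"
  by auto
termination by (relation "Wellfounded.measure snd") auto

declare dinv.simps [simp del]

lemma dconv_dinv:
  assumes g: "g 1 = 1" and n: "n > 0"
  shows "dconv (dinv g) g n = (if n = 1 then 1 else 0)"
proof -
  have "{d. d dvd n} = insert n {d. d dvd n \<and> d < n}" using n by (auto dest: dvd_imp_le)
  then have "dconv (dinv g) g n = dinv g n * g (n div n) + (\<Sum>d\<in>{d. d dvd n \<and> d < n}. dinv g d * g (n div d))"
    unfolding dconv_def by simp
  moreover have "dinv g n = - (\<Sum>d\<in>{d. d dvd n \<and> d < n}. dinv g d * g (n div d))" if "n \<noteq> 1"
    using that by (subst dinv.simps) simp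
  moreover have "{d. d dvd 1 \<and> d < (1::nat)} = {}" by auto
  moreover have "dinv g 1 = 1" by (subst dinv.simps) simp
  ultimately show ?thesis using n g by (cases "n = 1") simp_all
qed

text \<open>
  Multiplication by the logarithm is a derivation of the convolution ring. Apply it to \<open>h * g = 1\<close>,
  where \<open>g \<cdot> ln = L * g\<close>.
\<close>
lemma dconv_dinv_ln:
  assumes g: "g 1 = 1" and gL: "\<And>n. n > 0 \<Longrightarrow> g n * ln (real n) = dconv L g n" and n: "n > 0"
  shows "dconv (\<lambda>d. dinv g d * ln (real d)) g n = - L n"
proof -
  define h where "h = dinv g"
  have hg: "dconv h g n = (if n = 1 then 1 else 0)" if "n > 0" for n
    unfolding h_def by (rule dconv_dinv[where g = g, OF g that])
  have "dconv (\<lambda>d. h d * ln (real d)) g n + dconv h (\<lambda>d. g d * ln (real d)) n = dconv h g n * ln (real n)"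
    unfolding dconv_def sum_distrib_right sum.distrib[symmetric]
  proof (intro sum.cong refl)
    fix d assume "d \<in> {d. d dvd n}"
    then have d: "d > 0" "n div d > 0" "real n = real d * real (n div d)"
      using n by (auto simp flip: of_nat_mult intro: gr0I dest: dvd_imp_le simp: div_greater_zero_iff)
    then show "h d * ln (real d) * g (n div d) + h d * (g (n div d) * ln (real (n div d))) = h d * g (n div d) * ln (real n)"
      by (simp only: d(3)) (simp add: ln_mult algebra_simps)
  qed
  also have "\<dots> = 0" by (simp add: hg[OF n])
  finally have "dconv (\<lambda>d. h d * ln (real d)) g n = - dconv h (\<lambda>d. g d * ln (real d)) n" by simp
  also have "dconv h (\<lambda>d. g d * ln (real d)) n = dconv h (dconv L g) n"
    unfolding dconv_def[of h]
  proof (intro sum.cong refl arg_cong2[where f = "(*)"] gL)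
    fix d assume "d \<in> {d. d dvd n}" then show "n div d > 0"
      using n by (auto simp: div_greater_zero_iff intro: gr0I dest: dvd_imp_le)
  qed
  also have "\<dots> = dconv (dconv L g) h n" by (rule dconv_commute[OF n])
  also have "\<dots> = dconv L (dconv g h) n" by (rule dconv_assoc[OF n])
  also have "\<dots> = (\<Sum>d | d dvd n. L d * (if n div d = 1 then 1 else 0))"
    unfolding dconv_def[of L]
  proof (intro sum.cong refl arg_cong2[where f = "(*)"])
    fix d assume "d \<in> {d. d dvd n}" then have "n div d > 0"
      using n by (auto simp: div_greater_zero_iff intro: gr0I dest: dvd_imp_le)
    then show "dconv g h (n div d) = (if n div d = 1 then 1 else 0)"
      using dconv_commute[of "n div d" g h] hg by simp
  qed
  also have "\<dots> = (\<Sum>d | d dvd n. if d = n then L d else 0)"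
    by (intro sum.cong refl) (use n in \<open>auto dest!: dvd_div_eq_mult[of _ n 1] simp: dvd_div_eq_mult\<close>)
  also have "\<dots> = L n" using n by simp
  finally show ?thesis unfolding h_def .
qed

lemma Lam_1: "Lam k (Suc 0) = 0"
  by (simp add: Lam_def)

text \<open>
  The inverse \<open>h\<close> satisfies \<open>h \<cdot> ln = - \<Lambda> * h\<close> with the twisted \<open>\<Lambda>\<close>, whereas
  \<open>hecke 0 \<cdot> ln = \<Lambda>\<^sub>0 * hecke 0\<close> with \<open>\<bar>\<Lambda>\<bar> \<le> \<Lambda>\<^sub>0\<close>. These recursions allow a comparison by strong
  induction.
\<close>
lemma abs_dinv_hecke_le:
  assumes "n > 0"
  shows "\<bar>dinv (hecke k) n\<bar> \<le> hecke 0 n"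
  using assms
proof (induction n rule: less_induct)
  case (less n)
  define h where "h = dinv (hecke k)"
  have g1: "hecke k 1 = 1" by (rule hecke_1)
  have gL: "hecke k m * ln (real m) = dconv (Lam k) (hecke k) m" if "m > 0" for m
    unfolding dconv_def by (rule hecke_ln_eq_conv[OF that])
  show ?case
  proof (cases "n = 1")
    case True
    then show ?thesis using hecke_1[of 0] by (simp add: dinv.simps)
  next
    case False
    with less have n: "n > 1" by simp
    have hg: "dconv (hecke k) h m = (if m = 1 then 1 else 0)" if "m > 0" for m
      using dconv_dinv[where g = "hecke k", OF g1 that] dconv_commute[OF that] by (simp add: h_def)
    have dg: "dconv (\<lambda>d. h d * ln (real d)) (hecke k) m = - Lam k m" if "m > 0" for m
      unfolding h_def by (rule dconv_dinv_ln[where g = "hecke k", OF g1 gL that])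
    \<comment> \<open>Convolving with \<open>h\<close> once more gives \<open>h \<cdot> ln = - \<Lambda> * h\<close>.\<close>
    have "dconv (dconv (\<lambda>d. h d * ln (real d)) (hecke k)) h n = dconv (\<lambda>d. h d * ln (real d)) (dconv (hecke k) h) n"
      using n by (intro dconv_assoc) auto
    also have "\<dots> = (\<Sum>d | d dvd n. h d * ln (real d) * (if n div d = 1 then 1 else 0))"
      unfolding dconv_def[of "\<lambda>d. h d * ln (real d)"]
    proof (intro sum.cong refl arg_cong2[where f = "(*)"] hg)
      fix d assume "d \<in> {d. d dvd n}" then show "n div d > 0"
        using n by (auto simp: div_greater_zero_iff intro: gr0I dest: dvd_imp_le)
    qed
    also have "\<dots> = (\<Sum>d | d dvd n. if d = n then h d * ln (real d) else 0)"
      by (intro sum.cong refl) (use n in \<open>auto dest!: dvd_div_eq_mult[of _ n 1] simp: dvd_div_eq_mult\<close>)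
    also have "\<dots> = h n * ln (real n)" using n by simp
    finally have e: "h n * ln (real n) = dconv (dconv (\<lambda>d. h d * ln (real d)) (hecke k)) h n" ..
    also have "\<dots> = (\<Sum>d | d dvd n. - Lam k d * h (n div d))"
      unfolding dconv_def[of "dconv _ _"]
      by (intro sum.cong refl arg_cong2[where f = "(*)"] dg) (use n in \<open>auto intro: gr0I\<close>)
    finally have "\<bar>h n\<bar> * ln (real n) = \<bar>\<Sum>d | d dvd n. - Lam k d * h (n div d)\<bar>"
      using n by (metis abs_mult abs_of_nonneg ln_ge_zero of_nat_1 of_nat_le_iff less_imp_le)
    also have "\<dots> \<le> (\<Sum>d | d dvd n. Lam 0 d * hecke 0 (n div d))"
    proof (rule order.trans[OF sum_abs], intro sum_mono)
      fix d assume "d \<in> {d. d dvd n}"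
      then have d: "d dvd n" "d > 0" using n by (auto intro: gr0I)
      show "\<bar>- Lam k d * h (n div d)\<bar> \<le> Lam 0 d * hecke 0 (n div d)"
      \<comment> \<open>The divisor \<open>d = 1\<close>, to which the induction hypothesis does not apply, has \<open>\<Lambda> = 0\<close>.\<close>
      proof (cases "d = 1")
        case False
        then have "n div d < n" "n div d > 0"
          using d n by (auto simp: div_greater_zero_iff dest: dvd_imp_le)
        then have "\<bar>h (n div d)\<bar> \<le> hecke 0 (n div d)" unfolding h_def by (rule less.IH)
        then show ?thesis unfolding abs_mult by (intro mult_mono) (auto simp: abs_Lam_le Lam_0_nonneg)
      qed (simp add: Lam_1)
    qed
    also have "\<dots> = hecke 0 n * ln (real n)" using n by (intro hecke_ln_eq_conv[symmetric]) auto
    finally have "\<bar>h n\<bar> * ln (real n) \<le> hecke 0 n * ln (real n)" .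
    moreover have "ln (real n) > 0" using n by (intro ln_gt_zero) auto
    ultimately show ?thesis by (simp add: h_def)
  qed
qed

section \<open>Non-vanishing at 1\<close>

lemma ln_le_4_powr: "x > 0 \<Longrightarrow> ln x \<le> 4 * x powr (1 / 4)" for x :: real
proof -
  assume x: "x > 0"
  have "ln x = 4 * ln (x powr (1/4))" using x by (simp add: ln_powr)
  also have "\<dots> \<le> 4 * (x powr (1/4) - 1)" using x by (intro mult_left_mono ln_le_minus_one) auto
  finally show ?thesis by simp
qed

text \<open>
  If the Hecke series vanishes at 1, then its logarithmic derivative has a pole there of residue 1.
  Indeed \<open>\<Lambda> n + [n = 1] ln x\<close> is the convolution of \<open>h d * ln (x / d)\<close> with \<open>g\<close>, where \<open>h\<close> is the
  Dirichlet inverse of \<open>g = hecke k\<close>, and now the partial sums of \<open>g n / n\<close> are small.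
\<close>
lemma Lam_sum_if_zero:
  assumes C: "C \<ge> 0" and S: "\<And>x. x \<ge> 1 \<Longrightarrow> \<bar>hecke_sum k x\<bar> \<le> C / sqrt (real x)"
  obtains C' where "\<And>x. x \<ge> 1 \<Longrightarrow> \<bar>Lam_sum k x + ln (real x)\<bar> \<le> C'"
proof -
  define h where "h = dinv (hecke k)"
  have g1: "hecke k 1 = 1" by (rule hecke_1)
  have gL: "hecke k m * ln (real m) = dconv (Lam k) (hecke k) m" if "m > 0" for m
    unfolding dconv_def by (rule hecke_ln_eq_conv[OF that])
  have "\<bar>Lam_sum k x + ln (real x)\<bar> \<le> 160 * C" if x: "x \<ge> 1" for x
  proof -
    have conv: "(Lam k n + (if n = 1 then ln (real x) else 0)) / real n =
      (\<Sum>d | d dvd n. (h d / real d * ln (real x / real d)) * (hecke k (n div d) / real (n div d)))"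
      if n: "n \<in> {1..x}" for n
    proof -
      have "(\<Sum>d | d dvd n. (h d / real d * ln (real x / real d)) * (hecke k (n div d) / real (n div d))) =
        (\<Sum>d | d dvd n. (ln (real x) * (h d * hecke k (n div d)) - h d * ln (real d) * hecke k (n div d)) / real n)"
      proof (intro sum.cong refl)
        fix d assume "d \<in> {d. d dvd n}"
        then have d: "real n = real d * real (n div d)" "d > 0" using n by (auto simp flip: of_nat_mult intro: gr0I)
        have "ln (real x / real d) = ln (real x) - ln (real d)" using d x by (simp add: ln_div)
        then show "(h d / real d * ln (real x / real d)) * (hecke k (n div d) / real (n div d)) =
          (ln (real x) * (h d * hecke k (n div d)) - h d * ln (real d) * hecke k (n div d)) / real n"
          unfolding d(1) by (simp only: \<open>ln (real x / real d) = ln (real x) - ln (real d)\<close>) (simp add: algebra_simps diff_divide_distrib)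
      qed
      also have "\<dots> = (ln (real x) * dconv h (hecke k) n - dconv (\<lambda>d. h d * ln (real d)) (hecke k) n) / real n"
        by (simp add: dconv_def sum_subtractf sum_distrib_left flip: sum_divide_distrib)
      also have "dconv (\<lambda>d. h d * ln (real d)) (hecke k) n = - Lam k n"
        unfolding h_def using n by (intro dconv_dinv_ln[where g = "hecke k", OF g1 gL]) auto
      also have "dconv h (hecke k) n = (if n = 1 then 1 else 0)"
        unfolding h_def using n by (intro dconv_dinv[where g = "hecke k", OF g1]) auto
      finally show ?thesis by auto
    qed
    have "Lam_sum k x + ln (real x) = (\<Sum>n=1..x. (Lam k n + (if n = 1 then ln (real x) else 0)) / real n)"
    proof -
      have "(\<Sum>n=1..x. (if n = 1 then ln (real x) else 0) / real n) = (\<Sum>n=1..x. if n = 1 then ln (real x) else 0)"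
        by (intro sum.cong) auto
      also have "\<dots> = ln (real x)" using x by simp
      finally show ?thesis by (simp add: Lam_sum_def add_divide_distrib sum.distrib)
    qed
    also have "\<dots> = (\<Sum>n=1..x. \<Sum>d | d dvd n. (h d / real d * ln (real x / real d)) * (hecke k (n div d) / real (n div d)))"
      by (intro sum.cong refl conv)
    also have "\<dots> = (\<Sum>d=1..x. (h d / real d * ln (real x / real d)) * hecke_sum k (x div d))"
      unfolding hecke_sum_def by (rule sum_dirichlet_conv)
    also have "\<bar>\<dots>\<bar> \<le> (\<Sum>d=1..x. 8 * C * real x powr (- 1 / 4) * (hecke 0 d * real d powr (- 3 / 4)))"
    proof (rule order.trans[OF sum_abs], intro sum_mono)
      fix d assume "d \<in> {1..x}"
      then have d: "d \<ge> 1" "d \<le> x" by auto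
      have "ln (real x / real d) \<le> 4 * (real x / real d) powr (1/4)" using d by (intro ln_le_4_powr) auto
      moreover have "ln (real x / real d) \<ge> 0" using d by (intro ln_ge_zero) auto
      ultimately have l: "\<bar>ln (real x / real d)\<bar> \<le> 4 * (real x / real d) powr (1/4)" by simp
      have "\<bar>hecke_sum k (x div d)\<bar> \<le> C * (1 / sqrt (real (x div d)))" using S[OF real_div_bounds(4)[OF d]] by simp
      also have "\<dots> \<le> C * (2 * sqrt (real d) / sqrt (real x))"
        using C by (intro mult_left_mono inverse_sqrt_div_le d)
      finally have g: "\<bar>hecke_sum k (x div d)\<bar> \<le> C * (2 * sqrt (real d) / sqrt (real x))" .
      have h: "\<bar>h d\<bar> \<le> hecke 0 d" unfolding h_def using d by (intro abs_dinv_hecke_le) auto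
      have "\<bar>h d / real d * ln (real x / real d) * hecke_sum k (x div d)\<bar> = (\<bar>h d\<bar> / real d) * \<bar>ln (real x / real d)\<bar> * \<bar>hecke_sum k (x div d)\<bar>"
        by (simp add: abs_mult)
      also have "\<dots> \<le> (hecke 0 d / real d) * (4 * (real x / real d) powr (1/4)) * (C * (2 * sqrt (real d) / sqrt (real x)))"
        using C h by (intro mult_mono l g divide_right_mono) (auto simp: hecke_0_nonneg)
      also have "\<dots> = 8 * C * hecke 0 d * ((real x / real d) powr (1/4) * (sqrt (real d) / sqrt (real x)) / real d)"
        by (simp add: mult_ac)
      also have "(real x / real d) powr (1/4) * (sqrt (real d) / sqrt (real x)) / real d = real x powr (- 1 / 4) * real d powr (- 3 / 4)"
      proof -
        have x0: "real x > 0" "real d > 0" using d by auto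
        have s: "sqrt (real d) = real d powr (1/2)" "sqrt (real x) = real x powr (1/2)" using x0 by (simp_all add: powr_half_sqrt)
        have "real d = real d powr 1" using x0 by simp
        then have "(real x / real d) powr (1/4) * (sqrt (real d) / sqrt (real x)) / real d =
          (real x powr (1/4) / real d powr (1/4)) * (real d powr (1/2) / real x powr (1/2)) / real d powr 1"
          using x0 by (simp add: s powr_divide)
        also have "\<dots> = (real x powr (1/4) / real x powr (1/2)) * (real d powr (1/2) / (real d powr (1/4) * real d powr 1))"
          by (simp add: field_simps)
        also have "\<dots> = real x powr (- 1 / 4) * real d powr (- 3 / 4)"
          unfolding powr_add[symmetric] powr_diff[symmetric] by simp
        finally show ?thesis .
      qed
      finally show "\<bar>h d / real d * ln (real x / real d) * hecke_sum k (x div d)\<bar> \<le> 8 * C * real x powr (- 1 / 4) * (hecke 0 d * real d powr (- 3 / 4))"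
        by (simp add: mult_ac)
    qed
    also have "\<dots> = 8 * C * real x powr (- 1 / 4) * (\<Sum>d=1..x. hecke 0 d * real d powr (- 3 / 4))"
      by (simp only: sum_distrib_left)
    also have "\<dots> \<le> 8 * C * real x powr (- 1 / 4) * (5 * (4 * real x powr (1 / 4)))"
    proof (intro mult_left_mono)
      have "(\<Sum>d=1..x. hecke 0 d * real d powr (- 3 / 4)) \<le> 5 * (\<Sum>d=1..x. real d powr (- 3 / 4))"
        by (rule sum_weighted_le[OF sum_hecke_0_le]) (auto intro!: powr_mono2')
      also have "\<dots> \<le> 5 * (4 * real x powr (1 / 4))" by (intro mult_left_mono sum_powr_34_le) auto
      finally show "(\<Sum>d=1..x. hecke 0 d * real d powr (- 3 / 4)) \<le> 5 * (4 * real x powr (1 / 4))" .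
    qed (use C in auto)
    also have "\<dots> = 160 * C * (real x powr (- 1 / 4) * real x powr (1 / 4))" by simp
    also have "real x powr (- 1 / 4) * real x powr (1 / 4) = 1" using x by (simp flip: powr_add)
    finally show ?thesis by simp
  qed
  then show thesis by (rule that)
qed

text \<open>
  According to whether the value of the Hecke series at 1 is zero or not.
\<close>
lemma Lam_sum_bounded_or_minus_ln:
  assumes k: "k \<ge> 1"
  obtains (bounded) C where "\<And>x. x \<ge> 1 \<Longrightarrow> \<bar>Lam_sum k x\<bar> \<le> C"
    | (zero) C where "\<And>x. x \<ge> 1 \<Longrightarrow> \<bar>Lam_sum k x + ln (real x)\<bar> \<le> C"
proof -
  obtain L C where LC: "C \<ge> 0" "\<And>x. x \<ge> 1 \<Longrightarrow> \<bar>hecke_sum k x - L\<bar> \<le> C / sqrt (real x)"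
    by (rule hecke_sum_limit[OF k]) blast
  show thesis
  proof (cases "L = 0")
    case True
    then have "\<And>x. x \<ge> 1 \<Longrightarrow> \<bar>hecke_sum k x\<bar> \<le> C / sqrt (real x)" using LC by simp
    from Lam_sum_if_zero[OF LC(1) this] obtain C' where "\<And>x. x \<ge> 1 \<Longrightarrow> \<bar>Lam_sum k x + ln (real x)\<bar> \<le> C'" by blast
    then show thesis by (rule zero)
  next
    case False
    from Lam_sum_bounded_if_nonzero[OF this LC] obtain C' where "\<And>x. x \<ge> 1 \<Longrightarrow> \<bar>Lam_sum k x\<bar> \<le> C'" by blast
    then show thesis by (rule bounded)
  qed
qed

lemma Lam_sum_3_4_1: "3 * Lam_sum 0 x + 4 * Lam_sum k x + Lam_sum (2 * k) x \<ge> 0"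
proof -
  have "3 * Lam_sum 0 x + 4 * Lam_sum k x + Lam_sum (2 * k) x = (\<Sum>d=1..x. (3 * Lam 0 d + 4 * Lam k d + Lam (2 * k) d) / real d)"
    by (simp add: Lam_sum_def sum_distrib_left add_divide_distrib sum.distrib)
  also have "\<dots> \<ge> 0" by (intro sum_nonneg divide_nonneg_nonneg Lam_3_4_1) auto
  finally show ?thesis .
qed

text \<open>
  If the Hecke series of exponent \<open>4 * k\<close> vanished at 1, then the left-hand side of the inequality
  \<open>3 * Lam_sum 0 x + 4 * Lam_sum k x + Lam_sum (2 * k) x \<ge> 0\<close> would be at most
  \<open>3 ln x - 4 ln x + O 1\<close>, as \<open>Lam_sum (2 * k)\<close> is bounded above in either case.
\<close>
lemma Lam_sum_bounded:
  assumes k: "k \<ge> 1"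
  obtains C where "\<And>x. x \<ge> 1 \<Longrightarrow> \<bar>Lam_sum k x\<bar> \<le> C"
  using k
proof (cases rule: Lam_sum_bounded_or_minus_ln)
  case (zero C)
  obtain C0 where C0: "C0 \<ge> 0" "\<And>x. x \<ge> 1 \<Longrightarrow> \<bar>Lam_sum 0 x - ln (real x)\<bar> \<le> C0" by (rule Lam_sum_0) blast
  have "2 * k \<ge> 1" using k by simp
  then obtain C2 where C2: "\<And>x. x \<ge> 1 \<Longrightarrow> Lam_sum (2 * k) x \<le> C2"
  proof (cases rule: Lam_sum_bounded_or_minus_ln)
    case (bounded C)
    with that show thesis by (metis abs_le_D1)
  next
    case (zero C)
    have "Lam_sum (2 * k) x \<le> C" if "x \<ge> 1" for x
    proof -
      have "ln (real x) \<ge> 0" using that by (intro ln_ge_zero) simp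
      then show ?thesis using zero[OF that] by linarith
    qed
    with that show thesis by blast
  qed
  define x where "x = nat \<lceil>exp (3 * C0 + 4 * C + C2 + 1)\<rceil>"
  have e: "exp (3 * C0 + 4 * C + C2 + 1) \<le> real x" unfolding x_def by (rule real_nat_ceiling_ge)
  then have x0: "real x > 0" using exp_gt_zero less_le_trans by blast
  then have x1: "x \<ge> 1" by simp
  from e x0 have "3 * C0 + 4 * C + C2 + 1 \<le> ln (real x)" by (subst ln_ge_iff)
  moreover have "3 * Lam_sum 0 x + 4 * Lam_sum k x + Lam_sum (2 * k) x \<ge> 0" by (rule Lam_sum_3_4_1)
  ultimately have False using C0(2)[OF x1] C2[OF x1] zero[OF x1] by linarith
  then show thesis ..
qed (use that in blast)

section \<open>Primes congruent to 1 modulo 4\<close>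

definition primes_1_mod_4 :: "nat set" where
  "primes_1_mod_4 = {p. prime p \<and> p mod 4 = 1}"

text \<open>
  The part of \<open>Lam_sum\<close> that comes from the primes \<open>1 (mod 4)\<close>.
\<close>
definition prime_sum :: "nat \<Rightarrow> nat \<Rightarrow> real" where
  "prime_sum k x = (\<Sum>p\<in>primes_1_mod_4 \<inter> {1..x}. ln (real p) / real p * tau k p 1)"

lemma sum_proper_prime_powers:
  "(\<Sum>d\<in>{d\<in>{1..x}. primepow d \<and> \<not> prime d}. Lam 0 d / real d) \<le> 32"
proof -
  define P where "P = {p\<in>{1..x}. prime p}"
  have finP: "finite P" by (simp add: P_def)
  have sub: "{d\<in>{1..x}. primepow d \<and> \<not> prime d} \<subseteq> (\<lambda>(p,j). p ^ j) ` (P \<times> {2..x})"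
  proof
    fix d assume d: "d \<in> {d\<in>{1..x}. primepow d \<and> \<not> prime d}"
    then obtain p j where pj: "prime p" "j > 0" "d = p ^ j" by (auto simp: primepow_def)
    have "j \<noteq> 1" using d pj by auto
    moreover have "p ^ 1 \<le> p ^ j" using pj prime_gt_0_nat[of p] by (intro power_increasing) auto
    moreover have "j < p ^ j" using pj by (intro less_exp[THEN less_le_trans] power_mono prime_ge_2_nat) auto
    ultimately have "p \<in> P" "j \<in> {2..x}" using d pj prime_gt_0_nat[of p] by (auto simp: P_def)
    then show "d \<in> (\<lambda>(p,j). p ^ j) ` (P \<times> {2..x})" using pj by force
  qed
  have "(\<Sum>d\<in>{d\<in>{1..x}. primepow d \<and> \<not> prime d}. Lam 0 d / real d) \<le> (\<Sum>d\<in>(\<lambda>(p,j). p ^ j) ` (P \<times> {2..x}). Lam 0 d / real d)"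
    by (rule sum_mono2[OF _ sub]) (auto simp: P_def Lam_0_nonneg)
  also have "\<dots> \<le> (\<Sum>(p,j)\<in>P \<times> {2..x}. Lam 0 (p ^ j) / real (p ^ j))"
    using sum_image_le[of "P \<times> {2..x}" "\<lambda>d. Lam 0 d / real d" "\<lambda>(p,j). p ^ j"]
    by (auto simp: P_def Lam_0_nonneg case_prod_unfold comp_def)
  also have "\<dots> \<le> (\<Sum>(p,j)\<in>P \<times> {2..x}. 2 * ln (real p) * (1 / real p) ^ j)"
  proof (intro sum_mono)
    fix q assume "q \<in> P \<times> {2..x}"
    then obtain p j where q: "q = (p, j)" "prime p" "j \<ge> 2" by (auto simp: P_def)
    have "Lam 0 (p ^ j) \<le> ln (real p) * 2"
      using q prime_ge_1_nat[of p] by (subst Lam_prime_power) (auto intro!: mult_left_mono simp: tau_0)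
    then have "Lam 0 (p ^ j) / real (p ^ j) \<le> ln (real p) * 2 / real (p ^ j)" by (intro divide_right_mono) auto
    then show "(case q of (p,j) \<Rightarrow> Lam 0 (p ^ j) / real (p ^ j)) \<le> (case q of (p,j) \<Rightarrow> 2 * ln (real p) * (1 / real p) ^ j)"
      by (simp add: q power_divide mult.commute)
  qed
  also have "\<dots> = (\<Sum>p\<in>P. 2 * ln (real p) * (\<Sum>j=2..x. (1 / real p) ^ j))"
    unfolding sum_distrib_left by (subst sum.Sigma) (use finP in auto)
  also have "\<dots> \<le> (\<Sum>p\<in>P. 8 * (1 / (real p * sqrt (real p))))"
  proof (intro sum_mono)
    fix p assume "p \<in> P"
    then have p: "p \<ge> 2" by (auto simp: P_def prime_ge_2_nat)
    have "(\<Sum>j=2..x. (1 / real p) ^ j) \<le> 2 / (real p)\<^sup>2"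
    proof -
      have "(\<Sum>j=2..x. (1 / real p) ^ j) \<le> (1 / real p) ^ 2 / (1 - 1 / real p)"
      proof (cases "x \<ge> 2")
        case True
        have "(\<Sum>j=2..x. (1 / real p) ^ j) = ((1 / real p) ^ 2 - (1 / real p) ^ Suc x) / (1 - 1 / real p)"
          using p True by (subst sum_gp) auto
        also have "\<dots> \<le> (1 / real p) ^ 2 / (1 - 1 / real p)"
          using p by (intro divide_right_mono) auto
        finally show ?thesis .
      qed (use p in auto)
      also have "\<dots> \<le> (1 / real p) ^ 2 / (1 / 2)"
        using p by (intro divide_left_mono) (auto simp: field_simps)
      finally show ?thesis by (simp add: power_divide)
    qed
    moreover have "2 * ln (real p) \<le> 2 * (2 * sqrt (real p))" using p by (intro mult_left_mono ln_le_2_sqrt) auto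
    ultimately have "2 * ln (real p) * (\<Sum>j=2..x. (1 / real p) ^ j) \<le> 2 * (2 * sqrt (real p)) * (2 / (real p)\<^sup>2)"
      using p by (intro mult_mono) (auto intro!: sum_nonneg)
    also have "\<dots> = 8 * (sqrt (real p) / (real p * (sqrt (real p) * sqrt (real p))))" by (simp add: power2_eq_square)
    also have "\<dots> = 8 * (1 / (real p * sqrt (real p)))" using p by (simp add: field_simps)
    finally show "2 * ln (real p) * (\<Sum>j=2..x. (1 / real p) ^ j) \<le> 8 * (1 / (real p * sqrt (real p)))" .
  qed
  also have "\<dots> \<le> (\<Sum>p=1..x. 8 * (1 / (real p * sqrt (real p))))"
    by (intro sum_mono2) (auto simp: P_def)
  also have "\<dots> = 8 * (\<Sum>p=1..x. 1 / (real p * sqrt (real p)))" by (simp only: sum_distrib_left)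
  also have "\<dots> \<le> 8 * 4" by (intro mult_left_mono sum_inverse_n_sqrt_le) auto
  finally show ?thesis by simp
qed

text \<open>
  Powers with exponent at least 2 contribute a convergent series, inert primes nothing, and the
  prime 2 at most 1.
\<close>
lemma Lam_sum_prime_sum: "\<bar>Lam_sum k x - prime_sum k x\<bar> \<le> 33"
proof -
  define D where "D = {d\<in>{1..x}. primepow d \<and> \<not> prime d}"
  define Q where "Q = primes_1_mod_4 \<inter> {1..x}"
  define T where "T = {2} \<inter> {1..x}"
  have "Lam_sum k x = (\<Sum>d\<in>Q \<union> (D \<union> T). Lam k d / real d)"
    unfolding Lam_sum_def
  proof (rule sum.mono_neutral_right)
    show "\<forall>d\<in>{1..x} - (Q \<union> (D \<union> T)). Lam k d / real d = 0"
    proof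
      fix d assume d: "d \<in> {1..x} - (Q \<union> (D \<union> T))"
      show "Lam k d / real d = 0"
      proof (cases "primepow d")
        case True
        with d have "prime d" by (auto simp: D_def)
        moreover from this d have "d mod 4 = 3"
          by (auto simp: Q_def T_def primes_1_mod_4_def elim: prime_mod_4_cases)
        ultimately have "Lam 0 d = 0" using Lam_prime_power[of d 1 0] by (auto simp: tau_0)
        then show ?thesis using abs_Lam_le[of k d] by simp
      qed (simp add: Lam_eq_0)
    qed
  qed (auto simp: Q_def D_def T_def)
  also have "\<dots> = (\<Sum>d\<in>Q. Lam k d / real d) + (\<Sum>d\<in>D \<union> T. Lam k d / real d)"
    by (rule sum.union_disjoint) (auto simp: Q_def D_def T_def primes_1_mod_4_def)
  also have "(\<Sum>d\<in>D \<union> T. Lam k d / real d) = (\<Sum>d\<in>D. Lam k d / real d) + (\<Sum>d\<in>T. Lam k d / real d)"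
    by (rule sum.union_disjoint) (auto simp: D_def T_def)
  also have "(\<Sum>d\<in>Q. Lam k d / real d) = prime_sum k x"
    unfolding prime_sum_def Q_def[symmetric]
  proof (intro sum.cong refl)
    fix p assume "p \<in> Q"
    then have "prime p" by (simp add: Q_def primes_1_mod_4_def)
    then show "Lam k p / real p = ln (real p) / real p * tau k p 1" using Lam_prime_power[of p 1 k] by simp
  qed
  finally have "Lam_sum k x - prime_sum k x = (\<Sum>d\<in>D. Lam k d / real d) + (\<Sum>d\<in>T. Lam k d / real d)" by simp
  moreover have "\<bar>\<Sum>d\<in>D. Lam k d / real d\<bar> \<le> 32"
  proof -
    have "\<bar>\<Sum>d\<in>D. Lam k d / real d\<bar> \<le> (\<Sum>d\<in>D. Lam 0 d / real d)"
      by (rule order.trans[OF sum_abs], intro sum_mono) (auto simp: abs_Lam_le divide_right_mono)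
    also have "\<dots> \<le> 32" unfolding D_def by (rule sum_proper_prime_powers)
    finally show ?thesis .
  qed
  moreover have "\<bar>\<Sum>d\<in>T. Lam k d / real d\<bar> \<le> 1"
  proof (cases "x \<ge> 2")
    case True
    then have T: "T = {2}" by (auto simp: T_def)
    have "\<bar>Lam k 2\<bar> \<le> Lam 0 2" by (rule abs_Lam_le)
    also have "\<dots> = ln 2" using Lam_prime_power[of 2 1 0] by (simp add: tau_0)
    also have "\<dots> \<le> 1" using ln_le_minus_one[of "2::real"] by simp
    finally show ?thesis by (simp add: T)
  qed (auto simp: T_def)
  ultimately show ?thesis by linarith
qed

lemma prime_sum_0:
  obtains C where "\<And>x. x \<ge> 1 \<Longrightarrow> \<bar>prime_sum 0 x - ln (real x)\<bar> \<le> C"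
proof -
  obtain C where C: "C \<ge> 0" "\<And>x. x \<ge> 1 \<Longrightarrow> \<bar>Lam_sum 0 x - ln (real x)\<bar> \<le> C" by (rule Lam_sum_0) blast
  have "\<bar>prime_sum 0 x - ln (real x)\<bar> \<le> C + 33" if "x \<ge> 1" for x
    using C(2)[OF that] Lam_sum_prime_sum[of 0 x] by linarith
  then show thesis by (rule that)
qed

lemma prime_sum_bounded:
  assumes "k \<ge> 1"
  obtains C where "\<And>x. x \<ge> 1 \<Longrightarrow> \<bar>prime_sum k x\<bar> \<le> C"
proof -
  obtain C where C: "\<And>x. x \<ge> 1 \<Longrightarrow> \<bar>Lam_sum k x\<bar> \<le> C" by (rule Lam_sum_bounded[OF assms]) blast
  have "\<bar>prime_sum k x\<bar> \<le> C + 33" if "x \<ge> 1" for x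
    using C[OF that] Lam_sum_prime_sum[of k x] by linarith
  then show thesis by (rule that)
qed

lemma prime_sum_0_eq: "prime_sum 0 x = 2 * (\<Sum>p\<in>primes_1_mod_4 \<inter> {1..x}. ln (real p) / real p)"
  unfolding prime_sum_def sum_distrib_left
  by (intro sum.cong refl) (auto simp: tau_0 primes_1_mod_4_def)

text \<open>
  By Mertens' theorem the primes \<open>p \<equiv> 1 (mod 4)\<close> in \<open>(x / K, x]\<close> have \<open>\<Sum> ln p / p \<ge> 1\<close> when the
  constant \<open>K\<close> is large, and each of them is at least \<open>x / (2 * K)\<close>.
\<close>
lemma theta_lower:
  obtains c where "c > 0" "\<And>x. x \<ge> 5 \<Longrightarrow> c * real x \<le> (\<Sum>p\<in>primes_1_mod_4 \<inter> {1..x}. ln (real p))"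
proof -
  obtain C where C: "\<And>x. x \<ge> 1 \<Longrightarrow> \<bar>prime_sum 0 x - ln (real x)\<bar> \<le> C" by (rule prime_sum_0) blast
  \<comment> \<open>The logarithm of \<open>K\<close> has to exceed twice the error term of Mertens' theorem by at least 2.\<close>
  define K where "K = nat \<lceil>exp (2 * C + 3)\<rceil> + 5"
  have K: "ln (real K) \<ge> 2 * C + 3"
  proof -
    have "exp (2 * C + 3) \<le> real K" unfolding K_def of_nat_add using real_nat_ceiling_ge[of "exp (2 * C + 3)"] by linarith
    moreover have "real K > 0" using of_nat_0_less_iff[of K] by (auto simp: K_def simp del: of_nat_add)
    ultimately show ?thesis by (subst ln_ge_iff)
  qed
  have K5: "K \<ge> 5" by (simp add: K_def)
  define th where "th = (\<lambda>x. \<Sum>p\<in>primes_1_mod_4 \<inter> {1..x}. ln (real p))"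
  have big: "real x / (2 * real K) \<le> th x" if x: "x \<ge> K" for x
  proof -
    define y where "y = x div K"
    have d: "K \<ge> 1" using K5 by simp
    note b = real_div_bounds[OF d x]
    have y1: "y \<ge> 1" using b by (simp add: y_def)
    have "y \<le> x" by (simp add: y_def)
    then have split: "primes_1_mod_4 \<inter> {1..x} = (primes_1_mod_4 \<inter> {1..y}) \<union> (primes_1_mod_4 \<inter> {Suc y..x})"
      by auto
    have "prime_sum 0 x - prime_sum 0 y = 2 * (\<Sum>p\<in>primes_1_mod_4 \<inter> {Suc y..x}. ln (real p) / real p)"
      unfolding prime_sum_0_eq split by (subst sum.union_disjoint) auto
    moreover have "ln (real y) \<le> ln (real x / real K)"
      using b y1 by (subst ln_le_cancel_iff) (auto simp: y_def)
    moreover have "ln (real x / real K) = ln (real x) - ln (real K)" using x K5 by (subst ln_div) auto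
    ultimately have "1 \<le> (\<Sum>p\<in>primes_1_mod_4 \<inter> {Suc y..x}. ln (real p) / real p)"
      using C[of x] C[OF y1] K x K5 by linarith
    also have "\<dots> \<le> (\<Sum>p\<in>primes_1_mod_4 \<inter> {Suc y..x}. ln (real p) / (real x / (2 * real K)))"
    proof (intro sum_mono divide_left_mono)
      fix p assume "p \<in> primes_1_mod_4 \<inter> {Suc y..x}"
      then have "y \<le> p" "p \<ge> 1" by auto
      then have "real y \<le> real p" by simp
      then show "real x / (2 * real K) \<le> real p" using b(3) by (simp add: y_def)
      show "0 \<le> ln (real p)" "0 < real p * (real x / (2 * real K))"
        using \<open>p \<ge> 1\<close> x K5 by auto
    qed
    also have "\<dots> = (\<Sum>p\<in>primes_1_mod_4 \<inter> {Suc y..x}. ln (real p)) / (real x / (2 * real K))"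
      by (simp only: sum_divide_distrib)
    also have "\<dots> \<le> th x / (real x / (2 * real K))"
      unfolding th_def split by (intro divide_right_mono sum_mono2) auto
    finally show ?thesis using x K5 by (simp add: field_simps)
  qed
  define c where "c = 1 / (2 * real K)"
  have "c * real x \<le> th x" if x: "x \<ge> 5" for x
  proof (cases "x \<ge> K")
    case False
    have p5: "prime (5::nat)" by simp
    then have "5 \<in> primes_1_mod_4 \<inter> {1..x}" using x by (auto simp: primes_1_mod_4_def)
    then have "ln (real 5) \<le> th x" unfolding th_def by (intro member_le_sum) auto
    moreover have "1 \<le> ln (real 5)" by (subst ln_ge_iff) (use exp_le in auto)
    moreover have "c * real x \<le> 1" using False K5 by (simp add: c_def)
    ultimately show ?thesis by linarith
  qed (use big in \<open>auto simp: c_def\<close>)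
  moreover have "c > 0" using K5 by (simp add: c_def)
  ultimately show thesis using that unfolding th_def by blast
qed

text \<open>
  If the reciprocals of the primes beyond some \<open>N\<close> had sum at most \<open>1/4\<close>, then \<open>\<Sum> ln p / p\<close> over the
  primes up to \<open>x\<close> would be at most \<open>B + ln x / 4\<close>, which is half of its true growth.
\<close>
lemma not_summable_inverse_primes:
  "\<not> summable (\<lambda>p. if p \<in> primes_1_mod_4 then 1 / real p else 0)"
proof
  define f where "f = (\<lambda>p. if p \<in> primes_1_mod_4 then 1 / real p else 0)"
  assume "summable (\<lambda>p. if p \<in> primes_1_mod_4 then 1 / real p else 0)"
  then have "summable f" by (simp add: f_def)
  then obtain N where N: "\<And>m n. m \<ge> N \<Longrightarrow> norm (sum f {m..<n}) < 1 / 4"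
    unfolding summable_Cauchy by (metis zero_less_divide_1_iff zero_less_numeral)
  obtain C where C: "\<And>x. x \<ge> 1 \<Longrightarrow> \<bar>prime_sum 0 x - ln (real x)\<bar> \<le> C" by (rule prime_sum_0) blast
  define B where "B = (\<Sum>p=1..N. ln (real p))"
  have ub: "prime_sum 0 x \<le> 2 * B + ln (real x) / 2" if x: "x \<ge> 1" for x
  proof -
    have "(\<Sum>p\<in>primes_1_mod_4 \<inter> {1..x}. ln (real p) / real p) \<le>
      (\<Sum>p\<in>primes_1_mod_4 \<inter> {1..x}. (if p \<le> N then ln (real p) else 0) + ln (real x) * (if p > N then f p else 0))"
    proof (intro sum_mono)
      fix p assume p: "p \<in> primes_1_mod_4 \<inter> {1..x}"
      then have p1: "p \<ge> 1" "p \<le> x" by auto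
      have "ln (real p) / real p \<le> ln (real p) / 1" using p1 by (intro divide_left_mono) auto
      moreover have "ln (real p) / real p \<le> ln (real x) / real p" using p1 by (intro divide_right_mono) auto
      ultimately show "ln (real p) / real p \<le> (if p \<le> N then ln (real p) else 0) + ln (real x) * (if p > N then f p else 0)"
        using p by (auto simp: f_def)
    qed
    also have "\<dots> = (\<Sum>p\<in>primes_1_mod_4 \<inter> {1..x}. if p \<le> N then ln (real p) else 0)
       + ln (real x) * (\<Sum>p\<in>primes_1_mod_4 \<inter> {1..x}. if p > N then f p else 0)"
      by (simp add: sum.distrib sum_distrib_left)
    also have "(\<Sum>p\<in>primes_1_mod_4 \<inter> {1..x}. if p \<le> N then ln (real p) else 0) \<le> B"
    proof -
      have "(\<Sum>p\<in>primes_1_mod_4 \<inter> {1..x}. if p \<le> N then ln (real p) else 0) =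
            (\<Sum>p\<in>primes_1_mod_4 \<inter> {1..x} \<inter> {..N}. ln (real p))"
        by (simp add: sum.inter_restrict)
      also have "\<dots> \<le> B" unfolding B_def by (intro sum_mono2) auto
      finally show ?thesis .
    qed
    also have "(\<Sum>p\<in>primes_1_mod_4 \<inter> {1..x}. if p > N then f p else 0) \<le> 1 / 4"
    proof -
      have "(\<Sum>p\<in>primes_1_mod_4 \<inter> {1..x}. if p > N then f p else 0) = (\<Sum>p\<in>primes_1_mod_4 \<inter> {1..x} \<inter> {N<..}. f p)"
        by (simp add: sum.inter_restrict)
      also have "\<dots> \<le> sum f {N..<Suc x}" by (intro sum_mono2) (auto simp: f_def)
      also have "\<dots> \<le> 1 / 4" using N[of N "Suc x"] by simp
      finally show ?thesis .
    qed
    finally have "(\<Sum>p\<in>primes_1_mod_4 \<inter> {1..x}. ln (real p) / real p) \<le> B + ln (real x) * (1 / 4)"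
      using x by (simp add: mult_left_mono)
    then show ?thesis unfolding prime_sum_0_eq by simp
  qed
  define x where "x = nat \<lceil>exp (2 * (C + 2 * B + 1))\<rceil>"
  have e: "exp (2 * (C + 2 * B + 1)) \<le> real x" unfolding x_def by (rule real_nat_ceiling_ge)
  then have x0: "real x > 0" using exp_gt_zero less_le_trans by blast
  then have x1: "x \<ge> 1" by simp
  from e x0 have "2 * (C + 2 * B + 1) \<le> ln (real x)" by (subst ln_ge_iff)
  moreover have "ln (real x) - prime_sum 0 x \<le> C" using C[OF x1] by (simp add: abs_le_iff)
  moreover have "prime_sum 0 x \<le> 2 * B + ln (real x) / 2" by (rule ub[OF x1])
  ultimately show False by argo
qed

lemma sum_inverse_primes_unbounded:
  obtains Q where "finite Q" "Q \<subseteq> primes_1_mod_4" "\<And>p. p \<in> Q \<Longrightarrow> p > y" "(\<Sum>p\<in>Q. 1 / real p) \<ge> B"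
proof -
  define f where "f = (\<lambda>p. if p \<in> primes_1_mod_4 then 1 / real p else 0)"
  have "\<exists>x. (\<Sum>p<x. f p) > B + (\<Sum>p\<le>y. f p)"
  proof (rule ccontr)
    assume "\<not> ?thesis"
    then have H: "\<And>x. (\<Sum>p<x. f p) \<le> B + (\<Sum>p\<le>y. f p)" by (simp add: not_less)
    have "summable f"
    proof (rule bounded_imp_summable)
      show "(\<Sum>p\<le>n. f p) \<le> B + (\<Sum>p\<le>y. f p)" for n
        using H[of "Suc n"] by (simp only: lessThan_Suc_atMost)
    qed (simp add: f_def)
    then show False using not_summable_inverse_primes by (simp add: f_def)
  qed
  then obtain x where x: "(\<Sum>p<x. f p) > B + (\<Sum>p\<le>y. f p)" by blast
  define Q where "Q = primes_1_mod_4 \<inter> {y<..<x}"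
  have "(\<Sum>p<x. f p) \<le> (\<Sum>p\<in>{..y} \<union> {y<..<x}. f p)" by (intro sum_mono2) (auto simp: f_def)
  also have "\<dots> = (\<Sum>p\<le>y. f p) + (\<Sum>p\<in>{y<..<x}. f p)" by (intro sum.union_disjoint) auto
  also have "(\<Sum>p\<in>{y<..<x}. f p) = (\<Sum>p\<in>Q. 1 / real p)"
    unfolding Q_def f_def by (subst Int_commute) (simp add: sum.inter_restrict)
  finally have "(\<Sum>p\<in>Q. 1 / real p) \<ge> B" using x by linarith
  then show thesis by (intro that[of Q]) (auto simp: Q_def)
qed

section \<open>Angles of Gaussian primes\<close>

lemma norm_1_Re_mult_cnj:
  assumes "cmod z = 1" "cmod u = 1"
  shows "(2 * (1 + Re (z * cnj u))) ^ m =
    (\<Sum>i\<le>m. \<Sum>j\<le>m. real (m choose i) * real (m choose j) * Re (z ^ i * cnj z ^ j * (cnj u ^ i * u ^ j)))"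
proof -
  define w where "w = z * cnj u"
  have w: "cmod w = 1" using assms by (simp add: w_def norm_mult)
  have "w * cnj w = 1" using w by (simp add: complex_mult_cnj cmod_def)
  then have "of_real (2 * (1 + Re w)) = (w + 1) * (cnj w + 1)"
    by (simp add: algebra_simps complex_add_cnj)
  then have "of_real ((2 * (1 + Re w)) ^ m) = (w + 1) ^ m * (cnj w + 1) ^ m"
    by (simp flip: power_mult_distrib)
  also have "\<dots> = (\<Sum>i\<le>m. of_nat (m choose i) * w ^ i) * (\<Sum>j\<le>m. of_nat (m choose j) * cnj w ^ j)"
    by (simp add: binomial_ring)
  also have "\<dots> = (\<Sum>i\<le>m. \<Sum>j\<le>m. of_nat (m choose i) * of_nat (m choose j) * (z ^ i * cnj z ^ j * (cnj u ^ i * u ^ j)))"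
    unfolding sum_product by (intro sum.cong refl) (simp add: w_def power_mult_distrib mult_ac)
  finally have "Re (of_real ((2 * (1 + Re w)) ^ m)) =
     Re (\<Sum>i\<le>m. \<Sum>j\<le>m. of_nat (m choose i) * of_nat (m choose j) * (z ^ i * cnj z ^ j * (cnj u ^ i * u ^ j)))" by simp
  also have "\<dots> = (\<Sum>i\<le>m. \<Sum>j\<le>m. real (m choose i) * real (m choose j) * Re (z ^ i * cnj z ^ j * (cnj u ^ i * u ^ j)))"
    by (simp flip: of_nat_mult)
  finally show ?thesis by (simp add: w_def)
qed

lemma Re_power_cnj_power:
  assumes "cmod z = 1"
  shows "Re (z ^ i * cnj z ^ j) = Re (z ^ (if i \<le> j then j - i else i - j))"
proof -
  have zc: "z * cnj z = 1" using assms by (simp add: complex_mult_cnj cmod_def)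
  show ?thesis
  proof (cases "i \<le> j")
    case True
    then have "z ^ i * cnj z ^ j = (z * cnj z) ^ i * cnj z ^ (j - i)"
      by (simp add: power_mult_distrib mult.assoc flip: power_add)
    then show ?thesis using True zc by (simp flip: complex_cnj_power)
  next
    case False
    then have "z ^ i * cnj z ^ j = (z * cnj z) ^ j * z ^ (i - j)"
      by (simp add: power_mult_distrib mult_ac flip: power_add)
    then show ?thesis using False zc by simp
  qed
qed

text \<open>
  A power of \<open>\<bar>z + u\<bar>\<^sup>2\<close>, peaked at \<open>z = u\<close>. It is symmetrised in \<open>u\<close> and \<open>cnj u\<close> because only the
  cosines of the multiples of the angles of Gaussian primes are under control.
\<close>
definition angle_kernel :: "nat \<Rightarrow> complex \<Rightarrow> complex \<Rightarrow> real" where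
  "angle_kernel m u z = (2 * (1 + Re (z * cnj u))) ^ m + (2 * (1 + Re (z * u))) ^ m"

lemma angle_kernel_expand:
  assumes z: "cmod z = 1" and u: "cmod u = 1"
  shows "angle_kernel m u z = (\<Sum>i\<le>m. \<Sum>j\<le>m. real (m choose i) * real (m choose j) * Re (u ^ i * cnj u ^ j)
     * (2 * Re (z ^ (if i \<le> j then j - i else i - j))))"
proof -
  have u': "cmod (cnj u) = 1" using u by simp
  have "angle_kernel m u z = (\<Sum>i\<le>m. \<Sum>j\<le>m. real (m choose i) * real (m choose j) *
     (Re (z ^ i * cnj z ^ j * (cnj u ^ i * u ^ j)) + Re (z ^ i * cnj z ^ j * (u ^ i * cnj u ^ j))))"
    unfolding angle_kernel_def norm_1_Re_mult_cnj[OF z u]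
    using norm_1_Re_mult_cnj[OF z u', of m] by (simp add: sum.distrib distrib_left)
  also have "\<dots> = (\<Sum>i\<le>m. \<Sum>j\<le>m. real (m choose i) * real (m choose j) * Re (u ^ i * cnj u ^ j) * (2 * Re (z ^ i * cnj z ^ j)))"
  proof (intro sum.cong refl)
    fix i j
    have "cnj u ^ i * u ^ j = cnj (u ^ i * cnj u ^ j)" by simp
    moreover have "Re (a * cnj b) + Re (a * b) = 2 * Re a * Re b" for a b by simp
    ultimately have "Re (z ^ i * cnj z ^ j * (cnj u ^ i * u ^ j)) + Re (z ^ i * cnj z ^ j * (u ^ i * cnj u ^ j)) =
       2 * Re (z ^ i * cnj z ^ j) * Re (u ^ i * cnj u ^ j)" by metis
    then show "real (m choose i) * real (m choose j) *
     (Re (z ^ i * cnj z ^ j * (cnj u ^ i * u ^ j)) + Re (z ^ i * cnj z ^ j * (u ^ i * cnj u ^ j))) =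
     real (m choose i) * real (m choose j) * Re (u ^ i * cnj u ^ j) * (2 * Re (z ^ i * cnj z ^ j))"
      by (simp only:) (simp only: mult_ac)
  qed
  finally show ?thesis by (simp only: Re_power_cnj_power[OF z])
qed

text \<open>
  The fourth power removes the choice of a unit in \<open>gprime\<close>, and the real part removes the choice
  between \<open>gprime p\<close> and its conjugate.
\<close>
definition angle4 :: "nat \<Rightarrow> complex" where "angle4 p = sgn (gprime p) ^ 4"

lemma angle4:
  assumes "p \<in> primes_1_mod_4"
  shows "cmod (angle4 p) = 1" "tau k p 1 = 2 * Re (angle4 p ^ k)"
proof -
  have p: "prime p" "p mod 4 = 1" using assms by (auto simp: primes_1_mod_4_def)
  then have "gprime p \<noteq> 0" using gauss_pts_nonzero[OF gprime] by (auto simp: prime_gt_0_nat)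
  then show "cmod (angle4 p) = 1" by (simp add: angle4_def norm_power norm_sgn)
  have "p \<noteq> 2" using p by auto
  then show "tau k p 1 = 2 * Re (angle4 p ^ k)" using p by (simp add: tau_def angle4_def power_mult)
qed

text \<open>
  The kernel is a trigonometric polynomial. Its constant term, with coefficient
  \<open>\<Sum> (m choose i)\<^sup>2 = 2 * m choose m\<close>, contributes the multiple of \<open>ln x\<close>, and all other frequencies
  contribute bounded sums.
\<close>
lemma sum_angle_kernel_primes:
  assumes u: "cmod u = 1"
  obtains C where "\<And>x. x \<ge> 1 \<Longrightarrow>
    \<bar>(\<Sum>p\<in>primes_1_mod_4 \<inter> {1..x}. ln (real p) / real p * angle_kernel m u (angle4 p)) - real (2 * m choose m) * ln (real x)\<bar> \<le> C"
proof -
  define a where "a = (\<lambda>i j. real (m choose i) * real (m choose j) * Re (u ^ i * cnj u ^ j))"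
  define e where "e = (\<lambda>i j. if i \<le> j then j - i else (i - j :: nat))"
  have "\<exists>C. \<forall>x\<ge>1. \<bar>prime_sum k x - (if k = 0 then ln (real x) else 0)\<bar> \<le> C" for k
  proof (cases "k = 0")
    case True
    obtain C where "\<And>x. x \<ge> 1 \<Longrightarrow> \<bar>prime_sum 0 x - ln (real x)\<bar> \<le> C" by (rule prime_sum_0) blast
    with True show ?thesis by auto
  next
    case False
    then have "k \<ge> 1" by simp
    then obtain C where "\<And>x. x \<ge> 1 \<Longrightarrow> \<bar>prime_sum k x\<bar> \<le> C" by (rule prime_sum_bounded) blast
    with False show ?thesis by auto
  qed
  then obtain K where K: "\<And>k x. x \<ge> 1 \<Longrightarrow> \<bar>prime_sum k x - (if k = 0 then ln (real x) else 0)\<bar> \<le> K k" by metis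
  have uc: "u * cnj u = 1" using u by (simp add: complex_mult_cnj cmod_def)
  \<comment> \<open>The frequency of the pair \<open>(i, j)\<close> is zero on the diagonal only.\<close>
  have diag: "(\<Sum>i\<le>m. \<Sum>j\<le>m. a i j * (if e i j = 0 then l else 0)) = real (2 * m choose m) * l" for l
  proof -
    have "(\<Sum>i\<le>m. \<Sum>j\<le>m. a i j * (if e i j = 0 then l else 0)) = (\<Sum>i\<le>m. \<Sum>j\<le>m. if j = i then a i j * l else 0)"
      by (intro sum.cong refl) (auto simp: e_def)
    also have "\<dots> = (\<Sum>i\<le>m. a i i * l)" by simp
    also have "\<dots> = (\<Sum>i\<le>m. real ((m choose i)\<^sup>2) * l)"
    proof -
      have "u ^ i * cnj u ^ i = 1" for i by (simp add: uc flip: power_mult_distrib)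
      then show ?thesis by (simp only: a_def) (simp add: power2_eq_square)
    qed
    also have "\<dots> = real (\<Sum>i\<le>m. (m choose i)\<^sup>2) * l" by (simp add: sum_distrib_right)
    finally show ?thesis by (simp add: choose_square_sum)
  qed
  have "\<bar>(\<Sum>p\<in>primes_1_mod_4 \<inter> {1..x}. ln (real p) / real p * angle_kernel m u (angle4 p)) - real (2 * m choose m) * ln (real x)\<bar>
     \<le> (\<Sum>i\<le>m. \<Sum>j\<le>m. \<bar>a i j\<bar> * K (e i j))" if x: "x \<ge> 1" for x
  proof -
    let ?P = "primes_1_mod_4 \<inter> {1..x}"
    have "(\<Sum>p\<in>?P. ln (real p) / real p * angle_kernel m u (angle4 p)) =
       (\<Sum>p\<in>?P. \<Sum>i\<le>m. \<Sum>j\<le>m. a i j * (ln (real p) / real p * tau (e i j) p 1))"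
    proof (intro sum.cong refl)
      fix p assume "p \<in> ?P"
      then have p: "p \<in> primes_1_mod_4" by simp
      show "ln (real p) / real p * angle_kernel m u (angle4 p) = (\<Sum>i\<le>m. \<Sum>j\<le>m. a i j * (ln (real p) / real p * tau (e i j) p 1))"
        unfolding angle_kernel_expand[OF angle4(1)[OF p] u] angle4(2)[OF p] a_def e_def sum_distrib_left
        by (intro sum.cong refl) (simp only: mult_ac)
    qed
    also have "\<dots> = (\<Sum>i\<le>m. \<Sum>p\<in>?P. \<Sum>j\<le>m. a i j * (ln (real p) / real p * tau (e i j) p 1))"
      by (rule sum.swap)
    also have "\<dots> = (\<Sum>i\<le>m. \<Sum>j\<le>m. \<Sum>p\<in>?P. a i j * (ln (real p) / real p * tau (e i j) p 1))"
      by (intro sum.cong refl sum.swap)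
    also have "\<dots> = (\<Sum>i\<le>m. \<Sum>j\<le>m. a i j * prime_sum (e i j) x)"
      by (simp only: prime_sum_def sum_distrib_left)
    finally have "(\<Sum>p\<in>?P. ln (real p) / real p * angle_kernel m u (angle4 p)) - real (2 * m choose m) * ln (real x) =
       (\<Sum>i\<le>m. \<Sum>j\<le>m. a i j * (prime_sum (e i j) x - (if e i j = 0 then ln (real x) else 0)))"
      by (simp only: diag[symmetric] right_diff_distrib sum_subtractf)
    also have "\<bar>\<dots>\<bar> \<le> (\<Sum>i\<le>m. \<Sum>j\<le>m. \<bar>a i j\<bar> * K (e i j))"
      by (rule order.trans[OF sum_abs], intro sum_mono, rule order.trans[OF sum_abs], intro sum_mono)
         (auto simp only: abs_mult intro!: mult_left_mono K[OF x])
    finally show ?thesis .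
  qed
  then show thesis by (rule that)
qed

text \<open>
  The kernel has mean \<open>2 * m choose m\<close>, which is at least \<open>4 ^ m / (2 * m)\<close>, and is exponentially
  smaller than \<open>4 ^ m\<close> away from \<open>u\<close> and \<open>cnj u\<close>. If only finitely many primes had an angle near
  these two points, then the mean over the primes would be too small for large \<open>m\<close>.
\<close>
lemma infinitely_many_primes_near_angle:
  assumes t: "t \<in> {-1..1}" and eps: "\<epsilon> > 0"
  obtains p where "p \<in> primes_1_mod_4" "p > N" "\<bar>Re (angle4 p) - t\<bar> < \<epsilon>"
proof (rule ccontr)
  assume "\<not> thesis"
  then have no: "\<not> \<bar>Re (angle4 p) - t\<bar> < \<epsilon>" if "p \<in> primes_1_mod_4" "p > N" for p
    using \<open>\<And>p. p \<in> primes_1_mod_4 \<Longrightarrow> N < p \<Longrightarrow> \<bar>Re (angle4 p) - t\<bar> < \<epsilon> \<Longrightarrow> thesis\<close> that by blast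
  \<comment> \<open>The point of the upper half of the unit circle with real part \<open>t\<close>.\<close>
  define u where "u = Complex t (sqrt (1 - t\<^sup>2))"
  have "t\<^sup>2 \<le> 1" using t by (simp add: abs_square_le_1 abs_le_iff)
  then have u: "cmod u = 1" by (simp add: u_def cmod_def)
  define d where "d = min \<epsilon> 1"
  have d: "0 < d" "d \<le> 1" "d \<le> \<epsilon>" using eps by (auto simp: d_def)
  have d2: "0 < d\<^sup>2" "d\<^sup>2 \<le> 1" using d by (auto simp: power_le_one)
  \<comment> \<open>On the unit circle, \<open>2 * (1 + Re (z * cnj v)) = 4 - (cmod (z - v))\<^sup>2\<close>.\<close>
  have near: "2 * (1 + Re (z * cnj v)) \<le> 4 - d\<^sup>2" if "cmod z = 1" "cmod v = 1" "\<bar>Re z - Re v\<bar> \<ge> \<epsilon>" for z v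
  proof -
    have "(cmod (z - v))\<^sup>2 = (cmod z)\<^sup>2 + (cmod v)\<^sup>2 - 2 * Re (z * cnj v)"
      unfolding cmod_power2 by (simp add: power2_eq_square algebra_simps)
    then have e: "(cmod (z - v))\<^sup>2 = 2 - 2 * Re (z * cnj v)" using that by simp
    have "\<epsilon> \<le> cmod (z - v)" using that abs_Re_le_cmod[of "z - v"] by simp
    then have "d\<^sup>2 \<le> (cmod (z - v))\<^sup>2" using d by (intro power_mono) auto
    with e show ?thesis by simp
  qed
  have nonneg: "2 * (1 + Re (z * v)) \<ge> 0" if "cmod z = 1" "cmod v = 1" for z v
    using abs_Re_le_cmod[of "z * v"] that by (simp add: norm_mult)
  have far: "angle_kernel m u (angle4 p) \<le> 2 * (4 - d\<^sup>2) ^ m" if p: "p \<in> primes_1_mod_4" "p > N" for p m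
  proof -
    have "\<bar>Re (angle4 p) - t\<bar> \<ge> \<epsilon>" using no[OF p] by simp
    then have R: "\<bar>Re (angle4 p) - Re u\<bar> \<ge> \<epsilon>" "\<bar>Re (angle4 p) - Re (cnj u)\<bar> \<ge> \<epsilon>" by (simp_all add: u_def)
    have u': "cmod (cnj u) = 1" using u by simp
    note a = angle4(1)[OF p(1)]
    have "(2 * (1 + Re (angle4 p * cnj u))) ^ m \<le> (4 - d\<^sup>2) ^ m"
      by (rule power_mono[OF near[OF a u R(1)] nonneg[OF a u']])
    moreover have "(2 * (1 + Re (angle4 p * u))) ^ m \<le> (4 - d\<^sup>2) ^ m"
      using power_mono[OF near[OF a u' R(2)], of m] nonneg[OF a u] by simp
    ultimately show ?thesis by (simp add: angle_kernel_def)
  qed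
  have all: "angle_kernel m u (angle4 p) \<le> 2 * 4 ^ m" if p: "p \<in> primes_1_mod_4" for p m
  proof -
    have "2 * (1 + Re (angle4 p * v)) \<le> 4" if "cmod v = 1" for v
      using abs_Re_le_cmod[of "angle4 p * v"] angle4(1)[OF p] that by (simp add: norm_mult)
    then have "(2 * (1 + Re (angle4 p * v))) ^ m \<le> 4 ^ m" if "cmod v = 1" for v
      using nonneg[OF angle4(1)[OF p] that] that by (intro power_mono) auto
    from this[of u] this[of "cnj u"] u show ?thesis by (simp add: angle_kernel_def)
  qed
  obtain C0 where C0: "\<And>x. x \<ge> 1 \<Longrightarrow> \<bar>prime_sum 0 x - ln (real x)\<bar> \<le> C0" by (rule prime_sum_0) blast
  have C00: "C0 \<ge> 0" using C0[of 1] by linarith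
  \<comment> \<open>Averaging over the primes with weights \<open>ln p / p\<close>, where the primes up to \<open>N\<close> are negligible.\<close>
  have key: "real (2 * m choose m) \<le> (4 - d\<^sup>2) ^ m" for m
  proof (rule ccontr)
    assume "\<not> ?thesis"
    then have gap: "real (2 * m choose m) - (4 - d\<^sup>2) ^ m > 0" by simp
    obtain C where C: "\<And>x. x \<ge> 1 \<Longrightarrow>
      \<bar>(\<Sum>p\<in>primes_1_mod_4 \<inter> {1..x}. ln (real p) / real p * angle_kernel m u (angle4 p)) - real (2 * m choose m) * ln (real x)\<bar> \<le> C"
      by (rule sum_angle_kernel_primes[OF u]) blast
    define B where "B = (\<Sum>p=1..N. ln (real p) / real p * (2 * 4 ^ m))"
    have d4: "(4 - d\<^sup>2) ^ m \<ge> 0" using d2 by simp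
    have ub: "(\<Sum>p\<in>primes_1_mod_4 \<inter> {1..x}. ln (real p) / real p * angle_kernel m u (angle4 p)) \<le> B + (4 - d\<^sup>2) ^ m * prime_sum 0 x" for x
    proof -
      have "(\<Sum>p\<in>primes_1_mod_4 \<inter> {1..x}. ln (real p) / real p * angle_kernel m u (angle4 p)) \<le>
        (\<Sum>p\<in>primes_1_mod_4 \<inter> {1..x}. (if p \<le> N then ln (real p) / real p * (2 * 4 ^ m) else 0) + ln (real p) / real p * (2 * (4 - d\<^sup>2) ^ m))"
      proof (intro sum_mono)
        fix p assume p: "p \<in> primes_1_mod_4 \<inter> {1..x}"
        then have l: "ln (real p) / real p \<ge> 0" by auto
        show "ln (real p) / real p * angle_kernel m u (angle4 p) \<le>
          (if p \<le> N then ln (real p) / real p * (2 * 4 ^ m) else 0) + ln (real p) / real p * (2 * (4 - d\<^sup>2) ^ m)"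
        proof (cases "p \<le> N")
          case True
          have "ln (real p) / real p * angle_kernel m u (angle4 p) \<le> ln (real p) / real p * (2 * 4 ^ m)"
            using p l by (intro mult_left_mono all) auto
          moreover have "ln (real p) / real p * (2 * (4 - d\<^sup>2) ^ m) \<ge> 0"
            using l d4 by (intro mult_nonneg_nonneg) auto
          ultimately show ?thesis using True by simp
        next
          case False
          then have "ln (real p) / real p * angle_kernel m u (angle4 p) \<le> ln (real p) / real p * (2 * (4 - d\<^sup>2) ^ m)"
            using p l by (intro mult_left_mono far) auto
          then show ?thesis using False by simp
        qed
      qed
      also have "\<dots> = (\<Sum>p\<in>primes_1_mod_4 \<inter> {1..x}. if p \<le> N then ln (real p) / real p * (2 * 4 ^ m) else 0) + (4 - d\<^sup>2) ^ m * prime_sum 0 x"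
        unfolding prime_sum_0_eq by (simp add: sum.distrib sum_distrib_left mult_ac)
      also have "(\<Sum>p\<in>primes_1_mod_4 \<inter> {1..x}. if p \<le> N then ln (real p) / real p * (2 * 4 ^ m) else 0) \<le> B"
      proof -
        have "(\<Sum>p\<in>primes_1_mod_4 \<inter> {1..x}. if p \<le> N then ln (real p) / real p * (2 * 4 ^ m) else 0) =
          (\<Sum>p\<in>primes_1_mod_4 \<inter> {1..x} \<inter> {..N}. ln (real p) / real p * (2 * 4 ^ m))"
          by (subst sum.inter_restrict) (auto intro!: sum.cong)
        also have "\<dots> \<le> B" unfolding B_def by (intro sum_mono2) auto
        finally show ?thesis .
      qed
      finally show ?thesis by simp
    qed
    have le: "(real (2 * m choose m) - (4 - d\<^sup>2) ^ m) * ln (real x) \<le> C + B + (4 - d\<^sup>2) ^ m * C0" if x: "x \<ge> 1" for x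
    proof -
      have "(4 - d\<^sup>2) ^ m * prime_sum 0 x \<le> (4 - d\<^sup>2) ^ m * (ln (real x) + C0)"
        using C0[OF x] d4 by (intro mult_left_mono) auto
      then show ?thesis using ub[of x] C[OF x] by (simp add: algebra_simps abs_le_iff)
    qed
    define g where "g = real (2 * m choose m) - (4 - d\<^sup>2) ^ m"
    define x where "x = nat \<lceil>exp ((C + B + (4 - d\<^sup>2) ^ m * C0 + 1) / g)\<rceil>"
    have e: "exp ((C + B + (4 - d\<^sup>2) ^ m * C0 + 1) / g) \<le> real x" unfolding x_def by (rule real_nat_ceiling_ge)
    then have x0: "real x > 0" using exp_gt_zero less_le_trans by blast
    from e x0 have "(C + B + (4 - d\<^sup>2) ^ m * C0 + 1) / g \<le> ln (real x)" by (subst ln_ge_iff)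
    then have "C + B + (4 - d\<^sup>2) ^ m * C0 + 1 \<le> g * ln (real x)" using gap by (simp add: g_def field_simps)
    with le[of x] x0 show False by (simp add: g_def)
  qed
  have "1 / (2 * real m) \<le> (1 - d\<^sup>2 / 4) ^ m" if m: "m > 0" for m
  proof -
    have "4 ^ m / (2 * real m) \<le> (4 - d\<^sup>2) ^ m"
      using central_binomial_lower_bound[OF m] key[of m] by linarith
    also have "(4 - d\<^sup>2) ^ m = 4 ^ m * (1 - d\<^sup>2 / 4) ^ m" by (simp flip: power_mult_distrib)
    finally have "4 ^ m * (1 / (2 * real m)) \<le> 4 ^ m * (1 - d\<^sup>2 / 4) ^ m" by simp
    then show ?thesis by (rule mult_left_le_imp_le) simp
  qed
  then have "1 / 2 \<le> real m * (1 - d\<^sup>2 / 4) ^ m" if "m > 0" for m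
    using that by (simp add: field_simps)
  then have "eventually (\<lambda>m. 1 / 2 \<le> real m * (1 - d\<^sup>2 / 4) ^ m) sequentially"
    by (intro eventually_mono[OF eventually_gt_at_top[of 0]]) auto
  moreover have "(\<lambda>m. real m * (1 - d\<^sup>2 / 4) ^ m) \<longlonglongrightarrow> 0"
    using d2 by (intro powser_times_n_limit_0) auto
  then have "eventually (\<lambda>m. real m * (1 - d\<^sup>2 / 4) ^ m < 1 / 2) sequentially"
    by (intro order_tendstoD) auto
  ultimately have "eventually (\<lambda>m::nat. False) sequentially" by eventually_elim auto
  then show False by simp
qed

section \<open>Divisibility among sums of two squares\<close>

abbreviation "S2 \<equiv> sums_of_two_squares"

lemma S2_pos: "n \<in> S2 \<Longrightarrow> n > 0" by (simp add: sums_of_two_squares_def)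

lemma one_in_S2: "1 \<in> S2"
  using gauss_pts_1 by (simp add: sums_of_two_squares_iff)

lemma S2_prime_mult_iff:
  assumes p: "prime p" "p mod 4 \<noteq> 3"
  shows "p * n \<in> S2 \<longleftrightarrow> n \<in> S2"
  using p(1)
proof (cases rule: prime_mod_4_cases)
  case 1
  then show ?thesis by (simp add: sums_of_two_squares_iff gauss_pts_2_mult)
next
  case 2
  have "gauss_pts (p * n) \<noteq> {} \<longleftrightarrow> gauss_pts n \<noteq> {}"
    unfolding gauss_pts_prime_mult[OF p(1) gprime[OF p(1) 2]] by simp
  then show ?thesis using p prime_gt_0_nat[of p] by (simp add: sums_of_two_squares_iff)
qed (use p in simp)

lemma S2_inert_dvd:
  assumes p: "prime p" "p mod 4 = 3" and n: "p * n \<in> S2"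
  shows "p dvd n \<and> n div p \<in> S2"
proof -
  have "p dvd n" "gauss_pts (n div p) \<noteq> {}"
    using n unfolding sums_of_two_squares_iff gauss_pts_inert_mult[OF p] by (auto split: if_splits)
  moreover have "n > 0" using n S2_pos by (cases n) auto
  ultimately show ?thesis
    using prime_gt_0_nat[OF p(1)] by (auto simp: sums_of_two_squares_iff div_greater_zero_iff dvd_imp_le)
qed

lemma S2_div_prime: "prime p \<Longrightarrow> p mod 4 \<noteq> 3 \<Longrightarrow> p dvd n \<Longrightarrow> n \<in> S2 \<Longrightarrow> n div p \<in> S2"
  using S2_prime_mult_iff[of p "n div p"] by simp

lemma S2_div_inert_square:
  assumes "prime p" "p mod 4 = 3" "p dvd n" "n \<in> S2"
  shows "p\<^sup>2 dvd n" "n div p\<^sup>2 \<in> S2"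
proof -
  from assms obtain m where m: "n = p * m" by auto
  with S2_inert_dvd[OF assms(1,2), of m] assms(4) have "p dvd m" "m div p \<in> S2" by auto
  then obtain l where l: "m = p * l" by auto
  have "p > 0" using assms(1) by (simp add: prime_gt_0_nat)
  then show "p\<^sup>2 dvd n" "n div p\<^sup>2 \<in> S2" using \<open>m div p \<in> S2\<close> by (auto simp: m l power2_eq_square)
qed

lemma S2_div_square:
  assumes "prime p" "p\<^sup>2 dvd n" "n \<in> S2"
  shows "n div p\<^sup>2 \<in> S2"
proof (cases "p mod 4 = 3")
  case True
  have "p dvd n" using assms(2) by (auto simp: power2_eq_square)
  then show ?thesis using S2_div_inert_square(2)[OF assms(1) True] assms(3) by blast
next
  case False
  from assms(2) obtain m where "n = p\<^sup>2 * m" by (rule dvdE)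
  then have m: "n = p * (p * m)" by (simp add: power2_eq_square)
  have "p > 0" using assms(1) by (simp add: prime_gt_0_nat)
  moreover have "m \<in> S2" using assms(3) unfolding m S2_prime_mult_iff[OF assms(1) False] .
  ultimately show ?thesis by (simp add: m power2_eq_square)
qed

lemma S2_div_power:
  assumes p: "prime p" and n: "n \<in> S2" and d: "p ^ j dvd n" and j: "p mod 4 = 3 \<Longrightarrow> even j"
  shows "n div p ^ j \<in> S2"
proof (cases "p mod 4 = 3")
  case False
  show ?thesis using n d
  proof (induction j arbitrary: n)
    case (Suc j)
    have "p dvd n" using Suc.prems by (metis dvd_mult_left power_Suc)
    then have "n div p \<in> S2" using S2_div_prime[OF p False] Suc.prems by blast
    moreover have "p ^ j dvd n div p"
      using Suc.prems p \<open>p dvd n\<close> by (metis dvd_div_iff_mult mult.commute not_prime_0 power_Suc)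
    ultimately have "n div p div p ^ j \<in> S2" by (rule Suc.IH)
    then show ?case by (simp add: div_mult2_eq)
  qed simp
next
  case True
  then obtain i where i: "j = 2 * i" using j by auto
  have "(p\<^sup>2) ^ i dvd n \<Longrightarrow> n div (p\<^sup>2) ^ i \<in> S2" using n
  proof (induction i arbitrary: n)
    case (Suc i)
    have p2: "p\<^sup>2 dvd n" using Suc.prems by (metis dvd_mult_left power_Suc)
    then have "n div p\<^sup>2 \<in> S2" using S2_div_square[OF p] Suc.prems by blast
    moreover have "(p\<^sup>2) ^ i dvd n div p\<^sup>2"
      using Suc.prems p p2 by (metis dvd_div_iff_mult mult.commute not_prime_0 power_Suc power_eq_0_iff)
    ultimately have "n div p\<^sup>2 div (p\<^sup>2) ^ i \<in> S2" using Suc.IH by blast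
    then show ?case by (simp add: div_mult2_eq)
  qed simp
  then show ?thesis using d by (simp add: i power_mult)
qed

lemma S2_inert_multiplicity_even:
  assumes p: "prime p" "p mod 4 = 3" and n: "n \<in> S2"
  shows "even (multiplicity p n)"
proof (rule ccontr)
  assume odd: "odd (multiplicity p n)"
  define v where "v = multiplicity p n"
  have v: "v > 0" "even (v - 1)" using odd by (auto simp: v_def odd_pos)
  have "p ^ (v - 1) dvd n" by (rule multiplicity_dvd') (simp add: v_def)
  then have n': "n div p ^ (v - 1) \<in> S2" using v by (intro S2_div_power[OF p(1) n])
  have pv: "p ^ v dvd n" unfolding v_def by (rule multiplicity_dvd)
  have e: "p ^ v = p ^ (v - 1) * p" using v by (metis Suc_diff_1 power_Suc2)
  have p0: "p ^ (v - 1) \<noteq> 0" using p by auto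
  have "p dvd n div p ^ (v - 1)" using pv p0 \<open>p ^ (v - 1) dvd n\<close> by (metis dvd_div_iff_mult e mult.commute)
  then have "p\<^sup>2 dvd n div p ^ (v - 1)" using S2_div_inert_square(1)[OF p _ n'] by blast
  then have "p ^ (v - 1) * p\<^sup>2 dvd n" using p0 \<open>p ^ (v - 1) dvd n\<close> by (metis dvd_div_iff_mult mult.commute)
  moreover have "p ^ (v - 1) * p\<^sup>2 = p ^ Suc v" using v by (simp add: e power2_eq_square mult_ac)
  ultimately have "p ^ Suc v dvd n" by simp
  moreover have "n \<noteq> 0" "\<not> is_unit p" using S2_pos[OF n] p by auto
  ultimately have "Suc v \<le> v" unfolding v_def by (intro multiplicity_geI) 
  then show False by simp
qed

section \<open>Counting sums of two squares\<close>

text \<open>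
  The set \<open>Q\<close> is empty when all sums of two squares are counted, and a set of sieving primes
  otherwise.
\<close>
definition S2_ind :: "nat set \<Rightarrow> nat \<Rightarrow> real" where
  "S2_ind Q n = (if n \<in> S2 \<and> (\<forall>q\<in>Q. \<not> q dvd n) then 1 else 0)"

definition S2_log_sum :: "nat set \<Rightarrow> nat \<Rightarrow> real" where
  "S2_log_sum Q x = (\<Sum>m=1..x. S2_ind Q m / real m)"

definition S2_count :: "nat \<Rightarrow> real" where
  "S2_count x = real (card (S2 \<inter> {1..x}))"

lemma S2_ind_nonneg: "S2_ind Q n \<ge> 0" by (simp add: S2_ind_def)

lemma S2_ind_le_1: "S2_ind Q n \<le> 1" by (simp add: S2_ind_def)

lemma sum_S2_ind: "(\<Sum>n=1..x. S2_ind Q n) = real (card ({n\<in>S2. \<forall>q\<in>Q. \<not> q dvd n} \<inter> {1..x}))"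
proof -
  have "(\<Sum>n=1..x. S2_ind Q n) = (\<Sum>n\<in>{1..x} \<inter> {n\<in>S2. \<forall>q\<in>Q. \<not> q dvd n}. 1)"
    by (subst sum.inter_restrict) (auto simp: S2_ind_def)
  then show ?thesis by (simp add: Int_commute)
qed

lemma S2_count_eq: "S2_count x = (\<Sum>n=1..x. S2_ind {} n)"
  unfolding S2_count_def sum_S2_ind by simp

text \<open>
  Division of \<open>n\<close> by \<open>p ^ j\<close> does not leave the set, provided that \<open>j\<close> is even if \<open>p\<close> is inert. In
  the inert case only half of the exponents \<open>j\<close> count, but with weight \<open>tau 0 p j = 2\<close>.
\<close>
lemma multiplicity_S2_ind_le:
  assumes p: "prime p" and n: "n > 0"
  shows "real (multiplicity p n) * S2_ind Q n \<le> (\<Sum>j=1..multiplicity p n. tau 0 p j * S2_ind Q (n div p ^ j))"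
proof (cases "S2_ind Q n = 0")
  case False
  then have nS: "n \<in> S2" and nQ: "\<forall>q\<in>Q. \<not> q dvd n" by (auto simp: S2_ind_def split: if_splits)
  define v where "v = multiplicity p n"
  have f1: "S2_ind Q (n div p ^ j) = 1" if "j \<le> v" "p mod 4 = 3 \<Longrightarrow> even j" for j
  proof -
    have d: "p ^ j dvd n" using that by (intro multiplicity_dvd') (simp add: v_def)
    have "n div p ^ j \<in> S2" by (rule S2_div_power[OF p nS d that(2)])
    moreover have "\<forall>q\<in>Q. \<not> q dvd n div p ^ j" using nQ d by (metis dvd_mult_div_cancel dvd_mult)
    ultimately show ?thesis by (simp add: S2_ind_def)
  qed
  have "real v \<le> (\<Sum>j=1..v. tau 0 p j * S2_ind Q (n div p ^ j))"
  proof (cases "p mod 4 = 3")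
    case True
    then have p2: "p \<noteq> 2" by auto
    have "even v" unfolding v_def by (rule S2_inert_multiplicity_even[OF p True nS])
    then have "real v = (\<Sum>j=1..v. if even j then 2 else 0)"
    proof -
      have "(\<Sum>j=1..2*i. if even j then 2 else 0) = 2 * real i" for i by (induction i) auto
      with \<open>even v\<close> show ?thesis by (auto elim!: evenE)
    qed
    also have "\<dots> \<le> (\<Sum>j=1..v. tau 0 p j * S2_ind Q (n div p ^ j))"
      by (intro sum_mono) (use True p2 f1 in \<open>auto simp: tau_0\<close>)
    finally show ?thesis .
  next
    case False
    have "tau 0 p j \<ge> 1" for j using False p by (auto simp: tau_0 elim: prime_mod_4_cases)
    then have "(\<Sum>j=1..v. 1) \<le> (\<Sum>j=1..v. tau 0 p j * S2_ind Q (n div p ^ j))"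
      by (intro sum_mono) (use f1 False in auto)
    then show ?thesis by simp
  qed
  moreover have "S2_ind Q n = 1" using False by (simp add: S2_ind_def split: if_splits)
  ultimately show ?thesis by (simp add: v_def)
qed (auto intro!: sum_nonneg mult_nonneg_nonneg simp: S2_ind_nonneg tau_0)

lemma S2_ind_ln_le_conv:
  assumes n: "n > 0"
  shows "S2_ind Q n * ln (real n) \<le> (\<Sum>d | d dvd n. Lam 0 d * S2_ind Q (n div d))"
proof -
  have "S2_ind Q n * ln (real n) = (\<Sum>p\<in>prime_factors n. ln (real p) * (real (multiplicity p n) * S2_ind Q n))"
    unfolding ln_eq_sum_multiplicity[OF n] sum_distrib_left by (intro sum.cong refl) simp
  also have "\<dots> \<le> (\<Sum>p\<in>prime_factors n. ln (real p) * (\<Sum>j=1..multiplicity p n. tau 0 p j * S2_ind Q (n div p ^ j)))"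
  proof (intro sum_mono mult_left_mono multiplicity_S2_ind_le n)
    fix p assume "p \<in> prime_factors n"
    then show "prime p" "0 \<le> ln (real p)" by (auto simp: in_prime_factors_iff prime_ge_1_nat)
  qed
  finally show ?thesis using sum_divisors_Lam[OF n] by simp
qed

text \<open>
  The indicator times \<open>ln\<close> is at most its convolution with \<open>Lam 0\<close>, whose summatory function is
  \<open>O x\<close>. Replacing \<open>ln n\<close> by \<open>ln x\<close> costs \<open>ln (x / n) \<le> x / n\<close> per term.
\<close>
lemma count_S2_ind_upper: "(\<Sum>n=1..x. S2_ind Q n) * ln (real x) \<le> 9 * real x * S2_log_sum Q x"
proof (cases "x = 0")
  case False
  have "(\<Sum>n=1..x. S2_ind Q n * ln (real n)) \<le> (\<Sum>n=1..x. \<Sum>d | d dvd n. Lam 0 d * S2_ind Q (n div d))"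
    by (intro sum_mono S2_ind_ln_le_conv) auto
  also have "\<dots> = (\<Sum>n=1..x. \<Sum>d | d dvd n. S2_ind Q d * Lam 0 (n div d))"
    by (intro sum.cong refl dconv_commute[unfolded dconv_def]) auto
  also have "\<dots> = (\<Sum>m=1..x. S2_ind Q m * (\<Sum>d=1..x div m. Lam 0 d))"
    by (rule sum_dirichlet_conv)
  also have "\<dots> \<le> (\<Sum>m=1..x. 8 * real x * (S2_ind Q m / real m))"
  proof (intro sum_mono)
    fix m assume "m \<in> {1..x}"
    then have "real (x div m) \<le> real x / real m" by (intro real_div_bounds) auto
    then have "(\<Sum>d=1..x div m. Lam 0 d) \<le> 8 * (real x / real m)"
      using sum_Lam_0_le[of "x div m"] by linarith
    then have "S2_ind Q m * (\<Sum>d=1..x div m. Lam 0 d) \<le> S2_ind Q m * (8 * (real x / real m))"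
      by (rule mult_left_mono) (rule S2_ind_nonneg)
    then show "S2_ind Q m * (\<Sum>d=1..x div m. Lam 0 d) \<le> 8 * real x * (S2_ind Q m / real m)" by (simp add: mult_ac)
  qed
  also have "\<dots> = 8 * real x * S2_log_sum Q x" by (simp only: S2_log_sum_def sum_distrib_left)
  finally have 1: "(\<Sum>n=1..x. S2_ind Q n * ln (real n)) \<le> 8 * real x * S2_log_sum Q x" .
  have "(\<Sum>n=1..x. S2_ind Q n * ln (real x / real n)) \<le> (\<Sum>n=1..x. real x * (S2_ind Q n / real n))"
  proof (intro sum_mono)
    fix n assume n: "n \<in> {1..x}"
    have "ln (real x / real n) \<le> real x / real n - 1" using n by (intro ln_le_minus_one) auto
    then have "S2_ind Q n * ln (real x / real n) \<le> S2_ind Q n * (real x / real n)"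
      by (intro mult_left_mono S2_ind_nonneg) auto
    then show "S2_ind Q n * ln (real x / real n) \<le> real x * (S2_ind Q n / real n)" by (simp add: mult.commute)
  qed
  also have "\<dots> = real x * S2_log_sum Q x" by (simp only: S2_log_sum_def sum_distrib_left)
  finally have 2: "(\<Sum>n=1..x. S2_ind Q n * ln (real x / real n)) \<le> real x * S2_log_sum Q x" .
  have "(\<Sum>n=1..x. S2_ind Q n) * ln (real x) = (\<Sum>n=1..x. S2_ind Q n * ln (real n)) + (\<Sum>n=1..x. S2_ind Q n * ln (real x / real n))"
    unfolding sum_distrib_right sum.distrib[symmetric]
    by (intro sum.cong refl) (use False in \<open>auto simp: ln_div algebra_simps\<close>)
  with 1 2 show ?thesis by simp
qed (simp add: S2_log_sum_def)

lemma S2_log_sum_mono: "x \<le> y \<Longrightarrow> S2_log_sum Q x \<le> S2_log_sum Q y"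
  unfolding S2_log_sum_def by (intro sum_mono2) (auto simp: S2_ind_nonneg)

lemma S2_log_sum_ge_1: "x \<ge> 1 \<Longrightarrow> S2_log_sum {} x \<ge> 1"
proof -
  assume "x \<ge> 1"
  then have "S2_ind {} 1 / real 1 \<le> S2_log_sum {} x"
    unfolding S2_log_sum_def by (intro member_le_sum) (auto simp: S2_ind_nonneg)
  then show ?thesis using one_in_S2 by (simp add: S2_ind_def)
qed

text \<open>
  Each of the at most \<open>x\<close> terms with \<open>m > x div D\<close> is below \<open>D / x\<close>.
\<close>
lemma S2_log_sum_div_le:
  assumes D: "D \<ge> 1"
  shows "S2_log_sum Q x \<le> S2_log_sum Q (x div D) + real D"
proof -
  define y where "y = x div D"
  have yx: "y \<le> x" by (simp add: y_def)
  have split: "{1..x} = {1..y} \<union> {Suc y..x}" using yx by auto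
  have "S2_log_sum Q x = S2_log_sum Q y + (\<Sum>m=Suc y..x. S2_ind Q m / real m)"
    unfolding S2_log_sum_def split by (subst sum.union_disjoint) auto
  also have "(\<Sum>m=Suc y..x. S2_ind Q m / real m) \<le> (\<Sum>m=Suc y..x. 1 / real (Suc y))"
    by (intro sum_mono frac_le) (auto simp: S2_ind_le_1)
  also have "\<dots> = real (x - y) / real (Suc y)" by (simp add: Suc_diff_le)
  also have "\<dots> \<le> real D"
  proof -
    have "x = D * y + x mod D" by (simp add: y_def)
    moreover have "x mod D < D" using D by simp
    ultimately have "x - y \<le> D * Suc y" by (simp add: algebra_simps)
    then have "real (x - y) \<le> real (D * Suc y)" by (simp only: of_nat_le_iff)
    then show ?thesis by (simp add: divide_le_eq algebra_simps)
  qed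
  finally show ?thesis by (simp add: y_def)
qed

text \<open>
  Multiplying a sum of two squares by a prime \<open>p \<equiv> 1 (mod 4)\<close> gives a sum of two squares. In the sum
  of \<open>ln p\<close> over all products \<open>n = m * p \<le> x\<close>, each \<open>n\<close> is counted with weight at most \<open>ln n\<close>, and
  for each \<open>m\<close> the primes \<open>p \<le> x / m\<close> contribute at least a constant times \<open>x / m\<close>.
\<close>
lemma S2_count_lower:
  obtains c where "c > 0" "\<And>x. x \<ge> 5 \<Longrightarrow> c * real x * S2_log_sum {} x \<le> S2_count x * ln (real x)"
proof -
  obtain c where c: "c > 0" "\<And>x. x \<ge> 5 \<Longrightarrow> c * real x \<le> (\<Sum>p\<in>primes_1_mod_4 \<inter> {1..x}. ln (real p))"
    by (rule theta_lower) blast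
  \<comment> \<open>Logarithms of primes \<open>1 (mod 4)\<close>; it is bounded by the von Mangoldt function, whose divisor
    sum is the logarithm.\<close>
  define a where "a = (\<lambda>d. if d \<in> primes_1_mod_4 then ln (real d) else 0)"
  have main: "c / 12 * real x * S2_log_sum {} x \<le> S2_count x * ln (real x)" if x: "x \<ge> 5" for x
  proof -
    have th: "(\<Sum>d=1..y. a d) = (\<Sum>p\<in>primes_1_mod_4 \<inter> {1..y}. ln (real p))" for y
      unfolding a_def by (subst Int_commute) (simp add: sum.inter_restrict)
    have a0: "a d \<ge> 0" for d
    proof (cases "d \<in> primes_1_mod_4")
      case True
      then have "d \<ge> 1" by (auto simp: primes_1_mod_4_def prime_ge_1_nat)
      then show ?thesis by (simp add: a_def)
    qed (simp add: a_def)
    have "c / 2 * real x * S2_log_sum {} (x div 5) = (\<Sum>m=1..x div 5. S2_ind {} m * (c * (real x / (2 * real m))))"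
      by (simp add: S2_log_sum_def sum_distrib_left mult_ac)
    also have "\<dots> \<le> (\<Sum>m=1..x div 5. S2_ind {} m * (\<Sum>d=1..x div m. a d))"
    proof (intro sum_mono mult_left_mono S2_ind_nonneg)
      fix m assume m: "m \<in> {1..x div 5}"
      then have "m * 5 \<le> x" by (simp add: less_eq_div_iff_mult_less_eq)
      then have "5 \<le> x div m" using m by (simp add: less_eq_div_iff_mult_less_eq mult.commute)
      then have "c * real (x div m) \<le> (\<Sum>d=1..x div m. a d)" unfolding th by (rule c(2))
      moreover have "real x / (2 * real m) \<le> real (x div m)"
        using m by (intro real_div_bounds) auto
      ultimately show "c * (real x / (2 * real m)) \<le> (\<Sum>d=1..x div m. a d)"
        using c(1) by (meson mult_left_mono order.trans less_imp_le)
    qed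
    also have "\<dots> \<le> (\<Sum>m=1..x. S2_ind {} m * (\<Sum>d=1..x div m. a d))"
      by (intro sum_mono2) (auto intro!: mult_nonneg_nonneg sum_nonneg simp: S2_ind_nonneg a0)
    also have "\<dots> = (\<Sum>n=1..x. \<Sum>d | d dvd n. S2_ind {} d * a (n div d))"
      by (rule sum_dirichlet_conv[symmetric])
    also have "\<dots> = (\<Sum>n=1..x. \<Sum>d | d dvd n. a d * S2_ind {} (n div d))"
      by (intro sum.cong refl dconv_commute[unfolded dconv_def]) auto
    also have "\<dots> \<le> (\<Sum>n=1..x. S2_ind {} n * ln (real x))"
    proof (intro sum_mono)
      fix n assume n: "n \<in> {1..x}"
      have "(\<Sum>d | d dvd n. a d * S2_ind {} (n div d)) \<le> (\<Sum>d | d dvd n. mangoldt d * S2_ind {} n)"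
      proof (intro sum_mono)
        fix d assume d: "d \<in> {d. d dvd n}"
        show "a d * S2_ind {} (n div d) \<le> mangoldt d * S2_ind {} n"
        proof (cases "d \<in> primes_1_mod_4")
          case True
          then have p: "prime d" "d mod 4 \<noteq> 3" by (auto simp: primes_1_mod_4_def)
          then have "S2_ind {} (n div d) = S2_ind {} n" using S2_prime_mult_iff[of d "n div d"] d by (simp add: S2_ind_def)
          then show ?thesis using True p by (simp add: a_def)
        qed (simp add: a_def mangoldt_nonneg S2_ind_nonneg)
      qed
      also have "\<dots> = (\<Sum>d | d dvd n. mangoldt d) * S2_ind {} n" by (simp only: sum_distrib_right)
      also have "\<dots> = ln (real n) * S2_ind {} n" using n by (simp add: mangoldt_sum)
      also have "\<dots> \<le> ln (real x) * S2_ind {} n" using n by (intro mult_right_mono S2_ind_nonneg) auto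
      finally show "(\<Sum>d | d dvd n. a d * S2_ind {} (n div d)) \<le> S2_ind {} n * ln (real x)" by (simp add: mult.commute)
    qed
    also have "\<dots> = S2_count x * ln (real x)" by (simp add: S2_count_eq sum_distrib_right)
    finally have 1: "c / 2 * real x * S2_log_sum {} (x div 5) \<le> S2_count x * ln (real x)" .
    have "S2_log_sum {} x \<le> S2_log_sum {} (x div 5) + 5" using S2_log_sum_div_le[of 5 "{}" x] by simp
    moreover have "S2_log_sum {} (x div 5) \<ge> 1" using x by (intro S2_log_sum_ge_1) (simp add: Suc_le_eq div_greater_zero_iff)
    ultimately have "S2_log_sum {} x \<le> 6 * S2_log_sum {} (x div 5)" by linarith
    then have "c / 12 * real x * S2_log_sum {} x \<le> c / 12 * real x * (6 * S2_log_sum {} (x div 5))"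
      using c(1) by (intro mult_left_mono) auto
    also have "\<dots> = c / 2 * real x * S2_log_sum {} (x div 5)" by simp
    finally show ?thesis using 1 by linarith
  qed
  show thesis by (rule that[of "c / 12"]) (use c main in auto)
qed

text \<open>
  Compare the upper bound for \<open>S2_count (X div d)\<close> with the lower bound for \<open>S2_count X\<close>; the
  logarithmic sum is monotone, and the quotient of the logarithms of \<open>X\<close> and of \<open>X / d\<close> is
  \<open>O (1 + ln d)\<close>.
\<close>
lemma S2_count_regular:
  obtains C where "C > 0" "\<And>X d. X \<ge> 5 \<Longrightarrow> d \<ge> 1 \<Longrightarrow> S2_count (X div d) \<le> C * ((1 + ln (real d)) / real d) * S2_count X"
proof -
  obtain c where c: "c > 0" "\<And>x. x \<ge> 5 \<Longrightarrow> c * real x * S2_log_sum {} x \<le> S2_count x * ln (real x)"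
    by (rule S2_count_lower) blast
  have "S2_count (X div d) \<le> 10 / c * ((1 + ln (real d)) / real d) * S2_count X" if X: "X \<ge> 5" and d: "d \<ge> 1" for X d
  proof (cases "d \<le> X")
    case False
    then have "X div d = 0" by simp
    then have "S2_count (X div d) = 0" by (simp add: S2_count_def)
    moreover have "0 \<le> 10 / c * ((1 + ln (real d)) / real d) * S2_count X"
      using c(1) d by (intro mult_nonneg_nonneg divide_nonneg_nonneg) (auto simp: S2_count_def)
    ultimately show ?thesis by simp
  next
    case True
    define Y where "Y = X div d"
    note b = real_div_bounds[OF d True]
    have Y: "Y \<ge> 1" using b by (simp add: Y_def)
    have "S2_count Y \<le> real Y"
    proof -
      have "card (S2 \<inter> {1..Y}) \<le> card {1..Y}" by (intro card_mono) auto
      then show ?thesis by (simp add: S2_count_def)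
    qed
    also have "\<dots> \<le> real Y * S2_log_sum {} Y" using S2_log_sum_ge_1[OF Y] by (simp add: mult_le_cancel_left1)
    finally have "S2_count Y * (1 + ln (real Y)) \<le> 10 * real Y * S2_log_sum {} Y"
      using count_S2_ind_upper[where Q = "{}" and x = Y] unfolding S2_count_eq[symmetric] distrib_left by simp
    also have "\<dots> \<le> 10 * (real X / real d) * S2_log_sum {} X"
      using b S2_log_sum_ge_1[OF Y] by (intro mult_mono S2_log_sum_mono) (auto simp: Y_def)
    finally have 1: "S2_count Y * (1 + ln (real Y)) \<le> 10 * (real X / real d) * S2_log_sum {} X" .
    \<comment> \<open>The additive form \<open>ln X \<le> 1 + ln d + ln Y\<close> is weakened to a product so that \<open>1 + ln Y\<close>
      cancels.\<close>
    have 2: "ln (real X) \<le> (1 + ln (real d)) * (1 + ln (real Y))"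
    proof -
      have ld: "ln (real d) \<ge> 0" "ln (real Y) \<ge> 0" using d Y by auto
      have "real X \<le> 2 * (real d * real Y)" using b(3) d by (simp add: Y_def field_simps)
      then have "ln (real X) \<le> ln (2 * (real d * real Y))" using X d Y by (subst ln_le_cancel_iff) auto
      also have "\<dots> = ln 2 + (ln (real d) + ln (real Y))" using d Y by (simp add: ln_mult)
      also have "\<dots> \<le> 1 + (ln (real d) + ln (real Y))" using ln_le_minus_one[of "2::real"] by simp
      also have "\<dots> \<le> (1 + ln (real d)) * (1 + ln (real Y))" using ld by (simp add: algebra_simps)
      finally show ?thesis .
    qed
    have "S2_count Y * ln (real X) \<le> S2_count Y * ((1 + ln (real d)) * (1 + ln (real Y)))"
      by (rule mult_left_mono[OF 2]) (simp add: S2_count_def)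
    also have "\<dots> = (1 + ln (real d)) * (S2_count Y * (1 + ln (real Y)))" by simp
    also have "\<dots> \<le> (1 + ln (real d)) * (10 * (real X / real d) * S2_log_sum {} X)"
      using d by (intro mult_left_mono 1) auto
    also have "\<dots> = 10 / c * ((1 + ln (real d)) / real d) * (c * real X * S2_log_sum {} X)"
    proof -
      have "10 / c * (e / real d) * (c * real X * S2_log_sum {} X) = e * (10 * (real X / real d) * S2_log_sum {} X)" for e
        using c(1) by (simp add: divide_simps)
      then show ?thesis by (rule sym)
    qed
    also have "\<dots> \<le> 10 / c * ((1 + ln (real d)) / real d) * (S2_count X * ln (real X))"
      using c(1) d by (intro mult_left_mono c(2) X) auto
    finally have F: "S2_count Y * ln (real X) \<le> (10 / c * ((1 + ln (real d)) / real d) * S2_count X) * ln (real X)"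
      by (simp only: mult.assoc)
    have "ln (real X) > 0" using X by (intro ln_gt_zero) auto
    with F show ?thesis unfolding Y_def[symmetric] by (rule mult_right_le_imp_le)
  qed
  then show thesis using that[of "10 / c"] c(1) by simp
qed

section \<open>Sets of small relative density\<close>

text \<open>
  Densities are relative to the set of sums of two squares.
\<close>
definition upper_density_le :: "real \<Rightarrow> nat set \<Rightarrow> bool" where
  "upper_density_le \<epsilon> A \<longleftrightarrow> (\<forall>\<^sub>F X in sequentially. real (card (A \<inter> {1..X})) \<le> \<epsilon> * S2_count X)"

definition null_density :: "nat set \<Rightarrow> bool" where
  "null_density A \<longleftrightarrow> (\<forall>\<epsilon>>0. upper_density_le \<epsilon> A)"

lemma upper_density_le_subset_Un:
  assumes "upper_density_le e A" "upper_density_le e' B" "C \<subseteq> A \<union> B"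
  shows "upper_density_le (e + e') C"
  using assms(1,2) unfolding upper_density_le_def
proof eventually_elim
  case (elim X)
  have "card (C \<inter> {1..X}) \<le> card ((A \<inter> {1..X}) \<union> (B \<inter> {1..X}))"
    using assms(3) by (intro card_mono) auto
  also have "\<dots> \<le> card (A \<inter> {1..X}) + card (B \<inter> {1..X})" by (rule card_Un_le)
  finally have "real (card (C \<inter> {1..X})) \<le> real (card (A \<inter> {1..X})) + real (card (B \<inter> {1..X}))"
    unfolding of_nat_add[symmetric] of_nat_le_iff .
  with elim show ?case by (simp add: distrib_right)
qed

lemma upper_density_le_mono:
  assumes "upper_density_le e A" "C \<subseteq> A" "e \<le> e'"
  shows "upper_density_le e' C"
  using assms(1) unfolding upper_density_le_def
proof eventually_elim
  case (elim X)
  have "card (C \<inter> {1..X}) \<le> card (A \<inter> {1..X})" using assms(2) by (intro card_mono) auto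
  then have "real (card (C \<inter> {1..X})) \<le> e * S2_count X" using elim by linarith
  also have "\<dots> \<le> e' * S2_count X" using assms(3) by (intro mult_right_mono) (auto simp: S2_count_def)
  finally show ?case .
qed

lemma card_S2_dvd_le:
  assumes d: "d \<ge> 1"
  shows "real (card ({n\<in>S2. d dvd n \<and> n div d \<in> S2} \<inter> {1..X})) \<le> S2_count (X div d)"
proof -
  have "card ({n\<in>S2. d dvd n \<and> n div d \<in> S2} \<inter> {1..X}) \<le> card (S2 \<inter> {1..X div d})"
  proof (rule card_inj_on_le[where f = "\<lambda>n. n div d"])
    show "inj_on (\<lambda>n. n div d) ({n\<in>S2. d dvd n \<and> n div d \<in> S2} \<inter> {1..X})"
      by (auto simp: inj_on_def dvd_def)
    show "(\<lambda>n. n div d) ` ({n\<in>S2. d dvd n \<and> n div d \<in> S2} \<inter> {1..X}) \<subseteq> S2 \<inter> {1..X div d}"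
      using S2_pos by (auto simp: div_le_mono Suc_le_eq)
  qed auto
  then show ?thesis by (simp add: S2_count_def)
qed

lemma card_S2_UN_dvd_le:
  assumes C: "\<And>d. d \<ge> 1 \<Longrightarrow> S2_count (X div d) \<le> C * ((1 + ln (real d)) / real d) * S2_count X"
    and I: "finite I" "\<And>i. i \<in> I \<Longrightarrow> d i \<ge> 1"
    and A: "A \<inter> {1..X} \<subseteq> (\<Union>i\<in>I. {n\<in>S2. d i dvd n \<and> n div d i \<in> S2})"
  shows "real (card (A \<inter> {1..X})) \<le> C * (\<Sum>i\<in>I. (1 + ln (real (d i))) / real (d i)) * S2_count X"
proof -
  have "card (A \<inter> {1..X}) \<le> card (\<Union>i\<in>I. {n\<in>S2. d i dvd n \<and> n div d i \<in> S2} \<inter> {1..X})"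
    using A I(1) by (intro card_mono) auto
  also have "\<dots> \<le> (\<Sum>i\<in>I. card ({n\<in>S2. d i dvd n \<and> n div d i \<in> S2} \<inter> {1..X}))"
    by (rule card_UN_le[OF I(1)])
  finally have "real (card (A \<inter> {1..X})) \<le> (\<Sum>i\<in>I. real (card ({n\<in>S2. d i dvd n \<and> n div d i \<in> S2} \<inter> {1..X})))"
    unfolding of_nat_sum[symmetric] of_nat_le_iff .
  also have "\<dots> \<le> (\<Sum>i\<in>I. C * ((1 + ln (real (d i))) / real (d i)) * S2_count X)"
    using I(2) by (intro sum_mono order.trans[OF card_S2_dvd_le C]) auto
  also have "\<dots> = C * (\<Sum>i\<in>I. (1 + ln (real (d i))) / real (d i)) * S2_count X"
    by (simp add: sum_distrib_left sum_distrib_right)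
  finally show ?thesis .
qed

lemma one_plus_ln_le: "d \<ge> 1 \<Longrightarrow> 1 + ln (real d) \<le> 3 * sqrt (real d)"
proof -
  assume "d \<ge> 1"
  then have "ln (real d) \<le> 2 * sqrt (real d)" "1 \<le> sqrt (real d)" by (auto intro: ln_le_2_sqrt)
  then show ?thesis by linarith
qed

lemma tail_inverse_n_sqrt_le:
  assumes "y \<ge> 1"
  shows "(\<Sum>n=Suc y..x. 1 / (real n * sqrt (real n))) \<le> 4 / sqrt (real y)"
proof (cases "y \<le> x")
  case True
  have "(\<Sum>n=Suc y..x. 1 / (real n * sqrt (real n))) \<le> 4 / sqrt (real (Suc y)) - 4 / sqrt (real (Suc x))"
    using True
  proof (induction x rule: dec_induct)
    case (step x)
    define a where "a = real (Suc x)"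
    have a: "a \<ge> 1" "sqrt a > 0" by (auto simp: a_def)
    have "sqrt a * (a + 1) \<le> sqrt a * (2 * a)" using a by (intro mult_left_mono) auto
    then have "2 / (sqrt a * (2 * a)) \<le> 2 / (sqrt a * (a + 1))" using a by (intro divide_left_mono) auto
    moreover have "2 / (sqrt a * (2 * a)) = 1 / (a * sqrt a)" using a by (simp add: field_simps)
    ultimately have "1 / (a * sqrt a) \<le> 2 * (1 / (sqrt a * (a + 1)))" by simp
    also have "\<dots> \<le> 2 * (2 * (1 / sqrt (Suc x) - 1 / sqrt (Suc x + 1)))"
      unfolding a_def using inverse_sqrt_diff[of "Suc x"] by (intro mult_left_mono) (auto simp: add.commute)
    finally show ?case using step by (simp add: a_def add.commute)
  qed simp
  also have "\<dots> \<le> 4 / sqrt (real (Suc y))" by simp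
  also have "\<dots> \<le> 4 / sqrt (real y)" using assms by (intro divide_left_mono) auto
  finally show ?thesis .
qed (use assms in simp)

text \<open>
  Dividing a sum of two squares by \<open>p\<^sup>2\<close> gives a sum of two squares, and the sum of
  \<open>(1 + ln p\<^sup>2) / p\<^sup>2\<close> over \<open>p > y\<close> tends to 0.
\<close>
lemma large_square_divisor_density:
  assumes e: "\<epsilon> > 0"
  obtains y where "y \<ge> 5" "upper_density_le \<epsilon> {n\<in>S2. \<exists>p. prime p \<and> p > y \<and> p\<^sup>2 dvd n}"
proof -
  obtain C where C: "C > 0" "\<And>X d. X \<ge> 5 \<Longrightarrow> d \<ge> 1 \<Longrightarrow> S2_count (X div d) \<le> C * ((1 + ln (real d)) / real d) * S2_count X"
    by (rule S2_count_regular) blast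
  define y where "y = nat \<lceil>(20 * C / \<epsilon>)\<^sup>2\<rceil> + 5"
  have y5: "y \<ge> 5" by (simp add: y_def)
  have "(20 * C / \<epsilon>)\<^sup>2 \<le> real y" unfolding y_def of_nat_add using real_nat_ceiling_ge[of "(20 * C / \<epsilon>)\<^sup>2"] by linarith
  then have "20 * C / \<epsilon> \<le> sqrt (real y)" by (rule real_le_rsqrt)
  then have yC: "20 * C / sqrt (real y) \<le> \<epsilon>" using e y5 C(1) by (simp add: field_simps)
  define A where "A = {n\<in>S2. \<exists>p. prime p \<and> p > y \<and> p\<^sup>2 dvd n}"
  have "upper_density_le \<epsilon> A"
    unfolding upper_density_le_def eventually_sequentially
  proof (intro exI[of _ 5] allI impI)
    fix X :: nat assume X: "X \<ge> 5"
    have "A \<inter> {1..X} \<subseteq> (\<Union>p\<in>{p\<in>{Suc y..X}. prime p}. {n\<in>S2. p\<^sup>2 dvd n \<and> n div p\<^sup>2 \<in> S2})"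
    proof
      fix n assume n: "n \<in> A \<inter> {1..X}"
      then obtain p where p: "n \<in> S2" "prime p" "p > y" "p\<^sup>2 dvd n" "n \<ge> 1" "n \<le> X" by (auto simp: A_def)
      have "p\<^sup>2 \<le> n" using p by (intro dvd_imp_le) auto
      moreover have "p \<le> p\<^sup>2" by (simp add: power2_eq_square)
      ultimately have "p \<le> X" using p by linarith
      then show "n \<in> (\<Union>p\<in>{p\<in>{Suc y..X}. prime p}. {n\<in>S2. p\<^sup>2 dvd n \<and> n div p\<^sup>2 \<in> S2})"
        using p S2_div_square[OF p(2,4,1)] by (intro UN_I[of p]) auto
    qed
    then have "real (card (A \<inter> {1..X})) \<le> C * (\<Sum>p\<in>{p\<in>{Suc y..X}. prime p}. (1 + ln (real (p\<^sup>2))) / real (p\<^sup>2)) * S2_count X"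
      by (intro card_S2_UN_dvd_le C X) auto
    also have "\<dots> \<le> C * (\<Sum>p=Suc y..X. 5 * (1 / (real p * sqrt (real p)))) * S2_count X"
    proof (intro mult_right_mono mult_left_mono)
      have "(\<Sum>p\<in>{p\<in>{Suc y..X}. prime p}. (1 + ln (real (p\<^sup>2))) / real (p\<^sup>2)) \<le> (\<Sum>p=Suc y..X. (1 + ln (real (p\<^sup>2))) / real (p\<^sup>2))"
        by (intro sum_mono2) (auto intro!: divide_nonneg_nonneg add_nonneg_nonneg ln_ge_zero)
      also have "\<dots> \<le> (\<Sum>p=Suc y..X. 5 * (1 / (real p * sqrt (real p))))"
      proof (intro sum_mono)
        fix p assume "p \<in> {Suc y..X}"
        then have p: "real p \<ge> 1" "real p > 0" by auto
        have "ln (real (p\<^sup>2)) = 2 * ln (real p)" using p by (simp add: ln_realpow)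
        also have "\<dots> \<le> 2 * (2 * sqrt (real p))" using p by (intro mult_left_mono ln_le_2_sqrt) auto
        finally have "1 + ln (real (p\<^sup>2)) \<le> 5 * sqrt (real p)" using p real_sqrt_ge_one[of "real p"] by linarith
        then have "(1 + ln (real (p\<^sup>2))) / real (p\<^sup>2) \<le> 5 * sqrt (real p) / real (p\<^sup>2)" by (intro divide_right_mono) auto
        also have "\<dots> = 5 * (sqrt (real p) / (real p * (sqrt (real p) * sqrt (real p))))" using p by (simp add: power2_eq_square)
        also have "\<dots> = 5 * (1 / (real p * sqrt (real p)))" using p by (simp add: field_simps)
        finally show "(1 + ln (real (p\<^sup>2))) / real (p\<^sup>2) \<le> 5 * (1 / (real p * sqrt (real p)))" .
      qed
      finally show "(\<Sum>p\<in>{p\<in>{Suc y..X}. prime p}. (1 + ln (real (p\<^sup>2))) / real (p\<^sup>2)) \<le> (\<Sum>p=Suc y..X. 5 * (1 / (real p * sqrt (real p))))" .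
    qed (use C in \<open>auto simp: S2_count_def\<close>)
    also have "\<dots> = C * (5 * (\<Sum>p=Suc y..X. 1 / (real p * sqrt (real p)))) * S2_count X" by (simp only: sum_distrib_left)
    also have "\<dots> \<le> C * (5 * (4 / sqrt (real y))) * S2_count X"
      using C y5 by (intro mult_right_mono mult_left_mono tail_inverse_n_sqrt_le) (auto simp: S2_count_def)
    also have "\<dots> = 20 * C / sqrt (real y) * S2_count X" by simp
    also have "\<dots> \<le> \<epsilon> * S2_count X" by (intro mult_right_mono yC) (auto simp: S2_count_def)
    finally show "real (card (A \<inter> {1..X})) \<le> \<epsilon> * S2_count X" .
  qed
  then show thesis using that[of y] y5 by (simp add: A_def)
qed

text \<open>
  The exponent is chosen even, so that \<open>n div p ^ V\<close> is again a sum of two squares even if \<open>p\<close> is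
  inert.
\<close>
lemma high_power_divisor_density:
  assumes e: "\<epsilon> > 0"
  obtains V where "V \<ge> 2" "upper_density_le \<epsilon> {n\<in>S2. \<exists>p. prime p \<and> p \<le> y \<and> p ^ V dvd n}"
proof -
  obtain C where C: "C > 0" "\<And>X d. X \<ge> 5 \<Longrightarrow> d \<ge> 1 \<Longrightarrow> S2_count (X div d) \<le> C * ((1 + ln (real d)) / real d) * S2_count X"
    by (rule S2_count_regular) blast
  define f where "f = (\<lambda>V::nat. C * (real y * (3 / sqrt 2 ^ V)))"
  have "(\<lambda>V. (1 / sqrt 2) ^ V) \<longlonglongrightarrow> 0" by (intro LIMSEQ_realpow_zero) auto
  then have "(\<lambda>V. C * (real y * (3 * (1 / sqrt 2) ^ V))) \<longlonglongrightarrow> C * (real y * (3 * 0))" by (intro tendsto_mult tendsto_const)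
  moreover have "f = (\<lambda>V. C * (real y * (3 * (1 / sqrt 2) ^ V)))" by (simp add: f_def power_divide fun_eq_iff)
  ultimately have "f \<longlonglongrightarrow> 0" by simp
  then have "eventually (\<lambda>V. f V < \<epsilon>) sequentially" using e by (intro order_tendstoD) auto
  then obtain V0 where V0: "\<And>V. V \<ge> V0 \<Longrightarrow> f V < \<epsilon>" by (auto simp: eventually_sequentially)
  define V where "V = 2 * (V0 + 1)"
  have V: "even V" "V \<ge> 2" "f V \<le> \<epsilon>" using V0[of V] by (auto simp: V_def)
  define A where "A = {n\<in>S2. \<exists>p. prime p \<and> p \<le> y \<and> p ^ V dvd n}"
  have "upper_density_le \<epsilon> A"
    unfolding upper_density_le_def eventually_sequentially
  proof (intro exI[of _ 5] allI impI)
    fix X :: nat assume X: "X \<ge> 5"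
    have sub: "A \<inter> {1..X} \<subseteq> (\<Union>p\<in>{p\<in>{1..y}. prime p}. {n\<in>S2. p ^ V dvd n \<and> n div p ^ V \<in> S2})"
    proof
      fix n assume "n \<in> A \<inter> {1..X}"
      then obtain p where p: "n \<in> S2" "prime p" "p \<le> y" "p ^ V dvd n" by (auto simp: A_def)
      then have "n div p ^ V \<in> S2" using V by (intro S2_div_power)
      moreover have "p \<ge> 1" using p(2) by (rule prime_ge_1_nat)
      ultimately show "n \<in> (\<Union>p\<in>{p\<in>{1..y}. prime p}. {n\<in>S2. p ^ V dvd n \<and> n div p ^ V \<in> S2})"
        using p by (intro UN_I[of p]) auto
    qed
    have "real (card (A \<inter> {1..X})) \<le> C * (\<Sum>p\<in>{p\<in>{1..y}. prime p}. (1 + ln (real (p ^ V))) / real (p ^ V)) * S2_count X"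
      by (intro card_S2_UN_dvd_le C X sub) auto
    also have "\<dots> \<le> C * (\<Sum>p\<in>{p\<in>{1..y}. prime p}. 3 / sqrt 2 ^ V) * S2_count X"
    proof (intro mult_right_mono mult_left_mono sum_mono)
      fix p assume p: "p \<in> {p\<in>{1..y}. prime p}"
      then have p2: "p \<ge> 2" by (simp add: prime_ge_2_nat)
      then have pV: "p ^ V \<ge> 1" by simp
      then have P: "real (p ^ V) > 0" by linarith
      have "(1 + ln (real (p ^ V))) / real (p ^ V) \<le> 3 * sqrt (real (p ^ V)) / real (p ^ V)"
        using P by (intro divide_right_mono one_plus_ln_le pV) auto
      also have "\<dots> = 3 / sqrt (real (p ^ V))" using P by (simp add: field_simps)
      also have "\<dots> \<le> 3 / sqrt 2 ^ V"
      proof (intro divide_left_mono)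
        have "sqrt 2 ^ V \<le> sqrt (real p) ^ V" using p2 by (intro power_mono) auto
        then show "sqrt 2 ^ V \<le> sqrt (real (p ^ V))" by (simp add: real_sqrt_power)
      qed (use P in auto)
      finally show "(1 + ln (real (p ^ V))) / real (p ^ V) \<le> 3 / sqrt 2 ^ V" .
    qed (use C in \<open>auto simp: S2_count_def\<close>)
    also have "\<dots> \<le> f V * S2_count X"
    proof -
      have "card {p\<in>{1..y}. prime p} \<le> card {1..y}" by (intro card_mono) auto
      then have "real (card {p\<in>{1..y}. prime p}) \<le> real y" by simp
      then show ?thesis unfolding f_def sum_constant
        using C by (intro mult_right_mono mult_left_mono) (auto simp: S2_count_def)
    qed
    also have "\<dots> \<le> \<epsilon> * S2_count X" using V by (intro mult_right_mono) (auto simp: S2_count_def)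
    finally show "real (card (A \<inter> {1..X})) \<le> \<epsilon> * S2_count X" .
  qed
  then show thesis using that[of V] V by (simp add: A_def)
qed

section \<open>Many prime factors congruent to 1 modulo 4\<close>

lemma S2_log_sum_unbounded: "\<exists>x. S2_log_sum {} x \<ge> B"
proof -
  obtain Q where Q: "finite Q" "Q \<subseteq> primes_1_mod_4" "(\<Sum>p\<in>Q. 1 / real p) \<ge> B"
    by (rule sum_inverse_primes_unbounded[of 0 B])
  define x where "x = Max (insert 1 Q)"
  have le: "p \<le> x" if "p \<in> Q" for p using that Q(1) by (simp add: x_def)
  have QS: "p \<in> S2" if "p \<in> Q" for p
    using S2_prime_mult_iff[of p 1] one_in_S2 Q(2) that by (auto simp: primes_1_mod_4_def)
  have "(\<Sum>p\<in>Q. 1 / real p) = (\<Sum>p\<in>Q. S2_ind {} p / real p)" by (intro sum.cong) (auto simp: S2_ind_def QS)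
  also have "\<dots> \<le> S2_log_sum {} x"
    unfolding S2_log_sum_def using le QS S2_pos by (intro sum_mono2) (auto simp: S2_ind_nonneg Suc_le_eq)
  finally show ?thesis using Q(3) by (intro exI[of _ x]) simp
qed

text \<open>
  Split the sum according to divisibility by \<open>q\<close>: both parts contain a copy of the sum from which
  the multiples of \<open>q\<close> are removed, the second copy being multiplied by \<open>q\<close>.
\<close>
lemma S2_log_sum_insert:
  assumes q: "q \<in> primes_1_mod_4" "q \<notin> Q" and Q: "Q \<subseteq> primes_1_mod_4"
  shows "(1 + 1 / real q) * S2_log_sum (insert q Q) (x div q) \<le> S2_log_sum Q x"
proof -
  have qp: "prime q" "q mod 4 \<noteq> 3" and q0: "q > 0" using q by (auto simp: primes_1_mod_4_def prime_gt_0_nat)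
  have "S2_log_sum (insert q Q) (x div q) + 1 / real q * S2_log_sum (insert q Q) (x div q) \<le>
     (\<Sum>m\<in>{m\<in>{1..x}. \<not> q dvd m}. S2_ind Q m / real m) + (\<Sum>m\<in>{m\<in>{1..x}. q dvd m}. S2_ind Q m / real m)"
  proof (intro add_mono)
    have "S2_log_sum (insert q Q) (x div q) \<le> S2_log_sum (insert q Q) x" by (intro S2_log_sum_mono) auto
    also have "\<dots> = (\<Sum>m\<in>{m\<in>{1..x}. \<not> q dvd m}. S2_ind (insert q Q) m / real m)"
      unfolding S2_log_sum_def by (intro sum.mono_neutral_right) (auto simp: S2_ind_def)
    also have "\<dots> \<le> (\<Sum>m\<in>{m\<in>{1..x}. \<not> q dvd m}. S2_ind Q m / real m)"
      by (intro sum_mono divide_right_mono) (auto simp: S2_ind_def)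
    finally show "S2_log_sum (insert q Q) (x div q) \<le> (\<Sum>m\<in>{m\<in>{1..x}. \<not> q dvd m}. S2_ind Q m / real m)" .
    have "1 / real q * S2_log_sum (insert q Q) (x div q) = (\<Sum>m=1..x div q. S2_ind (insert q Q) m / real (q * m))"
      by (simp add: S2_log_sum_def sum_distrib_left)
    also have "\<dots> \<le> (\<Sum>m=1..x div q. S2_ind Q (q * m) / real (q * m))"
    proof (intro sum_mono divide_right_mono)
      fix m assume "m \<in> {1..x div q}"
      show "S2_ind (insert q Q) m \<le> S2_ind Q (q * m)"
      proof (cases "S2_ind (insert q Q) m = 0")
        case False
        then have m: "m \<in> S2" "\<And>r. r \<in> Q \<Longrightarrow> \<not> r dvd m" by (auto simp: S2_ind_def split: if_splits)
        have "\<not> r dvd q * m" if r: "r \<in> Q" for r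
        proof
          assume "r dvd q * m"
          have rp: "prime r" using r Q by (auto simp: primes_1_mod_4_def)
          then have "r dvd q \<or> r dvd m" using \<open>r dvd q * m\<close> by (simp add: prime_dvd_mult_iff)
          then have "r = q" using m(2)[OF r] rp qp(1) primes_dvd_imp_eq by blast
          then show False using r q by simp
        qed
        then have "S2_ind Q (q * m) = 1" using m(1) S2_prime_mult_iff[OF qp] by (simp add: S2_ind_def)
        then show ?thesis using S2_ind_le_1 by simp
      qed (simp add: S2_ind_nonneg)
    qed auto
    also have "\<dots> = (\<Sum>n\<in>(*) q ` {1..x div q}. S2_ind Q n / real n)"
      using q0 by (subst sum.reindex) (auto simp: inj_on_def)
    also have "\<dots> \<le> (\<Sum>m\<in>{m\<in>{1..x}. q dvd m}. S2_ind Q m / real m)"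
    proof (intro sum_mono2)
      show "(*) q ` {1..x div q} \<subseteq> {m\<in>{1..x}. q dvd m}"
        using q0 by (auto simp: less_eq_div_iff_mult_less_eq mult.commute Suc_le_eq)
    qed (auto simp: S2_ind_nonneg)
    finally show "1 / real q * S2_log_sum (insert q Q) (x div q) \<le> (\<Sum>m\<in>{m\<in>{1..x}. q dvd m}. S2_ind Q m / real m)" .
  qed
  also have "\<dots> = (\<Sum>m\<in>{m\<in>{1..x}. \<not> q dvd m} \<union> {m\<in>{1..x}. q dvd m}. S2_ind Q m / real m)"
    by (rule sum.union_disjoint[symmetric]) auto
  also have "{m\<in>{1..x}. \<not> q dvd m} \<union> {m\<in>{1..x}. q dvd m} = {1..x}" by auto
  finally show ?thesis by (simp add: S2_log_sum_def distrib_right)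
qed

lemma S2_log_sum_sieve:
  assumes "finite Q" "Q \<subseteq> primes_1_mod_4"
  shows "(\<Prod>q\<in>Q. 1 + 1 / real q) * S2_log_sum Q (x div \<Prod>Q) \<le> S2_log_sum {} x"
  using assms
proof (induction Q rule: finite_induct)
  case (insert q Q)
  have "(\<Prod>q\<in>insert q Q. 1 + 1 / real q) * S2_log_sum (insert q Q) (x div \<Prod>(insert q Q)) =
     (\<Prod>q\<in>Q. 1 + 1 / real q) * ((1 + 1 / real q) * S2_log_sum (insert q Q) (x div \<Prod>Q div q))"
    using insert by (simp add: mult_ac div_mult2_eq[symmetric])
  also have "\<dots> \<le> (\<Prod>q\<in>Q. 1 + 1 / real q) * S2_log_sum Q (x div \<Prod>Q)"
    using insert by (intro mult_left_mono S2_log_sum_insert prod_nonneg) auto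
  also have "\<dots> \<le> S2_log_sum {} x" using insert by auto
  finally show ?case .
qed simp

text \<open>
  The logarithmic sum over the sieved set is smaller by the factor \<open>\<Prod> (1 + 1 / q)\<close>, up to an
  additive constant that is negligible because the sum is unbounded. The upper bound for the
  counting function of the sieved set and the lower bound for that of all sums of two squares
  transfer this to densities.
\<close>
lemma no_prime_factor_density:
  obtains C where "C > 0" "\<And>Q. finite Q \<Longrightarrow> Q \<subseteq> primes_1_mod_4 \<Longrightarrow>
    upper_density_le (C / (\<Prod>q\<in>Q. 1 + 1 / real q)) {n\<in>S2. \<forall>q\<in>Q. \<not> q dvd n}"
proof -
  obtain c where c: "c > 0" "\<And>x. x \<ge> 5 \<Longrightarrow> c * real x * S2_log_sum {} x \<le> S2_count x * ln (real x)"
    by (rule S2_count_lower) blast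
  have "upper_density_le (18 / c / (\<Prod>q\<in>Q. 1 + 1 / real q)) {n\<in>S2. \<forall>q\<in>Q. \<not> q dvd n}"
    if Q: "finite Q" "Q \<subseteq> primes_1_mod_4" for Q
  proof -
    define P where "P = (\<Prod>q\<in>Q. 1 + 1 / real q)"
    have P: "P > 0" unfolding P_def by (intro prod_pos) (auto simp: add_pos_nonneg)
    define D where "D = \<Prod>Q"
    have D: "D \<ge> 1" unfolding D_def using Q(2)
      by (auto simp: Suc_le_eq primes_1_mod_4_def prime_gt_0_nat intro!: prod_pos)
    obtain x0 where x0: "S2_log_sum {} x0 \<ge> P * real D" using S2_log_sum_unbounded by blast
    show ?thesis
      unfolding upper_density_le_def eventually_sequentially
    proof (intro exI[of _ "x0 + 5"] allI impI)
      fix x assume x: "x \<ge> x0 + 5"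
      have "P * S2_log_sum Q (x div D) \<le> S2_log_sum {} x" unfolding P_def D_def by (rule S2_log_sum_sieve[OF Q])
      moreover have "P * real D \<le> S2_log_sum {} x" using x0 S2_log_sum_mono[of x0 x "{}"] x by simp
      moreover have "P * S2_log_sum Q x \<le> P * (S2_log_sum Q (x div D) + real D)"
        using P by (intro mult_left_mono S2_log_sum_div_le D) auto
      ultimately have PL: "P * S2_log_sum Q x \<le> 2 * S2_log_sum {} x" by (simp add: distrib_left)
      define N where "N = (\<Sum>n=1..x. S2_ind Q n)"
      have "c * (P * N * ln (real x)) \<le> c * (P * (9 * real x * S2_log_sum Q x))"
        using c P count_S2_ind_upper[of Q x] by (intro mult_left_mono) (auto simp: N_def)
      also have "\<dots> = 9 * c * real x * (P * S2_log_sum Q x)" by simp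
      also have "\<dots> \<le> 9 * c * real x * (2 * S2_log_sum {} x)" using c by (intro mult_left_mono PL) auto
      also have "\<dots> = 18 * (c * real x * S2_log_sum {} x)" by simp
      also have "\<dots> \<le> 18 * (S2_count x * ln (real x))" using x by (intro mult_left_mono c(2)) auto
      finally have "c * P * N * ln (real x) \<le> 18 * S2_count x * ln (real x)" by (simp add: mult_ac)
      moreover have "ln (real x) > 0" using x by (intro ln_gt_zero) auto
      ultimately have "c * P * N \<le> 18 * S2_count x" by simp
      then have "N \<le> 18 / c / P * S2_count x" using c P by (simp add: field_simps)
      then show "real (card ({n\<in>S2. \<forall>q\<in>Q. \<not> q dvd n} \<inter> {1..x})) \<le> 18 / c / (\<Prod>q\<in>Q. 1 + 1 / real q) * S2_count x"
        by (simp only: N_def sum_S2_ind P_def)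
    qed
  qed
  then show thesis using that[of "18 / c"] c(1) by simp
qed

lemma prod_one_plus_ge_sum:
  assumes "finite A" "\<And>i. i \<in> A \<Longrightarrow> a i \<ge> (0::real)"
  shows "(\<Prod>i\<in>A. 1 + a i) \<ge> 1 + (\<Sum>i\<in>A. a i)"
  using assms
proof (induction A rule: finite_induct)
  case (insert x A)
  have "1 + (\<Sum>i\<in>insert x A. a i) = a x + (1 + (\<Sum>i\<in>A. a i))" using insert by simp
  also have "\<dots> \<le> a x * (\<Prod>i\<in>A. 1 + a i) + (\<Prod>i\<in>A. 1 + a i)"
  proof (intro add_mono)
    have "(\<Sum>i\<in>A. a i) \<ge> 0" using insert by (intro sum_nonneg) auto
    then have "(\<Prod>i\<in>A. 1 + a i) \<ge> 1" using insert by auto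
    then show "a x \<le> a x * (\<Prod>i\<in>A. 1 + a i)" using insert.prems[of x] by (simp add: mult_le_cancel_left1)
  qed (use insert in auto)
  also have "\<dots> = (\<Prod>i\<in>insert x A. 1 + a i)" using insert by (simp add: algebra_simps)
  finally show ?case .
qed simp

text \<open>
  Induction on \<open>R\<close>. The reciprocals of the primes \<open>1 (mod 4)\<close> beyond \<open>y\<close> have a divergent sum, so
  nearly every \<open>n\<close> has a prime factor in a suitable finite set \<open>Q\<close> of them; the other prime factors
  are sought beyond \<open>Q\<close>.
\<close>
lemma few_prime_factors_null:
  "null_density {n\<in>S2. card {p\<in>primes_1_mod_4. p > y \<and> p dvd n} < R}"
proof -
  obtain C where C: "C > 0" "\<And>Q. finite Q \<Longrightarrow> Q \<subseteq> primes_1_mod_4 \<Longrightarrow>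
    upper_density_le (C / (\<Prod>q\<in>Q. 1 + 1 / real q)) {n\<in>S2. \<forall>q\<in>Q. \<not> q dvd n}"
    by (rule no_prime_factor_density) blast
  have "upper_density_le \<epsilon> {n\<in>S2. card {p\<in>primes_1_mod_4. p > y \<and> p dvd n} < R}" if "\<epsilon> > 0" for \<epsilon>
    using that
  proof (induction R arbitrary: y \<epsilon>)
    case 0
    then show ?case by (simp add: upper_density_le_def S2_count_def)
  next
    case (Suc R)
    obtain Q where Q: "finite Q" "Q \<subseteq> primes_1_mod_4" "\<And>p. p \<in> Q \<Longrightarrow> p > y" "(\<Sum>p\<in>Q. 1 / real p) \<ge> 2 * C / \<epsilon>"
      by (rule sum_inverse_primes_unbounded) blast
    define y' where "y' = Max (insert y Q)"
    have y': "y \<le> y'" "\<And>q. q \<in> Q \<Longrightarrow> q \<le> y'" using Q(1) by (auto simp: y'_def)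
    have "2 * C / \<epsilon> \<le> (\<Prod>q\<in>Q. 1 + 1 / real q)"
      using prod_one_plus_ge_sum[OF Q(1), of "\<lambda>q. 1 / real q"] Q(4) by simp
    moreover have "2 * C / \<epsilon> > 0" using C(1) Suc.prems by simp
    ultimately have "C / (\<Prod>q\<in>Q. 1 + 1 / real q) \<le> C / (2 * C / \<epsilon>)"
      using C(1) by (intro divide_left_mono mult_pos_pos) auto
    then have le: "C / (\<Prod>q\<in>Q. 1 + 1 / real q) \<le> \<epsilon> / 2" using C(1) by simp
    have 1: "upper_density_le (\<epsilon> / 2) {n\<in>S2. \<forall>q\<in>Q. \<not> q dvd n}"
      by (rule upper_density_le_mono[OF C(2)[OF Q(1,2)] order.refl le])
    have 2: "upper_density_le (\<epsilon> / 2) {n\<in>S2. card {p\<in>primes_1_mod_4. p > y' \<and> p dvd n} < R}"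
      using Suc.prems by (intro Suc.IH) auto
    have "{n\<in>S2. card {p\<in>primes_1_mod_4. p > y \<and> p dvd n} < Suc R} \<subseteq>
      {n\<in>S2. \<forall>q\<in>Q. \<not> q dvd n} \<union> {n\<in>S2. card {p\<in>primes_1_mod_4. p > y' \<and> p dvd n} < R}"
    proof
      fix n assume n: "n \<in> {n\<in>S2. card {p\<in>primes_1_mod_4. p > y \<and> p dvd n} < Suc R}"
      then have nS: "n \<in> S2" by simp
      have fin: "finite {p\<in>primes_1_mod_4. p > z \<and> p dvd n}" for z
        by (rule finite_subset[of _ "{0..n}"]) (use S2_pos[OF nS] in \<open>auto dest: dvd_imp_le\<close>)
      show "n \<in> {n\<in>S2. \<forall>q\<in>Q. \<not> q dvd n} \<union> {n\<in>S2. card {p\<in>primes_1_mod_4. p > y' \<and> p dvd n} < R}"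
      proof (cases "\<forall>q\<in>Q. \<not> q dvd n")
        case False
        then obtain q where q: "q \<in> Q" "q dvd n" by blast
        have "insert q {p\<in>primes_1_mod_4. p > y' \<and> p dvd n} \<subseteq> {p\<in>primes_1_mod_4. p > y \<and> p dvd n}"
          using q Q y' by auto
        then have "card (insert q {p\<in>primes_1_mod_4. p > y' \<and> p dvd n}) \<le> card {p\<in>primes_1_mod_4. p > y \<and> p dvd n}"
          by (rule card_mono[OF fin])
        moreover have "q \<notin> {p\<in>primes_1_mod_4. p > y' \<and> p dvd n}" using y'(2)[OF q(1)] by auto
        ultimately have "Suc (card {p\<in>primes_1_mod_4. p > y' \<and> p dvd n}) \<le> card {p\<in>primes_1_mod_4. p > y \<and> p dvd n}"
          using fin by simp
        then show ?thesis using n by auto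
      qed (use nS in simp)
    qed
    from upper_density_le_subset_Un[OF 1 2 this] show ?case by simp
  qed
  then show ?thesis by (simp add: null_density_def)
qed

section \<open>Counting vanishing sums\<close>

definition lists_sum :: "complex set \<Rightarrow> nat \<Rightarrow> complex \<Rightarrow> complex list set" where
  "lists_sum A L w = {xs. length xs = L \<and> set xs \<subseteq> A \<and> sum_list xs = w}"

lemma finite_lists_sum: "finite A \<Longrightarrow> finite (lists_sum A L w)"
  by (rule finite_subset[OF _ finite_lists_length_eq[of A L]]) (auto simp: lists_sum_def)

lemma card_lists_sum_le: "finite A \<Longrightarrow> card (lists_sum A L w) \<le> card A ^ L"
  using card_mono[OF finite_lists_length_eq[of A L], of "lists_sum A L w"]
  by (auto simp: lists_sum_def card_lists_length_eq)

lemma lists_sum_0: "lists_sum A 0 w = (if w = 0 then {[]} else {})"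
  by (auto simp: lists_sum_def)

lemma lists_sum_Suc: "lists_sum A (Suc L) w = (\<Union>z\<in>A. (#) z ` lists_sum A L (w - z))"
proof (intro equalityI subsetI)
  fix xs assume "xs \<in> lists_sum A (Suc L) w"
  then obtain z ys where "xs = z # ys" "length ys = L" "z \<in> A" "set ys \<subseteq> A" "z + sum_list ys = w"
    by (auto simp: lists_sum_def length_Suc_conv)
  then show "xs \<in> (\<Union>z\<in>A. (#) z ` lists_sum A L (w - z))"
    by (intro UN_I[of z] image_eqI[of _ _ ys]) (auto simp: lists_sum_def)
qed (auto simp: lists_sum_def)

lemma card_lists_sum_Suc:
  assumes "finite A"
  shows "card (lists_sum A (Suc L) w) = (\<Sum>z\<in>A. card (lists_sum A L (w - z)))"
  unfolding lists_sum_Suc using assms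
  by (subst card_UN_disjoint) (auto simp: finite_lists_sum card_image)

text \<open>
  The two subsums have separate targets \<open>u\<close> and \<open>v\<close> so that a recursion on the first element is
  possible.
\<close>
definition split_lists :: "complex set \<Rightarrow> complex set \<Rightarrow> nat \<Rightarrow> complex \<Rightarrow> complex \<Rightarrow> complex list set" where
  "split_lists A B L u v = {xs. length xs = L \<and> set xs \<subseteq> A \<union> B \<and>
     sum_list (filter (\<lambda>x. x \<in> A) xs) = u \<and> sum_list (filter (\<lambda>x. x \<notin> A) xs) = v}"

lemma finite_split_lists: "finite A \<Longrightarrow> finite B \<Longrightarrow> finite (split_lists A B L u v)"
  by (rule finite_subset[OF _ finite_lists_length_eq[of "A \<union> B" L]]) (auto simp: split_lists_def)

lemma split_lists_Suc:
  assumes "A \<inter> B = {}"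
  shows "split_lists A B (Suc L) u v = (\<Union>z\<in>A. (#) z ` split_lists A B L (u - z) v) \<union> (\<Union>z\<in>B. (#) z ` split_lists A B L u (v - z))"
proof (intro equalityI subsetI)
  fix xs assume xs: "xs \<in> split_lists A B (Suc L) u v"
  then obtain z ys where z: "xs = z # ys" "length ys = L" "z \<in> A \<union> B" "set ys \<subseteq> A \<union> B"
    by (auto simp: split_lists_def length_Suc_conv)
  show "xs \<in> (\<Union>z\<in>A. (#) z ` split_lists A B L (u - z) v) \<union> (\<Union>z\<in>B. (#) z ` split_lists A B L u (v - z))"
  proof (cases "z \<in> A")
    case True
    then have "ys \<in> split_lists A B L (u - z) v" using xs z by (auto simp: split_lists_def)
    then show ?thesis using True z by auto
  next
    case False
    then have "ys \<in> split_lists A B L u (v - z)" "z \<in> B" using xs z by (auto simp: split_lists_def)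
    then show ?thesis using z by auto
  qed
qed (use assms in \<open>auto simp: split_lists_def\<close>)

lemma pascal_sum:
  fixes X :: "nat \<Rightarrow> nat \<Rightarrow> nat"
  shows "(\<Sum>a\<le>L. (L choose a) * X (Suc a) (L - a)) + (\<Sum>a\<le>L. (L choose a) * X a (Suc L - a)) =
    (\<Sum>a\<le>Suc L. (Suc L choose a) * X a (Suc L - a))"
proof -
  have "(\<Sum>a\<le>L. (L choose a) * X a (Suc L - a)) = (\<Sum>a\<le>Suc L. (L choose a) * X a (Suc L - a))"
    by (simp add: binomial_eq_0)
  also have "\<dots> = X 0 (Suc L) + (\<Sum>a\<le>L. (L choose Suc a) * X (Suc a) (L - a))"
    by (simp only: sum.atMost_Suc_shift) simp
  moreover have "(\<Sum>a\<le>Suc L. (Suc L choose a) * X a (Suc L - a)) =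
     X 0 (Suc L) + (\<Sum>a\<le>L. ((L choose a) + (L choose Suc a)) * X (Suc a) (L - a))"
    by (simp only: sum.atMost_Suc_shift) simp
  ultimately show ?thesis by (simp only:) (simp add: sum.distrib distrib_right)
qed

text \<open>
  A list is determined by the positions of its elements from \<open>A\<close> and by the two sublists. The proof
  by induction on the length uses Pascal's rule.
\<close>
lemma card_split_lists:
  assumes fin: "finite A" "finite B" and disj: "A \<inter> B = {}"
  shows "card (split_lists A B L u v) = (\<Sum>a\<le>L. (L choose a) * (card (lists_sum A a u) * card (lists_sum B (L - a) v)))"
proof (induction L arbitrary: u v)
  case 0
  have "split_lists A B 0 u v = (if u = 0 \<and> v = 0 then {[]} else {})" by (auto simp: split_lists_def)
  then show ?case by (simp add: lists_sum_0)
next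
  case (Suc L)
  define X where "X = (\<lambda>a b. card (lists_sum A a u) * card (lists_sum B b v))"
  have "card (split_lists A B (Suc L) u v) =
     card (\<Union>z\<in>A. (#) z ` split_lists A B L (u - z) v) + card (\<Union>z\<in>B. (#) z ` split_lists A B L u (v - z))"
    unfolding split_lists_Suc[OF disj]
    by (rule card_Un_disjoint) (use fin disj in \<open>auto simp: finite_split_lists\<close>)
  also have "card (\<Union>z\<in>A. (#) z ` split_lists A B L (u - z) v) = (\<Sum>z\<in>A. card (split_lists A B L (u - z) v))"
    using fin by (subst card_UN_disjoint) (auto simp: finite_split_lists card_image)
  also have "card (\<Union>z\<in>B. (#) z ` split_lists A B L u (v - z)) = (\<Sum>z\<in>B. card (split_lists A B L u (v - z)))"
    using fin by (subst card_UN_disjoint) (auto simp: finite_split_lists card_image)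
  also have "(\<Sum>z\<in>A. card (split_lists A B L (u - z) v)) = (\<Sum>a\<le>L. (L choose a) * X (Suc a) (L - a))"
  proof -
    have "(\<Sum>z\<in>A. card (split_lists A B L (u - z) v)) =
       (\<Sum>a\<le>L. \<Sum>z\<in>A. (L choose a) * (card (lists_sum A a (u - z)) * card (lists_sum B (L - a) v)))"
      unfolding Suc.IH by (rule sum.swap)
    also have "\<dots> = (\<Sum>a\<le>L. (L choose a) * X (Suc a) (L - a))"
      by (simp add: X_def card_lists_sum_Suc[OF fin(1)] sum_distrib_left sum_distrib_right)
    finally show ?thesis .
  qed
  also have "(\<Sum>z\<in>B. card (split_lists A B L u (v - z))) = (\<Sum>a\<le>L. (L choose a) * X a (Suc L - a))"
  proof -
    have "(\<Sum>z\<in>B. card (split_lists A B L u (v - z))) =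
       (\<Sum>a\<le>L. \<Sum>z\<in>B. (L choose a) * (card (lists_sum A a u) * card (lists_sum B (L - a) (v - z))))"
      unfolding Suc.IH by (rule sum.swap)
    also have "\<dots> = (\<Sum>a\<le>L. (L choose a) * X a (Suc L - a))"
      by (intro sum.cong refl) (simp add: X_def Suc_diff_le card_lists_sum_Suc[OF fin(2)] sum_distrib_left)
    finally show ?thesis .
  qed
  also have "(\<Sum>a\<le>L. (L choose a) * X (Suc a) (L - a)) + (\<Sum>a\<le>L. (L choose a) * X a (Suc L - a)) =
    (\<Sum>a\<le>Suc L. (Suc L choose a) * X a (Suc L - a))" by (rule pascal_sum)
  finally show ?case by (simp only: X_def)
qed

lemma sum_list_filter_split:
  "sum_list xs = sum_list (filter P xs) + sum_list (filter (\<lambda>x. \<not> P x) (xs :: complex list))"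
  by (induction xs) (auto simp: algebra_simps)

lemma sum_list_map_mult: "sum_list (map ((*) c) xs) = c * sum_list (xs :: complex list)"
  by (induction xs) (auto simp: algebra_simps)

lemma card_lists_sum_scale:
  assumes "c \<noteq> 0"
  shows "card (lists_sum ((*) c ` A) L 0) = card (lists_sum A L 0)"
proof -
  have "lists_sum ((*) c ` A) L 0 = map ((*) c) ` lists_sum A L 0"
  proof (intro equalityI subsetI)
    fix xs assume xs: "xs \<in> lists_sum ((*) c ` A) L 0"
    define ys where "ys = map (\<lambda>x. x / c) xs"
    have "map ((*) c) ys = xs" using assms by (simp add: ys_def comp_def map_idI)
    moreover from this have "c * sum_list ys = 0" using xs sum_list_map_mult[of c ys] by (simp add: lists_sum_def)
    moreover have "set ys \<subseteq> A" using xs assms by (fastforce simp: ys_def lists_sum_def)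
    ultimately show "xs \<in> map ((*) c) ` lists_sum A L 0"
      using xs assms by (intro image_eqI[of _ _ ys]) (auto simp: lists_sum_def ys_def)
  qed (auto simp: lists_sum_def sum_list_map_mult intro!: imageI)
  moreover have "inj_on (map ((*) c)) S" for S using assms by (auto intro!: inj_onI dest: map_inj_on simp: inj_on_def)
  ultimately show ?thesis by (simp add: card_image)
qed

text \<open>
  In contrast to a semi-correlation, both coordinates have to cancel.
\<close>
definition corr :: "nat \<Rightarrow> nat \<Rightarrow> nat" where
  "corr m L = card (lists_sum (gauss_pts m) L 0)"

lemma corr_0 [simp]: "corr m 0 = 1" by (simp add: corr_def lists_sum_0)

lemma corr_le: "corr m L \<le> num_lattice_points m ^ L"
  unfolding corr_def card_gauss_pts[symmetric] by (rule card_lists_sum_le) simp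

lemma corr_2: "corr m 2 = num_lattice_points m"
proof -
  have "lists_sum (gauss_pts m) 2 0 = (\<lambda>z. [z, - z]) ` gauss_pts m"
  proof (intro equalityI subsetI)
    fix xs assume "xs \<in> lists_sum (gauss_pts m) 2 0"
    then obtain a b where "xs = [a, b]" "a \<in> gauss_pts m" "a + b = 0"
      by (auto simp: lists_sum_def length_Suc_conv numeral_2_eq_2)
    then show "xs \<in> (\<lambda>z. [z, - z]) ` gauss_pts m" by (auto simp: add_eq_0_iff)
  next
    fix xs assume "xs \<in> (\<lambda>z. [z, - z]) ` gauss_pts m"
    moreover have "- z \<in> gauss_pts m" if "z \<in> gauss_pts m" for z using that by (auto simp: gauss_pts_def)
    ultimately show "xs \<in> lists_sum (gauss_pts m) 2 0" by (auto simp: lists_sum_def)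
  qed
  then show ?thesis by (simp add: corr_def card_image inj_on_def flip: card_gauss_pts)
qed

text \<open>
  For odd \<open>m\<close> all points have an odd sum of coordinates, so that an odd number of them cannot
  cancel; for even \<open>m\<close> all points are divisible by \<open>1 + \<i>\<close>.
\<close>
lemma corr_odd:
  assumes "m > 0" "odd L"
  shows "corr m L = 0"
  using assms(1)
proof (induction m rule: less_induct)
  case (less m)
  show ?case
  proof (cases "even m")
    case True
    then obtain j where j: "m = 2 * j" by auto
    have "1 + \<i> \<noteq> 0" by (simp add: complex_eq_iff)
    then have "corr m L = corr j L" by (simp add: corr_def j gauss_pts_2_mult card_lists_sum_scale)
    then show ?thesis using less j by auto
  next
    case False
    have par: "\<exists>k :: int. Re (sum_list xs) + Im (sum_list xs) = of_int (int (length xs) + 2 * k)" if "set xs \<subseteq> gauss_pts m" for xs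
      using that
    proof (induction xs)
      case Nil
      then show ?case by (auto intro!: exI[of _ 0])
    next
      case (Cons z xs)
      then obtain k where k: "Re (sum_list xs) + Im (sum_list xs) = of_int (int (length xs) + 2 * k)" by auto
      have "z \<in> gauss_pts m" using Cons by simp
      then obtain a b where ab: "z = Complex (of_int a) (of_int b)" "a\<^sup>2 + b\<^sup>2 = int m" by (rule gauss_pts_E)
      have "odd (a\<^sup>2 + b\<^sup>2)" using False ab by simp
      then have "odd (a + b)" by simp
      then obtain c where c: "a + b = 2 * c + 1" by (rule oddE)
      then have "real_of_int a + real_of_int b = real_of_int (2 * c + 1)" by (simp flip: of_int_add)
      then show ?case using k by (intro exI[of _ "k + c"]) (simp add: ab)
    qed
    have "lists_sum (gauss_pts m) L 0 = {}"
    proof (rule ccontr)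
      assume "lists_sum (gauss_pts m) L 0 \<noteq> {}"
      then obtain xs where xs: "length xs = L" "set xs \<subseteq> gauss_pts m" "sum_list xs = 0" by (auto simp: lists_sum_def)
      from par[OF xs(2)] obtain k :: int where "0 = real_of_int (int L + 2 * k)" using xs by auto
      then have "int L + 2 * k = 0" by (metis of_int_0_eq_iff)
      then have "even (int L)" by presburger
      then show False using assms(2) by simp
    qed
    then show ?thesis by (simp add: corr_def)
  qed
qed

section \<open>Primes that create no new vanishing sums\<close>

text \<open>
  The sums of at most \<open>l\<close> points: shorter lists are padded with 0.
\<close>
definition short_sums :: "nat \<Rightarrow> nat \<Rightarrow> complex set" where
  "short_sums l m = sum_list ` {xs. set xs \<subseteq> insert 0 (gauss_pts m) \<and> length xs = l}"

text \<open>
  For \<open>p \<equiv> 1 (mod 4)\<close> the condition \<open>a \<noteq> 0\<close> implies \<open>b \<noteq> 0\<close>. A prime that is not bad admits only the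
  trivial relation between the two halves of the circle of norm \<open>p * m\<close>.
\<close>
definition bad_prime :: "nat \<Rightarrow> nat \<Rightarrow> nat \<Rightarrow> bool" where
  "bad_prime l m p \<longleftrightarrow> (\<exists>a\<in>short_sums l m. \<exists>b\<in>short_sums l m. a \<noteq> 0 \<and> gprime p * a + cnj (gprime p) * b = 0)"

lemma sum_list_in_short_sums:
  assumes "set xs \<subseteq> gauss_pts m" "length xs \<le> l"
  shows "sum_list xs \<in> short_sums l m"
proof -
  have "xs @ replicate (l - length xs) 0 \<in> {xs. set xs \<subseteq> insert 0 (gauss_pts m) \<and> length xs = l}"
    using assms by auto
  then show ?thesis unfolding short_sums_def
    by (rule rev_image_eqI) (simp add: sum_list_replicate)
qed

lemma short_sums_finite: "finite (short_sums l m)"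
  unfolding short_sums_def by (intro finite_imageI finite_lists_length_eq) simp

lemma card_short_sums_le: "card (short_sums l m) \<le> (num_lattice_points m + 1) ^ l"
proof -
  have "card (short_sums l m) \<le> card {xs. set xs \<subseteq> insert 0 (gauss_pts m) \<and> length xs = l}"
    unfolding short_sums_def by (intro card_image_le finite_lists_length_eq) simp
  also have "\<dots> = card (insert 0 (gauss_pts m)) ^ l" by (rule card_lists_length_eq) simp
  also have "\<dots> \<le> (num_lattice_points m + 1) ^ l"
    by (intro power_mono) (auto simp: card_insert_if card_gauss_pts)
  finally show ?thesis .
qed

text \<open>
  The ratio of \<open>gprime p\<close> and its conjugate determines \<open>p\<close>: the equation says that
  \<open>gprime p * cnj (gprime q)\<close> is real, hence an integer whose square is the product \<open>p * q\<close>.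
\<close>
lemma gprime_ratio_inj:
  assumes p: "p \<in> primes_1_mod_4" "q \<in> primes_1_mod_4"
    and e: "gprime p * cnj (gprime q) = cnj (gprime p) * gprime q"
  shows "p = q"
proof -
  have pr: "prime p" "prime q" using p by (auto simp: primes_1_mod_4_def)
  have g: "gprime p \<in> gauss_pts p" "gprime q \<in> gauss_pts q" using p gprime by (auto simp: primes_1_mod_4_def)
  have "gprime p * cnj (gprime q) \<in> gauss_pts (p * q)" using g by (intro gauss_pts_mult) auto
  then obtain a b where ab: "gprime p * cnj (gprime q) = Complex (of_int a) (of_int b)" "a\<^sup>2 + b\<^sup>2 = int (p * q)" by (rule gauss_pts_E)
  have "cnj (gprime p * cnj (gprime q)) = gprime p * cnj (gprime q)" using e by simp
  then have "b = 0" unfolding ab by (simp add: complex_eq_iff)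
  with ab have a: "a\<^sup>2 = int p * int q" by simp
  then have "int p dvd a\<^sup>2" by simp
  then have "int p dvd a" using pr by (simp add: prime_dvd_power_iff)
  then obtain c where "a = int p * c" by auto
  with a have "int p * (int p * c\<^sup>2) = int p * int q" by (simp add: power2_eq_square algebra_simps)
  then have "int p * c\<^sup>2 = int q" using pr by (auto simp: prime_gt_0_nat)
  then have "p dvd q" by (metis dvd_triv_left int_dvd_int_iff)
  then show ?thesis using pr primes_dvd_imp_eq by blast
qed

text \<open>
  A pair \<open>(a, b)\<close> with \<open>a \<noteq> 0\<close> prescribes the ratio of \<open>gprime p\<close> and its conjugate, hence
  determines \<open>p\<close>.
\<close>
lemma card_bad_primes_le:
  "finite {p\<in>primes_1_mod_4. bad_prime l m p}"
  "card {p\<in>primes_1_mod_4. bad_prime l m p} \<le> (num_lattice_points m + 1) ^ (2 * l)"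
proof -
  define B where "B = {p\<in>primes_1_mod_4. bad_prime l m p}"
  have "\<forall>p\<in>B. \<exists>q\<in>short_sums l m \<times> short_sums l m. fst q \<noteq> 0 \<and> gprime p * fst q + cnj (gprime p) * snd q = 0"
    by (auto simp: B_def bad_prime_def)
  then obtain f where f: "\<And>p. p \<in> B \<Longrightarrow> f p \<in> short_sums l m \<times> short_sums l m"
    "\<And>p. p \<in> B \<Longrightarrow> fst (f p) \<noteq> 0" "\<And>p. p \<in> B \<Longrightarrow> gprime p * fst (f p) + cnj (gprime p) * snd (f p) = 0"
    by metis
  have inj: "inj_on f B"
  proof (rule inj_onI)
    fix p q assume pq: "p \<in> B" "q \<in> B" "f p = f q"
    define a where "a = fst (f p)"
    define b where "b = snd (f p)"
    have a0: "a \<noteq> 0" using f(2)[OF pq(1)] by (simp add: a_def)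
    have e1: "gprime p * a = - (cnj (gprime p) * b)" using f(3)[OF pq(1)] by (simp add: a_def b_def add_eq_0_iff)
    have e2: "gprime q * a = - (cnj (gprime q) * b)" using f(3)[OF pq(2)] by (simp add: a_def b_def pq(3) add_eq_0_iff)
    have "a * (gprime p * cnj (gprime q)) = (gprime p * a) * cnj (gprime q)" by simp
    also have "\<dots> = cnj (gprime p) * (- (cnj (gprime q) * b))" unfolding e1 by simp
    also have "\<dots> = a * (cnj (gprime p) * gprime q)" unfolding e2[symmetric] by simp
    finally have "gprime p * cnj (gprime q) = cnj (gprime p) * gprime q" using a0 by simp
    then show "p = q" using pq by (intro gprime_ratio_inj) (auto simp: B_def)
  qed
  have sub: "f ` B \<subseteq> short_sums l m \<times> short_sums l m" using f(1) by blast
  have fin: "finite (short_sums l m \<times> short_sums l m)" by (simp add: short_sums_finite)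
  show "finite B" using finite_imageD[OF finite_subset[OF sub fin] inj] .
  have "card B = card (f ` B)" by (rule card_image[OF inj, symmetric])
  also have "\<dots> \<le> card (short_sums l m \<times> short_sums l m)" by (rule card_mono[OF fin sub])
  also have "\<dots> = card (short_sums l m) * card (short_sums l m)" by (rule card_cartesian_product)
  also have "\<dots> \<le> (num_lattice_points m + 1) ^ l * (num_lattice_points m + 1) ^ l"
    by (intro mult_mono card_short_sums_le) auto
  finally show "card B \<le> (num_lattice_points m + 1) ^ (2 * l)" by (simp add: mult_2 power_add)
qed

text \<open>
  One step of a chain: multiplication by \<open>p\<close> doubles the number of lattice points and creates no
  vanishing sums of length at most \<open>l\<close> other than those of the two halves.
\<close>
definition extends :: "nat \<Rightarrow> nat \<Rightarrow> nat \<Rightarrow> bool" where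
  "extends l m p \<longleftrightarrow> p \<in> primes_1_mod_4 \<and> \<not> p dvd m \<and> \<not> bad_prime l m p"

lemma extends_halves:
  assumes e: "extends l m p" and m: "m > 0"
  shows "gauss_pts (p * m) = (*) (gprime p) ` gauss_pts m \<union> (*) (cnj (gprime p)) ` gauss_pts m"
    "(*) (gprime p) ` gauss_pts m \<inter> (*) (cnj (gprime p)) ` gauss_pts m = {}" "gprime p \<noteq> 0"
proof -
  have p: "prime p" "p mod 4 = 1" "\<not> p dvd m" using e by (auto simp: extends_def primes_1_mod_4_def)
  note w = gprime[OF p(1,2)]
  show "gauss_pts (p * m) = (*) (gprime p) ` gauss_pts m \<union> (*) (cnj (gprime p)) ` gauss_pts m" by (rule gauss_pts_prime_mult[OF p(1) w])
  show "(*) (gprime p) ` gauss_pts m \<inter> (*) (cnj (gprime p)) ` gauss_pts m = {}" using gauss_pts_halves_inter[OF p(1,2) w m] p by simp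
  show "gprime p \<noteq> 0" using gauss_pts_nonzero[OF w] p by (simp add: prime_gt_0_nat)
qed

lemma num_lattice_points_extends:
  assumes "extends l m p" "m > 0"
  shows "num_lattice_points (p * m) = 2 * num_lattice_points m"
proof -
  note h = extends_halves[OF assms]
  have "card (gauss_pts (p * m)) = card ((*) (gprime p) ` gauss_pts m) + card ((*) (cnj (gprime p)) ` gauss_pts m)"
    unfolding h(1) by (rule card_Un_disjoint) (use h in auto)
  then show ?thesis using h(3) by (simp add: card_image inj_on_def card_gauss_pts)
qed

text \<open>
  In a vanishing sum over \<open>p * m\<close> the points from \<open>w\<close> times the circle of norm \<open>m\<close> and those from
  its conjugate have sums \<open>w * a\<close> and \<open>cnj w * b\<close>; since \<open>p\<close> is not bad, both vanish.
\<close>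
lemma corr_extends:
  assumes e: "extends l m p" and m: "m > 0" and L: "L \<le> l"
  shows "corr (p * m) L = (\<Sum>a\<le>L. (L choose a) * (corr m a * corr m (L - a)))"
proof -
  note h = extends_halves[OF e m]
  define w where "w = gprime p"
  define A where "A = (*) w ` gauss_pts m"
  define B where "B = (*) (cnj w) ` gauss_pts m"
  have w0: "w \<noteq> 0" using h(3) by (simp add: w_def)
  have disj: "A \<inter> B = {}" using h(2) by (simp add: A_def B_def w_def)
  have unscale: "\<exists>ys. set ys \<subseteq> gauss_pts m \<and> length ys = length xs \<and> sum_list xs = c * sum_list ys"
    if "set xs \<subseteq> (*) c ` gauss_pts m" "c \<noteq> 0" for c and xs :: "complex list"
  proof -
    define ys where "ys = map (\<lambda>x. x / c) xs"
    have "map ((*) c) ys = xs" using that by (simp add: ys_def comp_def map_idI)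
    then have "sum_list xs = c * sum_list ys" using sum_list_map_mult[of c ys] by simp
    moreover have "set ys \<subseteq> gauss_pts m" using that by (fastforce simp: ys_def)
    ultimately show ?thesis by (intro exI[of _ ys]) (simp add: ys_def)
  qed
  have "lists_sum (A \<union> B) L 0 = split_lists A B L 0 0"
  proof (intro equalityI subsetI)
    fix xs assume xs: "xs \<in> lists_sum (A \<union> B) L 0"
    define xa where "xa = filter (\<lambda>x. x \<in> A) xs"
    define xb where "xb = filter (\<lambda>x. x \<notin> A) xs"
    have sum0: "sum_list xa + sum_list xb = 0"
      using xs sum_list_filter_split[of xs "\<lambda>x. x \<in> A"] by (simp add: lists_sum_def xa_def xb_def)
    have "set xa \<subseteq> (*) w ` gauss_pts m" "set xb \<subseteq> (*) (cnj w) ` gauss_pts m"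
      using xs by (auto simp: xa_def xb_def lists_sum_def A_def B_def)
    then obtain ya yb where ya: "set ya \<subseteq> gauss_pts m" "length ya = length xa" "sum_list xa = w * sum_list ya"
      and yb: "set yb \<subseteq> gauss_pts m" "length yb = length xb" "sum_list xb = cnj w * sum_list yb"
      using unscale[of xa w] unscale[of xb "cnj w"] w0 by auto
    have len: "length xa \<le> l" "length xb \<le> l"
      using xs L length_filter_le[of "\<lambda>x. x \<in> A" xs] length_filter_le[of "\<lambda>x. x \<notin> A" xs] by (auto simp: lists_sum_def xa_def xb_def)
    have "sum_list ya \<in> short_sums l m" "sum_list yb \<in> short_sums l m"
      using ya yb len by (auto intro!: sum_list_in_short_sums)
    moreover have "w * sum_list ya + cnj w * sum_list yb = 0" using sum0 ya yb by simp
    moreover have "\<not> bad_prime l m p" using e by (simp add: extends_def)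
    ultimately have "sum_list ya = 0" unfolding bad_prime_def w_def by blast
    then have "sum_list xa = 0" "sum_list xb = 0" using ya sum0 by auto
    then show "xs \<in> split_lists A B L 0 0"
      using xs by (auto simp: split_lists_def lists_sum_def xa_def xb_def)
  next
    fix xs assume "xs \<in> split_lists A B L 0 0"
    then show "xs \<in> lists_sum (A \<union> B) L 0"
      using sum_list_filter_split[of xs "\<lambda>x. x \<in> A"] by (simp add: lists_sum_def split_lists_def)
  qed
  then have "corr (p * m) L = card (split_lists A B L 0 0)" using h(1) by (simp add: corr_def A_def B_def w_def)
  also have "\<dots> = (\<Sum>a\<le>L. (L choose a) * (card (lists_sum A a 0) * card (lists_sum B (L - a) 0)))"
    by (rule card_split_lists[OF _ _ disj]) (auto simp: A_def B_def)
  also have "\<dots> = (\<Sum>a\<le>L. (L choose a) * (corr m a * corr m (L - a)))"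
    using w0 by (simp add: A_def B_def card_lists_sum_scale corr_def)
  finally show ?thesis .
qed

text \<open>
  Up to conjugation every point of norm \<open>p * m\<close> is \<open>gprime p\<close> times a point of norm \<open>m\<close>, and
  conjugation does not change real parts. So a semi-correlation makes \<open>Re (gprime p * s)\<close> vanish for
  a sum \<open>s\<close> of points of norm \<open>m\<close>, and \<open>s \<noteq> 0\<close> would make \<open>p\<close> bad, with \<open>a = s\<close> and \<open>b = cnj s\<close>. The
  factor \<open>2 ^ l\<close> counts the choices of conjugates.
\<close>
lemma semi_correlations_extends:
  assumes e: "extends l m p" and m: "m > 0"
  shows "card (semi_correlations l (p * m)) \<le> 2 ^ l * corr m l"
proof -
  note h = extends_halves[OF e m]
  define w where "w = gprime p"
  have w0: "w \<noteq> 0" using h(3) by (simp add: w_def)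
  define emb where "emb = (\<lambda>(a::int, b::int). Complex (of_int a) (of_int b))"
  \<comment> \<open>The point of norm \<open>m\<close> that belongs to \<open>z\<close>, together with a flag that tells whether a
    conjugation was needed.\<close>
  define g where "g = (\<lambda>z. if z \<in> (*) w ` gauss_pts m then (True, z / w) else (False, cnj (z / cnj w)))"
  have g1: "snd (g z) \<in> gauss_pts m" "Re (w * snd (g z)) = Re z" if zz: "z \<in> gauss_pts (p * m)" for z
  proof -
    have "snd (g z) \<in> gauss_pts m \<and> Re (w * snd (g z)) = Re z"
    proof (cases "z \<in> (*) w ` gauss_pts m")
      case True
      then show ?thesis using w0 by (auto simp: g_def)
    next
      case False
      then obtain v where v: "v \<in> gauss_pts m" "z = cnj w * v" using zz unfolding h(1) w_def[symmetric] by blast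
      then have "g z = (False, cnj v)" using False w0 by (simp add: g_def)
      moreover have "w * cnj v = cnj z" by (simp add: v)
      ultimately show ?thesis using v by simp
    qed
    then show "snd (g z) \<in> gauss_pts m" "Re (w * snd (g z)) = Re z" by auto
  qed
  have ginj: "inj g" using w0 by (auto simp: inj_def g_def split: if_splits)
  have embpts: "emb q \<in> gauss_pts n" if "q \<in> lattice_points n" for q n
    using that unfolding gauss_pts_eq_image emb_def by blast
  define F where "F = (\<lambda>\<mu>. map (\<lambda>j. g (emb (\<mu> j))) [1..<Suc l])"
  define T where "T = {ts :: (bool \<times> complex) list. length ts = l \<and> map snd ts \<in> lists_sum (gauss_pts m) l 0}"
  have inT: "F \<mu> \<in> T" if mu: "\<mu> \<in> semi_correlations l (p * m)" for \<mu>
  proof -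
    define zs where "zs = map (\<lambda>j. emb (\<mu> j)) [1..<Suc l]"
    define ys where "ys = map (\<lambda>z. snd (g z)) zs"
    have zp: "set zs \<subseteq> gauss_pts (p * m)"
    proof
      fix z assume "z \<in> set zs"
      then have "z \<in> (\<lambda>j. emb (\<mu> j)) ` {1..l}"
        by (simp add: zs_def atLeastLessThanSuc_atLeastAtMost del: upt_Suc)
      then obtain j where j: "j \<in> {1..l}" "z = emb (\<mu> j)" by blast
      then have "\<mu> j \<in> lattice_points (p * m)" using mu by (auto simp: semi_correlations_def)
      then show "z \<in> gauss_pts (p * m)" unfolding j(2) by (rule embpts)
    qed
    have yp: "set ys \<subseteq> gauss_pts m" using zp g1(1) by (auto simp: ys_def)
    have "Re (w * sum_list ys) = (\<Sum>z\<leftarrow>zs. Re (w * snd (g z)))"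
      unfolding ys_def by (induction zs) (auto simp: distrib_left)
    also have "\<dots> = (\<Sum>z\<leftarrow>zs. Re z)" using zp g1(2) by (intro arg_cong[of _ _ sum_list] map_cong) auto
    also have "\<dots> = (\<Sum>j=1..l. Re (emb (\<mu> j)))"
      by (simp add: zs_def comp_def interv_sum_list_conv_sum_set_nat atLeastLessThanSuc_atLeastAtMost del: upt_Suc)
    also have "\<dots> = real_of_int (\<Sum>j=1..l. fst (\<mu> j))" by (simp add: emb_def case_prod_unfold)
    also have "\<dots> = 0" using mu by (simp add: semi_correlations_def)
    finally have R: "Re (w * sum_list ys) = 0" .
    have "w * sum_list ys + cnj w * cnj (sum_list ys) = 0" using R by (simp add: complex_eq_iff)
    moreover have "sum_list ys \<in> short_sums l m" using yp by (intro sum_list_in_short_sums) (auto simp: ys_def zs_def)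
    moreover have "cnj (sum_list ys) \<in> short_sums l m"
    proof -
      have "cnj (sum_list ys) = sum_list (map cnj ys)" by (induction ys) auto
      moreover have "sum_list (map cnj ys) \<in> short_sums l m"
      proof (rule sum_list_in_short_sums)
        show "set (map cnj ys) \<subseteq> gauss_pts m" using yp by auto
        show "length (map cnj ys) \<le> l" by (simp add: ys_def zs_def)
      qed
      ultimately show ?thesis by simp
    qed
    moreover have "\<not> bad_prime l m p" using e by (simp add: extends_def)
    ultimately have "sum_list ys = 0" unfolding bad_prime_def w_def by blast
    moreover have "map snd (F \<mu>) = ys" by (simp add: F_def ys_def zs_def)
    moreover have "length (F \<mu>) = l" by (simp add: F_def)
    moreover have "length ys = l" by (simp add: ys_def zs_def)
    ultimately show ?thesis using yp by (simp only: T_def lists_sum_def mem_Collect_eq)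
  qed
  have Finj: "inj_on F (semi_correlations l (p * m))"
  proof (rule inj_onI)
    fix \<mu> \<nu> assume mn: "\<mu> \<in> semi_correlations l (p * m)" "\<nu> \<in> semi_correlations l (p * m)" "F \<mu> = F \<nu>"
    show "\<mu> = \<nu>"
    proof (rule PiE_ext)
      show "\<mu> \<in> {1..l} \<rightarrow>\<^sub>E lattice_points (p * m)" "\<nu> \<in> {1..l} \<rightarrow>\<^sub>E lattice_points (p * m)"
        using mn by (auto simp: semi_correlations_def)
      fix j assume "j \<in> {1..l}"
      then have "g (emb (\<mu> j)) = g (emb (\<nu> j))" using mn(3) by (auto simp: F_def map_eq_conv)
      then have "emb (\<mu> j) = emb (\<nu> j)" using ginj by (auto dest: injD)
      then show "\<mu> j = \<nu> j" by (auto simp: emb_def case_prod_unfold prod_eq_iff)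
    qed
  qed
  define T' where "T' = (\<lambda>(bs, ys). zip bs ys) ` ({bs :: bool list. set bs \<subseteq> UNIV \<and> length bs = l} \<times> lists_sum (gauss_pts m) l 0)"
  have finT': "finite ({bs :: bool list. set bs \<subseteq> UNIV \<and> length bs = l} \<times> lists_sum (gauss_pts m) l 0)"
    by (intro finite_cartesian_product finite_lists_length_eq finite_lists_sum) auto
  have "T \<subseteq> T'"
  proof
    fix ts assume "ts \<in> T"
    then have "ts = zip (map fst ts) (map snd ts)" "map snd ts \<in> lists_sum (gauss_pts m) l 0" "length ts = l"
      by (auto simp: T_def zip_map_fst_snd)
    then show "ts \<in> T'" unfolding T'_def by (intro image_eqI[of _ _ "(map fst ts, map snd ts)"]) auto
  qed
  have "card (semi_correlations l (p * m)) \<le> card T'"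
    by (rule card_inj_on_le[OF Finj]) (use inT \<open>T \<subseteq> T'\<close> finT' in \<open>auto simp: T'_def\<close>)
  also have "\<dots> \<le> card ({bs :: bool list. set bs \<subseteq> UNIV \<and> length bs = l} \<times> lists_sum (gauss_pts m) l 0)"
    unfolding T'_def by (rule card_image_le[OF finT'])
  also have "\<dots> = 2 ^ l * corr m l"
    using card_lists_length_eq[of "UNIV :: bool set" l] by (simp add: card_cartesian_product corr_def)
  finally show ?thesis .
qed

section \<open>Moments of long chains\<close>

text \<open>
  For a Gaussian prediction the number of vanishing sums of \<open>2 * k\<close> points out of \<open>N\<close> would be
  \<open>(2 * k)! / (2 ^ k * k!) * N ^ k\<close>, the number of ways to cancel the points in pairs. The
  normalisation turns the coefficients \<open>2 * k choose 2 * a\<close> of the recursion into \<open>k choose a\<close>.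
\<close>
definition moment :: "nat \<Rightarrow> nat \<Rightarrow> real" where
  "moment k m = real (corr m (2 * k)) * (2 ^ k * fact k) / (fact (2 * k) * real (num_lattice_points m) ^ k)"

lemma sum_atMost_even:
  fixes f :: "nat \<Rightarrow> 'a::comm_monoid_add"
  assumes "\<And>a. odd a \<Longrightarrow> f a = 0"
  shows "(\<Sum>a\<le>2*k. f a) = (\<Sum>a\<le>k. f (2 * a))"
  using assms by (induction k) auto

lemma moment_extends:
  assumes e: "extends l m p" and m: "m > 0" and k: "2 * k \<le> l" and N: "num_lattice_points m > 0"
  shows "moment k (p * m) = (\<Sum>a\<le>k. real (k choose a) * (moment a m * moment (k - a) m)) / 2 ^ k"
proof -
  define N' where "N' = real (num_lattice_points m)"
  have N': "N' > 0" using N by (simp add: N'_def)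
  have "corr (p * m) (2 * k) = (\<Sum>a\<le>2*k. (2 * k choose a) * (corr m a * corr m (2 * k - a)))"
    by (rule corr_extends[OF e m k])
  also have "\<dots> = (\<Sum>a\<le>k. (2 * k choose (2 * a)) * (corr m (2 * a) * corr m (2 * k - 2 * a)))"
    by (rule sum_atMost_even) (simp add: corr_odd[OF m])
  finally have c: "real (corr (p * m) (2 * k)) = (\<Sum>a\<le>k. real (2 * k choose (2 * a)) * (real (corr m (2 * a)) * real (corr m (2 * k - 2 * a))))"
    by simp
  have "moment k (p * m) = (\<Sum>a\<le>k. real (2 * k choose (2 * a)) * (real (corr m (2 * a)) * real (corr m (2 * k - 2 * a))) *
      ((2 ^ k * fact k) / (fact (2 * k) * (2 * N') ^ k)))"
    unfolding moment_def num_lattice_points_extends[OF e m] c sum_distrib_right[symmetric] by (simp add: N'_def)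
  also have "\<dots> = (\<Sum>a\<le>k. real (k choose a) * (moment a m * moment (k - a) m) / 2 ^ k)"
  proof (intro sum.cong refl)
    fix a assume "a \<in> {..k}"
    then have a: "a \<le> k" by simp
    have b1: "real (2 * k choose (2 * a)) = fact (2 * k) / (fact (2 * a) * fact (2 * (k - a)))"
      using a by (simp add: binomial_fact diff_mult_distrib2)
    have b2: "real (k choose a) = fact k / (fact a * fact (k - a))" using a by (simp add: binomial_fact)
    have p1: "N' ^ k = N' ^ a * N' ^ (k - a)" "(2::real) ^ k = 2 ^ a * 2 ^ (k - a)" using a by (simp_all flip: power_add)
    have d: "2 * k - 2 * a = 2 * (k - a)" by simp
    have nz: "fact (2 * k) \<noteq> (0::real)" "fact k \<noteq> (0::real)" "fact a \<noteq> (0::real)" "fact (k - a) \<noteq> (0::real)"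
      "fact (2 * a) \<noteq> (0::real)" "fact (2 * (k - a)) \<noteq> (0::real)" "N' ^ a \<noteq> 0" "N' ^ (k - a) \<noteq> 0" "(2::real) ^ a \<noteq> 0" "(2::real) ^ (k - a) \<noteq> 0"
      using N' by auto
    show "real (2 * k choose (2 * a)) * (real (corr m (2 * a)) * real (corr m (2 * k - 2 * a))) *
      ((2 ^ k * fact k) / (fact (2 * k) * (2 * N') ^ k)) = real (k choose a) * (moment a m * moment (k - a) m) / 2 ^ k"
      unfolding b1 b2 moment_def d N'_def[symmetric] power_mult_distrib p1
      using nz by (simp add: divide_simps)
  qed
  finally show ?thesis by (simp add: sum_divide_distrib)
qed

lemma moment_0: "moment 0 m = 1" by (simp add: moment_def)

lemma moment_1: "num_lattice_points m > 0 \<Longrightarrow> moment 1 m = 1"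
  using corr_2[of m] by (simp add: moment_def numeral_2_eq_2[symmetric] fact_2)

lemma moment_nonneg: "moment k m \<ge> 0" by (simp add: moment_def)

text \<open>
  The recursion of the moments along a chain, started from a bound \<open>B\<close> for the moments of index at
  least 2.
\<close>
fun majorant :: "real \<Rightarrow> nat \<Rightarrow> nat \<Rightarrow> real" where
  "majorant B 0 k = (if k \<le> 1 then 1 else B)"
| "majorant B (Suc r) k = (\<Sum>a\<le>k. real (k choose a) * (majorant B r a * majorant B r (k - a))) / 2 ^ k"

lemma majorant_0: "majorant B r 0 = 1"
  by (induction r) auto

lemma majorant_1: "majorant B r (Suc 0) = 1"
  by (induction r) (auto simp: majorant_0)

lemma majorant_nonneg: "B \<ge> 0 \<Longrightarrow> majorant B r k \<ge> 0"
  by (induction r arbitrary: k) (auto intro!: sum_nonneg divide_nonneg_nonneg)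

text \<open>
  A contraction with a convergent perturbation converges to the fixed point of the limiting
  recursion.
\<close>
lemma tendsto_affine_recursion:
  fixes x b :: "nat \<Rightarrow> real"
  assumes q: "0 \<le> q" "q < 1" and x: "\<And>r. x (Suc r) = q * x r + b r" and b: "b \<longlonglongrightarrow> 1 - q"
  shows "x \<longlonglongrightarrow> 1"
proof (rule LIMSEQ_I)
  fix e :: real assume e: "e > 0"
  have "eventually (\<lambda>r. \<bar>b r - (1 - q)\<bar> < e / 2 * (1 - q)) sequentially"
  proof -
    have "0 < e / 2 * (1 - q)" using q e by simp
    then show ?thesis using b unfolding tendsto_iff dist_real_def by blast
  qed
  then obtain R where R: "\<And>r. r \<ge> R \<Longrightarrow> \<bar>b r - (1 - q)\<bar> \<le> e / 2 * (1 - q)" by (auto simp: eventually_sequentially intro: less_imp_le)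
  have bound: "\<bar>x (R + i) - 1\<bar> \<le> q ^ i * \<bar>x R - 1\<bar> + e / 2" for i
  proof (induction i)
    case (Suc i)
    have "x (R + Suc i) - 1 = q * (x (R + i) - 1) + (b (R + i) - (1 - q))" by (simp add: x algebra_simps)
    then have "\<bar>x (R + Suc i) - 1\<bar> \<le> q * \<bar>x (R + i) - 1\<bar> + \<bar>b (R + i) - (1 - q)\<bar>"
      using q by (metis abs_mult abs_of_nonneg abs_triangle_ineq)
    also have "\<dots> \<le> q * (q ^ i * \<bar>x R - 1\<bar> + e / 2) + e / 2 * (1 - q)"
      using q Suc R[of "R + i"] by (intro add_mono mult_left_mono) auto
    also have "\<dots> = q ^ Suc i * \<bar>x R - 1\<bar> + e / 2" by (simp add: field_simps)
    finally show ?case .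
  qed (use e in simp)
  have "(\<lambda>i. q ^ i * \<bar>x R - 1\<bar>) \<longlonglongrightarrow> 0 * \<bar>x R - 1\<bar>"
    using q by (intro tendsto_intros LIMSEQ_realpow_zero) auto
  then have "eventually (\<lambda>i. q ^ i * \<bar>x R - 1\<bar> < e / 2) sequentially" using e by (intro order_tendstoD) auto
  then obtain I where I: "\<And>i. i \<ge> I \<Longrightarrow> q ^ i * \<bar>x R - 1\<bar> < e / 2" by (auto simp: eventually_sequentially)
  have "norm (x n - 1) < e" if "n \<ge> R + I" for n
  proof -
    have e1: "R + (n - R) = n" and "I \<le> n - R" using that by auto
    from I[OF this(2)] have "\<bar>x (R + (n - R)) - 1\<bar> < e" using bound[of "n - R"] by linarith
    then show ?thesis unfolding e1 by simp
  qed
  then show "\<exists>no. \<forall>n\<ge>no. norm (x n - 1) < e" by blast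
qed

text \<open>
  Induction on \<open>k\<close>. The two extreme terms of the recursion both equal \<open>majorant B r k\<close> and together
  have the factor \<open>q = 2 / 2 ^ k < 1\<close>; the others tend to \<open>1 - q\<close> by induction.
\<close>
lemma majorant_tendsto: "(\<lambda>r. majorant B r k) \<longlonglongrightarrow> 1"
proof (induction k rule: less_induct)
  case (less k)
  show ?case
  proof (cases "k \<le> 1")
    case True
    then have "k = 0 \<or> k = Suc 0" by auto
    then show ?thesis by (auto simp: majorant_0 majorant_1)
  next
    case False
    then have k: "k \<ge> 2" by simp
    define q :: real where "q = 2 / 2 ^ k"
    have "(2::real) ^ 2 \<le> 2 ^ k" using k by (intro power_increasing) auto
    then have q: "0 \<le> q" "q < 1" by (auto simp: q_def)
    define b where "b = (\<lambda>r. (\<Sum>a=1..k-1. real (k choose a) * (majorant B r a * majorant B r (k - a))) / 2 ^ k)"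
    have split: "{..k} = insert 0 (insert k {1..k-1})" using k by auto
    have "majorant B (Suc r) k = q * majorant B r k + b r" for r
      unfolding majorant.simps split b_def q_def using k
      by (simp add: majorant_0 add_divide_distrib)
    moreover have "b \<longlonglongrightarrow> 1 - q"
    proof -
      have "b \<longlonglongrightarrow> (\<Sum>a=1..k-1. real (k choose a) * (1 * 1)) / 2 ^ k"
        unfolding b_def using k by (intro tendsto_intros less) auto
      also have "(\<Sum>a=1..k-1. real (k choose a) * (1 * 1)) / 2 ^ k = 1 - q"
      proof -
        have "(\<Sum>a\<le>k. real (k choose a)) = 2 ^ k"
          using choose_row_sum[of k] by (metis of_nat_numeral of_nat_power of_nat_sum)
        then have "(\<Sum>a=1..k-1. real (k choose a)) = 2 ^ k - 2" unfolding split using k by simp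
        then show ?thesis by (simp add: q_def diff_divide_distrib)
      qed
      finally show ?thesis .
    qed
    ultimately show ?thesis by (rule tendsto_affine_recursion[OF q])
  qed
qed

fun chain :: "nat \<Rightarrow> nat \<Rightarrow> nat list \<Rightarrow> bool" where
  "chain l m [] \<longleftrightarrow> True"
| "chain l m (p # ps) \<longleftrightarrow> extends l m p \<and> chain l (p * m) ps"

lemma chain_moment_le:
  assumes "chain l m ps" "m > 0" "num_lattice_points m > 0" "B \<ge> 0" "2 * K \<le> l"
    "\<And>k. k \<le> K \<Longrightarrow> moment k m \<le> majorant B r k"
  shows "num_lattice_points (m * prod_list ps) = 2 ^ length ps * num_lattice_points m \<and>
    (\<forall>k\<le>K. moment k (m * prod_list ps) \<le> majorant B (r + length ps) k)"
  using assms
proof (induction ps arbitrary: m r)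
  case (Cons p ps)
  have e: "extends l m p" using Cons.prems by simp
  have p0: "p > 0" using e by (auto simp: extends_def primes_1_mod_4_def prime_gt_0_nat)
  have N: "num_lattice_points (p * m) = 2 * num_lattice_points m"
    by (rule num_lattice_points_extends[OF e]) (use Cons.prems in simp)
  have "moment k (p * m) \<le> majorant B (Suc r) k" if k: "k \<le> K" for k
  proof -
    have "moment k (p * m) = (\<Sum>a\<le>k. real (k choose a) * (moment a m * moment (k - a) m)) / 2 ^ k"
      using Cons.prems k by (intro moment_extends[OF e]) auto
    also have "\<dots> \<le> majorant B (Suc r) k"
      unfolding majorant.simps using Cons.prems k
      by (intro divide_right_mono sum_mono mult_left_mono mult_mono)
         (auto simp: moment_nonneg majorant_nonneg)
    finally show ?thesis .
  qed
  then have "num_lattice_points ((p * m) * prod_list ps) = 2 ^ length ps * num_lattice_points (p * m) \<and>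
    (\<forall>k\<le>K. moment k ((p * m) * prod_list ps) \<le> majorant B (Suc r + length ps) k)"
    using Cons.prems p0 N by (intro Cons.IH) auto
  then show ?case using N by (simp add: mult_ac)
qed simp

lemma chain_append: "chain l m (ps @ qs) \<longleftrightarrow> chain l m ps \<and> chain l (m * prod_list ps) qs"
  by (induction ps arbitrary: m) (auto simp: mult_ac)

text \<open>
  The factor \<open>2 ^ (2 * k)\<close> comes from \<open>semi_correlations_extends\<close>, the factor 2 bounds the moment,
  and \<open>fact (2 * k)\<close> undoes the normalisation of the moment.
\<close>
definition corr_const :: "nat \<Rightarrow> real" where
  "corr_const k = 2 ^ (2 * k) * (2 * fact (2 * k))"

text \<open>
  The first primes of the chain bring the moments below 2, whatever the initial number of at most
  \<open>B\<close> lattice points; the last one turns vanishing sums into semi-correlations. The length \<open>R\<close>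
  depends on \<open>B\<close>, but the constant in the bound does not.
\<close>
lemma semi_correlations_chain:
  obtains R where "\<And>m ps p. m > 0 \<Longrightarrow> 0 < num_lattice_points m \<Longrightarrow> num_lattice_points m \<le> B \<Longrightarrow>
    chain (2 * k) m (ps @ [p]) \<Longrightarrow> length ps \<ge> R \<Longrightarrow>
    real (card (semi_correlations (2 * k) (m * prod_list (ps @ [p])))) \<le>
      corr_const k * real (num_lattice_points (m * prod_list (ps @ [p]))) ^ k"
proof -
  \<comment> \<open>A bound for the moments of any number with at most \<open>B\<close> lattice points, from the trivial bound
    for \<open>corr\<close>.\<close>
  define B' where "B' = 2 ^ k * fact k * real (B + 1) ^ k"
  have B'0: "B' \<ge> 0" by (simp add: B'_def)
  have "eventually (\<lambda>r. majorant B' r k < 2) sequentially"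
    using majorant_tendsto[of B' k] by (intro order_tendstoD) auto
  then obtain R where R: "\<And>r. r \<ge> R \<Longrightarrow> majorant B' r k < 2" by (auto simp: eventually_sequentially)
  have "real (card (semi_correlations (2 * k) (m * prod_list (ps @ [p])))) \<le>
      corr_const k * real (num_lattice_points (m * prod_list (ps @ [p]))) ^ k"
    if m: "m > 0" "0 < num_lattice_points m" "num_lattice_points m \<le> B" and ch: "chain (2 * k) m (ps @ [p])"
      and len: "length ps \<ge> R" for m ps p
  proof -
    define N where "N = num_lattice_points m"
    have base: "moment j m \<le> majorant B' 0 j" if j: "j \<le> k" for j
    proof (cases "j \<le> 1")
      case True
      then have "j = 0 \<or> j = 1" by auto
      then show ?thesis using moment_0 moment_1 m by auto
    next
      case False
      have "real (corr m (2 * j)) \<le> real (N ^ (2 * j))" unfolding N_def of_nat_le_iff by (rule corr_le)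
      also have "\<dots> = real N ^ j * real N ^ j" by (simp flip: power_add mult_2)
      finally have c: "real (corr m (2 * j)) \<le> real N ^ j * real N ^ j" .
      have "moment j m = real (corr m (2 * j)) * (2 ^ j * fact j) / (fact (2 * j) * real N ^ j)" by (simp add: moment_def N_def)
      also have "\<dots> \<le> (real N ^ j * real N ^ j) * (2 ^ j * fact j) / (1 * real N ^ j)"
        using m c by (intro frac_le mult_mono mult_right_mono) (auto simp: N_def)
      also have "\<dots> = real N ^ j * (2 ^ j * fact j)" using m by (simp add: N_def)
      also have "\<dots> \<le> real (B + 1) ^ k * (2 ^ k * fact k)"
      proof (intro mult_mono)
        have "real N ^ j \<le> real (B + 1) ^ j" using m by (intro power_mono) (auto simp: N_def)
        also have "\<dots> \<le> real (B + 1) ^ k" using j by (intro power_increasing) auto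
        finally show "real N ^ j \<le> real (B + 1) ^ k" .
      qed (use j in \<open>auto intro: power_increasing fact_mono\<close>)
      finally show ?thesis using False by (simp add: B'_def mult_ac)
    qed
    define M where "M = m * prod_list ps"
    have chps: "chain (2 * k) m ps" "extends (2 * k) M p" using ch by (auto simp: chain_append M_def)
    have c: "num_lattice_points M = 2 ^ length ps * N" "moment k M \<le> majorant B' (0 + length ps) k"
      using chain_moment_le[OF chps(1) m(1,2) B'0 order.refl base] by (auto simp: M_def N_def)
    have NM: "num_lattice_points M > 0" using c m by (simp add: N_def)
    have M0: "M > 0"
    proof -
      have "chain l m qs \<Longrightarrow> m > 0 \<Longrightarrow> m * prod_list qs > 0" for l m qs
        by (induction qs arbitrary: m) (force simp: extends_def primes_1_mod_4_def prime_gt_0_nat)+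
      then show ?thesis using chps(1) m by (simp add: M_def)
    qed
    have "moment k M \<le> 2" using c(2) R[OF len] by simp
    then have "real (corr M (2 * k)) * (2 ^ k * fact k) \<le> 2 * (fact (2 * k) * real (num_lattice_points M) ^ k)"
      using NM by (simp add: moment_def pos_divide_le_eq)
    moreover have "real (corr M (2 * k)) * 1 \<le> real (corr M (2 * k)) * (2 ^ k * fact k)"
    proof (intro mult_left_mono)
      have "(1::real) * 1 \<le> 2 ^ k * fact k" by (intro mult_mono) auto
      then show "(1::real) \<le> 2 ^ k * fact k" by simp
    qed auto
    ultimately have cM: "real (corr M (2 * k)) \<le> 2 * fact (2 * k) * real (num_lattice_points M) ^ k" by simp
    have "real (card (semi_correlations (2 * k) (p * M))) \<le> real (2 ^ (2 * k) * corr M (2 * k))"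
      unfolding of_nat_le_iff by (rule semi_correlations_extends[OF chps(2) M0])
    also have "\<dots> \<le> 2 ^ (2 * k) * (2 * fact (2 * k) * real (num_lattice_points M) ^ k)" using cM by simp
    also have "\<dots> \<le> 2 ^ (2 * k) * (2 * fact (2 * k) * real (num_lattice_points (p * M)) ^ k)"
      using num_lattice_points_extends[OF chps(2) M0] by (intro mult_left_mono power_mono) auto
    finally show ?thesis by (simp add: corr_const_def M_def mult_ac)
  qed
  then show thesis by (rule that)
qed

section \<open>Weighted sums over smooth numbers\<close>

lemma sum_inverse_powers_le:
  assumes "q \<ge> (2::nat)"
  shows "(\<Sum>v=1..K. 1 / real q ^ v) \<le> 2 / real q"
proof -
  have "(\<Sum>v=1..K. 1 / real q ^ v) \<le> 2 / real q - 2 / real q ^ Suc K"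
  proof (induction K)
    case (Suc K)
    have q: "real q \<ge> 2" using assms by simp
    have "1 / real q ^ Suc K \<le> 2 / real q ^ Suc K - 2 / real q ^ Suc (Suc K)"
      using q by (simp add: field_simps)
    moreover have "(\<Sum>v=1..Suc K. 1 / real q ^ v) = (\<Sum>v=1..K. 1 / real q ^ v) + 1 / real q ^ Suc K" by simp
    ultimately show ?case using Suc by linarith
  qed simp
  also have "\<dots> \<le> 2 / real q" by simp
  finally show ?thesis .
qed

abbreviation omega :: "nat \<Rightarrow> nat" where "omega m \<equiv> card (prime_factors m)"

lemma omega_prime_power_mult:
  assumes "prime q" "\<not> q dvd m" "m > 0"
  shows "omega (q ^ v * m) = (if v = 0 then 0 else 1) + omega m"
proof (cases "v = 0")
  case False
  have "q ^ v \<noteq> 0" using assms by auto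
  then have "prime_factors (q ^ v * m) = prime_factors (q ^ v) \<union> prime_factors m"
    using assms by (intro prime_factors_product) auto
  also have "prime_factors (q ^ v) = {q}" using assms False by (simp add: prime_factors_power prime_prime_factors)
  finally have e: "prime_factors (q ^ v * m) = insert q (prime_factors m)" by simp
  have "q \<notin> prime_factors m" using assms(2) by (auto simp: in_prime_factors_iff)
  then show ?thesis using False unfolding e by (subst card_insert_disjoint) auto
qed simp

text \<open>
  The right-hand side dominates an Euler product; induction on the set of primes, splitting off the
  power of one prime.
\<close>
lemma sum_smooth_le_prod:
  assumes D: "D \<ge> (0::real)" and F: "finite F" "\<And>q. q \<in> F \<Longrightarrow> prime q"
    and M: "finite M" "\<And>m. m \<in> M \<Longrightarrow> m > 0 \<and> prime_factors m \<subseteq> F"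
  shows "(\<Sum>m\<in>M. D ^ omega m / real m) \<le> (\<Prod>q\<in>F. 1 + 2 * D / real q)"
  using F M
proof (induction F arbitrary: M rule: finite_induct)
  case empty
  have one: "m = 1" if "m \<in> M" for m
  proof (rule ccontr)
    assume "m \<noteq> 1"
    then obtain p where "prime p" "p dvd m" using prime_factor_nat by blast
    moreover have "m > 0" "prime_factors m = {}" using empty(3)[OF that] by auto
    ultimately have "p \<in> {}" by (metis in_prime_factors_iff less_not_refl)
    then show False by simp
  qed
  then have "M \<subseteq> {1}" by auto
  have "(\<Sum>m\<in>M. D ^ omega m / real m) \<le> (\<Sum>m\<in>{1}. D ^ omega m / real m)"
    using \<open>M \<subseteq> {1}\<close> by (intro sum_mono2) auto
  then show ?case by simp
next
  case (insert q F)
  have q: "prime q" using insert.prems by simp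
  have q2: "q \<ge> 2" using q by (rule prime_ge_2_nat)
  define v where "v = (\<lambda>m::nat. multiplicity q m)"
  define rest where "rest = (\<lambda>m. m div q ^ v m)"
  have dec: "m = q ^ v m * rest m" "\<not> q dvd rest m" "rest m > 0" if "m \<in> M" for m
  proof -
    have "m > 0" using insert.prems(3)[OF that] by simp
    from prime_power_decompose[OF q this] obtain t where t: "m = q ^ multiplicity q m * t" "\<not> q dvd t" "t > 0" .
    have "q ^ multiplicity q m > 0" using q2 by simp
    then have "rest m = t" unfolding rest_def v_def by (subst t(1)) simp
    then show "m = q ^ v m * rest m" "\<not> q dvd rest m" "rest m > 0" using t by (simp_all add: v_def)
  qed
  define M' where "M' = rest ` M"
  define K where "K = Max (insert 0 (v ` M))"
  have vK: "v m \<le> K" if "m \<in> M" for m using that insert.prems(2) by (simp add: K_def)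
  have M': "finite M'" "\<And>m. m \<in> M' \<Longrightarrow> m > 0 \<and> prime_factors m \<subseteq> F"
  proof -
    show "finite M'" using insert.prems(2) by (simp add: M'_def)
    fix t assume "t \<in> M'"
    then obtain m where m: "m \<in> M" "t = rest m" by (auto simp: M'_def)
    have "m > 0" "prime_factors m \<subseteq> insert q F" using insert.prems(3)[OF m(1)] by auto
    moreover have "t dvd m" using dec(1)[OF m(1)] m(2) by (metis dvd_triv_right)
    ultimately have "prime_factors t \<subseteq> insert q F" using dvd_prime_factors[of m t] by auto
    moreover have "q \<notin> prime_factors t" using dec(2)[OF m(1)] m(2) by (auto simp: in_prime_factors_iff)
    ultimately show "t > 0 \<and> prime_factors t \<subseteq> F" using dec(3)[OF m(1)] m(2) by auto
  qed
  define g where "g = (\<lambda>(a, t). (if a = 0 then 1 else D / real q ^ a) * (D ^ omega t / real t))"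
  have "(\<Sum>m\<in>M. D ^ omega m / real m) = (\<Sum>m\<in>M. g (v m, rest m))"
  proof (intro sum.cong refl)
    fix m assume m: "m \<in> M"
    have "omega m = (if v m = 0 then 0 else 1) + omega (rest m)"
      by (subst (1) dec(1)[OF m]) (rule omega_prime_power_mult[OF q dec(2,3)[OF m]])
    moreover have "real m = real q ^ v m * real (rest m)" by (subst (1) dec(1)[OF m]) simp
    ultimately show "D ^ omega m / real m = g (v m, rest m)" by (simp add: g_def)
  qed
  also have "\<dots> = (\<Sum>x\<in>(\<lambda>m. (v m, rest m)) ` M. g x)"
  proof (subst sum.reindex)
    show "inj_on (\<lambda>m. (v m, rest m)) M" by (rule inj_onI) (metis dec(1) prod.inject)
  qed simp
  also have "\<dots> \<le> (\<Sum>x\<in>{0..K} \<times> M'. g x)"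
    using M'(1) vK D by (intro sum_mono2) (auto simp: g_def M'_def)
  also have "\<dots> = (\<Sum>a=0..K. if a = 0 then 1 else D / real q ^ a) * (\<Sum>t\<in>M'. D ^ omega t / real t)"
    by (simp only: g_def sum_product sum.cartesian_product)
  also have "(\<Sum>a=0..K. if a = 0 then 1 else D / real q ^ a) = 1 + D * (\<Sum>a=1..K. 1 / real q ^ a)"
    by (simp add: sum.atLeast_Suc_atMost sum_distrib_left)
  also have "(1 + D * (\<Sum>a=1..K. 1 / real q ^ a)) * (\<Sum>t\<in>M'. D ^ omega t / real t) \<le>
     (1 + D * (2 / real q)) * (\<Prod>q\<in>F. 1 + 2 * D / real q)"
  proof (intro mult_mono)
    show "1 + D * (\<Sum>a=1..K. 1 / real q ^ a) \<le> 1 + D * (2 / real q)"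
      using D by (intro add_left_mono mult_left_mono sum_inverse_powers_le q2)
    show "(\<Sum>t\<in>M'. D ^ omega t / real t) \<le> (\<Prod>q\<in>F. 1 + 2 * D / real q)"
      using insert.prems M' by (intro insert.IH) auto
  qed (use D in \<open>auto intro!: sum_nonneg\<close>)
  also have "\<dots> = (\<Prod>q\<in>insert q F. 1 + 2 * D / real q)" using insert by (simp add: mult.commute)
  finally show ?case .
qed

lemma sum_inverse_le_ln: "x \<ge> 1 \<Longrightarrow> (\<Sum>n=1..x. 1 / real n) \<le> 1 + ln (real x)"
proof (induction x rule: nat_induct_at_least)
  case (Suc x)
  have "ln (real x / real (Suc x)) \<le> real x / real (Suc x) - 1" using Suc by (intro ln_le_minus_one) auto
  also have "\<dots> = - (1 / real (Suc x))" by (simp add: field_simps)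
  finally have "1 / real (Suc x) \<le> ln (real (Suc x)) - ln (real x)" using Suc by (simp add: ln_div)
  with Suc show ?case by simp
qed simp

lemma sum_primes_ln_over_p_le:
  assumes "x \<ge> 1"
  shows "(\<Sum>p\<in>{p\<in>{1..x}. prime p}. ln (real p) / real p) \<le> 4 * (1 + ln (real x))"
proof -
  have "(\<Sum>p\<in>{p\<in>{1..x}. prime p}. ln (real p) / real p) = (\<Sum>p\<in>{p\<in>{1..x}. prime p}. mangoldt p * (1 / real p))"
    by (intro sum.cong) auto
  also have "\<dots> \<le> (\<Sum>d=1..x. mangoldt d * (1 / real d))"
    by (intro sum_mono2) (auto simp: mangoldt_nonneg)
  also have "\<dots> \<le> 4 * (\<Sum>d=1..x. 1 / real d)"
    by (rule sum_weighted_le[OF chebyshev_upper]) (auto intro!: divide_left_mono)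
  also have "\<dots> \<le> 4 * (1 + ln (real x))" using assms by (intro mult_left_mono sum_inverse_le_ln) auto
  finally show ?thesis .
qed

text \<open>
  The Euler product is at most \<open>exp (2 * D * \<Sum> 1 / q)\<close>. For \<open>q \<ge> P\<close> one has
  \<open>1 / q \<le> ln q / (q * ln P)\<close>, so that \<open>\<Sum> 1 / q \<le> B + O (ln r / ln P)\<close>, and a large \<open>P\<close> makes the
  power of \<open>r\<close> as small as desired.
\<close>
lemma sum_smooth_le:
  assumes D: "D \<ge> (0::real)"
  obtains C where "C > 0" "\<And>r M. r \<ge> 1 \<Longrightarrow> finite M \<Longrightarrow> (\<And>m. m \<in> M \<Longrightarrow> m > 0 \<and> prime_factors m \<subseteq> {..r}) \<Longrightarrow>
    (\<Sum>m\<in>M. D ^ omega m / real m) \<le> C * real r powr (1 / 4)"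
proof -
  \<comment> \<open>Chosen such that \<open>8 * D / ln P \<le> 1 / 4\<close>.\<close>
  define P where "P = exp (32 * D + 1)"
  have lnP: "ln P = 32 * D + 1" "P > 1" using D by (auto simp: P_def)
  define B where "B = (\<Sum>p=1..nat \<lceil>P\<rceil>. 1 / real p)"
  define C where "C = exp (2 * D * (B + 4))"
  have main: "(\<Sum>m\<in>M. D ^ omega m / real m) \<le> C * real r powr (1 / 4)"
    if r: "r \<ge> 1" and M: "finite M" "\<And>m. m \<in> M \<Longrightarrow> m > 0 \<and> prime_factors m \<subseteq> {..r}" for r M
  proof -
    define F where "F = {p\<in>{1..r}. prime p}"
    have finF: "finite F" by (simp add: F_def)
    have sub: "m > 0 \<and> prime_factors m \<subseteq> F" if "m \<in> M" for m
      using M(2)[OF that] by (auto simp: F_def Suc_le_eq intro: prime_gt_0_nat in_prime_factors_imp_prime)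
    have lr: "ln (real r) \<ge> 0" using r by simp
    have "(\<Sum>m\<in>M. D ^ omega m / real m) \<le> (\<Prod>q\<in>F. 1 + 2 * D / real q)"
      by (rule sum_smooth_le_prod[OF D finF _ M(1) sub]) (auto simp: F_def)
    also have "\<dots> \<le> (\<Prod>q\<in>F. exp (2 * D / real q))" using D by (intro prod_mono) auto
    also have "\<dots> = exp (2 * D * (\<Sum>q\<in>F. 1 / real q))" by (simp add: exp_sum[OF finF] sum_distrib_left)
    also have "\<dots> \<le> exp (2 * D * (B + 4) + 1 / 4 * ln (real r))"
    proof (subst exp_le_cancel_iff)
      have "(\<Sum>q\<in>F. 1 / real q) \<le> (\<Sum>q\<in>F. (if q \<le> nat \<lceil>P\<rceil> then 1 / real q else 0) + (ln (real q) / real q) / ln P)"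
      proof (intro sum_mono)
        fix q assume q: "q \<in> F"
        then have q1: "real q \<ge> 1" by (auto simp: F_def)
        show "1 / real q \<le> (if q \<le> nat \<lceil>P\<rceil> then 1 / real q else 0) + (ln (real q) / real q) / ln P"
        proof (cases "q \<le> nat \<lceil>P\<rceil>")
          case False
          then have "P \<le> real q" using real_nat_ceiling_ge[of P] by linarith
          then have "ln P \<le> ln (real q)" using lnP by (subst ln_le_cancel_iff) auto
          moreover have "ln P > 0" using lnP D by simp
          ultimately show ?thesis using False q1 by (simp add: field_simps)
        qed (use q1 lnP D in auto)
      qed
      also have "\<dots> = (\<Sum>q\<in>F. if q \<le> nat \<lceil>P\<rceil> then 1 / real q else 0) + (\<Sum>q\<in>F. ln (real q) / real q) / ln P"
        by (simp only: sum.distrib sum_divide_distrib)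
      also have "\<dots> \<le> B + 4 * (1 + ln (real r)) / ln P"
      proof (intro add_mono divide_right_mono)
        have "(\<Sum>q\<in>F. if q \<le> nat \<lceil>P\<rceil> then 1 / real q else 0) = (\<Sum>q\<in>F \<inter> {..nat \<lceil>P\<rceil>}. 1 / real q)"
          by (subst sum.inter_restrict) (auto simp: finF intro!: sum.cong)
        also have "\<dots> \<le> B" unfolding B_def by (intro sum_mono2) (auto simp: F_def)
        finally show "(\<Sum>q\<in>F. if q \<le> nat \<lceil>P\<rceil> then 1 / real q else 0) \<le> B" .
        show "(\<Sum>q\<in>F. ln (real q) / real q) \<le> 4 * (1 + ln (real r))"
          unfolding F_def by (rule sum_primes_ln_over_p_le[OF r])
      qed (use lnP D in auto)
      finally have "2 * D * (\<Sum>q\<in>F. 1 / real q) \<le> 2 * D * (B + 4 * (1 + ln (real r)) / ln P)"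
        using D by (intro mult_left_mono) auto
      also have "\<dots> = 2 * D * B + 8 * D / ln P + (8 * D / ln P) * ln (real r)"
        by (simp add: algebra_simps add_divide_distrib)
      also have "\<dots> \<le> 2 * D * B + 8 * D + 1 / 4 * ln (real r)"
      proof (intro add_mono mult_right_mono order.refl lr)
        show "8 * D / ln P \<le> 8 * D" using D lnP by (simp add: divide_le_eq mult_le_cancel_left1)
        show "8 * D / ln P \<le> 1 / 4" using D lnP by (simp add: divide_le_eq)
      qed (use D in \<open>auto simp: B_def intro!: sum_nonneg\<close>)
      finally show "2 * D * (\<Sum>q\<in>F. 1 / real q) \<le> 2 * D * (B + 4) + 1 / 4 * ln (real r)" by (simp add: algebra_simps)
    qed
    also have "\<dots> = C * real r powr (1 / 4)" using r by (simp add: C_def exp_add powr_def)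
    finally show ?thesis .
  qed
  show thesis by (rule that[of C]) (use main in \<open>auto simp: C_def\<close>)
qed

section \<open>Parts of a number supported on a set of primes\<close>

text \<open>
  The \<open>F\<close>-part of \<open>n\<close>, its largest divisor composed of primes from \<open>F\<close>.
\<close>
definition ppart :: "nat set \<Rightarrow> nat \<Rightarrow> nat" where
  "ppart F n = (\<Prod>q\<in>prime_factors n \<inter> F. q ^ multiplicity q n)"

lemma ppart_pos: "ppart F n > 0"
  unfolding ppart_def by (intro prod_pos) (auto intro: prime_gt_0_nat in_prime_factors_imp_prime)

lemma ppart_mult_disjoint:
  assumes "F \<inter> G = {}"
  shows "ppart F n * ppart G n = ppart (F \<union> G) n"
proof -
  have "prime_factors n \<inter> (F \<union> G) = (prime_factors n \<inter> F) \<union> (prime_factors n \<inter> G)" by auto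
  then show ?thesis unfolding ppart_def using assms by (subst prod.union_disjoint[symmetric]) auto
qed

lemma ppart_all: "n > 0 \<Longrightarrow> prime_factors n \<subseteq> F \<Longrightarrow> ppart F n = n"
  unfolding ppart_def using prime_factorization_nat[of n] by (simp add: Int_absorb2)

lemma ppart_complement: "n > 0 \<Longrightarrow> ppart F n * ppart (- F) n = n"
  by (subst ppart_mult_disjoint) (auto intro: ppart_all)

lemma ppart_dvd: "n > 0 \<Longrightarrow> ppart F n dvd n"
  by (metis dvd_triv_left ppart_complement)

lemma ppart_cong: "prime_factors n \<inter> F = prime_factors n \<inter> G \<Longrightarrow> ppart F n = ppart G n"
  by (simp add: ppart_def)

lemma prime_factors_ppart: "prime_factors (ppart F n) \<subseteq> prime_factors n \<inter> F"
proof
  fix p assume "p \<in> prime_factors (ppart F n)"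
  then have p: "prime p" "p dvd ppart F n" by auto
  then obtain q where q: "q \<in> prime_factors n \<inter> F" "p dvd q ^ multiplicity q n"
    unfolding ppart_def by (auto simp: prime_dvd_prod_iff)
  then have "p dvd q" using p(1) prime_dvd_power by blast
  then have "p = q" using p(1) q(1) by (auto intro: primes_dvd_imp_eq)
  then show "p \<in> prime_factors n \<inter> F" using q by simp
qed

lemma S2_mult_prime_power:
  assumes p: "prime p" "p mod 4 = 3 \<longrightarrow> even j" and n: "n > 0"
  shows "p ^ j * n \<in> S2 \<longleftrightarrow> n \<in> S2"
proof (cases "p mod 4 = 3")
  case False
  have "p ^ j * n \<in> S2 \<longleftrightarrow> n \<in> S2" by (induction j) (auto simp: mult.assoc S2_prime_mult_iff[OF p(1) False])
  then show ?thesis .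
next
  case True
  have p0: "p > 0" using p(1) by (simp add: prime_gt_0_nat)
  have step: "p * (p * k) \<in> S2 \<longleftrightarrow> k \<in> S2" for k
    using S2_inert_dvd[OF p(1) True, of "p * k"] p0 gauss_pts_inert_mult[OF p(1) True, of "p * k"]
    by (auto simp: sums_of_two_squares_iff)
  from True p obtain i where i: "j = 2 * i" by auto
  have "p ^ (2 * i) * n \<in> S2 \<longleftrightarrow> n \<in> S2" by (induction i) (auto simp: mult.assoc step)
  then show ?thesis by (simp add: i)
qed

lemma ppart_in_S2:
  assumes n: "n \<in> S2"
  shows "ppart F n \<in> S2"
proof -
  have "(\<Prod>q\<in>G. q ^ multiplicity q n) \<in> S2" if "finite G" "G \<subseteq> prime_factors n" for G
    using that
  proof (induction G rule: finite_induct)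
    case empty
    then show ?case using one_in_S2 by simp
  next
    case (insert q G)
    have q: "prime q" using insert.prems by auto
    have "(\<Prod>q\<in>G. q ^ multiplicity q n) \<in> S2" using insert by auto
    moreover from this have "(\<Prod>q\<in>G. q ^ multiplicity q n) > 0" by (rule S2_pos)
    ultimately show ?case
      using insert S2_mult_prime_power[OF q] S2_inert_multiplicity_even[OF q _ n] by simp
  qed
  then show ?thesis unfolding ppart_def by simp
qed

text \<open>
  Not every divisor of a sum of two squares has this property: here the inert primes occur in
  \<open>ppart F n\<close> with their full, even, multiplicity.
\<close>
lemma S2_div_ppart:
  assumes n: "n \<in> S2" and p: "p \<in> primes_1_mod_4" "p dvd n" "p \<notin> F"
  shows "ppart F n * p dvd n" "n div (ppart F n * p) \<in> S2"
proof -
  have n0: "n > 0" using n by (rule S2_pos)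
  have pr: "prime p" "p mod 4 \<noteq> 3" using p by (auto simp: primes_1_mod_4_def)
  have e: "n = ppart F n * ppart (- F) n" using ppart_complement[OF n0] by simp
  have "p dvd ppart F n * ppart (- F) n" using p(2) e by simp
  moreover have "\<not> p dvd ppart F n"
    using prime_factors_ppart[of F n] p(3) pr(1) ppart_pos[of F n] by (auto simp: in_prime_factors_iff)
  ultimately have d: "p dvd ppart (- F) n" using pr(1) by (simp add: prime_dvd_mult_iff)
  then obtain k where k: "ppart (- F) n = p * k" by auto
  have "p * k \<in> S2" using ppart_in_S2[OF n, of "- F"] k by simp
  then have "k \<in> S2" using S2_prime_mult_iff[OF pr] by simp
  have nk: "n = (ppart F n * p) * k" using e k by (simp add: mult.assoc)
  then show "ppart F n * p dvd n" by (metis dvd_triv_left)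
  have "ppart F n * p > 0" using ppart_pos[of F n] pr(1) by (simp add: prime_gt_0_nat)
  then have "n div (ppart F n * p) = k" using nk by (metis nonzero_mult_div_cancel_left less_not_refl)
  then show "n div (ppart F n * p) \<in> S2" using \<open>k \<in> S2\<close> by simp
qed

definition prime_count :: "nat \<Rightarrow> nat" where "prime_count m = size (prime_factorization m)"

text \<open>
  A prime \<open>1 (mod 4)\<close> at most doubles the number of lattice points, 2 preserves it, and for an inert
  \<open>q\<close> the circle of norm \<open>q * n\<close> is empty or a copy of that of norm \<open>n div q\<close>.
\<close>
lemma num_lattice_points_le_prime_count:
  assumes "m > 0"
  shows "num_lattice_points m \<le> 4 * 2 ^ prime_count m"
  using assms
proof (induction m rule: less_induct)
  case (less m)
  show ?case
  proof (cases "m = 1")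
    case True
    have "num_lattice_points 1 = 4" using hecke_1[of 0] by (simp add: hecke_0)
    then show ?thesis using True by (simp add: prime_count_def)
  next
    case False
    then obtain p where p: "prime p" "p dvd m" using prime_factor_nat by blast
    then obtain k where k: "m = p * k" by auto
    have k0: "k > 0" "k < m" using less.prems k prime_gt_1_nat[OF p(1)] by auto
    have om: "prime_count (q * j) = Suc (prime_count j)" if "prime q" "j > 0" for q j :: nat
      using that by (simp add: prime_count_def prime_factorization_mult prime_factorization_prime)
    have IH: "num_lattice_points k \<le> 4 * 2 ^ prime_count k" using less.IH[OF k0(2,1)] .
    show ?thesis using p(1)
    proof (cases rule: prime_mod_4_cases)
      case 1
      have "num_lattice_points m \<le> num_lattice_points k"
        unfolding card_gauss_pts[symmetric] k 1 gauss_pts_2_mult by (rule card_image_le) simp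
      then show ?thesis using IH om[OF p(1) k0(1)] by (simp add: k)
    next
      case 2
      have "num_lattice_points m \<le> card ((*) (gprime p) ` gauss_pts k) + card ((*) (cnj (gprime p)) ` gauss_pts k)"
        unfolding card_gauss_pts[symmetric] k gauss_pts_prime_mult[OF p(1) gprime[OF p(1) 2]] by (rule card_Un_le)
      also have "\<dots> \<le> num_lattice_points k + num_lattice_points k"
        unfolding card_gauss_pts[symmetric] by (intro add_mono card_image_le) auto
      finally show ?thesis using IH om[OF p(1) k0(1)] by (simp add: k)
    next
      case 3
      show ?thesis
      proof (cases "p dvd k")
        case True
        then obtain j where j: "k = p * j" by auto
        have "j \<le> k" using j prime_gt_0_nat[OF p(1)] by simp
        then have "j < m" using k0(2) by (rule le_less_trans)
        moreover have "j > 0" using k0 j by auto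
        ultimately have j0: "j > 0" "j < m" by auto
        have "gauss_pts m = (*) (of_nat p) ` gauss_pts j"
          unfolding k gauss_pts_inert_mult[OF p(1) 3] using True j prime_gt_0_nat[OF p(1)] by simp
        then have "num_lattice_points m \<le> num_lattice_points j"
          unfolding card_gauss_pts[symmetric] by (simp add: card_image_le)
        also have "\<dots> \<le> 4 * 2 ^ prime_count j" by (rule less.IH[OF j0(2,1)])
        also have "\<dots> \<le> 4 * 2 ^ prime_count m" using om[OF p(1) k0(1)] om[OF p(1) j0(1)] by (simp add: k j)
        finally show ?thesis .
      next
        case False
        then have "num_lattice_points m = 0"
          unfolding card_gauss_pts[symmetric] k gauss_pts_inert_mult[OF p(1) 3] by simp
        then show ?thesis by simp
      qed
    qed
  qed
qed

lemma ln_le_prime_count: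
  assumes "m > 0" "\<And>q. q \<in> prime_factors m \<Longrightarrow> q \<le> p" "p \<ge> 1"
  shows "ln (real m) \<le> real (prime_count m) * ln (real p)"
proof -
  have "ln (real m) = (\<Sum>q\<in>prime_factors m. ln (real q) * real (multiplicity q m))"
    by (rule ln_eq_sum_multiplicity[OF assms(1)])
  also have "\<dots> \<le> (\<Sum>q\<in>prime_factors m. ln (real p) * real (multiplicity q m))"
  proof (intro sum_mono mult_right_mono)
    fix q assume q: "q \<in> prime_factors m"
    then have "q > 0" by (intro prime_gt_0_nat in_prime_factors_imp_prime)
    then show "ln (real q) \<le> ln (real p)" using assms(2)[OF q] by simp
  qed simp
  also have "\<dots> = ln (real p) * real (\<Sum>q\<in>prime_factors m. multiplicity q m)" by (simp add: sum_distrib_left)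
  also have "(\<Sum>q\<in>prime_factors m. multiplicity q m) = prime_count m"
    unfolding prime_count_def size_multiset_overloaded_eq
    by (intro sum.cong refl) (auto simp: count_prime_factorization_prime in_prime_factors_iff)
  finally show ?thesis by (simp add: mult.commute)
qed

lemma prime_count_le:
  assumes "\<And>q. q \<in> prime_factors m \<Longrightarrow> q \<le> y \<Longrightarrow> multiplicity q m \<le> V"
    "\<And>q. q \<in> prime_factors m \<Longrightarrow> q > y \<Longrightarrow> multiplicity q m \<le> 1"
  shows "prime_count m \<le> V * Suc y + omega m"
proof -
  have "prime_count m = (\<Sum>q\<in>prime_factors m. multiplicity q m)"
    unfolding prime_count_def size_multiset_overloaded_eq
    by (intro sum.cong refl) (auto simp: count_prime_factorization_prime in_prime_factors_iff)
  also have "\<dots> \<le> (\<Sum>q\<in>prime_factors m. (if q \<le> y then V else 0) + 1)"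
  proof (intro sum_mono)
    fix q assume "q \<in> prime_factors m"
    then show "multiplicity q m \<le> (if q \<le> y then V else 0) + 1"
      using assms(1)[of q] assms(2)[of q] by (cases "q \<le> y") auto
  qed
  also have "\<dots> = (\<Sum>q\<in>prime_factors m. if q \<le> y then V else 0) + omega m" by (simp only: sum.distrib) simp
  also have "(\<Sum>q\<in>prime_factors m. if q \<le> y then V else 0) = (\<Sum>q\<in>prime_factors m \<inter> {..y}. V)"
    by (subst sum.inter_restrict) auto
  also have "\<dots> \<le> (\<Sum>q\<in>{..y}. V)" by (intro sum_mono2) auto
  also have "\<dots> = V * Suc y" by simp
  finally show ?thesis by simp
qed

lemma multiplicity_ppart:
  assumes n: "n > 0" and q: "q \<in> prime_factors (ppart F n)"
  shows "multiplicity q (ppart F n) \<le> multiplicity q n"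
  using ppart_dvd[OF n, of F] n by (intro dvd_imp_multiplicity_le) auto

section \<open>Almost all sums of two squares are long chains\<close>

text \<open>
  Writing \<open>p powr (-3/4)\<close> as a sum over \<open>r \<ge> p\<close> replaces a condition that ties \<open>p\<close> to the prime
  factors of \<open>m\<close> by the condition that all of them are at most \<open>r\<close>.
\<close>
lemma powr_34_le_sum:
  assumes "p \<ge> 1" "2 * p \<le> R"
  shows "real p powr (- 3 / 4) \<le> 4 * (\<Sum>r=p..R. real r powr (- 7 / 4))"
proof -
  have p: "real p > 0" using assms by simp
  have "real p powr (- 3 / 4) = real p * real p powr (- 7 / 4)"
    using powr_mult_base[of "real p" "- 7 / 4"] p by simp
  also have "\<dots> \<le> real p * (4 * (2 * real p) powr (- 7 / 4))"
  proof (intro mult_left_mono)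
    have "(2::real) powr (7 / 4) \<le> 2 powr 2" by (intro powr_mono) auto
    then have "1 \<le> 4 * (2::real) powr (- 7 / 4)" by (simp add: powr_minus field_simps)
    then have "1 * real p powr (- 7 / 4) \<le> (4 * 2 powr (- 7 / 4)) * real p powr (- 7 / 4)" by (rule mult_right_mono) simp
    then show "real p powr (- 7 / 4) \<le> 4 * (2 * real p) powr (- 7 / 4)" using p by (simp add: powr_mult)
  qed (use p in simp)
  also have "\<dots> = 4 * (\<Sum>r=Suc p..2*p. (2 * real p) powr (- 7 / 4))" by simp
  also have "\<dots> \<le> 4 * (\<Sum>r=Suc p..2*p. real r powr (- 7 / 4))"
    using p by (intro mult_left_mono sum_mono powr_mono2') auto
  also have "\<dots> \<le> 4 * (\<Sum>r=p..R. real r powr (- 7 / 4))"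
    using assms by (intro mult_left_mono sum_mono2) auto
  finally show ?thesis .
qed

text \<open>
  For tame \<open>m\<close> the number of lattice points, the logarithm of \<open>m\<close> relative to \<open>ln p\<close>, and hence the
  number of bad \<open>p\<close> are bounded by a power of \<open>2 ^ omega m\<close>. After \<open>1 / p\<close>, up to logarithms, has
  been replaced by a sum of \<open>r powr (-7/4)\<close> over \<open>r \<ge> p\<close>, the sum over \<open>m\<close> runs over \<open>r\<close>-smooth
  numbers and is \<open>O (r powr (1/4))\<close>. What remains is the tail of \<open>\<Sum> r powr (-3/2)\<close> beyond \<open>z\<close>.
\<close>
lemma bad_pairs_sum_le:
  assumes A: "A \<ge> 0"
  obtains C where "C > 0"
    "\<And>z I. z \<ge> 1 \<Longrightarrow> finite I \<Longrightarrow> (\<And>m p. (m, p) \<in> I \<Longrightarrow> m > 0 \<and> p > z \<and> p \<in> primes_1_mod_4 \<and>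
        bad_prime l m p \<and> (\<forall>q\<in>prime_factors m. q < p) \<and> real (2 ^ prime_count m) \<le> A * 2 ^ omega m) \<Longrightarrow>
      (\<Sum>(m,p)\<in>I. (1 + ln (real (m * p))) / real (m * p)) \<le> C / sqrt (real z)"
proof -
  \<comment> \<open>A factor \<open>2 ^ (2 * l)\<close> per prime factor of \<open>m\<close> for the number of bad primes, and a factor 2
    for the logarithm of \<open>m\<close>.\<close>
  define D :: real where "D = 2 * 2 ^ (2 * l)"
  have D0: "D \<ge> 0" by (simp add: D_def)
  obtain C where C: "C > 0" "\<And>r M. r \<ge> 1 \<Longrightarrow> finite M \<Longrightarrow> (\<And>m. m \<in> M \<Longrightarrow> m > 0 \<and> prime_factors m \<subseteq> {..r}) \<Longrightarrow>
    (\<Sum>m\<in>M. D ^ omega m / real m) \<le> C * real r powr (1 / 4)"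
    by (rule sum_smooth_le[OF D0]) blast
  define K where "K = 5 * A * (5 * A) ^ (2 * l)"
  have K0: "K \<ge> 0" using A by (simp add: K_def)
  have main: "(\<Sum>(m,p)\<in>I. (1 + ln (real (m * p))) / real (m * p)) \<le> (16 * K * C + 1) / sqrt (real z)"
    if z: "z \<ge> 1" and fin: "finite I" and I: "\<And>m p. (m, p) \<in> I \<Longrightarrow> m > 0 \<and> p > z \<and> p \<in> primes_1_mod_4 \<and>
        bad_prime l m p \<and> (\<forall>q\<in>prime_factors m. q < p) \<and> real (2 ^ prime_count m) \<le> A * 2 ^ omega m" for z I
  proof -
    define R where "R = 2 * Max (insert 0 (snd ` I))"
    have pR: "2 * p \<le> R" if "(m, p) \<in> I" for m p
      using fin that by (auto simp: R_def intro!: Max_ge image_eqI[of p snd "(m,p)"])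
    define w where "w = (\<lambda>m. 5 * A * 2 ^ omega m / real m)"
    have w0: "w m \<ge> 0" for m using A by (simp add: w_def)
    have summand: "(1 + ln (real (m * p))) / real (m * p) \<le> w m * real p powr (- 3 / 4)" if mp: "(m, p) \<in> I" for m p
    proof -
      note i = I[OF mp]
      have p1: "p \<ge> 1" using i z by auto
      have m0: "real m > 0" "real p > 0" using i by auto
      have lp: "ln (real p) \<ge> 0" using p1 by simp
      have "ln (real m) \<le> real (prime_count m) * ln (real p)"
        using i p1 by (intro ln_le_prime_count) (auto intro: less_imp_le)
      then have "1 + ln (real (m * p)) \<le> (1 + real (prime_count m)) * (1 + ln (real p))"
        using m0 by (simp add: ln_mult algebra_simps)
      also have "\<dots> \<le> (A * 2 ^ omega m) * (5 * real p powr (1 / 4))"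
      proof (intro mult_mono)
        have "1 + prime_count m \<le> 2 ^ prime_count m" using less_exp[of "prime_count m"] by (simp add: Suc_le_eq)
        then have "real (1 + prime_count m) \<le> real (2 ^ prime_count m)" by (simp only: of_nat_le_iff)
        then show "1 + real (prime_count m) \<le> A * 2 ^ omega m" using i by simp
        have "1 \<le> real p powr (1 / 4)" using p1 by (intro ge_one_powr_ge_zero) auto
        then show "1 + ln (real p) \<le> 5 * real p powr (1 / 4)" using ln_le_4_powr[OF m0(2)] by linarith
      qed (use A lp in auto)
      finally have "(1 + ln (real (m * p))) / real (m * p) \<le> (A * 2 ^ omega m) * (5 * real p powr (1 / 4)) / real (m * p)"
        by (intro divide_right_mono) auto
      also have "\<dots> = w m * (real p powr (1 / 4) / real p)" by (simp add: w_def)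
      also have "real p powr (1 / 4) / real p = real p powr (- 3 / 4)"
        using m0 powr_diff[of "real p" "1/4" 1] by simp
      finally show ?thesis .
    qed
    have "(\<Sum>(m,p)\<in>I. (1 + ln (real (m * p))) / real (m * p)) \<le> (\<Sum>(m,p)\<in>I. w m * (4 * (\<Sum>r=Suc z..R. if p \<le> r then real r powr (- 7 / 4) else 0)))"
    proof (intro sum_mono)
      fix q assume "q \<in> I"
      then obtain m p where q: "q = (m, p)" "(m, p) \<in> I" by (cases q) auto
      note i = I[OF q(2)]
      have "real p powr (- 3 / 4) \<le> 4 * (\<Sum>r=p..R. real r powr (- 7 / 4))"
        using i pR[OF q(2)] by (intro powr_34_le_sum) auto
      also have "(\<Sum>r=p..R. real r powr (- 7 / 4)) = (\<Sum>r=p..R. if p \<le> r then real r powr (- 7 / 4) else 0)"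
        by (intro sum.cong) auto
      also have "\<dots> \<le> (\<Sum>r=Suc z..R. if p \<le> r then real r powr (- 7 / 4) else 0)"
        using i by (intro sum_mono2) auto
      finally have "w m * real p powr (- 3 / 4) \<le> w m * (4 * (\<Sum>r=Suc z..R. if p \<le> r then real r powr (- 7 / 4) else 0))"
        by (intro mult_left_mono w0) simp
      with summand[OF q(2)] show "(case q of (m,p) \<Rightarrow> (1 + ln (real (m * p))) / real (m * p)) \<le>
         (case q of (m,p) \<Rightarrow> w m * (4 * (\<Sum>r=Suc z..R. if p \<le> r then real r powr (- 7 / 4) else 0)))"
        by (simp add: q)
    qed
    also have "\<dots> = (\<Sum>(m,p)\<in>I. \<Sum>r=Suc z..R. 4 * real r powr (- 7 / 4) * (if p \<le> r then w m else 0))"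
      by (intro sum.cong refl) (auto simp: sum_distrib_left intro!: sum.cong)
    also have "\<dots> = (\<Sum>r=Suc z..R. \<Sum>(m,p)\<in>I. 4 * real r powr (- 7 / 4) * (if p \<le> r then w m else 0))"
      unfolding case_prod_unfold by (rule sum.swap)
    also have "\<dots> = (\<Sum>r=Suc z..R. 4 * real r powr (- 7 / 4) * (\<Sum>(m,p)\<in>I. if p \<le> r then w m else 0))"
      by (simp add: sum_distrib_left case_prod_unfold)
    also have "\<dots> \<le> (\<Sum>r=Suc z..R. 4 * real r powr (- 7 / 4) * (K * (C * real r powr (1 / 4))))"
    proof (intro sum_mono mult_left_mono)
      fix r assume r: "r \<in> {Suc z..R}"
      define Mr where "Mr = {m \<in> fst ` I. prime_factors m \<subseteq> {..r}}"
      define P where "P = (\<lambda>m. {p. (m, p) \<in> I})"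
      have finMr: "finite Mr" using fin by (simp add: Mr_def)
      have Mr: "m > 0 \<and> prime_factors m \<subseteq> {..r}" if "m \<in> Mr" for m
        using that I by (auto simp: Mr_def)
      have finP: "finite (P m)" for m
        by (rule finite_subset[of _ "snd ` I"]) (use fin in \<open>force simp: P_def\<close>)+
      \<comment> \<open>The number of bad \<open>p\<close> is at most a power of the number of lattice points of norm \<open>m\<close>.\<close>
      have cardP: "real (card (P m)) * w m \<le> K * (D ^ omega m / real m)" if m: "m \<in> Mr" for m
      proof -
        obtain p where p: "(m, p) \<in> I" using m by (auto simp: Mr_def)
        have A2: "real (2 ^ prime_count m) \<le> A * 2 ^ omega m" "m > 0" using I[OF p] by auto
        have "P m \<subseteq> {p\<in>primes_1_mod_4. bad_prime l m p}" using I by (auto simp: P_def)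
        then have "card (P m) \<le> card {p\<in>primes_1_mod_4. bad_prime l m p}"
          by (intro card_mono card_bad_primes_le)
        also have "\<dots> \<le> (num_lattice_points m + 1) ^ (2 * l)" by (rule card_bad_primes_le)
        also have "\<dots> \<le> (5 * 2 ^ prime_count m) ^ (2 * l)"
        proof (intro power_mono)
          have "(1::nat) \<le> 2 ^ prime_count m" by simp
          then show "num_lattice_points m + 1 \<le> 5 * 2 ^ prime_count m"
            using num_lattice_points_le_prime_count[OF A2(2)] by linarith
        qed simp
        finally have "real (card (P m)) \<le> real ((5 * 2 ^ prime_count m) ^ (2 * l))" by (simp only: of_nat_le_iff)
        also have "\<dots> = (5 * real (2 ^ prime_count m)) ^ (2 * l)" by simp
        also have "\<dots> \<le> (5 * (A * 2 ^ omega m)) ^ (2 * l)"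
          using A2 by (intro power_mono mult_left_mono) auto
        also have "\<dots> = (5 * A) ^ (2 * l) * (2 ^ (2 * l)) ^ omega m"
        proof -
          have "(5 * (A * 2 ^ omega m)) ^ (2 * l) = ((5 * A) * 2 ^ omega m) ^ (2 * l)" by (simp only: mult.assoc)
          also have "\<dots> = (5 * A) ^ (2 * l) * (2 ^ omega m) ^ (2 * l)" by (rule power_mult_distrib)
          also have "((2::real) ^ omega m) ^ (2 * l) = (2 ^ (2 * l)) ^ omega m"
            unfolding power_mult[symmetric] mult.commute[of "omega m"] ..
          finally show ?thesis .
        qed
        finally have "real (card (P m)) * w m \<le> ((5 * A) ^ (2 * l) * (2 ^ (2 * l)) ^ omega m) * w m"
          by (rule mult_right_mono) (rule w0)
        also have "\<dots> = K * (D ^ omega m / real m)" by (simp add: K_def D_def w_def power_mult_distrib)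
        finally show ?thesis .
      qed
      have "(\<Sum>(m,p)\<in>I. if p \<le> r then w m else 0) = (\<Sum>(m,p)\<in>{(m,p)\<in>I. p \<le> r}. w m)"
        using fin by (intro sum.mono_neutral_cong_right) (auto split: if_splits)
      also have "\<dots> \<le> (\<Sum>(m,p)\<in>(SIGMA m:Mr. P m). w m)"
      proof (rule sum_mono2)
        show "finite (SIGMA m:Mr. P m)" using finMr finP by auto
        show "{(m,p)\<in>I. p \<le> r} \<subseteq> (SIGMA m:Mr. P m)"
        proof
          fix q assume "q \<in> {(m,p)\<in>I. p \<le> r}"
          then obtain m p where q: "q = (m, p)" "(m, p) \<in> I" "p \<le> r" by auto
          have "prime_factors m \<subseteq> {..r}" using I[OF q(2)] q(3) by force
          moreover have "m \<in> fst ` I" using q(2) by force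
          ultimately show "q \<in> (SIGMA m:Mr. P m)" using q by (auto simp: Mr_def P_def)
        qed
      qed (auto simp: w0)
      also have "\<dots> = (\<Sum>m\<in>Mr. \<Sum>p\<in>P m. w m)" using finMr finP by (intro sum.Sigma[symmetric]) auto
      also have "\<dots> = (\<Sum>m\<in>Mr. real (card (P m)) * w m)" by simp
      also have "\<dots> \<le> (\<Sum>m\<in>Mr. K * (D ^ omega m / real m))" by (intro sum_mono cardP)
      also have "\<dots> = K * (\<Sum>m\<in>Mr. D ^ omega m / real m)" by (simp only: sum_distrib_left)
      also have "\<dots> \<le> K * (C * real r powr (1 / 4))"
        using r by (intro mult_left_mono K0 C(2) finMr Mr) auto
      finally show "(\<Sum>(m,p)\<in>I. if p \<le> r then w m else 0) \<le> K * (C * real r powr (1 / 4))" .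
    qed auto
    also have "\<dots> = 4 * K * C * (\<Sum>r=Suc z..R. 1 / (real r * sqrt (real r)))"
    proof -
      have pw: "real r powr (- 7 / 4) * real r powr (1 / 4) = 1 / (real r * sqrt (real r))" if "r \<in> {Suc z..R}" for r
      proof -
        have r: "real r > 0" using that by auto
        have "real r powr (- 7 / 4) * real r powr (1 / 4) = real r powr (- (1 + 1 / 2))" by (simp flip: powr_add)
        also have "\<dots> = 1 / (real r powr 1 * real r powr (1/2))" unfolding powr_minus_divide powr_add ..
        finally show ?thesis using r by (simp add: powr_half_sqrt)
      qed
      have re: "4 * a * (K * (C * b)) = 4 * K * C * (a * b)" for a b :: real by simp
      have "(\<Sum>r=Suc z..R. 4 * real r powr (- 7 / 4) * (K * (C * real r powr (1 / 4)))) =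
        (\<Sum>r=Suc z..R. 4 * K * C * (1 / (real r * sqrt (real r))))"
        by (intro sum.cong refl) (simp only: re pw)
      then show ?thesis by (simp only: sum_distrib_left)
    qed
    also have "\<dots> \<le> 4 * K * C * (4 / sqrt (real z))"
      using K0 C(1) z by (intro mult_left_mono tail_inverse_n_sqrt_le) auto
    also have "\<dots> = (16 * K * C) / sqrt (real z)" by simp
    also have "\<dots> \<le> (16 * K * C + 1) / sqrt (real z)" by (intro divide_right_mono) auto
    finally show ?thesis .
  qed
  have "16 * K * C + 1 > 0" using K0 C(1) by (simp add: add_nonneg_pos)
  then show thesis using main by (rule that)
qed

text \<open>
  No large prime divides \<open>n\<close> twice and no small prime divides it \<open>V\<close> times, so that the number of
  prime factors with multiplicity exceeds \<open>omega\<close> by a bounded amount only.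
\<close>
definition tame :: "nat \<Rightarrow> nat \<Rightarrow> nat \<Rightarrow> bool" where
  "tame y V n \<longleftrightarrow> (\<forall>p. prime p \<longrightarrow> p \<le> y \<longrightarrow> \<not> p ^ V dvd n) \<and> (\<forall>p. prime p \<longrightarrow> p > y \<longrightarrow> \<not> p\<^sup>2 dvd n)"

lemma tame_multiplicity:
  assumes t: "tame y V n" and n: "n > 0" and q: "prime q"
  shows "q \<le> y \<Longrightarrow> multiplicity q n \<le> V" "q > y \<Longrightarrow> multiplicity q n \<le> 1"
proof -
  assume "q \<le> y"
  then have "\<not> q ^ V dvd n" using t q by (auto simp: tame_def)
  then show "multiplicity q n \<le> V" by (metis multiplicity_dvd' nat_le_linear)
next
  assume "q > y"
  then have "\<not> q\<^sup>2 dvd n" using t q by (auto simp: tame_def)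
  then have "multiplicity q n < 2" by (metis multiplicity_dvd' not_le)
  then show "multiplicity q n \<le> 1" by simp
qed

text \<open>
  The prime \<open>p\<close> and the part \<open>m\<close> of \<open>n\<close> below \<open>p\<close> form a bad pair, and \<open>n div (m * p)\<close> is a sum of
  two squares. So the union bound over the pairs applies.
\<close>
lemma bad_chain_density:
  assumes e: "\<epsilon> > 0"
  obtains z where "z \<ge> y" "z \<ge> 1" "upper_density_le \<epsilon>
    {n\<in>S2. tame y V n \<and> (\<exists>p\<in>primes_1_mod_4. p > z \<and> p dvd n \<and> bad_prime l (ppart {..<p} n) p)}"
proof -
  obtain C where C: "C > 0" "\<And>X d. X \<ge> 5 \<Longrightarrow> d \<ge> 1 \<Longrightarrow> S2_count (X div d) \<le> C * ((1 + ln (real d)) / real d) * S2_count X"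
    by (rule S2_count_regular) blast
  define A :: real where "A = 2 ^ (V * Suc y)"
  have A0: "A \<ge> 0" by (simp add: A_def)
  obtain C' where C': "C' > 0"
    "\<And>z I. z \<ge> 1 \<Longrightarrow> finite I \<Longrightarrow> (\<And>m p. (m, p) \<in> I \<Longrightarrow> m > 0 \<and> p > z \<and> p \<in> primes_1_mod_4 \<and>
        bad_prime l m p \<and> (\<forall>q\<in>prime_factors m. q < p) \<and> real (2 ^ prime_count m) \<le> A * 2 ^ omega m) \<Longrightarrow>
      (\<Sum>(m,p)\<in>I. (1 + ln (real (m * p))) / real (m * p)) \<le> C' / sqrt (real z)"
    by (rule bad_pairs_sum_le[OF A0, of l]) blast
  define z where "z = nat \<lceil>(C * C' / \<epsilon>)\<^sup>2\<rceil> + y + 1"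
  have z: "z \<ge> y" "z \<ge> 1" by (auto simp: z_def)
  have "(C * C' / \<epsilon>)\<^sup>2 \<le> real z" unfolding z_def of_nat_add using real_nat_ceiling_ge[of "(C * C' / \<epsilon>)\<^sup>2"] by linarith
  then have "C * C' / \<epsilon> \<le> sqrt (real z)" by (rule real_le_rsqrt)
  then have zC: "C * (C' / sqrt (real z)) \<le> \<epsilon>" using e z C(1) C'(1) by (simp add: field_simps)
  define E where "E = {n\<in>S2. tame y V n \<and> (\<exists>p\<in>primes_1_mod_4. p > z \<and> p dvd n \<and> bad_prime l (ppart {..<p} n) p)}"
  have "upper_density_le \<epsilon> E"
    unfolding upper_density_le_def eventually_sequentially
  proof (intro exI[of _ 5] allI impI)
    fix X :: nat assume X: "X \<ge> 5"
    define I where "I = {(m, p) \<in> {1..X} \<times> {1..X}. p > z \<and> p \<in> primes_1_mod_4 \<and> bad_prime l m p \<and>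
       (\<forall>q\<in>prime_factors m. q < p) \<and> real (2 ^ prime_count m) \<le> A * 2 ^ omega m}"
    have finI: "finite I" by (rule finite_subset[of _ "{1..X} \<times> {1..X}"]) (auto simp: I_def)
    have sub: "E \<inter> {1..X} \<subseteq> (\<Union>i\<in>I. {n\<in>S2. fst i * snd i dvd n \<and> n div (fst i * snd i) \<in> S2})"
    proof
      fix n assume "n \<in> E \<inter> {1..X}"
      then obtain p where n: "n \<in> S2" "tame y V n" "n \<le> X" "n \<ge> 1" and p: "p \<in> primes_1_mod_4" "p > z" "p dvd n"
        "bad_prime l (ppart {..<p} n) p" by (auto simp: E_def)
      define m where "m = ppart {..<p} n"
      have d: "m * p dvd n" "n div (m * p) \<in> S2" unfolding m_def by (rule S2_div_ppart[OF n(1) p(1,3)]; simp)+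
      have mp: "m > 0" "p > 0" using ppart_pos p by (auto simp: m_def)
      have pf: "q \<in> prime_factors n \<and> q < p" if "q \<in> prime_factors m" for q
        using prime_factors_ppart[of "{..<p}" n] that by (auto simp: m_def)
      have mult: "multiplicity q m \<le> multiplicity q n" if "q \<in> prime_factors m" for q
        using multiplicity_ppart[of n q "{..<p}"] that n by (simp add: m_def)
      have "prime_count m \<le> V * Suc y + omega m"
      proof (rule prime_count_le)
        fix q assume q: "q \<in> prime_factors m"
        then have qp: "prime q" by (rule in_prime_factors_imp_prime)
        show "multiplicity q m \<le> V" if "q \<le> y"
          using tame_multiplicity(1)[OF n(2) _ qp that] mult[OF q] n by simp
        show "multiplicity q m \<le> 1" if "q > y"
          using tame_multiplicity(2)[OF n(2) _ qp that] mult[OF q] n by simp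
      qed
      then have "(2::real) ^ prime_count m \<le> 2 ^ (V * Suc y + omega m)" by (intro power_increasing) auto
      then have "real (2 ^ prime_count m) \<le> A * 2 ^ omega m" by (simp add: A_def power_add)
      moreover have "m \<le> X" "p \<le> X"
        using n(3,4) ppart_dvd[of n "{..<p}"] p(3) by (auto simp: m_def dest!: dvd_imp_le)
      ultimately have "(m, p) \<in> I" using mp p pf by (auto simp: I_def m_def)
      then show "n \<in> (\<Union>i\<in>I. {n\<in>S2. fst i * snd i dvd n \<and> n div (fst i * snd i) \<in> S2})"
        using n d by (intro UN_I[of "(m, p)"]) auto
    qed
    have "real (card (E \<inter> {1..X})) \<le> C * (\<Sum>i\<in>I. (1 + ln (real (fst i * snd i))) / real (fst i * snd i)) * S2_count X"
      by (rule card_S2_UN_dvd_le[OF C(2)[OF X] finI _ sub]) (auto simp: I_def)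
    also have "\<dots> \<le> C * (C' / sqrt (real z)) * S2_count X"
    proof (intro mult_right_mono mult_left_mono)
      have "(\<Sum>(m,p)\<in>I. (1 + ln (real (m * p))) / real (m * p)) \<le> C' / sqrt (real z)"
        by (rule C'(2)[OF z(2) finI]) (auto simp: I_def)
      then show "(\<Sum>i\<in>I. (1 + ln (real (fst i * snd i))) / real (fst i * snd i)) \<le> C' / sqrt (real z)"
        by (simp add: case_prod_unfold)
    qed (use C(1) in \<open>auto simp: S2_count_def\<close>)
    also have "\<dots> \<le> \<epsilon> * S2_count X" by (intro mult_right_mono zC) (auto simp: S2_count_def)
    finally show "real (card (E \<inter> {1..X})) \<le> \<epsilon> * S2_count X" .
  qed
  then show thesis using that[of z] z by (simp add: E_def)
qed

text \<open>
  The prime factors of \<open>n\<close> beyond \<open>z\<close> are simple because \<open>n\<close> is tame, and therefore not inert.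
  Adding them in increasing order runs through the parts of \<open>n\<close> below its prime factors.
\<close>
lemma sorted_list_chain:
  assumes n: "n \<in> S2" and t: "tame y V n" and z: "z \<ge> y" "z \<ge> 2"
    and good: "\<And>p. p \<in> primes_1_mod_4 \<Longrightarrow> p > z \<Longrightarrow> p dvd n \<Longrightarrow> \<not> bad_prime l (ppart {..<p} n) p"
    and ps: "sorted_wrt (<) ps" "set ps = {q\<in>prime_factors n. q > z}"
  shows "chain l (ppart {..z} n) ps \<and> ppart {..z} n * prod_list ps = n"
  using z good ps
proof (induction ps arbitrary: z)
  case Nil
  then have "prime_factors n \<subseteq> {..z}" by (auto simp: not_less[symmetric])
  then show ?case using S2_pos[OF n] by (simp add: ppart_all)
next
  case (Cons p ps)
  have n0: "n > 0" using n by (rule S2_pos)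
  have p: "p \<in> prime_factors n" "p > z" using Cons.prems by auto
  have pp: "prime p" "p dvd n" using p by auto
  have p2: "\<not> p\<^sup>2 dvd n" using t pp(1) p(2) Cons.prems(1) by (auto simp: tame_def)
  have p4: "p mod 4 = 1" using pp(1)
  proof (cases rule: prime_mod_4_cases)
    case 3
    then show ?thesis using S2_div_inert_square(1)[OF pp(1) 3 pp(2) n] p2 by simp
  qed (use p Cons.prems in auto)
  then have pP: "p \<in> primes_1_mod_4" using pp by (simp add: primes_1_mod_4_def)
  have tail: "set ps = {q\<in>prime_factors n. q > p}"
  proof
    show "set ps \<subseteq> {q\<in>prime_factors n. q > p}" using Cons.prems(4,5) by auto
    show "{q\<in>prime_factors n. q > p} \<subseteq> set ps"
    proof
      fix q assume q: "q \<in> {q\<in>prime_factors n. q > p}"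
      then have "q \<in> set (p # ps)" unfolding Cons.prems(5) using p(2) by auto
      then show "q \<in> set ps" using q by auto
    qed
  qed
  have min: "q \<le> z \<or> q = p \<or> q > p" if "q \<in> prime_factors n" for q
  proof (rule ccontr)
    assume "\<not> ?thesis"
    then have "q \<in> set (p # ps)" "q \<noteq> p" "\<not> q > p" unfolding Cons.prems(5) using that by auto
    then show False using tail by auto
  qed
  have same: "ppart {..z} n = ppart {..<p} n"
    by (rule ppart_cong) (use min p in force)
  have "ppart {..p} n = ppart ({..<p} \<union> {p}) n" by (rule ppart_cong) auto
  also have "\<dots> = ppart {..<p} n * ppart {p} n" by (rule ppart_mult_disjoint[symmetric]) auto
  also have "ppart {p} n = p"
  proof -
    have "multiplicity p n \<le> 1" using tame_multiplicity(2)[OF t n0 pp(1)] p(2) Cons.prems(1) by simp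
    moreover have "multiplicity p n > 0" using pp n0 by (simp add: prime_multiplicity_gt_zero_iff)
    ultimately have "multiplicity p n = 1" by simp
    moreover have "prime_factors n \<inter> {p} = {p}" using p by auto
    ultimately show ?thesis by (simp add: ppart_def)
  qed
  finally have step: "ppart {..p} n = p * ppart {..z} n" using same by simp
  have "\<not> p dvd ppart {..<p} n"
    using prime_factors_ppart[of "{..<p}" n] pp(1) ppart_pos[of "{..<p}" n] by (auto simp: in_prime_factors_iff)
  then have "extends l (ppart {..z} n) p"
    unfolding extends_def same using pP Cons.prems(3)[OF pP p(2) pp(2)] by simp
  moreover have "chain l (ppart {..p} n) ps \<and> ppart {..p} n * prod_list ps = n"
    by (rule Cons.IH) (use Cons.prems p tail in auto)
  ultimately show ?case using step by (simp add: mult_ac)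
qed

text \<open>
  Outside of four sets of small density, \<open>n\<close> is tame, its prime factors beyond \<open>z\<close> are not bad for
  the part below them, and there are many of them. So \<open>n\<close> is a long chain over its \<open>z\<close>-smooth part,
  which is bounded in terms of \<open>z\<close> and \<open>V\<close>.
\<close>
lemma exceptional_null:
  "null_density {n\<in>S2. \<not> (real (card (semi_correlations (2 * k) n)) \<le> corr_const k * real (num_lattice_points n) ^ k
      \<and> num_lattice_points n \<ge> B)}"
  unfolding null_density_def
proof (intro allI impI)
  fix \<epsilon> :: real assume e: "\<epsilon> > 0"
  define e4 where "e4 = \<epsilon> / 4"
  have e4: "e4 > 0" using e by (simp add: e4_def)
  define l where "l = 2 * k"
  obtain y where y: "y \<ge> 5" "upper_density_le e4 {n\<in>S2. \<exists>p. prime p \<and> p > y \<and> p\<^sup>2 dvd n}"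
    by (rule large_square_divisor_density[OF e4])
  obtain V where V: "V \<ge> 2" "upper_density_le e4 {n\<in>S2. \<exists>p. prime p \<and> p \<le> y \<and> p ^ V dvd n}"
    by (rule high_power_divisor_density[OF e4])
  obtain z where z: "z \<ge> y" "z \<ge> 1" "upper_density_le e4
    {n\<in>S2. tame y V n \<and> (\<exists>p\<in>primes_1_mod_4. p > z \<and> p dvd n \<and> bad_prime l (ppart {..<p} n) p)}"
    by (rule bad_chain_density[OF e4])
  \<comment> \<open>A bound for the \<open>z\<close>-smooth part of a tame number.\<close>
  define Mx where "Mx = (\<Prod>q\<in>{1..z}. q ^ V)"
  define N0 where "N0 = (\<Sum>m\<le>Mx. num_lattice_points m)"
  obtain R where R: "\<And>m ps p. m > 0 \<Longrightarrow> 0 < num_lattice_points m \<Longrightarrow> num_lattice_points m \<le> N0 \<Longrightarrow>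
    chain (2 * k) m (ps @ [p]) \<Longrightarrow> length ps \<ge> R \<Longrightarrow>
    real (card (semi_correlations (2 * k) (m * prod_list (ps @ [p])))) \<le>
      corr_const k * real (num_lattice_points (m * prod_list (ps @ [p]))) ^ k"
    by (rule semi_correlations_chain[of N0 k]) blast
  \<comment> \<open>The length \<open>R\<close> makes the bound for semi-correlations available; further \<open>B\<close> prime factors
    produce at least \<open>2 ^ B\<close> lattice points.\<close>
  have E4: "upper_density_le e4 {n\<in>S2. card {p\<in>primes_1_mod_4. p > z \<and> p dvd n} < R + B + 1}"
    using few_prime_factors_null e4 by (simp add: null_density_def)
  let ?E1 = "{n\<in>S2. \<exists>p. prime p \<and> p > y \<and> p\<^sup>2 dvd n}"
  let ?E2 = "{n\<in>S2. \<exists>p. prime p \<and> p \<le> y \<and> p ^ V dvd n}"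
  let ?E3 = "{n\<in>S2. tame y V n \<and> (\<exists>p\<in>primes_1_mod_4. p > z \<and> p dvd n \<and> bad_prime l (ppart {..<p} n) p)}"
  let ?E4 = "{n\<in>S2. card {p\<in>primes_1_mod_4. p > z \<and> p dvd n} < R + B + 1}"
  let ?T = "{n\<in>S2. \<not> (real (card (semi_correlations (2 * k) n)) \<le> corr_const k * real (num_lattice_points n) ^ k
      \<and> num_lattice_points n \<ge> B)}"
  have "?T \<subseteq> (?E1 \<union> ?E2) \<union> (?E3 \<union> ?E4)"
  proof (rule ccontr)
    assume "\<not> ?T \<subseteq> (?E1 \<union> ?E2) \<union> (?E3 \<union> ?E4)"
    then obtain n where n: "n \<in> ?T" "n \<notin> ?E1" "n \<notin> ?E2" "n \<notin> ?E3" "n \<notin> ?E4" by blast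
    have nS: "n \<in> S2" using n(1) by simp
    have n0: "n > 0" using nS by (rule S2_pos)
    have t: "tame y V n" using n(2,3) nS by (auto simp: tame_def)
    have good: "\<not> bad_prime l (ppart {..<p} n) p" if "p \<in> primes_1_mod_4" "p > z" "p dvd n" for p
      using n(4) nS t that by blast
    define Q where "Q = {q\<in>prime_factors n. q > z}"
    define ps where "ps = sorted_list_of_set Q"
    have finQ: "finite Q" by (simp add: Q_def)
    have ps: "sorted_wrt (<) ps" "set ps = {q\<in>prime_factors n. q > z}" "length ps = card Q"
      using finQ by (auto simp: ps_def Q_def[symmetric])
    define m where "m = ppart {..z} n"
    have z2: "z \<ge> 2" using z y by simp
    have ch: "chain l m ps" "m * prod_list ps = n"
      using sorted_list_chain[OF nS t z(1) z2 good ps(1,2)] by (auto simp: m_def)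
    have "{p\<in>primes_1_mod_4. p > z \<and> p dvd n} \<subseteq> Q" using n0 by (auto simp: Q_def primes_1_mod_4_def in_prime_factors_iff)
    then have "card {p\<in>primes_1_mod_4. p > z \<and> p dvd n} \<le> card Q" by (rule card_mono[OF finQ])
    then have len: "length ps \<ge> R + B + 1" using n(5) nS ps(3) by simp
    then have "ps \<noteq> []" by auto
    then have qs0: "ps = butlast ps @ [last ps]" by simp
    define qs where "qs = butlast ps"
    define p where "p = last ps"
    have qs: "ps = qs @ [p]" using qs0 by (simp add: qs_def p_def)
    have m0: "m > 0" by (simp add: m_def ppart_pos)
    have mS: "m \<in> S2" unfolding m_def by (rule ppart_in_S2[OF nS])
    have Nm: "num_lattice_points m > 0"
      using mS finite_gauss_pts[of m] by (auto simp: sums_of_two_squares_iff card_gauss_pts[symmetric] card_gt_0_iff)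
    have "m \<le> Mx"
    proof -
      have "m \<le> (\<Prod>q\<in>prime_factors n \<inter> {..z}. q ^ V)"
        unfolding m_def ppart_def
      proof (intro prod_mono conjI)
        fix q assume q: "q \<in> prime_factors n \<inter> {..z}"
        then have qp: "prime q" by auto
        have "multiplicity q n \<le> V"
        proof (cases "q \<le> y")
          case False
          then have "multiplicity q n \<le> 1" using tame_multiplicity(2)[OF t n0 qp] by simp
          then show ?thesis using V(1) by simp
        qed (use tame_multiplicity(1)[OF t n0 qp] in simp)
        then show "q ^ multiplicity q n \<le> q ^ V" using prime_gt_0_nat[OF qp] by (intro power_increasing) auto
      qed simp
      also have "\<dots> \<le> Mx"
        unfolding Mx_def
      proof (intro dvd_imp_le prod_dvd_prod_subset)
        show "prime_factors n \<inter> {..z} \<subseteq> {1..z}"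
        proof
          fix q assume q: "q \<in> prime_factors n \<inter> {..z}"
          then have "prime q" by auto
          then show "q \<in> {1..z}" using q prime_ge_1_nat by auto
        qed
      qed (auto intro!: prod_pos)
      finally show ?thesis .
    qed
    then have "num_lattice_points m \<le> N0" unfolding N0_def by (intro member_le_sum) auto
    then have bound: "real (card (semi_correlations (2 * k) n)) \<le> corr_const k * real (num_lattice_points n) ^ k"
      using R[OF m0 Nm, of qs p] ch len qs by (simp add: l_def)
    have "num_lattice_points n = 2 ^ length ps * num_lattice_points m"
      using chain_moment_le[OF ch(1) m0 Nm, where B = 0 and K = 0 and r = 0] ch(2) by (simp add: moment_0)
    moreover have "B < 2 ^ length ps" using len less_exp[of "length ps"] by linarith
    ultimately have "num_lattice_points n \<ge> B" using Nm by (simp add: le_trans[OF less_imp_le])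
    with bound n(1) show False by simp
  qed
  from upper_density_le_subset_Un[OF upper_density_le_subset_Un[OF y(2) V(2) order.refl] upper_density_le_subset_Un[OF z(3) E4 order.refl] this]
  show "upper_density_le \<epsilon> ?T" by (simp add: e4_def)
qed

section \<open>Assembling the sequence\<close>

text \<open>
  Diagonalisation: beyond a threshold \<open>f B\<close> the set \<open>A B\<close> has relative density at most
  \<open>1 / (B + 1)\<close>, and \<open>E\<close> takes from \<open>A B\<close> only what lies beyond the threshold.
\<close>
lemma diagonal_null:
  fixes A :: "nat \<Rightarrow> nat set"
  assumes null: "\<And>B. null_density (A B)" and mono: "\<And>B B'. B \<le> B' \<Longrightarrow> A B \<subseteq> A B'"
  obtains E where "null_density E" "\<And>B. finite (A B - E)"
proof -
  have "\<exists>X0. \<forall>X\<ge>X0. real (card (A B \<inter> {1..X})) \<le> 1 / real (Suc B) * S2_count X" for B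
    using null[of B] unfolding null_density_def upper_density_le_def eventually_sequentially
    by (meson divide_pos_pos of_nat_0_less_iff zero_less_Suc zero_less_one)
  then obtain f where f: "\<And>B X. X \<ge> f B \<Longrightarrow> real (card (A B \<inter> {1..X})) \<le> 1 / real (Suc B) * S2_count X" by metis
  define E where "E = {n. \<exists>B. f B + B \<le> n \<and> n \<in> A B}"
  have "null_density E"
    unfolding null_density_def upper_density_le_def
  proof (intro allI impI)
    fix \<epsilon> :: real assume e: "\<epsilon> > 0"
    then obtain B0 where B0: "1 / real (Suc B0) < \<epsilon>" using nat_approx_posE by blast
    show "\<forall>\<^sub>F X in sequentially. real (card (E \<inter> {1..X})) \<le> \<epsilon> * S2_count X"
      unfolding eventually_sequentially
    proof (intro exI[of _ "f B0 + B0"] allI impI)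
      fix X assume X: "X \<ge> f B0 + B0"
      define S where "S = {B. f B + B \<le> X}"
      have "S \<subseteq> {..X}" by (auto simp: S_def)
      then have finS: "finite S" by (rule finite_subset) simp
      \<comment> \<open>Below \<open>X\<close> only finitely many \<open>A B\<close> take part in \<open>E\<close>, and the largest contains the others.\<close>
      define M where "M = Max S"
      have B0S: "B0 \<in> S" using X by (simp add: S_def)
      then have M: "M \<in> S" "B0 \<le> M" using finS by (auto simp: M_def intro: Max_in)
      have "E \<inter> {1..X} \<subseteq> A M \<inter> {1..X}"
      proof
        fix n assume "n \<in> E \<inter> {1..X}"
        then obtain B where B: "f B + B \<le> n" "n \<in> A B" "n \<in> {1..X}" by (auto simp: E_def)
        then have "B \<in> S" by (simp add: S_def)
        then have "B \<le> M" using finS by (simp add: M_def)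
        then show "n \<in> A M \<inter> {1..X}" using mono B by blast
      qed
      then have "card (E \<inter> {1..X}) \<le> card (A M \<inter> {1..X})" by (intro card_mono) auto
      then have "real (card (E \<inter> {1..X})) \<le> real (card (A M \<inter> {1..X}))" by simp
      also have "\<dots> \<le> 1 / real (Suc M) * S2_count X" using M by (intro f) (simp add: S_def)
      also have "\<dots> \<le> \<epsilon> * S2_count X"
      proof (rule mult_right_mono)
        have "1 / real (Suc M) \<le> 1 / real (Suc B0)" using M(2) by (intro divide_left_mono) auto
        then show "1 / real (Suc M) \<le> \<epsilon>" using B0 by simp
      qed (simp add: S2_count_def)
      finally show "real (card (E \<inter> {1..X})) \<le> \<epsilon> * S2_count X" .
    qed
  qed
  moreover have "finite (A B - E)" for B
  proof (rule finite_subset)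
    show "A B - E \<subseteq> {..<f B + B}" by (auto simp: E_def not_le[symmetric])
  qed simp
  ultimately show thesis by (rule that)
qed

lemma relative_density_one_if_null:
  assumes E: "null_density (S2 - S')" and sub: "S' \<subseteq> S2"
  shows "relative_density_one S' S2"
  unfolding relative_density_one_def
proof (rule LIMSEQ_I)
  fix e :: real assume e: "e > 0"
  have "\<forall>\<^sub>F X in sequentially. real (card ((S2 - S') \<inter> {1..X})) \<le> e / 2 * S2_count X"
    using E half_gt_zero[OF e] unfolding null_density_def upper_density_le_def by blast
  then obtain X0 where X0: "\<And>X. X \<ge> X0 \<Longrightarrow> real (card ((S2 - S') \<inter> {1..X})) \<le> e / 2 * S2_count X"
    by (auto simp: eventually_sequentially)
  have "norm (real (card (S' \<inter> {1..X})) / real (card (S2 \<inter> {1..X})) - 1) < e" if X: "X \<ge> X0 + 1" for X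
  proof -
    have "1 \<in> S2 \<inter> {1..X}" using one_in_S2 X by auto
    then have "card (S2 \<inter> {1..X}) > 0" by (subst card_gt_0_iff) auto
    then have pos: "S2_count X > 0" by (simp add: S2_count_def)
    have "S2 \<inter> {1..X} = (S' \<inter> {1..X}) \<union> ((S2 - S') \<inter> {1..X})" using sub by auto
    moreover have "card ((S' \<inter> {1..X}) \<union> ((S2 - S') \<inter> {1..X})) = card (S' \<inter> {1..X}) + card ((S2 - S') \<inter> {1..X})"
      by (rule card_Un_disjoint) auto
    ultimately have c: "S2_count X = real (card (S' \<inter> {1..X})) + real (card ((S2 - S') \<inter> {1..X}))"
      by (simp add: S2_count_def)
    have "real (card (S' \<inter> {1..X})) / S2_count X - 1 = - (real (card ((S2 - S') \<inter> {1..X})) / S2_count X)"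
      using pos c by (simp add: field_simps)
    then have "norm (real (card (S' \<inter> {1..X})) / S2_count X - 1) = real (card ((S2 - S') \<inter> {1..X})) / S2_count X"
      using pos by simp
    also have "\<dots> \<le> e / 2" using X0[of X] X pos by (simp add: divide_le_eq)
    also have "\<dots> < e" using e by simp
    finally show ?thesis by (simp add: S2_count_def)
  qed
  then show "\<exists>no. \<forall>n\<ge>no. norm (real (card (S' \<inter> {1..n})) / real (card (S2 \<inter> {1..n})) - 1) < e" by blast
qed

lemma circle_point_eq: "n > 0 \<Longrightarrow> q \<in> lattice_points n \<Longrightarrow>
    circle_point n q = sgn (Complex (of_int (fst q)) (of_int (snd q)))"
proof -
  assume n: "n > 0" and q: "q \<in> lattice_points n"
  obtain a b where ab: "q = (a, b)" by force
  have "Complex (of_int a) (of_int b) \<in> gauss_pts n" using q by (simp add: ab Complex_gauss_pts_iff lattice_points_def)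
  then have "(cmod (Complex (of_int a) (of_int b)))\<^sup>2 = real n" by (simp add: gauss_pts_def)
  then have "cmod (Complex (of_int a) (of_int b)) = sqrt (real n)" by (metis norm_ge_zero real_sqrt_unique)
  then show ?thesis by (simp add: ab circle_point_def sgn_eq)
qed

definition nu4 :: "nat \<Rightarrow> real" where "nu4 n = hecke 1 n / hecke 0 n"

lemma fourier_coeff_eq_nu4:
  assumes n: "n > 0"
  shows "fourier_coeff (circle_measure n) 4 = of_real (nu4 n)"
proof -
  have "(\<Sum>q\<in>lattice_points n. circle_point n q ^ 4) = (\<Sum>q\<in>lattice_points n. sgn (Complex (of_int (fst q)) (of_int (snd q))) ^ 4)"
    by (intro sum.cong refl) (simp add: circle_point_eq[OF n])
  also have "\<dots> = (\<Sum>z\<in>gauss_pts n. sgn z ^ (4 * 1))"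
    unfolding gauss_pts_eq_image by (subst sum.reindex[OF inj_lattice_embed]) (simp add: case_prod_unfold)
  also have "\<dots> = of_real (4 * hecke 1 n)" by (rule sum_sgn_gauss_pts)
  finally show ?thesis unfolding fourier_coeff_4[OF n] by (simp add: nu4_def hecke_0)
qed

lemma abs_nu4_le: "\<bar>nu4 n\<bar> \<le> 1"
proof (cases "hecke 0 n = 0")
  case False
  then have "hecke 0 n > 0" using hecke_0_nonneg[of n] by linarith
  then show ?thesis using abs_hecke_le[of 1 n] by (simp add: nu4_def abs_divide)
qed (simp add: nu4_def)

lemma nu4_1: "nu4 1 = 1"
  using hecke_1 by (simp add: nu4_def)

text \<open>
  The average of the character over the circle is multiplicative, and over the two points \<open>w\<close> and
  \<open>cnj w\<close>, up to units, it is the real part of \<open>angle4 p\<close>.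
\<close>
lemma nu4_extends:
  assumes e: "extends l m p" and m: "m > 0"
  shows "nu4 (p * m) = Re (angle4 p) * nu4 m"
proof -
  have p: "prime p" "p mod 4 = 1" "\<not> p dvd m" using e by (auto simp: extends_def primes_1_mod_4_def)
  have "hecke 1 (p * m) = 2 * Re (angle4 p) * hecke 1 m"
    using hecke_prime_1_mod_4[OF p(1,2) gprime[OF p(1,2)] m, of 1] p(3) by (simp add: angle4_def)
  moreover have "hecke 0 (p * m) = 2 * hecke 0 m" using num_lattice_points_extends[OF e m] by (simp add: hecke_0)
  ultimately show ?thesis by (simp add: nu4_def)
qed

text \<open>
  Only finitely many primes divide \<open>m\<close> or are bad for it, whereas there are infinitely many with the
  prescribed angle.
\<close>
lemma extends_exists:
  assumes m: "m > 0" and t: "t \<in> {-1..1}" and e: "\<epsilon> > 0"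
  obtains p where "extends l m p" "\<bar>Re (angle4 p) - t\<bar> < \<epsilon>"
proof -
  define N where "N = Max (insert m {p\<in>primes_1_mod_4. bad_prime l m p})"
  have N: "m \<le> N" "\<And>p. p \<in> primes_1_mod_4 \<Longrightarrow> bad_prime l m p \<Longrightarrow> p \<le> N"
    using card_bad_primes_le(1)[of l m] by (auto simp: N_def)
  obtain p where p: "p \<in> primes_1_mod_4" "p > N" "\<bar>Re (angle4 p) - t\<bar> < \<epsilon>"
    by (rule infinitely_many_primes_near_angle[OF t e])
  have "\<not> p dvd m" using p(2) N(1) m by (auto dest: dvd_imp_le)
  moreover have "\<not> bad_prime l m p" using N(2)[OF p(1)] p(2) by auto
  ultimately show thesis using p by (intro that[of p]) (auto simp: extends_def)
qed

lemma chain_near_1: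
  assumes e: "\<epsilon> > 0"
  shows "\<exists>ps. chain l 1 ps \<and> length ps = r \<and> \<bar>nu4 (prod_list ps) - 1\<bar> < \<epsilon> \<and> prod_list ps > 0"
  using e
proof (induction r arbitrary: \<epsilon>)
  case 0
  then show ?case using nu4_1 by (intro exI[of _ "[]"]) simp
next
  case (Suc r)
  obtain ps where ps: "chain l 1 ps" "length ps = r" "\<bar>nu4 (prod_list ps) - 1\<bar> < \<epsilon> / 2" "prod_list ps > 0"
    using Suc.IH[of "\<epsilon> / 2"] Suc.prems by auto
  obtain p where p: "extends l (prod_list ps) p" "\<bar>Re (angle4 p) - 1\<bar> < \<epsilon> / 2"
    by (rule extends_exists[OF ps(4), of 1 "\<epsilon> / 2"]) (use Suc.prems in auto)
  have p0: "p > 0" using p(1) by (auto simp: extends_def primes_1_mod_4_def prime_gt_0_nat)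
  have "chain l 1 (ps @ [p])" using ps(1) p(1) by (simp add: chain_append)
  moreover have "\<bar>nu4 (prod_list (ps @ [p])) - 1\<bar> < \<epsilon>"
  proof -
    have "prod_list (ps @ [p]) = p * prod_list ps" by simp
    then have "nu4 (prod_list (ps @ [p])) = Re (angle4 p) * nu4 (prod_list ps)"
      by (simp only: nu4_extends[OF p(1) ps(4)])
    then have "nu4 (prod_list (ps @ [p])) - 1 = (Re (angle4 p) - 1) * nu4 (prod_list ps) + (nu4 (prod_list ps) - 1)"
      by (simp add: algebra_simps)
    also have "\<bar>\<dots>\<bar> \<le> \<bar>Re (angle4 p) - 1\<bar> * \<bar>nu4 (prod_list ps)\<bar> + \<bar>nu4 (prod_list ps) - 1\<bar>"
      by (metis abs_mult abs_triangle_ineq)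
    also have "\<dots> \<le> \<bar>Re (angle4 p) - 1\<bar> * 1 + \<bar>nu4 (prod_list ps) - 1\<bar>"
      by (intro add_mono mult_left_mono abs_nu4_le) auto
    also have "\<dots> < \<epsilon> / 2 + \<epsilon> / 2" using p(2) ps(3) by (intro add_strict_mono) simp_all
    finally show ?thesis by simp
  qed
  ultimately show ?case using ps p0 by (intro exI[of _ "ps @ [p]"]) simp
qed

text \<open>
  A long chain with coefficient close to 1, followed by one prime whose factor is close to \<open>t\<close>.
\<close>
lemma chain_with_nu4:
  assumes t: "t \<in> {-1..1}" and e: "\<epsilon> > 0"
  obtains n where "n \<in> S2" "\<bar>nu4 n - t\<bar> < \<epsilon>" "num_lattice_points n \<ge> B"
    "real (card (semi_correlations (2 * k) n)) \<le> corr_const k * real (num_lattice_points n) ^ k"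
proof -
  have N1: "num_lattice_points 1 = 4" using hecke_1[of 0] by (simp add: hecke_0)
  obtain R where R: "\<And>m ps p. m > 0 \<Longrightarrow> 0 < num_lattice_points m \<Longrightarrow> num_lattice_points m \<le> 4 \<Longrightarrow>
    chain (2 * k) m (ps @ [p]) \<Longrightarrow> length ps \<ge> R \<Longrightarrow>
    real (card (semi_correlations (2 * k) (m * prod_list (ps @ [p])))) \<le>
      corr_const k * real (num_lattice_points (m * prod_list (ps @ [p]))) ^ k"
    by (rule semi_correlations_chain[of 4 k]) blast
  obtain ps where ps: "chain (2 * k) 1 ps" "length ps = R + B" "\<bar>nu4 (prod_list ps) - 1\<bar> < \<epsilon> / 2" "prod_list ps > 0"
    using chain_near_1[of "\<epsilon> / 2" "2 * k" "R + B"] e by auto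
  obtain p where p: "extends (2 * k) (prod_list ps) p" "\<bar>Re (angle4 p) - t\<bar> < \<epsilon> / 2"
    by (rule extends_exists[OF ps(4) t half_gt_zero[OF e], of "2 * k"])
  \<comment> \<open>The factor 1 is the start of the chain.\<close>
  define n where "n = 1 * prod_list (ps @ [p])"
  have np: "n = p * prod_list ps" by (simp add: n_def)
  have ch: "chain (2 * k) 1 (ps @ [p])" using ps(1) p(1) by (simp add: chain_append)
  have Nn: "num_lattice_points n = 2 ^ length (ps @ [p]) * 4"
    unfolding n_def using chain_moment_le[OF ch, where B = 0 and K = 0 and r = 0] N1 by (simp add: moment_0)
  have lB: "B < 2 ^ length (ps @ [p])"
  proof -
    have "B \<le> length (ps @ [p])" using ps(2) by simp
    then show ?thesis using less_exp[of "length (ps @ [p])"] by (rule le_less_trans)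
  qed
  have n0: "n > 0" using ps(4) p(1) by (simp add: np extends_def primes_1_mod_4_def prime_gt_0_nat)
  have "gauss_pts n \<noteq> {}" using Nn by (auto simp: card_gauss_pts[symmetric])
  then have 1: "n \<in> S2" using n0 by (simp add: sums_of_two_squares_iff)
  have 2: "\<bar>nu4 n - t\<bar> < \<epsilon>"
  proof -
    define c where "c = Re (angle4 p)"
    have c1: "\<bar>c\<bar> \<le> 1"
    proof -
      have "p \<in> primes_1_mod_4" using p(1) by (simp add: extends_def)
      then show ?thesis using abs_Re_le_cmod[of "angle4 p"] angle4(1) by (simp add: c_def)
    qed
    have "nu4 n = c * nu4 (prod_list ps)" unfolding np c_def by (rule nu4_extends[OF p(1) ps(4)])
    then have "nu4 n - t = c * (nu4 (prod_list ps) - 1) + (c - t)" by (simp add: algebra_simps)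
    also have "\<bar>\<dots>\<bar> \<le> \<bar>c\<bar> * \<bar>nu4 (prod_list ps) - 1\<bar> + \<bar>c - t\<bar>" by (metis abs_mult abs_triangle_ineq)
    also have "\<dots> \<le> 1 * \<bar>nu4 (prod_list ps) - 1\<bar> + \<bar>c - t\<bar>" by (intro add_mono mult_right_mono c1) auto
    also have "\<dots> < \<epsilon> / 2 + \<epsilon> / 2" using p(2) ps(3) by (intro add_strict_mono) (simp_all add: c_def)
    finally show ?thesis by simp
  qed
  have 3: "num_lattice_points n \<ge> B" using Nn lB by simp
  have 4: "real (card (semi_correlations (2 * k) n)) \<le> corr_const k * real (num_lattice_points n) ^ k"
    unfolding n_def using R[of 1 ps p] N1 ch ps(2) by simp
  from 1 2 3 4 show thesis by (rule that)
qed

lemma nu4_dense_family: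
  obtains t where "\<And>i. t i \<in> S2" "\<And>i. num_lattice_points (t i) \<ge> i"
    "\<And>i. real (card (semi_correlations (2 * k) (t i))) \<le> corr_const k * real (num_lattice_points (t i)) ^ k"
    "\<And>s \<epsilon> I. s \<in> {-1..1} \<Longrightarrow> \<epsilon> > 0 \<Longrightarrow> \<exists>i\<ge>I. \<bar>nu4 (t i) - s\<bar> < \<epsilon>"
proof -
  \<comment> \<open>The index encodes a rational number, truncated to \<open>[-1, 1]\<close>, and a second component, so that
    each target recurs at arbitrarily large indices.\<close>
  define target where "target = (\<lambda>i. max (- 1) (min 1 (real_of_rat (from_nat (fst (prod_decode i))))))"
  have tgt: "target i \<in> {-1..1}" for i by (auto simp: target_def)
  have "\<exists>n. n \<in> S2 \<and> \<bar>nu4 n - target i\<bar> < 1 / real (Suc i) \<and> num_lattice_points n \<ge> i \<and>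
    real (card (semi_correlations (2 * k) n)) \<le> corr_const k * real (num_lattice_points n) ^ k" for i
  proof -
    have "1 / real (Suc i) > 0" by simp
    then obtain n where "n \<in> S2" "\<bar>nu4 n - target i\<bar> < 1 / real (Suc i)" "num_lattice_points n \<ge> i"
      "real (card (semi_correlations (2 * k) n)) \<le> corr_const k * real (num_lattice_points n) ^ k"
      by (rule chain_with_nu4[OF tgt])
    then show ?thesis by blast
  qed
  then obtain t where t: "\<And>i. t i \<in> S2 \<and> \<bar>nu4 (t i) - target i\<bar> < 1 / real (Suc i) \<and> num_lattice_points (t i) \<ge> i \<and>
    real (card (semi_correlations (2 * k) (t i))) \<le> corr_const k * real (num_lattice_points (t i)) ^ k" by metis
  have "\<exists>i\<ge>I. \<bar>nu4 (t i) - s\<bar> < \<epsilon>" if s: "s \<in> {-1..1}" and e: "\<epsilon> > 0" for s \<epsilon> I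
  proof -
    obtain q where q: "s - \<epsilon> / 2 < real_of_rat q" "real_of_rat q < s + \<epsilon> / 2"
      using of_rat_dense[of "s - \<epsilon> / 2" "s + \<epsilon> / 2"] e by auto
    obtain J where J: "1 / real (Suc J) < \<epsilon> / 2" using nat_approx_posE[of "\<epsilon> / 2"] e by auto
    define i where "i = prod_encode (to_nat q, max I J)"
    have iI: "max I J \<le> i" unfolding i_def by (rule le_prod_encode_2)
    have "target i = max (- 1) (min 1 (real_of_rat q))" by (simp add: target_def i_def)
    moreover have "\<bar>max (- 1) (min 1 x) - s\<bar> \<le> \<bar>x - s\<bar>" for x
      using s by (auto simp: max_def min_def)
    moreover have "\<bar>real_of_rat q - s\<bar> < \<epsilon> / 2" using q unfolding abs_less_iff by (intro conjI; linarith)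
    ultimately have "\<bar>target i - s\<bar> < \<epsilon> / 2" by (metis le_less_trans)
    moreover have "1 / real (Suc i) \<le> 1 / real (Suc J)" using iI by (intro divide_left_mono) auto
    ultimately have "\<bar>nu4 (t i) - s\<bar> < \<epsilon>" using t[of i] J by linarith
    then show ?thesis using iI by (intro exI[of _ i]) auto
  qed
  with t show thesis by (intro that[of t]) auto
qed

lemma accumulation_points_subset:
  assumes "S' \<subseteq> S2"
  shows "accumulation_points (\<lambda>n. fourier_coeff (circle_measure n) 4) S' \<subseteq> complex_of_real ` {-1..1}"
proof
  fix x assume x: "x \<in> accumulation_points (\<lambda>n. fourier_coeff (circle_measure n) 4) S'"
  have cl: "closed (complex_of_real ` {-1..1})"
    by (intro compact_imp_closed compact_continuous_image continuous_intros compact_Icc)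
  show "x \<in> complex_of_real ` {-1..1}"
  proof (rule ccontr)
    assume nx: "x \<notin> complex_of_real ` {-1..1}"
    have "open (- (complex_of_real ` {-1..1}))" using cl by auto
    then have "infinite {n \<in> S'. fourier_coeff (circle_measure n) 4 \<in> - (complex_of_real ` {-1..1})}"
      using x nx unfolding accumulation_points_def by blast
    then obtain n where n: "n \<in> S'" "fourier_coeff (circle_measure n) 4 \<notin> complex_of_real ` {-1..1}"
      using not_finite_existsD by fastforce
    have "n > 0" using n(1) assms S2_pos by auto
    then have "fourier_coeff (circle_measure n) 4 = of_real (nu4 n)" by (rule fourier_coeff_eq_nu4)
    moreover have "nu4 n \<in> {-1..1}" using abs_nu4_le[of n] by (auto simp: abs_le_iff)
    ultimately show False using n(2) by blast
  qed
qed

theorem theorem1p3: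
  fixes k l :: nat
  assumes "l = 2 * k" and "l \<ge> 4"
  shows "\<exists>S' \<subseteq> sums_of_two_squares.
    relative_density_one S' sums_of_two_squares \<and>
    accumulation_points (\<lambda>n. fourier_coeff (circle_measure n) 4) S' = complex_of_real ` {-1..1} \<and>
    filterlim num_lattice_points at_top (at_top_along S') \<and>
    (\<lambda>n. real (card (semi_correlations l n))) \<in> O[at_top_along S'](\<lambda>n. real (num_lattice_points n) ^ k)"
proof -
  \<comment> \<open>\<open>A B\<close> consists of the \<open>n\<close> that violate the bound or have fewer than \<open>B\<close> lattice points. The
    null set \<open>E\<close> absorbs each \<open>A B\<close> up to finitely many elements, so that the number of lattice
    points tends to infinity off \<open>E\<close>.\<close>
  define P where "P = (\<lambda>n. real (card (semi_correlations (2 * k) n)) \<le> corr_const k * real (num_lattice_points n) ^ k)"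
  define A where "A = (\<lambda>B. {n\<in>S2. \<not> (P n \<and> num_lattice_points n \<ge> B)})"
  have nullA: "null_density (A B)" for B unfolding A_def P_def by (rule exceptional_null)
  have monoA: "A B \<subseteq> A B'" if "B \<le> B'" for B B' using that by (auto simp: A_def)
  obtain E where E: "null_density E" "\<And>B. finite (A B - E)" 
    by (rule diagonal_null[of A, OF nullA monoA]) auto
  \<comment> \<open>A sequence with dense Fourier coefficients. It is kept even where it meets \<open>E\<close>, which affects
    neither the density nor the two bounds.\<close>
  obtain t where t: "\<And>i. t i \<in> S2" "\<And>i. num_lattice_points (t i) \<ge> i"
    "\<And>i. real (card (semi_correlations (2 * k) (t i))) \<le> corr_const k * real (num_lattice_points (t i)) ^ k"
    "\<And>s \<epsilon> I. s \<in> {-1..1} \<Longrightarrow> \<epsilon> > 0 \<Longrightarrow> \<exists>i\<ge>I. \<bar>nu4 (t i) - s\<bar> < \<epsilon>"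
    by (rule nu4_dense_family[of k]) blast
  define S' where "S' = {n\<in>S2 - E. P n} \<union> range t"
  have sub: "S' \<subseteq> S2" using t(1) by (auto simp: S'_def)
  have PS: "P n" if "n \<in> S'" for n using that t(3) by (auto simp: S'_def P_def)
  have "null_density (S2 - S')"
    unfolding null_density_def
  proof (intro allI impI)
    fix e :: real assume e: "e > 0"
    have 1: "upper_density_le (e / 2) E" using E(1) e by (simp add: null_density_def)
    have 2: "upper_density_le (e / 2) (A 0)" using nullA[of 0] e by (simp add: null_density_def)
    have "S2 - S' \<subseteq> E \<union> A 0" by (auto simp: S'_def A_def)
    from upper_density_le_subset_Un[OF 1 2 this] show "upper_density_le e (S2 - S')" by simp
  qed
  then have dens: "relative_density_one S' S2" by (rule relative_density_one_if_null[OF _ sub])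
  have finS: "finite {n\<in>S'. num_lattice_points n < B}" for B
  proof (rule finite_subset)
    show "{n\<in>S'. num_lattice_points n < B} \<subseteq> (A B - E) \<union> t ` {..<B}"
    proof
      fix n assume n: "n \<in> {n\<in>S'. num_lattice_points n < B}"
      show "n \<in> (A B - E) \<union> t ` {..<B}"
      proof (cases "n \<in> range t")
        case True
        then obtain i where i: "n = t i" by auto
        then have "i < B" using t(2)[of i] n by auto
        then show ?thesis using i by auto
      next
        case False
        then have "n \<in> S2 - E" using n by (auto simp: S'_def)
        then show ?thesis using n by (auto simp: A_def)
      qed
    qed
  qed (use E(2) in auto)
  have lim: "filterlim num_lattice_points at_top (at_top_along S')"
    unfolding filterlim_at_top at_top_along_def
  proof
    fix B
    from finS[of B] obtain N where N: "\<forall>n\<in>{n\<in>S'. num_lattice_points n < B}. n < N"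
      unfolding finite_nat_set_iff_bounded ..
    show "\<forall>\<^sub>F n in inf at_top (principal S'). B \<le> num_lattice_points n"
      unfolding eventually_inf_principal
      using eventually_ge_at_top[of N]
    proof eventually_elim
      case (elim n)
      show ?case
      proof
        assume "n \<in> S'"
        then show "B \<le> num_lattice_points n" using N elim by (cases "num_lattice_points n < B") auto
      qed
    qed
  qed
  have acc: "accumulation_points (\<lambda>n. fourier_coeff (circle_measure n) 4) S' = complex_of_real ` {-1..1}"
  proof
    show "accumulation_points (\<lambda>n. fourier_coeff (circle_measure n) 4) S' \<subseteq> complex_of_real ` {-1..1}"
      by (rule accumulation_points_subset[OF sub])
    show "complex_of_real ` {-1..1} \<subseteq> accumulation_points (\<lambda>n. fourier_coeff (circle_measure n) 4) S'"
    proof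
      fix x assume "x \<in> complex_of_real ` {-1..1}"
      then obtain s where s: "x = of_real s" "s \<in> {-1..1}" by blast
      show "x \<in> accumulation_points (\<lambda>n. fourier_coeff (circle_measure n) 4) S'"
        unfolding accumulation_points_def
      proof (intro CollectI allI impI)
        fix U assume U: "open U \<and> x \<in> U"
        then obtain e where e: "e > 0" "ball x e \<subseteq> U" using open_contains_ball by blast
        \<comment> \<open>As \<open>num_lattice_points\<close> is unbounded on \<open>H\<close>, this set is infinite.\<close>
        define H where "H = {n \<in> S'. fourier_coeff (circle_measure n) 4 \<in> U}"
        have "\<exists>n\<in>H. num_lattice_points n \<ge> I" for I
        proof -
          obtain i where i: "i \<ge> I" "\<bar>nu4 (t i) - s\<bar> < e" using t(4)[OF s(2) e(1)] by blast
          have "t i > 0" using t(1) S2_pos by blast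
          then have f: "fourier_coeff (circle_measure (t i)) 4 = of_real (nu4 (t i))" by (rule fourier_coeff_eq_nu4)
          have "dist x (of_real (nu4 (t i))) < e"
            using i(2) unfolding s(1) dist_norm by (metis norm_minus_commute norm_of_real of_real_diff)
          then have "t i \<in> H" using f e(2) by (auto simp: H_def S'_def)
          then show ?thesis using i(1) t(2)[of i] by (meson le_trans)
        qed
        then have unb: "\<And>I. \<exists>N\<in>num_lattice_points ` H. N \<ge> I" by blast
        have "infinite (num_lattice_points ` H)"
        proof
          assume "finite (num_lattice_points ` H)"
          then obtain M where "\<forall>N\<in>num_lattice_points ` H. N < M" unfolding finite_nat_set_iff_bounded ..
          with unb[of M] show False by (meson not_le)
        qed
        then show "infinite {n \<in> S'. fourier_coeff (circle_measure n) 4 \<in> U}"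
          unfolding H_def[symmetric] by (metis finite_imageI)
      qed
    qed
  qed
  have "(\<lambda>n. real (card (semi_correlations l n))) \<in> O[at_top_along S'](\<lambda>n. real (num_lattice_points n) ^ k)"
  proof (rule bigoI[where c = "corr_const k"])
    show "\<forall>\<^sub>F n in at_top_along S'. norm (real (card (semi_correlations l n))) \<le> corr_const k * norm (real (num_lattice_points n) ^ k)"
      unfolding at_top_along_def eventually_inf_principal
      using PS by (intro always_eventually) (auto simp: P_def assms(1))
  qed
  with sub dens acc lim show ?thesis by blast
qed

end
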